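(* There is an algorithm which, given a directed graph $G=(V,E,w)$ with $w:E\to\mathbb{R}_{>0}$ and two vertices $s,t\in V$, runs in time $O(|V|^4|E|^3\log|V|)$ and determines whether there exists a next-to-shortest path from $s$ to $t$ in $G$, and if so outputs such a path.
   Context: Graphs are finite simple directed graphs (no self-loops, no parallel edges) with positive real edge weights. A path is a walk with no repeated vertices; the length $w(P)$ of a path is the sum of its edge weights. $d_G(u,v)$ denotes the minimum length of a $u\to v$ path ($\infty$ if none exists). An $s\to t$ path $P$ is a not-shortest path if $w(P)>d_G(s,t)$. An $s\to t$ path is a next-to-shortest path if it is a not-shortest path and has minimum length among all not-shortest $s\to t$ paths. *)

theory Defs
  imports "Graph_Theory.Pair_Digraph" "Graph_Theory.Shortest_Path"
begin

section \<open>Next-to-shortest paths\<close>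

text \<open>
  Paths without repeated vertices are the library's \<^verbatim>\<open>apath\<close>. The library distance
  \<^verbatim>\<open>\<mu>\<close> ranges over walks, so the distance over paths is defined here.
\<close>

context wf_digraph
begin

definition path_dist :: "'b weight_fun \<Rightarrow> 'a \<Rightarrow> 'a \<Rightarrow> ereal" where
  "path_dist w u v = (INF p\<in>{p. apath u p v}. ereal (awalk_cost w p))"

definition not_shortest_path :: "'b weight_fun \<Rightarrow> 'a \<Rightarrow> 'b awalk \<Rightarrow> 'a \<Rightarrow> bool" where
  "not_shortest_path w s p t \<longleftrightarrow> apath s p t \<and> ereal (awalk_cost w p) > path_dist w s t"

definition next_to_shortest_path :: "'b weight_fun \<Rightarrow> 'a \<Rightarrow> 'b awalk \<Rightarrow> 'a \<Rightarrow> bool" where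
  "next_to_shortest_path w s p t \<longleftrightarrow> not_shortest_path w s p t \<and>
     (\<forall>q. not_shortest_path w s q t \<longrightarrow> awalk_cost w p \<le> awalk_cost w q)"

end


section \<open>The machine model\<close>

text \<open>
  Algorithms are programs of a random access machine with real numbers, at unit cost. A program
  uses finitely many named memories, each an array of cells indexed by the natural numbers, holding
  either naturals or reals; a scalar variable is cell 0 of a memory.

  Naturals admit constants, (truncated) subtraction, addition and comparison; the absence of
  multiplication keeps unit cost reasonable. Reals admit only addition, subtraction and
  comparison, and influence naturals only through control flow: there is no rounding, and
  reals cannot serve as addresses.
\<close>

type_synonym mem_name = string

record state =
  nmem :: "mem_name \<Rightarrow> nat \<Rightarrow> nat"
  rmem :: "mem_name \<Rightarrow> nat \<Rightarrow> real"

datatype nexp =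
    NConst nat
  | NRead mem_name nexp
  | NAdd nexp nexp
  | NSub nexp nexp

datatype rexp =
    RZero
  | RRead mem_name nexp
  | RAdd rexp rexp
  | RSub rexp rexp

datatype bexp =
    NLess nexp nexp
  | RLess rexp rexp
  | BNot bexp
  | BAnd bexp bexp

datatype com =
    Skip
  | NWrite mem_name nexp nexp
  | RWrite mem_name nexp rexp
  | Seq com com
  | Cond bexp com com
  | While bexp com

primrec nval :: "nexp \<Rightarrow> state \<Rightarrow> nat" where
  "nval (NConst k) \<sigma> = k"
| "nval (NRead x i) \<sigma> = nmem \<sigma> x (nval i \<sigma>)"
| "nval (NAdd a b) \<sigma> = nval a \<sigma> + nval b \<sigma>"
| "nval (NSub a b) \<sigma> = nval a \<sigma> - nval b \<sigma>"

primrec rval :: "rexp \<Rightarrow> state \<Rightarrow> real" where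
  "rval RZero \<sigma> = 0"
| "rval (RRead x i) \<sigma> = rmem \<sigma> x (nval i \<sigma>)"
| "rval (RAdd a b) \<sigma> = rval a \<sigma> + rval b \<sigma>"
| "rval (RSub a b) \<sigma> = rval a \<sigma> - rval b \<sigma>"

primrec bval :: "bexp \<Rightarrow> state \<Rightarrow> bool" where
  "bval (NLess a b) \<sigma> \<longleftrightarrow> nval a \<sigma> < nval b \<sigma>"
| "bval (RLess a b) \<sigma> \<longleftrightarrow> rval a \<sigma> < rval b \<sigma>"
| "bval (BNot b) \<sigma> \<longleftrightarrow> \<not> bval b \<sigma>"
| "bval (BAnd a b) \<sigma> \<longleftrightarrow> bval a \<sigma> \<and> bval b \<sigma>"

primrec ncost :: "nexp \<Rightarrow> nat" where
  "ncost (NConst k) = 1"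
| "ncost (NRead x i) = 1 + ncost i"
| "ncost (NAdd a b) = 1 + ncost a + ncost b"
| "ncost (NSub a b) = 1 + ncost a + ncost b"

primrec rcost :: "rexp \<Rightarrow> nat" where
  "rcost RZero = 1"
| "rcost (RRead x i) = 1 + ncost i"
| "rcost (RAdd a b) = 1 + rcost a + rcost b"
| "rcost (RSub a b) = 1 + rcost a + rcost b"

primrec bcost :: "bexp \<Rightarrow> nat" where
  "bcost (NLess a b) = 1 + ncost a + ncost b"
| "bcost (RLess a b) = 1 + rcost a + rcost b"
| "bcost (BNot b) = 1 + bcost b"
| "bcost (BAnd a b) = 1 + bcost a + bcost b"

definition nwrite :: "mem_name \<Rightarrow> nat \<Rightarrow> nat \<Rightarrow> state \<Rightarrow> state" where
  "nwrite x i k \<sigma> = \<sigma>\<lparr>nmem := (nmem \<sigma>)(x := (nmem \<sigma> x)(i := k))\<rparr>"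

definition rwrite :: "mem_name \<Rightarrow> nat \<Rightarrow> real \<Rightarrow> state \<Rightarrow> state" where
  "rwrite x i r \<sigma> = \<sigma>\<lparr>rmem := (rmem \<sigma>)(x := (rmem \<sigma> x)(i := r))\<rparr>"

text \<open>\<^verbatim>\<open>exec c \<sigma> k \<tau>\<close>: started in \<open>\<sigma>\<close>, program \<open>c\<close> halts in \<open>\<tau>\<close> after time \<open>k\<close>.\<close>

inductive exec :: "com \<Rightarrow> state \<Rightarrow> nat \<Rightarrow> state \<Rightarrow> bool" where
  Skip: "exec Skip \<sigma> 1 \<sigma>"
| NWrite: "exec (NWrite x i a) \<sigma> (1 + ncost i + ncost a) (nwrite x (nval i \<sigma>) (nval a \<sigma>) \<sigma>)"
| RWrite: "exec (RWrite x i a) \<sigma> (1 + ncost i + rcost a) (rwrite x (nval i \<sigma>) (rval a \<sigma>) \<sigma>)"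
| Seq: "exec c1 \<sigma> k1 \<sigma>' \<Longrightarrow> exec c2 \<sigma>' k2 \<tau> \<Longrightarrow> exec (Seq c1 c2) \<sigma> (k1 + k2) \<tau>"
| CondTrue: "bval b \<sigma> \<Longrightarrow> exec c1 \<sigma> k \<tau> \<Longrightarrow> exec (Cond b c1 c2) \<sigma> (1 + bcost b + k) \<tau>"
| CondFalse: "\<not> bval b \<sigma> \<Longrightarrow> exec c2 \<sigma> k \<tau> \<Longrightarrow> exec (Cond b c1 c2) \<sigma> (1 + bcost b + k) \<tau>"
| WhileFalse: "\<not> bval b \<sigma> \<Longrightarrow> exec (While b c) \<sigma> (1 + bcost b) \<sigma>"
| WhileTrue: "bval b \<sigma> \<Longrightarrow> exec c \<sigma> k1 \<sigma>' \<Longrightarrow> exec (While b c) \<sigma>' k2 \<tau> \<Longrightarrow>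
    exec (While b c) \<sigma> (1 + bcost b + k1 + k2) \<tau>"

lemma exec_deterministic:
  "exec c \<sigma> k \<tau> \<Longrightarrow> exec c \<sigma> k' \<tau>' \<Longrightarrow> k' = k \<and> \<tau>' = \<tau>"
proof (induction arbitrary: k' \<tau>' rule: exec.induct)
  case (Skip \<sigma>)
  then show ?case by cases simp
next
  case (NWrite x i a \<sigma>)
  then show ?case by cases simp
next
  case (RWrite x i a \<sigma>)
  then show ?case by cases simp
next
  case (Seq c1 \<sigma> k1 \<sigma>' c2 k2 \<tau>)
  note IH = Seq.IH
  from Seq.prems show ?case
  proof cases
    case (Seq l1 \<rho> l2)
    from IH(1)[OF this(2)] IH(2) this show ?thesis by simp
  qed
next
  case (CondTrue b \<sigma> c1 k \<tau> c2)
  from CondTrue.prems show ?case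
    by cases (simp_all add: CondTrue.IH CondTrue.hyps)
next
  case (CondFalse b \<sigma> c2 k \<tau> c1)
  from CondFalse.prems show ?case
    by cases (simp_all add: CondFalse.IH CondFalse.hyps)
next
  case (WhileFalse b \<sigma> c)
  from WhileFalse.prems show ?case
    by cases (simp_all add: WhileFalse.hyps)
next
  case (WhileTrue b \<sigma> c k1 \<sigma>' k2 \<tau>)
  note IH = WhileTrue.IH and hyps = WhileTrue.hyps
  from WhileTrue.prems show ?case
  proof cases
    case WhileFalse
    with hyps(1) show ?thesis by simp
  next
    case (WhileTrue l1 \<rho> l2)
    from IH(1)[OF this(3)] IH(2) this show ?thesis by simp
  qed
qed


section \<open>Input and output conventions\<close>

definition array :: "'a::zero list \<Rightarrow> nat \<Rightarrow> 'a" where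
  "array xs i = (if i < length xs then xs ! i else 0)"

text \<open>
  A graph with vertices \<open>0, \<dots>, n - 1\<close> is presented to the machine as a list \<open>es\<close> of its arcs:
  memories \<^verbatim>\<open>src\<close>, \<^verbatim>\<open>dst\<close> and \<^verbatim>\<open>wt\<close> hold tail, head and weight of the arcs. Cells that
  carry no input are 0.
\<close>

definition input_state ::
    "nat \<Rightarrow> (nat \<times> nat) list \<Rightarrow> (nat \<times> nat) weight_fun \<Rightarrow> nat \<Rightarrow> nat \<Rightarrow> state" where
  "input_state n es w s t =
    \<lparr>nmem = (\<lambda>_ _. 0)
       (''n'' := array [n], ''m'' := array [length es], ''s'' := array [s], ''t'' := array [t],
        ''src'' := array (map fst es), ''dst'' := array (map snd es)),
     rmem = (\<lambda>_ _. 0)(''wt'' := array (map w es))\<rparr>"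

text \<open>
  The answer is \<open>None\<close> (no path exists) if cell 0 of \<^verbatim>\<open>found\<close> is 0, and otherwise the vertex
  sequence in the first cells of \<^verbatim>\<open>path\<close>, their number being given by \<^verbatim>\<open>len\<close>.
\<close>

definition result :: "state \<Rightarrow> nat list option" where
  "result \<sigma> = (if nmem \<sigma> ''found'' 0 = 0 then None
     else Some (map (nmem \<sigma> ''path'') [0..<nmem \<sigma> ''len'' 0]))"

definition correct_answer ::
    "nat pair_pre_digraph \<Rightarrow> (nat \<times> nat) weight_fun \<Rightarrow> nat \<Rightarrow> nat \<Rightarrow> nat list option \<Rightarrow> bool" where
  "correct_answer G w s t ans = (case ans of
     None \<Rightarrow> \<not> (\<exists>p. wf_digraph.next_to_shortest_path (with_proj G) w s p t)
   | Some vs \<Rightarrow> (\<exists>p. wf_digraph.next_to_shortest_path (with_proj G) w s p t \<and>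
                    vs = pre_digraph.awalk_verts (with_proj G) s p))"

end

theory Submission
  imports Defs
begin

text \<open>
  Add a source \<open>S\<close> with an arc to \<open>s\<close> and a sink \<open>T\<close> with an arc from \<open>t\<close>. The arcs on shortest paths
  from \<open>S\<close> to \<open>T\<close> form an acyclic graph \<open>De\<close>, and a path is a not-shortest path iff it uses an arc
  outside \<open>De\<close>. Among the not-shortest paths of minimum length choose \<open>P\<close> with the fewest arcs outside
  \<open>De\<close>; these arcs cut \<open>P\<close> into segments inside \<open>De\<close>. Rerouting \<open>P\<close> through \<open>De\<close> shows that no path of
  \<open>De\<close> leads from an inner segment to a later inner segment. Hence the segments of \<open>P\<close> can be traversed
  by pebbles in an order compatible with reachability in \<open>De\<close>: one pebble walks along the initial
  segment, one along the final segment, and a third one along the inner segments, taken from the last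
  to the first. Such an order makes it impossible to visit a vertex twice unless there is a cheaper
  not-shortest path, so no memory of visited vertices is needed: two arcs and three vertices describe
  a state. With \<open>n\<close> vertices and \<open>m\<close> arcs the game has \<open>O(m\<^sup>3 n\<^sup>3)\<close> transitions and optimal runs of
  length \<open>O(n)\<close>, and \<open>O(n)\<close> rounds of the Bellman-Ford algorithm find a cheapest run.
\<close>

section \<open>Walks and paths\<close>

text \<open>The tie-break by the number of arcs outside \<open>De\<close> is essential. With
  \<open>h\<close> the distance from the source, the length of a path is determined by the reduced
  costs \<open>h u + w (u, v) - h v\<close> of its arcs outside \<open>De\<close>. They are
  nonnegative but may vanish: an arc can be tight for the source without leading to the sink along a
  shortest path. Dropping such an arc saves no length, it only lowers the count. The two new arcs
  make the first and the last arc of \<open>P\<close> belong to \<open>De\<close>, so each outer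
  pebble can be represented by the arc it traversed last. The tail of that arc takes part in the
  side conditions. The game does not force the inner segments to be disjoint from each other. A
  repetition among them can be cut out while the closing arc outside \<open>De\<close> survives,
  which leaves a strictly cheaper not-shortest path. So each complete run costs at least as much as
  some not-shortest path, and an optimal path has a run of its own cost. Both together make the walk
  of a cheapest run simple.\<close>

fun arcs_of :: "'a list \<Rightarrow> ('a \<times> 'a) list" where
  "arcs_of (x # y # zs) = (x, y) # arcs_of (y # zs)"
| "arcs_of _ = []"

definition cost :: "('a \<times> 'a \<Rightarrow> real) \<Rightarrow> 'a list \<Rightarrow> real" where
  "cost w xs = sum_list (map w (arcs_of xs))"

definition walk :: "('a \<times> 'a) set \<Rightarrow> 'a \<Rightarrow> 'a list \<Rightarrow> 'a \<Rightarrow> bool" where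
  "walk E a xs b \<longleftrightarrow> xs \<noteq> [] \<and> hd xs = a \<and> last xs = b \<and> set (arcs_of xs) \<subseteq> E"

definition path :: "('a \<times> 'a) set \<Rightarrow> 'a \<Rightarrow> 'a list \<Rightarrow> 'a \<Rightarrow> bool" where
  "path E a xs b \<longleftrightarrow> walk E a xs b \<and> distinct xs"

lemma arcs_of_split: "arcs_of (xs @ y # ys) = arcs_of (xs @ [y]) @ arcs_of (y # ys)"
  by (induction xs rule: arcs_of.induct) auto

lemma arcs_of_join: "xs \<noteq> [] \<Longrightarrow> ys \<noteq> [] \<Longrightarrow> arcs_of (xs @ ys) = arcs_of xs @ (last xs, hd ys) # arcs_of ys"
  by (induction xs rule: arcs_of.induct) (auto simp: neq_Nil_conv)

lemma set_arcs_of_subset: "(u, v) \<in> set (arcs_of xs) \<Longrightarrow> u \<in> set xs \<and> v \<in> set xs"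
  by (induction xs rule: arcs_of.induct) auto

lemma in_arcs_of_iff: "e \<in> set (arcs_of xs) \<longleftrightarrow> (\<exists>i. Suc i < length xs \<and> e = (xs ! i, xs ! Suc i))"
proof (induction xs rule: arcs_of.induct)
  case (1 x y zs)
  show ?case unfolding arcs_of.simps
    by (auto simp: 1 less_Suc_eq_0_disj)
qed auto

lemma distinct_arcs_of: "distinct xs \<Longrightarrow> distinct (arcs_of xs)"
  by (induction xs rule: arcs_of.induct) (auto dest: set_arcs_of_subset)

lemma distinct_arcs_eq:
  assumes "distinct xs" "(u, v) \<in> set (arcs_of xs)" "(u, v') \<in> set (arcs_of xs)"
  shows "v = v'"
proof -
  obtain i j where "Suc i < length xs" "(u, v) = (xs ! i, xs ! Suc i)"
    "Suc j < length xs" "(u, v') = (xs ! j, xs ! Suc j)"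
    using assms(2,3) unfolding in_arcs_of_iff by blast
  then show ?thesis using assms(1) by (auto simp: nth_eq_iff_index_eq)
qed

lemma cost_split: "cost w (xs @ y # ys) = cost w (xs @ [y]) + cost w (y # ys)"
  unfolding cost_def by (subst arcs_of_split) simp

lemma cost_join: "xs \<noteq> [] \<Longrightarrow> ys \<noteq> [] \<Longrightarrow> cost w (xs @ ys) = cost w xs + w (last xs, hd ys) + cost w ys"
  by (simp add: cost_def arcs_of_join)

lemma cost_simps [simp]: "cost w [] = 0" "cost w [x] = 0" "cost w (x # y # zs) = w (x, y) + cost w (y # zs)"
  by (auto simp: cost_def)

lemma cost_nonneg: "\<forall>e\<in>set (arcs_of xs). 0 < w e \<Longrightarrow> 0 \<le> cost w xs"
  unfolding cost_def by (induction xs rule: arcs_of.induct) force+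

lemma walk_single [simp]: "walk E a [x] b \<longleftrightarrow> x = a \<and> x = b"
  by (auto simp: walk_def)

lemma walk_Cons2: "walk E a (x # y # zs) b \<longleftrightarrow> x = a \<and> (x, y) \<in> E \<and> walk E y (y # zs) b"
  by (auto simp: walk_def)

lemma walk_mono: "walk E a xs b \<Longrightarrow> E \<subseteq> F \<Longrightarrow> walk F a xs b"
  by (auto simp: walk_def)

lemma walk_join:
  assumes "walk E a xs b" "walk E c ys d" "(b, c) \<in> E"
  shows "walk E a (xs @ ys) d"
  using assms by (auto simp: walk_def arcs_of_join)

lemma walk_glue:
  assumes "walk E a xs b" "walk E b ys c"
  shows "walk E a (xs @ tl ys) c" "cost w (xs @ tl ys) = cost w xs + cost w ys"
proof -
  have ne: "xs \<noteq> []" "last xs = b" "ys \<noteq> []" "hd ys = b" using assms by (auto simp: walk_def)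
  obtain zs where xs: "xs = zs @ [b]" using ne by (metis append_butlast_last_id)
  obtain us where ys: "ys = b # us" using ne by (cases ys) auto
  show "walk E a (xs @ tl ys) c" using assms unfolding xs ys walk_def
    by (auto simp: arcs_of_split[of zs b us] hd_append split: if_splits)
  show "cost w (xs @ tl ys) = cost w xs + cost w ys" unfolding xs ys using cost_split[of w zs b us] by simp
qed

lemma walk_splitI:
  assumes "walk E a (xs @ y # ys) b"
  shows "walk E a (xs @ [y]) y" "walk E y (y # ys) b"
  using assms unfolding walk_def by (auto simp: arcs_of_split[of xs y ys] hd_append split: if_splits)

lemma walk_rtrancl: "walk E a xs b \<Longrightarrow> (a, b) \<in> E\<^sup>*"
proof (induction xs arbitrary: a)
  case (Cons x xs)
  then show ?case by (cases xs) (auto simp: walk_Cons2 intro: converse_rtrancl_into_rtrancl)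
qed (auto simp: walk_def)

lemma walk_verts_rtrancl: "walk E a xs b \<Longrightarrow> v \<in> set xs \<Longrightarrow> (a, v) \<in> E\<^sup>* \<and> (v, b) \<in> E\<^sup>*"
  by (metis in_set_conv_decomp walk_splitI walk_rtrancl)

text \<open>A closed piece, which has positive length, is cut out until no vertex repeats. The
  strict inequality for walks with repetitions is what later excludes cheapest runs that visit a
  vertex twice.\<close>

lemma walk_to_path:
  assumes "walk E a xs b" "\<forall>e\<in>E. 0 < w e"
  shows "\<exists>ys. path E a ys b \<and> set ys \<subseteq> set xs \<and> cost w ys \<le> cost w xs \<and> (\<not> distinct xs \<longrightarrow> cost w ys < cost w xs)"
  using assms(1)
proof (induction "length xs" arbitrary: xs rule: less_induct)
  case less
  show ?case
  proof (cases "distinct xs")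
    case True
    then show ?thesis using less.prems unfolding path_def by auto
  next
    case False
    then obtain us x vs zs where xs: "xs = us @ [x] @ vs @ [x] @ zs"
      using not_distinct_decomp by blast
    have w1: "walk E a (us @ [x]) x" "walk E x (x # vs @ [x] @ zs) b"
      using walk_splitI[of E a us x "vs @ [x] @ zs" b] less.prems xs by auto
    have w2: "walk E x (x # vs @ [x]) x" "walk E x (x # zs) b"
      using walk_splitI[of E x "x # vs" x zs b] w1 by auto
    have w3: "walk E a (us @ x # zs) b" and c3: "cost w (us @ x # zs) = cost w (us @ [x]) + cost w (x # zs)"
      using walk_glue[OF w1(1) w2(2)] by auto
    have "cost w xs = cost w (us @ [x]) + cost w (x # vs @ [x]) + cost w (x # zs)"
      unfolding xs using cost_split[of w us x "vs @ [x] @ zs"] cost_split[of w "x # vs" x zs] by simp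
    moreover have "0 < cost w (x # vs @ [x])"
    proof -
      obtain y ys where y: "vs @ [x] = y # ys" by (cases vs) auto
      have "0 < w (x, y)" "0 \<le> cost w (y # ys)"
        using w2(1) assms(2) unfolding y walk_def by (auto intro!: cost_nonneg)
      then show ?thesis unfolding y by simp
    qed
    ultimately have lt: "cost w (us @ x # zs) < cost w xs" using c3 by simp
    have "length (us @ x # zs) < length xs" unfolding xs by simp
    from less.hyps[OF this w3] lt show ?thesis unfolding xs by force
  qed
qed

lemma rtrancl_path:
  assumes "(a, b) \<in> E\<^sup>*"
  shows "\<exists>xs. path E a xs b"
proof -
  have "\<exists>xs. walk E a xs b" using assms
  proof (induction rule: converse_rtrancl_induct)
    case base
    have "walk E b [b] b" by simp
    then show ?case by blast
  next
    case (step y z)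
    then obtain xs where "walk E z xs b" by blast
    with step(1) have "walk E y (y # xs) b" by (cases xs) (auto simp: walk_def)
    then show ?case by blast
  qed
  then obtain xs where "walk E a xs b" by blast
  \<comment> \<open>Weight 1 on every arc supplies the positivity hypothesis where only the path
    itself is wanted.\<close>
  from walk_to_path[OF this, of "\<lambda>_. 1"] show ?thesis by auto
qed

text \<open>Every vertex of a walk from \<open>a\<close> to \<open>b\<close> is reachable from
  \<open>a\<close> and reaches \<open>b\<close>. Because of this confinement, later arguments about
  a cut have to inspect only vertices between the two ends of a walk.\<close>

lemma rtrancl_between:
  assumes "(a, b) \<in> R\<^sup>*"
  shows "(a, b) \<in> (R \<inter> {v. (a, v) \<in> R\<^sup>* \<and> (v, b) \<in> R\<^sup>*} \<times> {v. (a, v) \<in> R\<^sup>* \<and> (v, b) \<in> R\<^sup>*})\<^sup>*"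
  (is "_ \<in> (R \<inter> ?X \<times> ?X)\<^sup>*")
proof -
  obtain xs where xs: "walk R a xs b" using rtrancl_path[OF assms] by (auto simp: path_def)
  then have "set xs \<subseteq> ?X" using walk_verts_rtrancl by fast
  then have "walk (R \<inter> ?X \<times> ?X) a xs b"
    using xs unfolding walk_def by (auto dest!: set_arcs_of_subset) 
  then show ?thesis by (rule walk_rtrancl)
qed

lemma rtrancl_cut:
  assumes "(a, b) \<in> R\<^sup>*" "a \<in> C" "b \<notin> C"
  shows "\<exists>u v. (u, v) \<in> R \<and> u \<in> C \<and> v \<notin> C"
  using assms by (induction rule: rtrancl_induct) blast+

section \<open>The graph of shortest paths\<close>

text \<open>\<open>h\<close> is the distance from \<open>s\<close> seen as a potential: exact on
  \<open>De\<close>, feasible on all arcs that leave reachable vertices. The assumptions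
  \<open>s_in\<close>, \<open>t_out\<close>, \<open>s_out\<close> and \<open>t_in\<close> record
  what the added source and sink provide.\<close>

locale spd =
  fixes E De :: "('a \<times> 'a) set" and w :: "'a \<times> 'a \<Rightarrow> real" and h :: "'a \<Rightarrow> real" and s t :: 'a
  assumes wpos: "\<forall>e\<in>E. 0 < w e" and De_sub: "De \<subseteq> E"
    and De_h: "(u, v) \<in> De \<Longrightarrow> h v = h u + w (u, v)"
    and h_le: "(s, u) \<in> E\<^sup>* \<Longrightarrow> (u, v) \<in> E \<Longrightarrow> h v \<le> h u + w (u, v)"
    and De_s: "(u, v) \<in> De \<Longrightarrow> (s, u) \<in> De\<^sup>*"
    and De_t: "(u, v) \<in> De \<Longrightarrow> (v, t) \<in> De\<^sup>*"
    and s_in: "(u, s) \<notin> E" and t_out: "(t, v) \<notin> E"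
    and s_out: "(s, t) \<in> E\<^sup>* \<Longrightarrow> (s, v) \<in> E \<Longrightarrow> (s, v) \<in> De"
    and t_in: "(s, t) \<in> E\<^sup>* \<Longrightarrow> (u, t) \<in> E \<Longrightarrow> (u, t) \<in> De"
    and s_neq_t: "s \<noteq> t"
begin

abbreviation reach :: "'a \<Rightarrow> 'a \<Rightarrow> bool" where "reach u v \<equiv> (u, v) \<in> De\<^sup>*"

text \<open>Both ends of each arc must lie in \<open>X\<close>, but the empty walk is always
  allowed: \<open>(a, a)\<close> belongs to \<open>inside X\<close> even for \<open>a\<close>
  outside \<open>X\<close>.\<close>

abbreviation inside :: "'a set \<Rightarrow> ('a \<times> 'a) set" where "inside X \<equiv> (De \<inter> X \<times> X)\<^sup>*"

definition dv :: "'a \<Rightarrow> bool" where "dv c \<longleftrightarrow> reach s c \<and> reach c t"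

lemma reach_h_le: "reach u v \<Longrightarrow> h u \<le> h v"
proof (induction rule: rtrancl_induct)
  case (step y z)
  then show ?case using De_h[OF step(2)] wpos De_sub by fastforce
qed simp

text \<open>\<open>h\<close> rises strictly along every arc of \<open>De\<close>, since weights are
  positive.\<close>

lemma reach_antisym:
  assumes "reach u v" "reach v u" shows "u = v"
proof (rule ccontr)
  assume "u \<noteq> v"
  then obtain y where y: "(u, y) \<in> De" "reach y v" using assms(1) by (metis converse_rtranclE)
  have "h u < h y" using De_h[OF y(1)] wpos De_sub y(1) by fastforce
  then show False using reach_h_le[OF y(2)] reach_h_le[OF assms(2)] by simp
qed

lemma reach_s: "reach u s \<Longrightarrow> u = s"
  by (metis De_sub rtranclE s_in subsetD)

lemma reach_t: "reach t u \<Longrightarrow> u = t"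
  by (metis De_sub converse_rtranclE subsetD t_out)

lemma De_dv: "(u, v) \<in> De \<Longrightarrow> dv u \<and> dv v"
  unfolding dv_def by (meson De_s De_t converse_rtrancl_into_rtrancl rtrancl_into_rtrancl)

lemma reach_dv: "reach u v \<Longrightarrow> u \<noteq> v \<Longrightarrow> dv u \<and> dv v"
  by (metis De_dv converse_rtranclE rtranclE)

lemma inside_reach: "(u, v) \<in> inside X \<Longrightarrow> reach u v"
  by (meson Int_lower1 rtrancl_mono subsetD)

lemma inside_mono: "X \<subseteq> Y \<Longrightarrow> (u, v) \<in> inside X \<Longrightarrow> (u, v) \<in> inside Y"
  by (rule subsetD[OF rtrancl_mono]) auto

lemma inside_between:
  assumes "(a, b) \<in> inside X" "a \<in> X"
  shows "(a, b) \<in> inside {c \<in> X. reach a c \<and> reach c b}"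
proof -
  let ?R = "De \<inter> X \<times> X"
  let ?Y = "{v. (a, v) \<in> ?R\<^sup>* \<and> (v, b) \<in> ?R\<^sup>*}"
  have Y: "?Y \<subseteq> {c \<in> X. reach a c \<and> reach c b}"
  proof
    fix v assume "v \<in> ?Y"
    then have v: "(a, v) \<in> ?R\<^sup>*" "(v, b) \<in> ?R\<^sup>*" by auto
    then have "v \<in> X" using assms(2) by (metis Int_iff SigmaD2 rtranclE)
    then show "v \<in> {c \<in> X. reach a c \<and> reach c b}" using v inside_reach by blast
  qed
  have "(a, b) \<in> (?R \<inter> ?Y \<times> ?Y)\<^sup>*" using rtrancl_between[OF assms(1)] by simp
  then show ?thesis using Y by (auto elim!: rtrancl_mono[THEN subsetD, rotated])
qed

lemma reach_between: "reach a b \<Longrightarrow> (a, b) \<in> inside {c. reach a c \<and> reach c b}"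
  using rtrancl_between[of a b De] by simp

text \<open>Reduced cost for the potential \<open>h\<close>: the excess of an arc over being tight
  as seen from \<open>s\<close>.\<close>

definition red :: "'a \<times> 'a \<Rightarrow> real" where "red e = h (fst e) + w e - h (snd e)"

lemma cost_red: "xs \<noteq> [] \<Longrightarrow> cost w xs = h (last xs) - h (hd xs) + sum_list (map red (arcs_of xs))"
  by (induction xs rule: arcs_of.induct) (auto simp: red_def)

lemma cost_De: "set (arcs_of xs) \<subseteq> De \<Longrightarrow> xs \<noteq> [] \<Longrightarrow> cost w xs = h (last xs) - h (hd xs)"
  by (induction xs rule: arcs_of.induct) (auto simp: De_h)

lemma red_nonneg: "walk E s xs b \<Longrightarrow> e \<in> set (arcs_of xs) \<Longrightarrow> 0 \<le> red e"
proof -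
  assume a: "walk E s xs b" "e \<in> set (arcs_of xs)"
  obtain u v where e: "e = (u, v)" by force
  then have "(s, u) \<in> E\<^sup>*" using walk_verts_rtrancl[OF a(1)] set_arcs_of_subset a(2) by fast
  moreover have "(u, v) \<in> E" using a e by (auto simp: walk_def)
  ultimately show ?thesis using h_le[of u v] unfolding red_def e by simp
qed

lemma red_De: "e \<in> De \<Longrightarrow> red e = 0"
  by (cases e) (auto simp: red_def De_h)

text \<open>The potential telescopes and \<open>red\<close> vanishes on \<open>De\<close>, so
  comparing two paths from \<open>s\<close> to \<open>t\<close> amounts to comparing their sets of
  arcs outside \<open>De\<close>. Distinct vertices allow the passage from the list of arcs to its
  set.\<close>

lemma cost_red_set:
  assumes "path E s N t"
  shows "cost w N = h t - h s + (\<Sum>e\<in>set (arcs_of N) - De. red e)"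
proof -
  have d: "distinct (arcs_of N)" using assms by (simp add: path_def distinct_arcs_of)
  have "sum_list (map red (arcs_of N)) = (\<Sum>e\<in>set (arcs_of N). red e)"
    using d by (simp add: sum_list_distinct_conv_sum_set)
  also have "\<dots> = (\<Sum>e\<in>set (arcs_of N) - De. red e)"
    by (rule sum.mono_neutral_right) (auto simp: red_De)
  finally show ?thesis using cost_red[of N] assms by (auto simp: path_def walk_def)
qed

end

section \<open>Exchange arguments for an optimal path\<close>

locale opt = spd +
  fixes P :: "'a list"
  assumes P: "path E s P t" and Pn: "\<not> set (arcs_of P) \<subseteq> De"
    and Pmin: "path E s N t \<Longrightarrow> \<not> set (arcs_of N) \<subseteq> De \<Longrightarrow>
      cost w P < cost w N \<or> cost w P = cost w N \<and> card (set (arcs_of P) - De) \<le> card (set (arcs_of N) - De)"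
begin

text \<open>\<open>N\<close> takes its arcs outside \<open>De\<close> from \<open>P\<close> and
  misses \<open>e0\<close>. As reduced costs are nonnegative, \<open>N\<close> is no longer than
  \<open>P\<close>; it has fewer arcs outside \<open>De\<close>, which the choice of
  \<open>P\<close> forbids even when the lengths agree.\<close>

lemma exchange:
  assumes N: "path E s N t" "set (arcs_of N) \<subseteq> De \<union> set (arcs_of P)" "\<not> set (arcs_of N) \<subseteq> De"
    and e0: "e0 \<in> set (arcs_of P)" "e0 \<notin> De" "e0 \<notin> set (arcs_of N)"
  shows False
proof -
  have sub: "set (arcs_of N) - De \<subset> set (arcs_of P) - De" using N(2) e0 by blast
  have "(\<Sum>e\<in>set (arcs_of N) - De. red e) \<le> (\<Sum>e\<in>set (arcs_of P) - De. red e)"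
    using sub P red_nonneg by (intro sum_mono2) (auto simp: path_def)
  then have "cost w N \<le> cost w P" using cost_red_set[OF N(1)] cost_red_set[OF P] by simp
  moreover have "card (set (arcs_of N) - De) < card (set (arcs_of P) - De)"
    using sub by (intro psubset_card_mono) auto
  ultimately show False using Pmin[OF N(1,3)] by simp
qed

text \<open>A path from \<open>s\<close> to \<open>t\<close> has to leave \<open>C\<close>, and here it can do so only through an arc of \<open>P\<close> outside \<open>De\<close>.\<close>

lemma exchange_cut:
  assumes C: "s \<in> C" "t \<notin> C" and e0: "e0 \<in> set (arcs_of P)" "e0 \<notin> De"
    and U: "(s, t) \<in> ({(a, b). (a, b) \<in> De \<and> (a \<in> C \<longrightarrow> b \<in> C)} \<union> (set (arcs_of P) - De - {e0}))\<^sup>*" (is "_ \<in> ?U\<^sup>*")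
  shows False
proof -
  obtain N where N: "path ?U s N t" using rtrancl_path[OF U] by blast
  have UE: "?U \<subseteq> E" using De_sub P by (auto simp: path_def walk_def)
  have "\<not> set (arcs_of N) \<subseteq> De"
  proof
    assume a: "set (arcs_of N) \<subseteq> De"
    have "walk {(a, b). (a, b) \<in> De \<and> (a \<in> C \<longrightarrow> b \<in> C)} s N t"
      using N a unfolding path_def walk_def by auto
    from rtrancl_cut[OF walk_rtrancl[OF this] C] show False by auto
  qed
  moreover have "path E s N t" using N UE walk_mono by (fastforce simp: path_def)
  ultimately show False using exchange[OF _ _ _ e0, of N] N e0 by (auto simp: path_def walk_def)
qed

section \<open>The segments of the optimal path\<close>

lemma P_nz: "P \<noteq> []" and P_hd: "P ! 0 = s" and P_last: "P ! (length P - 1) = t" and P_dist: "distinct P"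
  using P by (auto simp: path_def walk_def hd_conv_nth last_conv_nth)

lemma P_arc: "Suc r < length P \<Longrightarrow> (P ! r, P ! Suc r) \<in> E"
  using P in_arcs_of_iff[of "(P ! r, P ! Suc r)" P] by (auto simp: path_def walk_def)

definition pos :: "'a \<Rightarrow> nat" where "pos v = (THE i. i < length P \<and> P ! i = v)"

lemma pos_nth [simp]: "i < length P \<Longrightarrow> pos (P ! i) = i"
  unfolding pos_def using P_dist by (auto simp: nth_eq_iff_index_eq)

lemma nth_pos: "v \<in> set P \<Longrightarrow> P ! pos v = v" and pos_lt: "v \<in> set P \<Longrightarrow> pos v < length P"
  by (auto simp: in_set_conv_nth)

text \<open>The arcs outside \<open>De\<close> cut \<open>P\<close> into segments \<open>0, \<dots>, K\<close>; \<open>nd i\<close> is the segment of position \<open>i\<close>.\<close>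

definition bad :: "nat \<Rightarrow> bool" where "bad r \<longleftrightarrow> Suc r < length P \<and> (P ! r, P ! Suc r) \<notin> De"

definition nd :: "nat \<Rightarrow> nat" where "nd i = card {r. r < i \<and> bad r}"

definition K :: nat where "K = nd (length P)"

abbreviation seg :: "'a \<Rightarrow> nat" where "seg v \<equiv> nd (pos v)"

lemma nd_0 [simp]: "nd 0 = 0" by (simp add: nd_def)

lemma nd_Suc: "nd (Suc i) = (if bad i then Suc (nd i) else nd i)"
proof -
  have "{r. r < Suc i \<and> bad r} = (if bad i then insert i {r. r < i \<and> bad r} else {r. r < i \<and> bad r})"
    by (auto simp: less_Suc_eq)
  then show ?thesis unfolding nd_def by simp
qed

lemma nd_mono: "i \<le> j \<Longrightarrow> nd i \<le> nd j"
  unfolding nd_def by (rule card_mono) auto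

lemma nd_le_K: "nd i \<le> K"
proof -
  have "{r. r < i \<and> bad r} \<subseteq> {r. r < length P \<and> bad r}" by (auto simp: bad_def)
  then show ?thesis unfolding nd_def K_def by (intro card_mono) auto
qed

lemma nd_last: "nd (length P - 1) = K"
proof -
  have "{r. r < length P \<and> bad r} = {r. r < length P - 1 \<and> bad r}" by (auto simp: bad_def)
  then show ?thesis by (simp add: nd_def K_def)
qed

lemma nd_lt_bad: "nd i < nd j \<Longrightarrow> \<exists>r. i \<le> r \<and> r < j \<and> bad r"
proof (rule ccontr)
  assume a: "nd i < nd j" "\<not> (\<exists>r. i \<le> r \<and> r < j \<and> bad r)"
  have "{r. r < j \<and> bad r} \<subseteq> {r. r < i \<and> bad r}" using a(2) by (auto simp: not_le)
  then have "nd j \<le> nd i" unfolding nd_def by (intro card_mono) auto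
  then show False using a(1) by simp
qed

lemma bad_nd_lt: "bad r \<Longrightarrow> i \<le> r \<Longrightarrow> r < j \<Longrightarrow> nd i < nd j"
  using nd_mono[of i r] nd_mono[of "Suc r" j] by (auto simp: nd_Suc)

lemma nd_less_imp: "nd i < nd j \<Longrightarrow> i < j"
  by (metis leI leD nd_mono)

definition fb :: nat where "fb = (LEAST r. bad r)"

text \<open>Position of the head of the last arc outside \<open>De\<close>, whereas
  \<open>fb\<close> is the position of the tail of the first one. So segment 0 ends at
  \<open>fb\<close> and segment \<open>K\<close> begins at \<open>lb\<close>.\<close>

definition lb :: nat where "lb = Suc (Max {r. bad r})"

lemma bad_ex: "\<exists>r. bad r"
  using Pn unfolding bad_def in_arcs_of_iff subset_iff by auto

lemma fin_bad: "finite {r. bad r}"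
  by (rule finite_subset[of _ "{..<length P}"]) (auto simp: bad_def)

lemma fb: "bad fb" "nd fb = 0" "fb < length P"
proof -
  show b: "bad fb" using bad_ex unfolding fb_def by (metis LeastI)
  have "{r. r < fb \<and> bad r} = {}" unfolding fb_def by (auto dest: not_less_Least)
  then show "nd fb = 0" by (simp add: nd_def)
  show "fb < length P" using b by (simp add: bad_def)
qed

lemma lb: "bad (lb - 1)" "nd lb = K" "lb < length P" "0 < lb"
proof -
  have m: "Max {r. bad r} \<in> {r. bad r}" using bad_ex fin_bad by (intro Max_in) auto
  then show "bad (lb - 1)" by (simp add: lb_def)
  show "0 < lb" by (simp add: lb_def)
  show "lb < length P" using m by (simp add: lb_def bad_def)
  have "{r. r < length P \<and> bad r} \<subseteq> {r. r < lb \<and> bad r}"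
    using fin_bad unfolding lb_def by (auto simp: less_Suc_eq_le)
  then have "K \<le> nd lb" unfolding nd_def K_def by (intro card_mono) auto
  then show "nd lb = K" using nd_le_K[of lb] by simp
qed

lemma bad_ge_fb: "bad r \<Longrightarrow> fb \<le> r" unfolding fb_def by (rule Least_le)

lemma bad_lt_lb: "bad r \<Longrightarrow> r < lb" using fin_bad unfolding lb_def by (auto simp: less_Suc_eq_le)

lemma nd_lt_K: "i < lb \<Longrightarrow> nd i < K" using bad_nd_lt[OF lb(1), of i lb] lb(2,4) by simp

lemma nd_pos: "fb < i \<Longrightarrow> 0 < nd i" using bad_nd_lt[OF fb(1), of 0 i] by simp

lemma nd_lt_K_iff: "nd i < K \<longleftrightarrow> i < lb"
  using nd_lt_K[of i] nd_mono[of lb i] lb(2) by linarith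

lemma nd_pos_iff: "0 < nd i \<longleftrightarrow> fb < i"
  using nd_pos[of i] nd_mono[of i fb] fb(2) by linarith

lemma st_reach: "(s, t) \<in> E\<^sup>*"
  using walk_rtrancl P by (auto simp: path_def)

lemma len2: "2 \<le> length P"
  using P_hd P_last s_neq_t P_nz by (cases P rule: arcs_of.cases) auto

lemma first_De: "(P ! 0, P ! Suc 0) \<in> De"
  using s_out[OF st_reach] P_arc[of 0] len2 P_hd by auto

lemma last_De: "(P ! (length P - 2), P ! (length P - 1)) \<in> De"
  using t_in[OF st_reach] P_arc[of "length P - 2"] len2 P_last by (auto simp: Suc_diff_Suc numeral_2_eq_2)

text \<open>The arc that leaves \<open>s\<close> lies in \<open>De\<close>, so the initial segment
  has at least one arc by which its pebble can be represented. \<open>lb_lt\<close> is the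
  counterpart at the sink.\<close>

lemma fb_pos: "0 < fb" using fb(1) first_De by (cases fb) (auto simp: bad_def)

lemma lb_lt: "lb < length P - 1"
proof -
  have "lb - 1 \<noteq> length P - 2" using lb(1) last_De len2 unfolding bad_def
    by (metis (no_types, lifting) One_nat_def Suc_1 Suc_diff_Suc Suc_leD diff_Suc_1 diff_Suc_eq_diff_pred le_add_diff_inverse less_Suc_eq_le numeral_2_eq_2 plus_1_eq_Suc lessI Suc_le_lessD)
  then show ?thesis using lb(3,4) by linarith
qed

abbreviation z1 :: 'a where "z1 \<equiv> P ! fb"
abbreviation yk :: 'a where "yk \<equiv> P ! lb"

lemma not_bad_De: "Suc r < length P \<Longrightarrow> \<not> bad r \<Longrightarrow> (P ! r, P ! Suc r) \<in> De"
  by (simp add: bad_def)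

lemma same_seg:
  assumes "i \<le> j" "j < length P" "nd i = nd j"
  shows "(P ! i, P ! j) \<in> inside {c \<in> set P. seg c = nd i}"
  using assms
proof (induction j)
  case (Suc j)
  show ?case
  proof (cases "i = Suc j")
    case False
    then have ij: "i \<le> j" using Suc.prems by simp
    have n: "nd i = nd j" using nd_mono[OF ij] nd_mono[of j "Suc j"] Suc.prems(3) by simp
    have "\<not> bad j" using n Suc.prems(3) by (auto simp: nd_Suc)
    then have "(P ! j, P ! Suc j) \<in> De" using not_bad_De Suc.prems(2) by blast
    moreover have "P ! j \<in> set P" "P ! Suc j \<in> set P" using Suc.prems(2) by auto
    ultimately have "(P ! j, P ! Suc j) \<in> De \<inter> {c \<in> set P. seg c = nd i} \<times> {c \<in> set P. seg c = nd i}"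
      using n Suc.prems(2,3) by auto
    then show ?thesis using Suc.IH[OF ij _ n] Suc.prems(2) by (meson Suc_lessD rtrancl.rtrancl_into_rtrancl)
  qed simp
qed simp

lemma same_seg_reach:
  assumes "u \<in> set P" "v \<in> set P" "pos u \<le> pos v" "seg u = seg v"
  shows "(u, v) \<in> inside {c \<in> set P. seg c = seg u}"
  using same_seg[of "pos u" "pos v"] assms nth_pos pos_lt by simp

lemma arcs_take: "e \<in> set (arcs_of (take (Suc i) P)) \<Longrightarrow> i < length P \<Longrightarrow> \<exists>r<i. e = (P ! r, P ! Suc r)"
  by (auto simp: in_arcs_of_iff)

lemma arcs_drop: "e \<in> set (arcs_of (drop j P)) \<Longrightarrow> \<exists>r\<ge>j. Suc r < length P \<and> e = (P ! r, P ! Suc r)"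
  by (auto simp: in_arcs_of_iff) (metis add_Suc_right le_add1 less_diff_conv add.commute)

lemma arcs_eq_iff:
  "Suc r < length P \<Longrightarrow> Suc q < length P \<Longrightarrow> (P ! r, P ! Suc r) = (P ! q, P ! Suc q) \<longleftrightarrow> r = q"
  using P_dist by (auto simp: nth_eq_iff_index_eq)

text \<open>Replacing the part of \<open>P\<close> between \<open>u\<close> and \<open>v\<close> by
  \<open>xs\<close> gives a path again, because \<open>xs\<close> meets \<open>P\<close> only at its
  ends, and an arc outside \<open>De\<close> is lost. By \<open>exchange\<close> the result must lie
  in \<open>De\<close>, so \<open>P\<close> has no arc outside \<open>De\<close> before
  \<open>u\<close> or after \<open>v\<close>.\<close>

lemma exchange_link:
  assumes xs: "path De u xs v" and uv: "u \<in> set P" "v \<in> set P" and xP: "set xs \<inter> set P = {u, v}"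
    and lt: "seg u < seg v"
  shows "seg u = 0 \<and> seg v = K"
proof (rule ccontr)
  assume neg: "\<not> (seg u = 0 \<and> seg v = K)"
  let ?i = "pos u" and ?j = "pos v"
  have ij: "?i < ?j" using nd_less_imp[OF lt] .
  have il: "?i < length P" "?j < length P" and ui: "P ! ?i = u" "P ! ?j = v" using uv nth_pos pos_lt by auto
  let ?A = "take (Suc ?i) P" and ?B = "drop ?j P"
  have A: "walk (set (arcs_of ?A)) s ?A u"
    using il P_hd ui P_nz by (auto simp: walk_def hd_conv_nth last_conv_nth)
  have B: "walk (set (arcs_of ?B)) v ?B t"
    using il P_last ui P_nz by (auto simp: walk_def hd_drop_conv_nth last_conv_nth)
  let ?F = "set (arcs_of ?A) \<union> De \<union> set (arcs_of ?B)"
  have w: "walk De u xs v" using xs by (simp add: path_def)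
  have w1: "walk ?F s (?A @ tl xs) v"
    by (rule walk_glue(1)[OF walk_mono[OF A] walk_mono[OF w]]) auto
  have w2: "walk ?F s ((?A @ tl xs) @ tl ?B) t"
    by (rule walk_glue(1)[OF w1 walk_mono[OF B]]) auto
  let ?N = "(?A @ tl xs) @ tl ?B"
  obtain ys where ys: "xs = u # ys" using w by (cases xs) (auto simp: walk_def)
  have B': "tl ?B = drop (Suc ?j) P" by (metis drop_Suc tl_drop)
  have d1: "set ys \<inter> set P \<subseteq> {v}" using xP xs unfolding ys path_def by auto
  have vA: "v \<notin> set ?A"
  proof
    assume "v \<in> set ?A"
    then obtain k where "k < Suc ?i" "P ! k = v" using il by (auto simp: in_set_conv_nth)
    then show False using ij il ui pos_nth[of k] by simp
  qed
  have vB: "v \<notin> set (tl ?B)"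
    using P_dist il ui unfolding B' by (metis Cons_nth_drop_Suc distinct.simps(2) distinct_drop)
  have dAB: "set ?A \<inter> set (tl ?B) = {}" unfolding B' using ij by (intro set_take_disj_set_drop_if_distinct P_dist) auto
  have "distinct ?N"
  proof -
    have "set ys \<inter> set ?A = {}" using d1 vA set_take_subset[of "Suc ?i" P] by blast
    moreover have "set ys \<inter> set (tl ?B) = {}" using d1 vB set_drop_subset[of "Suc ?j" P] unfolding B' by blast
    moreover have "distinct ys" using xs unfolding ys path_def by simp
    moreover have "distinct ?A" "distinct (tl ?B)" using P_dist unfolding B' by auto
    ultimately show ?thesis using dAB unfolding ys by auto
  qed
  have FE: "?F \<subseteq> De \<union> set (arcs_of P)"
  proof -
    have "set (arcs_of ?A) \<subseteq> set (arcs_of P)"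
    proof
      fix e assume "e \<in> set (arcs_of ?A)"
      then obtain r where "r < ?i" "e = (P ! r, P ! Suc r)" using arcs_take il by blast
      then show "e \<in> set (arcs_of P)" unfolding in_arcs_of_iff using il by (auto intro!: exI[of _ r])
    qed
    moreover have "set (arcs_of ?B) \<subseteq> set (arcs_of P)"
    proof
      fix e assume "e \<in> set (arcs_of ?B)"
      then show "e \<in> set (arcs_of P)" using arcs_drop unfolding in_arcs_of_iff[of e P] by blast
    qed
    ultimately show ?thesis by blast
  qed
  have PE: "set (arcs_of P) \<subseteq> E" using P by (simp add: path_def walk_def)
  have Np: "path E s ?N t" using w2 \<open>distinct ?N\<close> FE PE De_sub walk_mono[of ?F s ?N t E] unfolding path_def by blast
  \<comment> \<open>A rise of the segment number forces an arc outside \<open>De\<close> between the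
    two positions. It is the arc that the detour drops.\<close>
  obtain r where r: "?i \<le> r" "r < ?j" "bad r" using nd_lt_bad[OF lt] by blast
  let ?e = "(P ! r, P ! Suc r)"
  have rl: "Suc r < length P" using r(3) by (simp add: bad_def)
  have e1: "?e \<in> set (arcs_of P)" "?e \<notin> De" using r(3) by (auto simp: bad_def in_arcs_of_iff)
  have e2: "?e \<notin> ?F"
  proof
    assume "?e \<in> ?F"
    then consider "?e \<in> set (arcs_of ?A)" | "?e \<in> set (arcs_of ?B)" using e1 by blast
    then show False
    proof cases
      case 1
      then obtain q where "q < ?i" "?e = (P ! q, P ! Suc q)" using arcs_take il by blast
      then show False using arcs_eq_iff[OF rl, of q] r il by auto
    next
      case 2
      then obtain q where "q \<ge> ?j" "Suc q < length P" "?e = (P ! q, P ! Suc q)" using arcs_drop by blast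
      then show False using arcs_eq_iff[OF rl, of q] r by auto
    qed
  qed
  have NF: "set (arcs_of ?N) \<subseteq> ?F" using w2 by (simp add: walk_def)
  have nDe: "\<not> set (arcs_of ?N) \<subseteq> De"
  proof
    assume a: "set (arcs_of ?N) \<subseteq> De"
    have arcsN: "set (arcs_of ?N) \<supseteq> set (arcs_of ?A) \<union> set (arcs_of ?B)"
    proof -
      have g: "set (arcs_of (as @ tl bs)) \<supseteq> set (arcs_of as) \<union> set (arcs_of bs)"
        if ne: "as \<noteq> []" "bs \<noteq> []" "last as = hd bs" for as bs :: "'a list"
      proof -
        obtain cs c where as: "as = cs @ [c]" using ne by (cases as rule: rev_cases) auto
        obtain ds where bs: "bs = c # ds" using ne as by (cases bs) auto
        show ?thesis using arcs_of_split[of cs c ds] unfolding as bs by auto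
      qed
      have "set (arcs_of ?A) \<subseteq> set (arcs_of (?A @ tl xs))" using g[of ?A xs] A w by (auto simp: walk_def)
      moreover have "set (arcs_of (?A @ tl xs)) \<union> set (arcs_of ?B) \<subseteq> set (arcs_of ?N)"
        using g[of "?A @ tl xs" ?B] w1 B by (auto simp: walk_def)
      ultimately show ?thesis by blast
    qed
    have "seg u = 0"
    proof (rule ccontr)
      assume "seg u \<noteq> 0"
      then obtain q where q: "q < ?i" "bad q" using nd_lt_bad[of 0 ?i] by auto
      then have "(P ! q, P ! Suc q) \<in> set (arcs_of ?A)" using il by (auto simp: in_arcs_of_iff intro!: exI[of _ q])
      then show False using a arcsN q by (auto simp: bad_def)
    qed
    moreover have "seg v = K"
    proof (rule ccontr)
      assume "seg v \<noteq> K"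
      then have "nd ?j < nd (length P)" using nd_le_K[of ?j] unfolding K_def by simp
      then obtain q where q: "?j \<le> q" "q < length P" "bad q" using nd_lt_bad by blast
      then have "(P ! q, P ! Suc q) \<in> set (arcs_of ?B)"
        unfolding in_arcs_of_iff by (intro exI[of _ "q - ?j"]) (auto simp: bad_def Suc_diff_le)
      then show False using a arcsN q by (auto simp: bad_def)
    qed
    ultimately show False using neg by simp
  qed
  show False using exchange[OF Np _ nDe e1] NF FE e2 by blast
qed

end

section \<open>How \<open>De\<close> connects the segments\<close>

context opt begin

text \<open>A piece of a walk in \<open>De\<close> between consecutive visits to \<open>P\<close>.
  By \<open>exchange_link\<close> such a piece raises the segment number only from 0 to
  \<open>K\<close>; this restriction is made part of the definition so that inductions over links
  can use it.\<close>

definition link :: "('a \<times> 'a) set" where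
  "link = {(a, b). a \<in> set P \<and> b \<in> set P \<and> (seg b \<le> seg a \<or> seg a = 0 \<and> seg b = K) \<and>
     (a, b) \<in> inside ({a, b} \<union> - set P)}"

text \<open>A path in \<open>De\<close> is cut at its visits to \<open>P\<close>. Each piece meets
  \<open>P\<close> only at its ends, so \<open>exchange_link\<close> applies to it.\<close>

lemma reach_link:
  assumes "reach u v" "u \<in> set P" "v \<in> set P"
  shows "(u, v) \<in> link\<^sup>*"
proof -
  obtain xs where "path De u xs v" using rtrancl_path[OF assms(1)] by blast
  then show ?thesis using assms(2)
  proof (induction "length xs" arbitrary: xs u rule: less_induct)
    case less
    obtain ys where xs: "xs = u # ys" using less.prems(1) by (cases xs) (auto simp: path_def walk_def)
    show ?case
    proof (cases ys)
      case Nil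
      then show ?thesis using less.prems(1) xs by (auto simp: path_def)
    next
      case (Cons y0 ys0)
      then have "v \<in> set ys" using less.prems(1) xs by (auto simp: path_def walk_def)
      then have "\<exists>b\<in>set ys. b \<in> set P" using assms(3) by blast
      then obtain as b bs where ys: "ys = as @ b # bs" "b \<in> set P" "\<forall>y\<in>set as. y \<notin> set P"
        using split_list_first_prop[of ys "\<lambda>b. b \<in> set P"] by metis
      have w: "walk De u (u # as @ [b]) b" "walk De b (b # bs) v"
        using less.prems(1) walk_splitI[of De u "u # as" b bs v] unfolding xs ys path_def by auto
      have d: "distinct (u # as @ [b])" "distinct (b # bs)" using less.prems(1) unfolding xs ys path_def by auto
      have "(b, v) \<in> link\<^sup>*"
        using less.hyps[of "b # bs" b] w(2) d(2) ys unfolding xs path_def by auto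
      moreover have "(u, b) \<in> link"
      proof -
        have "path De u (u # as @ [b]) b" "set (u # as @ [b]) \<inter> set P = {u, b}"
          using w d ys less.prems(2) by (auto simp: path_def)
        then have "seg b \<le> seg u \<or> seg u = 0 \<and> seg b = K"
          using exchange_link[of u "u # as @ [b]" b] less.prems(2) ys(2) by linarith
        moreover have "walk (De \<inter> ({u, b} \<union> - set P) \<times> ({u, b} \<union> - set P)) u (u # as @ [b]) b"
          using w(1) ys(3) unfolding walk_def by (auto dest!: set_arcs_of_subset)
        ultimately show ?thesis using walk_rtrancl less.prems(2) ys(2) unfolding link_def by auto
      qed
      ultimately show ?thesis by (rule converse_rtrancl_into_rtrancl[rotated])
    qed
  qed
qed

lemma linkD: "(a, b) \<in> link \<Longrightarrow> a \<in> set P \<and> b \<in> set P \<and> (seg b \<le> seg a \<or> seg a = 0 \<and> seg b = K)"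
  by (auto simp: link_def)

lemma link_inside: "(a, b) \<in> link \<Longrightarrow> - set P \<subseteq> X \<Longrightarrow> a \<in> X \<Longrightarrow> b \<in> X \<Longrightarrow> (a, b) \<in> inside X"
proof -
  assume a: "(a, b) \<in> link" "- set P \<subseteq> X" "a \<in> X" "b \<in> X"
  have "{a, b} \<union> - set P \<subseteq> X" using a by auto
  moreover have "(a, b) \<in> inside ({a, b} \<union> - set P)" using a(1) unfolding link_def by blast
  ultimately show ?thesis by (rule inside_mono)
qed

lemma links_reach: "(a, b) \<in> link\<^sup>* \<Longrightarrow> reach a b"
proof (induction rule: rtrancl_induct)
  case (step y z)
  have "(y, z) \<in> inside UNIV" using link_inside[OF step(2), of UNIV] by simp
  then show ?case using inside_reach step(3) by (meson rtrancl_trans)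
qed simp

text \<open>The only upward move is the jump from segment 0 to segment \<open>K\<close>. To get from
  segment 0 into an inner segment, a walk has to visit segment \<open>K\<close>; after its last
  visit there it descends and hence stays at or above \<open>seg c\<close>.\<close>

lemma links_from_last:
  assumes "(a, c) \<in> link\<^sup>*" "seg a = 0" "0 < seg c" "seg c < K"
  shows "\<exists>y\<in>set P. seg y = K \<and> (y, c) \<in> inside {v. v \<notin> set P \<or> seg c \<le> seg v}"
  using assms
proof (induction rule: rtrancl_induct)
  case (step d c)
  have d: "d \<in> set P" "seg c \<le> seg d" using linkD[OF step(2)] step.prems by auto
  have l: "(d, c) \<in> inside {v. v \<notin> set P \<or> seg c \<le> seg v}" using step(2) d by (intro link_inside) auto
  show ?case
  proof (cases "seg d = K")
    case True
    then show ?thesis using l d by blast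
  next
    case False
    then obtain y where y: "y \<in> set P" "seg y = K" "(y, d) \<in> inside {v. v \<notin> set P \<or> seg d \<le> seg v}"
      using step.IH step.prems d nd_le_K[of "pos d"] by auto
    have "(y, d) \<in> inside {v. v \<notin> set P \<or> seg c \<le> seg v}" by (rule inside_mono[OF _ y(3)]) (use d in auto)
    then show ?thesis using y l by (meson rtrancl_trans)
  qed
qed simp

text \<open>Mirror image of \<open>links_from_last\<close>: an inner segment is connected to segment
  \<open>K\<close> only through segment 0, and until segment 0 is met the walk does not
  rise.\<close>

lemma links_to_first:
  assumes "(c, b) \<in> link\<^sup>*" "seg b = K" "0 < seg c" "seg c < K"
  shows "\<exists>y\<in>set P. seg y = 0 \<and> (c, y) \<in> inside {v. v \<notin> set P \<or> seg v \<le> seg c}"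
  using assms
proof (induction rule: converse_rtrancl_induct)
  case (step c d)
  have d: "d \<in> set P" "seg d \<le> seg c" using linkD[OF step(1)] step.prems by auto
  have l: "(c, d) \<in> inside {v. v \<notin> set P \<or> seg v \<le> seg c}" using step(1) d by (intro link_inside) auto
  show ?case
  proof (cases "seg d = 0")
    case True
    then show ?thesis using l d by blast
  next
    case False
    then obtain y where y: "y \<in> set P" "seg y = 0" "(d, y) \<in> inside {v. v \<notin> set P \<or> seg v \<le> seg d}"
      using step.IH step.prems d by auto
    have "(d, y) \<in> inside {v. v \<notin> set P \<or> seg v \<le> seg c}" by (rule inside_mono[OF _ y(3)]) (use d in auto)
    then show ?thesis using y l by (meson rtrancl_trans)
  qed
qed simp

text \<open>A walk that ends in a higher segment must jump from 0 to \<open>K\<close>. The vertex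
  \<open>y\<close> is the end of its first jump; before it the walk never rises above
  \<open>seg a\<close>.\<close>

lemma links_rise_end:
  assumes "(a, b) \<in> link\<^sup>*" "seg a < K" "seg a < seg b"
  shows "\<exists>y\<in>set P. seg y = K \<and> (a, y) \<in> inside ({c. c \<notin> set P \<or> seg c \<le> seg a} \<union> {y}) \<and> reach y b"
  using assms
proof (induction rule: converse_rtrancl_induct)
  case (step a d)
  have rdb: "reach d b" using links_reach[OF step(2)] .
  show ?case
  proof (cases "seg d = K")
    case True
    have "(a, d) \<in> inside ({c. c \<notin> set P \<or> seg c \<le> seg a} \<union> {d})" using step(1) by (intro link_inside) auto
    then show ?thesis using True rdb linkD[OF step(1)] by blast
  next
    case False
    then have d: "d \<in> set P" "seg d \<le> seg a" using linkD[OF step(1)] by auto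
    then obtain y where y: "y \<in> set P" "seg y = K" "(d, y) \<in> inside ({c. c \<notin> set P \<or> seg c \<le> seg d} \<union> {y})" "reach y b"
      using step.IH step.prems by auto
    have "(d, y) \<in> inside ({c. c \<notin> set P \<or> seg c \<le> seg a} \<union> {y})" by (rule inside_mono[OF _ y(3)]) (use d in auto)
    moreover have "(a, d) \<in> inside ({c. c \<notin> set P \<or> seg c \<le> seg a} \<union> {y})" using step(1) d by (intro link_inside) auto
    ultimately show ?thesis using y by (meson rtrancl_trans)
  qed
qed simp

text \<open>Here \<open>y\<close> is the start of the last jump; after it the walk stays at or above
  \<open>seg b\<close>.\<close>

lemma links_rise_start:
  assumes "(a, b) \<in> link\<^sup>*" "0 < seg b" "seg a < seg b"
  shows "\<exists>y\<in>set P. seg y = 0 \<and> (y, b) \<in> inside ({c. c \<notin> set P \<or> seg b \<le> seg c} \<union> {y}) \<and> reach a y"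
  using assms
proof (induction rule: rtrancl_induct)
  case (step d b)
  have rad: "reach a d" using links_reach[OF step(1)] .
  show ?case
  proof (cases "seg d = 0")
    case True
    have "(d, b) \<in> inside ({c. c \<notin> set P \<or> seg b \<le> seg c} \<union> {d})" using step(2) by (intro link_inside) auto
    then show ?thesis using True rad linkD[OF step(2)] by blast
  next
    case False
    then have d: "d \<in> set P" "seg b \<le> seg d" using linkD[OF step(2)] by auto
    then obtain y where y: "y \<in> set P" "seg y = 0" "(y, d) \<in> inside ({c. c \<notin> set P \<or> seg d \<le> seg c} \<union> {y})" "reach a y"
      using step.IH step.prems by auto
    have "(y, d) \<in> inside ({c. c \<notin> set P \<or> seg b \<le> seg c} \<union> {y})" by (rule inside_mono[OF _ y(3)]) (use d in auto)
    moreover have "(d, b) \<in> inside ({c. c \<notin> set P \<or> seg b \<le> seg c} \<union> {y})" using step(2) d by (intro link_inside) auto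
    ultimately show ?thesis using y by (meson rtrancl_trans)
  qed
qed simp

lemma s_P: "s \<in> set P" "pos s = 0" and t_P: "t \<in> set P" "pos t = length P - 1"
  and z1_P: "z1 \<in> set P" "pos z1 = fb" and yk_P: "yk \<in> set P" "pos yk = lb"
  using P_hd P_last P_nz fb(3) lb(3) pos_nth[of 0] pos_nth[of "length P - 1"] nth_mem[of 0 P] nth_mem[of "length P - 1" P]
  by (auto simp del: pos_nth intro: pos_nth)

lemma seg_t: "seg t = K" using nd_last t_P by simp

lemma dv_yk: "dv yk" "reach s yk"
proof -
  have "(yk, t) \<in> inside {c \<in> set P. seg c = seg yk}"
    using same_seg_reach[of yk t] yk_P t_P lb lb_lt nd_last by auto
  moreover have "yk \<noteq> t" using yk_P t_P lb_lt by auto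
  ultimately show "dv yk" using inside_reach reach_dv by blast
  then show "reach s yk" by (simp add: dv_def)
qed

lemma dv_z1: "dv z1" "reach z1 t"
proof -
  have "(s, z1) \<in> inside {c \<in> set P. seg c = seg s}"
    using same_seg_reach[of s z1] z1_P s_P fb by auto
  moreover have "s \<noteq> z1" using z1_P s_P fb_pos by auto
  ultimately show "dv z1" using inside_reach reach_dv by blast
  then show "reach z1 t" by (simp add: dv_def)
qed

text \<open>A walk from \<open>s\<close> enters the inner segments by descending from segment
  \<open>K\<close>, all of which is reachable from \<open>yk\<close>. So in the order of
  \<open>De\<close> the vertex \<open>yk\<close> comes before every inner vertex of \<open>P\<close>
  in \<open>dv\<close>, and by \<open>mid_to_z1\<close> the vertex \<open>z1\<close> comes after it:
  the reverse of the order on \<open>P\<close>.\<close>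

lemma mid_from_yk:
  assumes "c \<in> set P" "dv c" "0 < seg c" "seg c < K"
  shows "(yk, c) \<in> inside {v. v \<notin> set P \<or> seg c \<le> seg v}"
proof -
  have "(s, c) \<in> link\<^sup>*" using reach_link[of s c] assms s_P by (auto simp: dv_def)
  then obtain y where y: "y \<in> set P" "seg y = K" "(y, c) \<in> inside {v. v \<notin> set P \<or> seg c \<le> seg v}"
    using links_from_last[of s c] assms s_P by auto
  have "lb \<le> pos y" using y(2) nd_lt_K[of "pos y"] by linarith
  then have "(yk, y) \<in> inside {c \<in> set P. seg c = seg yk}"
    using same_seg_reach[of yk y] y yk_P lb by auto
  then have "(yk, y) \<in> inside {v. v \<notin> set P \<or> seg c \<le> seg v}"
    by (rule inside_mono[rotated]) (use assms yk_P lb in auto)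
  then show ?thesis using y(3) by (rule rtrancl_trans)
qed

lemma mid_to_z1:
  assumes "c \<in> set P" "dv c" "0 < seg c" "seg c < K"
  shows "(c, z1) \<in> inside {v. v \<notin> set P \<or> seg v \<le> seg c}"
proof -
  have "(c, t) \<in> link\<^sup>*" using reach_link[of c t] assms t_P by (auto simp: dv_def)
  then obtain y where y: "y \<in> set P" "seg y = 0" "(c, y) \<in> inside {v. v \<notin> set P \<or> seg v \<le> seg c}"
    using links_to_first[of c t] assms seg_t by auto
  have "pos y \<le> fb" using y(2) nd_pos[of "pos y"] by linarith
  then have "(y, z1) \<in> inside {c \<in> set P. seg c = seg y}"
    using same_seg_reach[of y z1] y z1_P fb by auto
  then have "(y, z1) \<in> inside {v. v \<notin> set P \<or> seg v \<le> seg c}"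
    by (rule inside_mono[rotated]) (use y in auto)
  with y(3) show ?thesis by (rule rtrancl_trans)
qed

section \<open>Cuts: no inner segment reaches a later inner segment\<close>

abbreviation cutarcs :: "'a set \<Rightarrow> 'a \<times> 'a \<Rightarrow> ('a \<times> 'a) set" where
  "cutarcs C e \<equiv> {(a, b). (a, b) \<in> De \<and> (a \<in> C \<longrightarrow> b \<in> C)} \<union> (set (arcs_of P) - De - {e})"

text \<open>A set that lies on one side of the cut contains no crossing arc.\<close>

lemma cut_inside: "(a, b) \<in> inside X \<Longrightarrow> X \<subseteq> C \<or> X \<inter> C = {} \<Longrightarrow> (a, b) \<in> (cutarcs C e)\<^sup>*"
  by (rule subsetD[OF rtrancl_mono]) auto

lemma cut_P:
  assumes "i \<le> j" "j < length P"
    and "\<And>r. i \<le> r \<Longrightarrow> r < j \<Longrightarrow> bad r \<Longrightarrow> (P ! r, P ! Suc r) \<noteq> e"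
    and "\<And>r. i \<le> r \<Longrightarrow> r < j \<Longrightarrow> \<not> bad r \<Longrightarrow> P ! r \<in> C \<Longrightarrow> P ! Suc r \<in> C"
  shows "(P ! i, P ! j) \<in> (cutarcs C e)\<^sup>*"
  using assms
proof (induction j)
  case (Suc j)
  show ?case
  proof (cases "i = Suc j")
    case False
    then have ij: "i \<le> j" using Suc.prems by simp
    have "(P ! i, P ! j) \<in> (cutarcs C e)\<^sup>*" using Suc.IH[OF ij] Suc.prems by auto
    moreover have "(P ! j, P ! Suc j) \<in> cutarcs C e"
    proof (cases "bad j")
      case True
      then have "(P ! j, P ! Suc j) \<in> set (arcs_of P)" unfolding bad_def in_arcs_of_iff by blast
      then show ?thesis using Suc.prems(3)[of j] ij True unfolding bad_def by auto
    next
      case F: False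
      then show ?thesis using Suc.prems(4)[of j] not_bad_De[of j] Suc.prems(2) ij by auto
    qed
    ultimately show ?thesis by (rule rtrancl_into_rtrancl)
  qed simp
qed simp

definition e_first :: "'a \<times> 'a" where "e_first = (P ! fb, P ! Suc fb)"
definition e_last :: "'a \<times> 'a" where "e_last = (P ! (lb - 1), P ! Suc (lb - 1))"

lemma e_first: "e_first \<in> set (arcs_of P)" "e_first \<notin> De"
  using fb(1) unfolding e_first_def bad_def in_arcs_of_iff by blast+

lemma e_last: "e_last \<in> set (arcs_of P)" "e_last \<notin> De"
  using lb(1) unfolding e_last_def bad_def in_arcs_of_iff by blast+

text \<open>The rerouted walk goes from \<open>s\<close> through \<open>De\<close> to
  \<open>yk\<close> and on to \<open>x\<close>, along the segment to \<open>v\<close>, through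
  \<open>De\<close> to \<open>z1\<close>, along \<open>P\<close> to \<open>u\<close>, and through
  \<open>De\<close> to the final segment and \<open>t\<close>. It avoids \<open>e_last\<close>
  because \<open>u\<close> precedes \<open>lb\<close>. The purpose: the start \<open>u\<close> of a
  segment that reaches \<open>v\<close> also reaches all earlier vertices of the segment of
  \<open>v\<close>.\<close>

lemma no_rise_aux1:
  assumes u: "u \<in> set P" "0 < seg u" "0 < pos u" "bad (pos u - 1)"
    and v: "v \<in> set P" "seg u < seg v" "seg v < K"
    and x: "x \<in> set P" "seg x = seg v" "pos x \<le> pos v"
    and uv: "reach u v" and nux: "\<not> reach u x"
  shows False
proof -
  \<comment> \<open>\<open>C\<close> is chosen so that the pieces of the route up to
    \<open>z1\<close> lie inside and those from \<open>u\<close> on lie outside. Along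
    \<open>P\<close> from \<open>z1\<close> to \<open>u\<close> the arcs of \<open>De\<close> do not
    leave \<open>C\<close>, so the route leaves it on an arc outside \<open>De\<close>.\<close>
  let ?C = "({c. \<not> reach u c} - {c \<in> set P. 0 < seg c \<and> seg c < seg u}) \<union> {c \<in> set P. seg c = seg v}
     \<union> {c. reach v c \<and> \<not> (c \<in> set P \<and> seg c = K)}"
  have unv: "u \<noteq> v" using v by auto
  have dvs: "dv u" "dv v" using reach_dv[OF uv unv] by auto
  have xv: "(x, v) \<in> inside {c \<in> set P. seg c = seg x}" using same_seg_reach x v by simp
  have dvx: "dv x" using inside_reach[OF xv] dvs reach_dv by (cases "x = v") auto
  have sC: "s \<in> ?C" using reach_s[of u] u s_P by auto
  have st1: "(s, yk) \<in> (cutarcs ?C e_last)\<^sup>*"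
  proof (rule cut_inside[OF reach_between[OF dv_yk(2)]], rule disjI1, rule subsetI)
    fix c assume "c \<in> {c. reach s c \<and> reach c yk}"
    then have c: "reach s c" "reach c yk" by auto
    have "reach yk x" using inside_reach[OF mid_from_yk[of x]] x dvx v u by auto
    then have "\<not> reach u c" using nux c by (meson rtrancl_trans)
    moreover have "\<not> (c \<in> set P \<and> 0 < seg c \<and> seg c < seg u)"
    proof
      assume a: "c \<in> set P \<and> 0 < seg c \<and> seg c < seg u"
      have "c \<noteq> yk" using a yk_P lb v by auto
      then have "dv c" using reach_dv c by blast
      then have "reach yk c" using inside_reach[OF mid_from_yk[of c]] a v by auto
      then show False using reach_antisym[OF c(2)] \<open>c \<noteq> yk\<close> by blast
    qed
    ultimately show "c \<in> ?C" by blast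
  qed
  have st2: "(yk, x) \<in> (cutarcs ?C e_last)\<^sup>*"
  proof (rule cut_inside[OF inside_between[OF mid_from_yk[of x]]])
    show "{c \<in> {v. v \<notin> set P \<or> seg x \<le> seg v}. reach yk c \<and> reach c x} \<subseteq> ?C \<or>
      {c \<in> {v. v \<notin> set P \<or> seg x \<le> seg v}. reach yk c \<and> reach c x} \<inter> ?C = {}"
      using nux x v by (intro disjI1) (auto dest: rtrancl_trans)
  qed (use x dvx v u yk_P lb in auto)
  have st3: "(x, v) \<in> (cutarcs ?C e_last)\<^sup>*"
    by (rule cut_inside[OF xv]) (use x in auto)
  have st4: "(v, z1) \<in> (cutarcs ?C e_last)\<^sup>*"
  proof (rule cut_inside[OF inside_between[OF mid_to_z1[of v]]])
    show "{c \<in> {x. x \<notin> set P \<or> seg x \<le> seg v}. reach v c \<and> reach c z1} \<subseteq> ?C \<or>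
      {c \<in> {x. x \<notin> set P \<or> seg x \<le> seg v}. reach v c \<and> reach c z1} \<inter> ?C = {}"
      using v by (intro disjI1) auto
  qed (use v u dvs in auto)
  have pu: "pos u < lb" using v nd_lt_K_iff[of "pos u"] by simp
  have st5: "(z1, P ! pos u) \<in> (cutarcs ?C e_last)\<^sup>*"
  proof (rule cut_P)
    show "fb \<le> pos u" using u nd_pos_iff[of "pos u"] by simp
    show "pos u < length P" using u pos_lt by simp
    show "(P ! r, P ! Suc r) \<noteq> e_last" if "fb \<le> r" "r < pos u" "bad r" for r
      using that pu arcs_eq_iff[of r "lb - 1"] lb unfolding e_last_def bad_def by auto
    show "P ! Suc r \<in> ?C" if r: "fb \<le> r" "r < pos u" "\<not> bad r" "P ! r \<in> ?C" for r
    proof -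
      have fr: "fb < r" using r fb(1) by (metis le_neq_implies_less)
      \<comment> \<open>The arc of \<open>P\<close> into \<open>u\<close> is outside
        \<open>De\<close>, so the present arc ends before \<open>u\<close>.\<close>
      have rl: "Suc r < pos u" using r u(3,4) by (metis Suc_lessI diff_Suc_1)
      have len: "pos u < length P" using u pos_lt by simp
      have n: "nd (Suc r) = nd r" "0 < nd r" using r nd_pos[OF fr] by (auto simp: nd_Suc)
      have n2: "nd (Suc r) < seg u" using bad_nd_lt[OF u(4), of "Suc r" "pos u"] rl u(3) by simp
      have p: "pos (P ! r) = r" "pos (P ! Suc r) = Suc r" "P ! r \<in> set P" "P ! Suc r \<in> set P"
        using rl len by auto
      have "reach v (P ! r)" using r(4) n n2 p v by auto
      then have "reach v (P ! Suc r)" using not_bad_De[of r] r rl len by (meson rtrancl_into_rtrancl Suc_lessD less_trans)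
      then show ?thesis using n n2 p v by auto
    qed
  qed
  \<comment> \<open>\<open>y\<close> is the end of the jump into the final segment that every way
    from \<open>u\<close> up to \<open>v\<close> has to make.\<close>
  obtain y where y: "y \<in> set P" "seg y = K" "(u, y) \<in> inside ({c. c \<notin> set P \<or> seg c \<le> seg u} \<union> {y})" "reach y v"
    using links_rise_end[OF reach_link[OF uv]] u v by auto
  have st6: "(u, y) \<in> (cutarcs ?C e_last)\<^sup>*"
  proof (rule cut_inside[OF inside_between[OF y(3)]])
    show "u \<in> {c. c \<notin> set P \<or> seg c \<le> seg u} \<union> {y}" by simp
    have "c \<notin> ?C" if c: "c \<notin> set P \<or> seg c \<le> seg u \<or> c = y" "reach u c" "reach c y" for c
    proof -
      have "reach c v" using c(3) y(4) by (rule rtrancl_trans)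
      then have "\<not> reach v c" using reach_antisym[of c v] c(1) v y by auto
      then show ?thesis using c v y by auto
    qed
    then show "{c \<in> {c. c \<notin> set P \<or> seg c \<le> seg u} \<union> {y}. reach u c \<and> reach c y} \<subseteq> ?C \<or>
       {c \<in> {c. c \<notin> set P \<or> seg c \<le> seg u} \<union> {y}. reach u c \<and> reach c y} \<inter> ?C = {}"
      by (intro disjI2) blast
  qed
  have "pos y \<le> pos t" using t_P pos_lt[OF y(1)] by simp
  then have yt: "(y, t) \<in> inside {c \<in> set P. seg c = seg y}" using same_seg_reach[of y t] y t_P seg_t by simp
  have key: "c \<notin> ?C" if "c \<in> set P" "seg c = K" "reach y c" for c
    using that v inside_reach[OF y(3)] by (auto dest: rtrancl_trans)
  have st7: "(y, t) \<in> (cutarcs ?C e_last)\<^sup>*"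
  proof (rule cut_inside[OF inside_between[OF yt]])
    show "y \<in> {c \<in> set P. seg c = seg y}" using y by simp
    show "{c \<in> {c \<in> set P. seg c = seg y}. reach y c \<and> reach c t} \<subseteq> ?C \<or>
      {c \<in> {c \<in> set P. seg c = seg y}. reach y c \<and> reach c t} \<inter> ?C = {}"
    proof (rule disjI2, rule equals0I)
      fix c assume c: "c \<in> {c \<in> {c \<in> set P. seg c = seg y}. reach y c \<and> reach c t} \<inter> ?C"
      have "c \<in> set P" "seg c = K" "reach y c" using IntD1[OF c] y(2) by auto
      then show False using key IntD2[OF c] by blast
    qed
  qed
  have tC: "t \<notin> ?C" using key[of t] t_P seg_t inside_reach[OF yt] by simp
  have "(s, t) \<in> (cutarcs ?C e_last)\<^sup>*"
    by (rule rtrancl_trans[OF st1 rtrancl_trans[OF st2 rtrancl_trans[OF st3 rtrancl_trans[OF st4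
          rtrancl_trans[OF st5[unfolded nth_pos[OF u(1)]] rtrancl_trans[OF st6 st7]]]]]])
  then show False by (rule exchange_cut[OF sC tC e_last])
qed

text \<open>The rerouted walk goes from \<open>s\<close> along the initial segment to
  \<open>z\<close>, through \<open>De\<close> to \<open>v\<close>, along \<open>P\<close> to
  \<open>yk\<close>, through \<open>De\<close> to \<open>u1\<close>, along the segment to
  \<open>u2\<close>, and through \<open>De\<close> to \<open>z1\<close> and \<open>t\<close>. It
  avoids \<open>e_first\<close> because it follows \<open>P\<close> only from \<open>v\<close> on
  across arcs outside \<open>De\<close>, and \<open>v\<close> lies behind \<open>fb\<close>.\<close>

lemma no_rise_aux2:
  assumes u: "u1 \<in> set P" "u2 \<in> set P" "0 < seg u1" "seg u1 = seg u2"
    and v: "v \<in> set P" "seg u1 < seg v" "seg v < K"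
    and r: "reach u1 v" "reach v u2"
  shows False
proof -
  \<comment> \<open>The pieces up to \<open>v\<close> lie in \<open>C\<close>, those from
    \<open>yk\<close> on lie outside. Between \<open>v\<close> and \<open>yk\<close> the arcs of
    \<open>De\<close> on \<open>P\<close> do not leave \<open>C\<close>, so the route leaves it on
    an arc of \<open>P\<close> outside \<open>De\<close>.\<close>
  let ?C = "{c \<in> set P. seg c = 0 \<and> reach c v} \<union> {c. reach u1 c \<and> reach c v \<and> \<not> (c \<in> set P \<and> 0 < seg c \<and> seg c \<le> seg u1)}
     \<union> {c \<in> set P. seg v \<le> seg c \<and> seg c < K \<and> reach u1 c}"
  have dvs: "dv u1" "dv v" "dv u2" using reach_dv[OF r(1)] reach_dv[OF r(2)] u v by auto
  have u12: "pos u1 \<le> pos u2"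
  proof (rule ccontr)
    assume "\<not> pos u1 \<le> pos u2"
    then have "reach u2 u1" using inside_reach[OF same_seg_reach[of u2 u1]] u by simp
    then have "v = u2" using reach_antisym[OF r(2)] r(1) by (meson rtrancl_trans)
    then show False using v u by simp
  qed
  have sC: "s \<in> ?C" using dvs s_P by (auto simp: dv_def)
  obtain z where z: "z \<in> set P" "seg z = 0" "(z, v) \<in> inside ({c. c \<notin> set P \<or> seg v \<le> seg c} \<union> {z})" "reach u1 z"
    using links_rise_start[OF reach_link[OF r(1)]] u v by auto
  have st1: "(s, z) \<in> (cutarcs ?C e_first)\<^sup>*"
  proof (rule cut_inside[OF inside_between[OF same_seg_reach[of s z]]])
    show "{c \<in> {c \<in> set P. seg c = seg s}. reach s c \<and> reach c z} \<subseteq> ?C \<or>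
      {c \<in> {c \<in> set P. seg c = seg s}. reach s c \<and> reach c z} \<inter> ?C = {}"
      using inside_reach[OF z(3)] s_P by (intro disjI1) (auto dest: rtrancl_trans)
  qed (use s_P z in auto)
  have st2: "(z, v) \<in> (cutarcs ?C e_first)\<^sup>*"
  proof (rule cut_inside[OF inside_between[OF z(3)]])
    show "{c \<in> {c. c \<notin> set P \<or> seg v \<le> seg c} \<union> {z}. reach z c \<and> reach c v} \<subseteq> ?C \<or>
      {c \<in> {c. c \<notin> set P \<or> seg v \<le> seg c} \<union> {z}. reach z c \<and> reach c v} \<inter> ?C = {}"
      using z u v by (intro disjI1) (auto dest: rtrancl_trans)
  qed simp
  have pv: "fb < pos v" "pos v < lb" using u v nd_pos_iff[of "pos v"] nd_lt_K_iff[of "pos v"] by auto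
  have st3: "(P ! pos v, yk) \<in> (cutarcs ?C e_first)\<^sup>*"
  proof (rule cut_P)
    show "pos v \<le> lb" "lb < length P" using pv lb by auto
    show "(P ! q, P ! Suc q) \<noteq> e_first" if "pos v \<le> q" "q < lb" "bad q" for q
      using that pv arcs_eq_iff[of q fb] fb unfolding e_first_def bad_def by auto
    show "P ! Suc q \<in> ?C" if q: "pos v \<le> q" "q < lb" "\<not> bad q" "P ! q \<in> ?C" for q
    proof -
      have sl: "Suc q < lb" using q lb(1) by (metis Suc_lessI diff_Suc_1)
      have n: "nd (Suc q) = nd q" "nd q < K" "seg v \<le> nd q"
        using q nd_lt_K[of q] nd_mono[of "pos v" q] by (auto simp: nd_Suc)
      have p: "pos (P ! q) = q" "pos (P ! Suc q) = Suc q" "P ! q \<in> set P" "P ! Suc q \<in> set P"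
        using sl lb(3) by auto
      have "reach u1 (P ! q)" using q(4) n p v by auto
      then have "reach u1 (P ! Suc q)" using not_bad_De[of q] q sl lb(3) by (meson rtrancl_into_rtrancl less_trans)
      then show ?thesis using n p by auto
    qed
  qed
  have st4: "(yk, u1) \<in> (cutarcs ?C e_first)\<^sup>*"
  proof (rule cut_inside[OF inside_between[OF mid_from_yk[of u1]]])
    have "c \<notin> ?C" if c: "c \<notin> set P \<or> seg u1 \<le> seg c" "reach c u1" for c
    proof (cases "c = u1")
      case False
      then have "\<not> reach u1 c" using c(2) reach_antisym by blast
      then show ?thesis using c(1) u by auto
    qed (use u v in auto)
    then show "{c \<in> {v. v \<notin> set P \<or> seg u1 \<le> seg v}. reach yk c \<and> reach c u1} \<subseteq> ?C \<or>
      {c \<in> {v. v \<notin> set P \<or> seg u1 \<le> seg v}. reach yk c \<and> reach c u1} \<inter> ?C = {}" by (intro disjI2) blast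
  qed (use u v dvs yk_P lb in auto)
  have st5: "(u1, u2) \<in> (cutarcs ?C e_first)\<^sup>*"
    by (rule cut_inside[OF same_seg_reach[of u1 u2]]) (use u u12 v in auto)
  have st6: "(u2, z1) \<in> (cutarcs ?C e_first)\<^sup>*"
  proof (rule cut_inside[OF inside_between[OF mid_to_z1[of u2]]])
    have "c \<notin> ?C" if c: "c \<notin> set P \<or> seg c \<le> seg u2" "reach u2 c" for c
    proof -
      have "\<not> reach c v" using reach_antisym[of c v] rtrancl_trans[OF r(2) c(2)] c(1) u v by auto
      then show ?thesis using c u v by auto
    qed
    then show "{c \<in> {v. v \<notin> set P \<or> seg v \<le> seg u2}. reach u2 c \<and> reach c z1} \<subseteq> ?C \<or>
      {c \<in> {v. v \<notin> set P \<or> seg v \<le> seg u2}. reach u2 c \<and> reach c z1} \<inter> ?C = {}" by (intro disjI2) blast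
  qed (use u v dvs in auto)
  have vz: "reach v z1" using inside_reach[OF mid_to_z1[of v]] v u dvs by auto
  have key: "c \<notin> ?C" if c: "reach z1 c" for c
  proof -
    have "\<not> reach c v"
    proof
      assume "reach c v"
      then have "reach z1 v" using c by (meson rtrancl_trans)
      then have "v = z1" using vz reach_antisym by blast
      then show False using v z1_P fb by simp
    qed
    moreover have "\<not> (c \<in> set P \<and> seg v \<le> seg c \<and> seg c < K)"
    proof
      assume a: "c \<in> set P \<and> seg v \<le> seg c \<and> seg c < K"
      have "c \<noteq> z1" using a v z1_P fb by auto
      then have "dv c" using reach_dv c by blast
      then have "reach c z1" using inside_reach[OF mid_to_z1[of c]] a v by auto
      then show False using reach_antisym[OF c] \<open>c \<noteq> z1\<close> by blast
    qed
    ultimately show ?thesis by blast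
  qed
  have st7: "(z1, t) \<in> (cutarcs ?C e_first)\<^sup>*"
    by (rule cut_inside[OF reach_between[OF dv_z1(2)]]) (use key in blast)
  have tC: "t \<notin> ?C" using key dv_z1 by blast
  have "(s, t) \<in> (cutarcs ?C e_first)\<^sup>*"
    by (rule rtrancl_trans[OF st1 rtrancl_trans[OF st2 rtrancl_trans[OF st3[unfolded nth_pos[OF v(1)]]
          rtrancl_trans[OF st4 rtrancl_trans[OF st5 rtrancl_trans[OF st6 st7]]]]]])
  then show False by (rule exchange_cut[OF sC tC e_first])
qed

text \<open>Arcs of \<open>De\<close> have both ends in \<open>dv\<close>, so all arcs of
  \<open>P\<close> from \<open>b\<close> to \<open>a\<close> are outside \<open>De\<close>. If
  \<open>P ! a\<close> did not reach \<open>P ! b\<close>, the route through \<open>De\<close> to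
  \<open>P ! b\<close>, along \<open>P\<close> to \<open>P ! a\<close> and through \<open>De\<close>
  to \<open>t\<close> would avoid \<open>e_first\<close> and cross the cut only on such arcs. So a
  detour of \<open>P\<close> off \<open>De\<close> leads backwards in the order of
  \<open>De\<close>.\<close>

lemma ear_back:
  assumes a: "a < length P" "0 < a" "bad (a - 1)" "dv (P ! a)" and b: "b < a" "dv (P ! b)"
    and mid: "\<And>r. b < r \<Longrightarrow> r < a \<Longrightarrow> \<not> dv (P ! r)" and e: "fb < b"
  shows "reach (P ! a) (P ! b)"
proof (rule ccontr)
  assume na: "\<not> reach (P ! a) (P ! b)"
  let ?C = "{c. reach c (P ! b)}"
  have allbad: "bad r" if "b \<le> r" "r < a" for r
  proof (rule ccontr)
    assume nb: "\<not> bad r"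
    then have "(P ! r, P ! Suc r) \<in> De" using not_bad_De[of r] that a by simp
    then have "dv (P ! Suc r)" using De_dv by blast
    then have "Suc r = a" using mid[of "Suc r"] that by (cases "Suc r = a") auto
    then show False using a(3) nb by auto
  qed
  have st1: "(s, P ! b) \<in> (cutarcs ?C e_first)\<^sup>*"
    by (rule cut_inside[OF reach_between]) (use b in \<open>auto simp: dv_def\<close>)
  have st2: "(P ! b, P ! a) \<in> (cutarcs ?C e_first)\<^sup>*"
  proof (rule cut_P)
    show "(P ! r, P ! Suc r) \<noteq> e_first" if "b \<le> r" "r < a" "bad r" for r
      using that e arcs_eq_iff[of r fb] fb unfolding e_first_def bad_def by auto
  qed (use allbad a b in auto)
  have st3: "(P ! a, t) \<in> (cutarcs ?C e_first)\<^sup>*"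
    by (rule cut_inside[OF reach_between]) (use a na in \<open>auto simp: dv_def dest: rtrancl_trans\<close>)
  have tC: "t \<notin> ?C" using na a by (auto simp: dv_def dest: rtrancl_trans)
  have sC: "s \<in> ?C" using b by (simp add: dv_def)
  show False
    by (rule exchange_cut[OF sC tC e_first rtrancl_trans[OF st1 rtrancl_trans[OF st2 st3]]])
qed

lemma seg_start:
  assumes "v \<in> set P" "0 < seg v"
  shows "\<exists>x\<in>set P. seg x = seg v \<and> pos x \<le> pos v \<and> 0 < pos x \<and> bad (pos x - 1)"
proof -
  let ?i = "LEAST i. nd i = seg v"
  have i: "nd ?i = seg v" by (rule LeastI[of _ "pos v"]) simp
  have le: "?i \<le> pos v" by (rule Least_le) simp
  have i0: "0 < ?i" using i assms(2) by (metis gr0I nd_0 less_irrefl)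
  have "nd (?i - 1) \<noteq> seg v" using not_less_Least[of "?i - 1" "\<lambda>i. nd i = seg v"] i0 by simp
  then have "bad (?i - 1)" using i i0 nd_Suc[of "?i - 1"] by (auto split: if_splits)
  moreover have "?i < length P" using le pos_lt[OF assms(1)] by simp
  ultimately show ?thesis using i le i0 by (intro bexI[of _ "P ! ?i"]) auto
qed

text \<open>Let \<open>u0\<close> and \<open>x\<close> be the starts of the segments of
  \<open>u\<close> and \<open>v\<close>. By \<open>no_rise_aux1\<close>, \<open>u0\<close> reaches
  \<open>x\<close>; by \<open>ear_back\<close>, \<open>x\<close> reaches the vertex
  \<open>P ! b\<close> at which the detour into \<open>x\<close> begins. So \<open>u0\<close>
  reaches \<open>P ! b\<close>, whose segment is below that of \<open>v\<close>. If it is the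
  segment of \<open>u\<close>, \<open>no_rise_aux2\<close> gives the contradiction, otherwise the
  induction on the difference of the segment numbers does.\<close>

theorem no_rise:
  assumes "u \<in> set P" "v \<in> set P" "0 < seg u" "seg u < seg v" "seg v < K" "reach u v"
  shows False
  using assms
proof (induction "seg v - seg u" arbitrary: u v rule: less_induct)
  case less
  obtain u0 where u0: "u0 \<in> set P" "seg u0 = seg u" "pos u0 \<le> pos u" "0 < pos u0" "bad (pos u0 - 1)"
    using seg_start less.prems by blast
  obtain x where x: "x \<in> set P" "seg x = seg v" "pos x \<le> pos v" "0 < pos x" "bad (pos x - 1)"
    using seg_start[of v] less.prems by auto
  have u0v: "reach u0 v" using inside_reach[OF same_seg_reach[of u0 u]] u0 less.prems by (meson rtrancl_trans)
  have u0x: "reach u0 x"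
    using no_rise_aux1[of u0 v x] u0 x u0v less.prems by auto
  have "u0 \<noteq> x" using u0(2) x(2) less.prems(4) by auto
  then have dvs: "dv u0" "dv x" using reach_dv[OF u0x] by auto
  let ?B = "{b. b < pos x \<and> dv (P ! b)}"
  have u0B: "pos u0 \<in> ?B" using dvs u0 x nth_pos less.prems nd_less_imp[of "pos u0" "pos x"] by auto
  define b where "b = Max ?B"
  have bB: "b \<in> ?B" unfolding b_def by (rule Max_in) (use u0B in auto)
  have bge: "pos u0 \<le> b" unfolding b_def by (rule Max_ge) (use u0B in auto)
  have mid: "\<not> dv (P ! r)" if "b < r" "r < pos x" for r
  proof
    assume "dv (P ! r)"
    then have "r \<le> b" unfolding b_def by (intro Max_ge) (use that in auto)
    then show False using that by simp
  qed
  have bl: "b < length P" using bB pos_lt[OF x(1)] by auto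
  have "fb < b" using bge u0 less.prems nd_pos_iff[of "pos u0"] by simp
  then have xb: "reach x (P ! b)"
    using ear_back[of "pos x" b] pos_lt[OF x(1)] x dvs bB mid nth_pos[OF x(1)] by auto
  have nb: "nd b < seg x" using bad_nd_lt[OF x(5), of b "pos x"] bB x(4) by auto
  have nb2: "seg u \<le> nd b" using nd_mono[OF bge] u0 by simp
  have u0b: "reach u0 (P ! b)" using u0x xb by (rule rtrancl_trans)
  show False
  proof (cases "nd b = seg u")
    case True
    then show False using no_rise_aux2[of u0 "P ! b" x] u0 x xb u0x less.prems bl by auto
  next
    case False
    have "seg (P ! b) - seg u0 < seg v - seg u" using nb nb2 x(2) u0(2) bl less.prems(4) by simp
    then show False using less.hyps[of "P ! b" u0] False u0 x u0b nb nb2 less.prems bl by auto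
  qed
qed

end

section \<open>The pebble game\<close>

text \<open>\<open>An\<close> holds the guess of an arc on the initial segment, \<open>Ln\<close> is
  the situation between two inner segments, and \<open>Gn\<close> the one inside an inner
  segment.\<close>

datatype node = Src | An nat | Ln nat nat nat | Gn nat nat nat nat nat | Fin

lemma (in spd) walk_De_distinct: "walk De a xs b \<Longrightarrow> distinct xs"
proof (induction xs arbitrary: a)
  case (Cons x xs)
  show ?case
  proof (cases xs)
    case (Cons y ys)
    then have xy: "(x, y) \<in> De" "walk De y xs b" using Cons.prems by (auto simp: walk_Cons2)
    have "x \<notin> set xs"
    proof
      assume "x \<in> set xs"
      then have "reach y x" using walk_verts_rtrancl[OF xy(2)] by blast
      then have "x = y" using reach_antisym[of x y] xy(1) by blast
      then show False using De_h[OF xy(1)] wpos De_sub xy(1) by fastforce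
    qed
    then show ?thesis using Cons.IH[OF xy(2)] by simp
  qed simp
qed simp

locale dp_data =
  fixes N M :: nat and src dst :: "nat \<Rightarrow> nat" and wt :: "nat \<Rightarrow> real" and dE :: "nat \<Rightarrow> bool"
    and rc :: "nat \<Rightarrow> nat \<Rightarrow> bool" and hh gg :: "nat \<Rightarrow> real"
begin

text \<open>
  A run of the game reconstructs the segments of an optimal path. Arcs \<open>i\<close> and \<open>j\<close> are the last arcs
  traversed on the initial and on the final segment. The middle segments are built from the back:
  \<open>c\<close> is the first vertex of what has been built so far, and in a state \<open>Gn i j a x c\<close> the current
  segment starts in \<open>a\<close> and has reached \<open>x\<close>. The reachability conditions let a vertex be entered
  only if no other pebble can still come to it. Label \<open>M\<close> stands for a step without an arc.
\<close>

inductive tr :: "node \<Rightarrow> node \<Rightarrow> real \<Rightarrow> nat \<Rightarrow> bool" where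
  tr_src: "i < M \<Longrightarrow> dE i \<Longrightarrow> tr Src (An i) 0 i"
| tr_start: "i < M \<Longrightarrow> j < M \<Longrightarrow> dE i \<Longrightarrow> dE j \<Longrightarrow> \<not> rc (src j) (src i) \<Longrightarrow> dst i \<noteq> src j \<Longrightarrow>
    tr (An i) (Ln i j (src j)) (gg (src j)) j"
| tr_L1: "i < M \<Longrightarrow> j < M \<Longrightarrow> c < N \<Longrightarrow> e < M \<Longrightarrow> dE e \<Longrightarrow> src e = dst i \<Longrightarrow> \<not> rc (dst j) (dst i) \<Longrightarrow>
    \<not> rc (dst i) (src j) \<Longrightarrow> tr (Ln i j c) (Ln e j c) 0 e"
| tr_L2: "i < M \<Longrightarrow> j < M \<Longrightarrow> c < N \<Longrightarrow> e < M \<Longrightarrow> dE e \<Longrightarrow> src e = dst j \<Longrightarrow> \<not> rc (dst i) (dst j) \<Longrightarrow>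
    tr (Ln i j c) (Ln i e c) 0 e"
| tr_G1: "i < M \<Longrightarrow> j < M \<Longrightarrow> a < N \<Longrightarrow> x < N \<Longrightarrow> c < N \<Longrightarrow> e < M \<Longrightarrow> dE e \<Longrightarrow> src e = dst i \<Longrightarrow>
    \<not> rc (dst j) (dst i) \<Longrightarrow> \<not> rc (dst i) (src j) \<Longrightarrow> \<not> rc x (dst i) \<Longrightarrow> tr (Gn i j a x c) (Gn e j a x c) 0 e"
| tr_G2: "i < M \<Longrightarrow> j < M \<Longrightarrow> a < N \<Longrightarrow> x < N \<Longrightarrow> c < N \<Longrightarrow> e < M \<Longrightarrow> dE e \<Longrightarrow> src e = dst j \<Longrightarrow>
    \<not> rc (dst i) (dst j) \<Longrightarrow> \<not> rc x (dst j) \<Longrightarrow> tr (Gn i j a x c) (Gn i e a x c) 0 e"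
| tr_open: "i < M \<Longrightarrow> j < M \<Longrightarrow> a < N \<Longrightarrow> c < N \<Longrightarrow> \<not> rc a (src i) \<Longrightarrow> \<not> rc a (src j) \<Longrightarrow>
    tr (Ln i j c) (Gn i j a a c) 0 M"
| tr_step: "i < M \<Longrightarrow> j < M \<Longrightarrow> a < N \<Longrightarrow> x < N \<Longrightarrow> c < N \<Longrightarrow> e < M \<Longrightarrow> dE e \<Longrightarrow> src e = x \<Longrightarrow>
    \<not> rc (dst i) x \<Longrightarrow> \<not> rc (dst j) x \<Longrightarrow> tr (Gn i j a x c) (Gn i j a (dst e) c) (wt e) e"
| tr_close: "i < M \<Longrightarrow> j < M \<Longrightarrow> a < N \<Longrightarrow> x < N \<Longrightarrow> c < N \<Longrightarrow> e < M \<Longrightarrow> src e = x \<Longrightarrow> dst e = c \<Longrightarrow>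
    \<not> rc (dst i) x \<Longrightarrow> \<not> rc (dst j) x \<Longrightarrow> tr (Gn i j a x c) (Ln i j a) (wt e) e"
| tr_fin: "i < M \<Longrightarrow> j < M \<Longrightarrow> c < N \<Longrightarrow> e < M \<Longrightarrow> src e = dst i \<Longrightarrow> dst e = c \<Longrightarrow> \<not> dE e \<Longrightarrow>
    \<not> rc (dst j) (dst i) \<Longrightarrow> tr (Ln i j c) Fin (wt e + hh (dst i)) e"

text \<open>Labels are collected in reverse, so \<open>last ls\<close> is the arc guessed by
  \<open>tr_src\<close>. The length of the final segment is charged at once by
  \<open>tr_start\<close> and that of the initial one by \<open>tr_fin\<close>, which makes the
  moves of the two outer pebbles free.\<close>

inductive run :: "node \<Rightarrow> real \<Rightarrow> nat list \<Rightarrow> bool" where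
  run_src: "run Src 0 []"
| run_step: "run u c ls \<Longrightarrow> tr u v d l \<Longrightarrow> run v (c + d) (l # ls)"

end

section \<open>Soundness: what a run says about walks\<close>

locale dp = dp_data N M src dst wt dE rc hh gg + spd E De w hh s t
  for N M src dst wt dE rc hh gg and E De :: "(nat \<times> nat) set" and w s t +
  fixes pre suf :: "nat \<Rightarrow> nat list"
  assumes E_def: "E = (\<lambda>e. (src e, dst e)) ` {..<M}"
    and inj: "inj_on (\<lambda>e. (src e, dst e)) {..<M}"
    and w_wt: "e < M \<Longrightarrow> w (src e, dst e) = wt e"
    and De_dE: "e < M \<Longrightarrow> (src e, dst e) \<in> De \<longleftrightarrow> dE e"
    and src_dst: "e < M \<Longrightarrow> src e < N \<and> dst e < N"
    and rc: "u < N \<Longrightarrow> v < N \<Longrightarrow> rc u v \<longleftrightarrow> (u, v) \<in> De\<^sup>*"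
    and gg: "dv u \<Longrightarrow> gg u = hh t - hh u"
    and hh_s: "hh s = 0"
    and pre: "dv u \<Longrightarrow> walk De s (pre u) u"
    and suf: "dv u \<Longrightarrow> walk De u (suf u) t"
begin

abbreviation arc :: "nat \<Rightarrow> nat \<times> nat" where "arc e \<equiv> (src e, dst e)"

lemma dE_De: "e < M \<Longrightarrow> dE e \<Longrightarrow> arc e \<in> De" using De_dE by blast

lemma arc_E: "e < M \<Longrightarrow> arc e \<in> E" using E_def by blast

lemma dE_dv: "e < M \<Longrightarrow> dE e \<Longrightarrow> dv (src e) \<and> dv (dst e)"
  using De_dv dE_De by blast

lemma De_step: "(u, v) \<in> De \<Longrightarrow> reach v x \<Longrightarrow> reach u x"
  by (rule converse_rtrancl_into_rtrancl)

text \<open>A run does not record how the initial segment gets to its guessed arc;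
  \<open>pre\<close> fills this gap. The corresponding gap at the end of the final segment is filled
  by \<open>suf\<close> when the run is complete.\<close>

definition labset :: "nat list \<Rightarrow> (nat \<times> nat) set" where
  "labset ls = set (arcs_of (pre (src (last ls)))) \<union> arc ` (set ls - {M})"

text \<open>\<open>A\<close>, \<open>m\<close> and \<open>B\<close> are the vertices used so far on
  the initial, the inner and the final segments. Whatever an outer pebble can still enter is
  reachable from \<open>dst i\<close> or \<open>dst j\<close>, so the negated reachabilities exclude
  future collisions in terms of the current positions alone. Nothing keeps \<open>m\<close> from
  repeating a vertex of its own.\<close>

definition inv :: "nat \<Rightarrow> nat \<Rightarrow> nat \<Rightarrow> real \<Rightarrow> nat list \<Rightarrow> nat list \<Rightarrow> nat list \<Rightarrow> bool" where
  "inv i j c C A m B \<longleftrightarrow> i < M \<and> j < M \<and> dE i \<and> dE j \<and> c < N \<and> walk De s A (src i) \<and> B \<noteq> [] \<and>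
     walk De (hd B) B (src j) \<and> walk E c (m @ [hd B]) (hd B) \<and> C = cost w (m @ [hd B]) + gg (hd B) \<and>
     set A \<inter> set B = {} \<and> set m \<inter> (set A \<union> set B) = {} \<and>
     (\<forall>v\<in>set m. \<not> reach (dst i) v \<and> \<not> reach (dst j) v) \<and> (\<forall>v\<in>set A. \<not> reach (dst j) v) \<and> dst i \<notin> set B"

text \<open>The last vertex \<open>x\<close> is exempt from the condition on
  \<open>butlast X\<close>: the third pebble still stands there, and the check is made when it moves
  on.\<close>

definition invX :: "nat \<Rightarrow> nat \<Rightarrow> nat \<Rightarrow> nat \<Rightarrow> nat list \<Rightarrow> nat list \<Rightarrow> nat list \<Rightarrow> bool" where
  "invX i j a x X A B \<longleftrightarrow> a < N \<and> x < N \<and> walk De a X x \<and> set X \<inter> (set A \<union> set B) = {} \<and>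
     (\<forall>v\<in>set (butlast X). \<not> reach (dst i) v \<and> \<not> reach (dst j) v) \<and> (\<forall>v\<in>set A \<union> set B. \<not> reach x v)"

definition arcsum :: "nat \<Rightarrow> nat \<Rightarrow> nat list \<Rightarrow> nat list \<Rightarrow> nat list \<Rightarrow> (nat \<times> nat) set" where
  "arcsum i j A m B = set (arcs_of (A @ [dst i])) \<union> set (arcs_of (m @ [hd B])) \<union> set (arcs_of (B @ [dst j]))"

text \<open>At \<open>Fin\<close> the alternative to a simple walk is a strictly cheaper
  not-shortest path, which contradicts that the run is cheapest. The arcs of \<open>W\<close> are
  recorded as a set because the program rebuilds the path from the labels without their
  order.\<close>

fun state_inv :: "node \<Rightarrow> real \<Rightarrow> nat list \<Rightarrow> bool" where
  "state_inv Src C ls \<longleftrightarrow> C = 0 \<and> ls = []"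
| "state_inv (An i) C ls \<longleftrightarrow> C = 0 \<and> ls = [i] \<and> i < M \<and> dE i"
| "state_inv (Ln i j c) C ls \<longleftrightarrow> (ls \<noteq> [] \<and> last ls < M \<and> dE (last ls) \<and>
     (\<exists>A m B. inv i j c C A m B \<and> arcsum i j A m B = labset ls))"
| "state_inv (Gn i j a x c) C ls \<longleftrightarrow> (ls \<noteq> [] \<and> last ls < M \<and> dE (last ls) \<and>
     (\<exists>A m B X D. inv i j c D A m B \<and> invX i j a x X A B \<and> C = D + cost w X \<and>
        arcsum i j A m B \<union> set (arcs_of X) = labset ls))"
| "state_inv Fin C ls \<longleftrightarrow> (ls \<noteq> [] \<and> last ls < M \<and> dE (last ls) \<and>
     (\<exists>W q. walk E s W t \<and> cost w W = C \<and> dv q \<and> set (arcs_of W) = labset ls \<union> set (arcs_of (suf q)) \<and>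
       \<not> set (arcs_of W) \<subseteq> De \<and>
       (distinct W \<or> (\<exists>N. path E s N t \<and> \<not> set (arcs_of N) \<subseteq> De \<and> cost w N < C))))"

lemma labset_Cons: "ls \<noteq> [] \<Longrightarrow> l < M \<Longrightarrow> labset (l # ls) = insert (arc l) (labset ls)"
  "ls \<noteq> [] \<Longrightarrow> labset (M # ls) = labset ls"
  by (auto simp: labset_def)

lemma arcs_snoc: "xs \<noteq> [] \<Longrightarrow> set (arcs_of (xs @ [y])) = insert (last xs, y) (set (arcs_of xs))"
  using arcs_of_join[of xs "[y]"] by simp

text \<open>\<open>dst i\<close> joins \<open>A\<close>, so it must be out of reach of
  \<open>dst j\<close>. The next vertex cannot lie in \<open>B\<close>: every vertex of
  \<open>B\<close> reaches \<open>src j\<close>, and \<open>dst i\<close> does not.\<close>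

lemma inv_T1:
  assumes I: "inv i j c C A m B" and e: "e < M" "dE e" "src e = dst i"
    and c: "\<not> reach (dst j) (dst i)" "\<not> reach (dst i) (src j)"
  shows "inv e j c C (A @ [dst i]) m B" "arcsum e j (A @ [dst i]) m B = insert (arc e) (arcsum i j A m B)"
proof -
  have A: "A \<noteq> []" "last A = src i" using I by (auto simp: inv_def walk_def)
  have st: "(dst i, dst e) \<in> De" using dE_De[of e] e by auto
  have w1: "walk De s (A @ [dst i]) (dst i)"
    by (rule walk_join[of _ _ _ "src i" "dst i"]) (use I dE_De in \<open>auto simp: inv_def\<close>)
  have im: "dst i \<notin> set m" using I by (auto simp: inv_def)
  have n: "dst e \<notin> set B"
  proof
    assume "dst e \<in> set B"
    then have "reach (dst e) (src j)" using I walk_verts_rtrancl[of De "hd B" B "src j"] by (auto simp: inv_def)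
    then show False using c De_step[OF st] by blast
  qed
  show "inv e j c C (A @ [dst i]) m B"
    using I w1 im n e c st unfolding inv_def by (auto dest: De_step[OF st])
  show "arcsum e j (A @ [dst i]) m B = insert (arc e) (arcsum i j A m B)"
    using e A arcs_snoc[of "A @ [dst i]" "dst e"] unfolding arcsum_def by auto
qed

lemma inv_T2:
  assumes I: "inv i j c C A m B" and e: "e < M" "dE e" "src e = dst j"
    and c: "\<not> reach (dst i) (dst j)"
  shows "inv i e c C A m (B @ [dst j])" "arcsum i e A m (B @ [dst j]) = insert (arc e) (arcsum i j A m B)"
proof -
  have B: "B \<noteq> []" "last B = src j" using I by (auto simp: inv_def walk_def)
  have st: "(dst j, dst e) \<in> De" using dE_De[of e] e by auto
  have w1: "walk De (hd B) (B @ [dst j]) (dst j)"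
    by (rule walk_join[of _ _ _ "src j" "dst j"]) (use I dE_De in \<open>auto simp: inv_def\<close>)
  have h: "hd (B @ [dst j]) = hd B" using B by simp
  have im: "dst j \<notin> set m" "dst j \<notin> set A" using I by (auto simp: inv_def)
  have "dst i \<noteq> dst j" using c by auto
  then show "inv i e c C A m (B @ [dst j])"
    using I w1 im e c st unfolding inv_def h by (auto dest: De_step[OF st])
  show "arcsum i e A m (B @ [dst j]) = insert (arc e) (arcsum i j A m B)"
    using e B arcs_snoc[of "B @ [dst j]" "dst e"] unfolding arcsum_def h by auto
qed

text \<open>Formulated for any \<open>m'\<close> with vertices among those of \<open>m\<close>, so
  that it covers both the walk of the run and its shortcut.\<close>

lemma inv_fin:
  assumes I: "inv i j c C A m B" and e: "e < M" "src e = dst i" "dst e = c" "\<not> dE e"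
    and q: "\<not> reach (dst j) (dst i)"
    and m': "walk E c (m' @ [hd B]) (hd B)" "set m' \<subseteq> set m"
  shows "walk E s (A @ [dst i] @ m' @ B @ suf (dst j)) t"
    and "cost w (A @ [dst i] @ m' @ B @ suf (dst j)) = cost w (m' @ [hd B]) + gg (hd B) + (wt e + hh (dst i))"
    and "set (arcs_of (A @ [dst i] @ m' @ B @ suf (dst j))) = insert (arc e) (arcsum i j A m' B) \<union> set (arcs_of (suf (dst j)))"
    and "distinct m' \<Longrightarrow> distinct (A @ [dst i] @ m' @ B @ suf (dst j))"
proof -
  have ij: "i < M" "j < M" "dE i" "dE j" using I by (auto simp: inv_def)
  have dvj: "dv (dst j)" "dv (src j)" using dE_dv ij by auto
  note sf = suf[OF dvj(1)]
  have S: "suf (dst j) \<noteq> []" "hd (suf (dst j)) = dst j" using sf by (auto simp: walk_def)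
  have A: "A \<noteq> []" "last A = src i" and B: "B \<noteq> []" "last B = src j" "walk De (hd B) B (src j)"
    using I by (auto simp: inv_def walk_def)
  have w1: "walk De s (A @ [dst i]) (dst i)"
    by (rule walk_join[of _ _ _ "src i" "dst i"]) (use I dE_De in \<open>auto simp: inv_def\<close>)
  have w2: "walk De (hd B) (B @ suf (dst j)) t"
    by (rule walk_join[OF B(3) sf]) (use dE_De ij in auto)
  have w3: "walk E c (m' @ B @ suf (dst j)) t"
    using walk_glue(1)[OF m'(1) walk_mono[OF w2 De_sub]] B(1) by (cases B) auto
  have c3: "cost w (m' @ B @ suf (dst j)) = cost w (m' @ [hd B]) + cost w (B @ suf (dst j))"
    using walk_glue(2)[OF m'(1) walk_mono[OF w2 De_sub]] B(1) by (cases B) auto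
  show w4: "walk E s (A @ [dst i] @ m' @ B @ suf (dst j)) t"
    using walk_join[OF walk_mono[OF w1 De_sub] w3] arc_E[of e] e by auto
  have ne: "m' @ B @ suf (dst j) \<noteq> []" "hd (m' @ B @ suf (dst j)) = c" using w3 by (auto simp: walk_def)
  have "cost w (A @ [dst i]) = hh (dst i)" using cost_De[of "A @ [dst i]"] w1 hh_s by (auto simp: walk_def)
  moreover have "cost w (B @ suf (dst j)) = gg (hd B)"
  proof -
    have "dv (hd B)" using B dvj reach_dv[of "hd B" "src j"] walk_rtrancl[OF B(3)] by metis
    then show ?thesis using cost_De[of "B @ suf (dst j)"] w2 gg by (auto simp: walk_def)
  qed
  moreover have "cost w ((A @ [dst i]) @ m' @ B @ suf (dst j)) = cost w (A @ [dst i]) + w (dst i, c) + cost w (m' @ B @ suf (dst j))"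
    using cost_join[of "A @ [dst i]" "m' @ B @ suf (dst j)" w] ne by simp
  moreover have "w (dst i, c) = wt e" using w_wt e by metis
  ultimately show "cost w (A @ [dst i] @ m' @ B @ suf (dst j)) = cost w (m' @ [hd B]) + gg (hd B) + (wt e + hh (dst i))"
    using c3 by simp
  have a1: "set (arcs_of ((A @ [dst i]) @ m' @ B @ suf (dst j))) = set (arcs_of (A @ [dst i])) \<union> {(dst i, c)} \<union> set (arcs_of (m' @ B @ suf (dst j)))"
    using arcs_of_join[of "A @ [dst i]" "m' @ B @ suf (dst j)"] ne by auto
  have a2: "set (arcs_of (m' @ B @ suf (dst j))) = set (arcs_of (m' @ [hd B])) \<union> set (arcs_of (B @ suf (dst j)))"
    using arcs_of_split[of m' "hd B" "tl B @ suf (dst j)"] B(1) by (cases B) auto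
  have a3: "set (arcs_of (B @ suf (dst j))) = set (arcs_of (B @ [dst j])) \<union> set (arcs_of (suf (dst j)))"
    using arcs_of_join[of B "suf (dst j)"] arcs_snoc[of B "dst j"] B S by auto
  show "set (arcs_of (A @ [dst i] @ m' @ B @ suf (dst j))) = insert (arc e) (arcsum i j A m' B) \<union> set (arcs_of (suf (dst j)))"
    using a1 a2 a3 e unfolding arcsum_def by auto
  assume dm: "distinct m'"
  have d1: "distinct (A @ [dst i])" using walk_De_distinct[OF w1] .
  have d2: "distinct (B @ suf (dst j))" using walk_De_distinct[OF w2] .
  have sq: "v \<in> set (suf (dst j)) \<Longrightarrow> reach (dst j) v" for v using walk_verts_rtrancl[OF sf] by blast
  have f: "set A \<inter> set B = {}" "set m \<inter> (set A \<union> set B) = {}" "dst i \<notin> set B"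
    "\<forall>v\<in>set m. \<not> reach (dst i) v \<and> \<not> reach (dst j) v" "\<forall>v\<in>set A. \<not> reach (dst j) v"
    using I by (auto simp: inv_def)
  have f2: "dst i \<notin> set m'" using f(4) m'(2) by auto
  have f3: "set m' \<inter> (set A \<union> set B) = {}" using f(2) m'(2) by blast
  have f4: "set m' \<inter> set (suf (dst j)) = {}" using f(4) m'(2) sq by blast
  have f5: "set A \<inter> set (suf (dst j)) = {}" "dst i \<notin> set (suf (dst j))" using f(5) sq q by blast+
  show "distinct (A @ [dst i] @ m' @ B @ suf (dst j))"
    using dm d1 d2 f(1,3) f2 f3 f4 f5 by auto
qed

lemma state_inv_tr:
  assumes "tr u v d l" "state_inv u C ls"
  shows "state_inv v (C + d) (l # ls)"
  using assms
proof (induction arbitrary: C ls rule: tr.induct)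
  case (tr_start i j)
  \<comment> \<open>All vertices of the path \<open>pre (src i)\<close> reach \<open>src i\<close>,
    so the single test of \<open>src j\<close> against \<open>src i\<close> protects every one of
    them.\<close>
  let ?A = "pre (src i)" and ?B = "[src j]"
  have ls: "ls = [i]" "C = 0" using tr_start by auto
  have dvs: "dv (src i)" "dv (src j)" "dv (dst j)" using dE_dv tr_start by auto
  note p = pre[OF dvs(1)]
  have nr: "\<not> reach (src j) v" if "v \<in> set ?A" for v
    using walk_verts_rtrancl[OF p that] tr_start src_dst rc by (meson rtrancl_trans)
  have st: "(src j, dst j) \<in> De" using dE_De tr_start by auto
  have "inv i j (src j) (C + gg (src j)) ?A [] ?B"
    unfolding inv_def using tr_start ls p nr src_dst De_step[OF st] by auto
  moreover have "arcsum i j ?A [] ?B = labset (j # ls)"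
    using ls tr_start p arcs_snoc[of ?A "dst i"] by (auto simp: arcsum_def labset_def walk_def)
  ultimately show ?case using tr_start ls by auto
next
  case (tr_L1 i j c e)
  obtain A m B where I: "inv i j c C A m B" "arcsum i j A m B = labset ls" and l: "ls \<noteq> []" "last ls < M" "dE (last ls)"
    using tr_L1 by auto
  have c: "\<not> reach (dst j) (dst i)" "\<not> reach (dst i) (src j)" using tr_L1(1-8) rc src_dst by auto
  note T = inv_T1[OF I(1) tr_L1(4-6) c]
  have "arcsum e j (A @ [dst i]) m B = labset (e # ls)" using T(2) I(2) labset_Cons(1)[OF l(1) tr_L1(4)] by simp
  then show ?case using T(1) l by auto
next
  case (tr_L2 i j c e)
  obtain A m B where I: "inv i j c C A m B" "arcsum i j A m B = labset ls" and l: "ls \<noteq> []" "last ls < M" "dE (last ls)"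
    using tr_L2 by auto
  have c: "\<not> reach (dst i) (dst j)" using tr_L2(1-7) rc src_dst by auto
  note T = inv_T2[OF I(1) tr_L2(4-6) c]
  have "arcsum i e A m (B @ [dst j]) = labset (e # ls)" using T(2) I(2) labset_Cons(1)[OF l(1) tr_L2(4)] by simp
  then show ?case using T(1) l by auto
next
  case (tr_G1 i j a x c e)
  obtain A m B X D where I: "inv i j c D A m B" "invX i j a x X A B" "C = D + cost w X"
    "arcsum i j A m B \<union> set (arcs_of X) = labset ls" and l: "ls \<noteq> []" "last ls < M" "dE (last ls)"
    using tr_G1 by auto
  have c: "\<not> reach (dst j) (dst i)" "\<not> reach (dst i) (src j)" "\<not> reach x (dst i)" using tr_G1(1-11) rc src_dst by auto
  note T = inv_T1[OF I(1) tr_G1(6-8) c(1,2)]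
  have st: "(dst i, dst e) \<in> De" using dE_De[of e] tr_G1(6-8) by auto
  have X: "X \<noteq> []" "last X = x" using I(2) by (auto simp: invX_def walk_def)
  have "dst i \<notin> set X"
  proof
    assume a: "dst i \<in> set X"
    have "set X = insert x (set (butlast X))" using X append_butlast_last_id[of X]
      by (metis insert_is_Un list.simps(15) set_append sup_commute empty_set)
    then consider "dst i = x" | "dst i \<in> set (butlast X)" using a by blast
    then show False using c(3) I(2) by cases (auto simp: invX_def)
  qed
  then have X': "invX e j a x X (A @ [dst i]) B"
    using I(2) c unfolding invX_def by (auto dest: De_step[OF st])
  have lab: "arcsum e j (A @ [dst i]) m B \<union> set (arcs_of X) = labset (e # ls)"
    using T(2) I(4) labset_Cons(1)[OF l(1) tr_G1(6)] by simp
  show ?case unfolding state_inv.simps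
    by (intro conjI exI, use l in simp, use l in simp, use l in simp, rule T(1), rule X', use I(3) in simp, rule lab)
next
  case (tr_G2 i j a x c e)
  obtain A m B X D where I: "inv i j c D A m B" "invX i j a x X A B" "C = D + cost w X"
    "arcsum i j A m B \<union> set (arcs_of X) = labset ls" and l: "ls \<noteq> []" "last ls < M" "dE (last ls)"
    using tr_G2 by auto
  have c: "\<not> reach (dst i) (dst j)" "\<not> reach x (dst j)" using tr_G2(1-10) rc src_dst by auto
  note T = inv_T2[OF I(1) tr_G2(6-8) c(1)]
  have st: "(dst j, dst e) \<in> De" using dE_De[of e] tr_G2(6-8) by auto
  have X: "X \<noteq> []" "last X = x" using I(2) by (auto simp: invX_def walk_def)
  have "dst j \<notin> set X"
  proof
    assume a: "dst j \<in> set X"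
    have "set X = insert x (set (butlast X))" using X append_butlast_last_id[of X]
      by (metis insert_is_Un list.simps(15) set_append sup_commute empty_set)
    then consider "dst j = x" | "dst j \<in> set (butlast X)" using a by blast
    then show False using c(2) I(2) by cases (auto simp: invX_def)
  qed
  then have X': "invX i e a x X A (B @ [dst j])"
    using I(2) c unfolding invX_def by (auto dest: De_step[OF st])
  have lab: "arcsum i e A m (B @ [dst j]) \<union> set (arcs_of X) = labset (e # ls)"
    using T(2) I(4) labset_Cons(1)[OF l(1) tr_G2(6)] by simp
  show ?case unfolding state_inv.simps
    by (intro conjI exI, use l in simp, use l in simp, use l in simp, rule T(1), rule X', use I(3) in simp, rule lab)
next
  case (tr_open i j a c)
  obtain A m B where I: "inv i j c C A m B" "arcsum i j A m B = labset ls" and l: "ls \<noteq> []" "last ls < M" "dE (last ls)"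
    using tr_open by auto
  have c: "\<not> reach a (src i)" "\<not> reach a (src j)" using tr_open(1-6) rc src_dst by auto
  \<comment> \<open>Every vertex of \<open>A\<close> reaches \<open>src i\<close> and every vertex
    of \<open>B\<close> reaches \<open>src j\<close>, so two tests of \<open>a\<close>
    suffice.\<close>
  have "\<not> reach a v" if "v \<in> set A \<union> set B" for v
  proof -
    have "reach v (src i) \<or> reach v (src j)"
      using that I(1) walk_verts_rtrancl[of De s A "src i" v] walk_verts_rtrancl[of De "hd B" B "src j" v]
      unfolding inv_def by blast
    then show ?thesis using c by (meson rtrancl_trans)
  qed
  then have X': "invX i j a a [a] A B" using tr_open(3) unfolding invX_def by auto
  have lab: "arcsum i j A m B \<union> set (arcs_of [a]) = labset (M # ls)" using I(2) labset_Cons(2)[OF l(1)] by simp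
  show ?case unfolding state_inv.simps
    by (intro conjI exI, use l in simp, use l in simp, use l in simp, rule I(1), rule X', simp, rule lab)
next
  case (tr_step i j a x c e)
  obtain A m B X D where I: "inv i j c D A m B" "invX i j a x X A B" "C = D + cost w X"
    "arcsum i j A m B \<union> set (arcs_of X) = labset ls" and l: "ls \<noteq> []" "last ls < M" "dE (last ls)"
    using tr_step by auto
  note hy = tr_step(1-10)
  have c: "\<not> reach (dst i) x" "\<not> reach (dst j) x" using hy rc src_dst by auto
  have st: "(x, dst e) \<in> De" using dE_De[of e] hy by auto
  have X: "X \<noteq> []" "last X = x" using I(2) by (auto simp: invX_def walk_def)
  have w: "walk De a (X @ [dst e]) (dst e)"
    by (rule walk_join[of _ _ _ x "dst e"]) (use I(2) st in \<open>auto simp: invX_def\<close>)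
  have sX: "set X = insert x (set (butlast X))" using X append_butlast_last_id[of X]
    by (metis insert_is_Un list.simps(15) set_append sup_commute empty_set)
  have "dst e \<notin> set A \<union> set B" using I(2) st unfolding invX_def by blast
  then have X': "invX i j a (dst e) (X @ [dst e]) A B"
    using I(2) w c src_dst[OF hy(6)] sX unfolding invX_def by (auto dest: De_step[OF st])
  have co: "cost w (X @ [dst e]) = cost w X + wt e"
    using cost_join[of X "[dst e]" w] X w_wt[of e] hy by simp
  have lab: "arcsum i j A m B \<union> set (arcs_of (X @ [dst e])) = labset (e # ls)"
    using hy(6,8) I(4) labset_Cons(1)[OF l(1), of e] arcs_snoc[of X "dst e"] X by auto
  show ?case unfolding state_inv.simps
    by (intro conjI exI, use l in simp, use l in simp, use l in simp, rule I(1), rule X', use I(3) co in simp, rule lab)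
next
  case (tr_close i j a x c e)
  obtain A m B X D where I: "inv i j c D A m B" "invX i j a x X A B" "C = D + cost w X"
    "arcsum i j A m B \<union> set (arcs_of X) = labset ls" and l: "ls \<noteq> []" "last ls < M" "dE (last ls)"
    using tr_close by auto
  note hy = tr_close(1-10)
  have c: "\<not> reach (dst i) x" "\<not> reach (dst j) x" using hy rc src_dst by auto
  have X: "X \<noteq> []" "last X = x" using I(2) by (auto simp: invX_def walk_def)
  have sX: "set X = insert x (set (butlast X))" using X append_butlast_last_id[of X]
    by (metis insert_is_Un list.simps(15) set_append sup_commute empty_set)
  have mw: "walk E c (m @ [hd B]) (hd B)" using I(1) by (simp add: inv_def)
  have xc: "(x, c) \<in> E" using arc_E[of e] hy by auto
  have w: "walk E a (X @ m @ [hd B]) (hd B)"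
    by (rule walk_join[of _ _ _ x c]) (use I(2) walk_mono[OF _ De_sub] mw xc in \<open>auto simp: invX_def\<close>)
  have hm: "hd (m @ [hd B]) = c" using mw by (auto simp: walk_def)
  have co: "cost w (X @ m @ [hd B]) = cost w X + wt e + cost w (m @ [hd B])"
    using cost_join[of X "m @ [hd B]" w] X w_wt[of e] hy hm by simp
  have ar: "set (arcs_of (X @ m @ [hd B])) = insert (arc e) (set (arcs_of X) \<union> set (arcs_of (m @ [hd B])))"
    using arcs_of_join[of X "m @ [hd B]"] X hy(7,8) hm by auto
  have "inv i j a (C + wt e) A (X @ m) B"
    using I(1,2,3) w co c hy(3) sX unfolding inv_def invX_def by auto
  moreover have "arcsum i j A (X @ m) B = labset (e # ls)"
    using hy(6) I(4)[symmetric] labset_Cons(1)[OF l(1), of e] ar unfolding arcsum_def by auto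
  ultimately show ?case using l by auto
next
  case (tr_fin i j c e)
  obtain A m B where I: "inv i j c C A m B" "arcsum i j A m B = labset ls" and l: "ls \<noteq> []" "last ls < M" "dE (last ls)"
    using tr_fin by auto
  note hy = tr_fin(1-8)
  have q: "\<not> reach (dst j) (dst i)" using hy rc src_dst by auto
  have ij: "j < M" "dE j" using I by (auto simp: inv_def)
  have mw: "walk E c (m @ [hd B]) (hd B)" and Cc: "C = cost w (m @ [hd B]) + gg (hd B)" and hB: "hd B \<in> set B"
    using I(1) by (auto simp: inv_def)
  note f = inv_fin[OF I(1) hy(4-7) q]
  let ?W = "\<lambda>m. A @ [dst i] @ m @ B @ suf (dst j)"
  have nDe: "arc e \<notin> De" using De_dE[OF hy(4)] hy(7) by blast
  have W: "walk E s (?W m) t" "cost w (?W m) = C + (wt e + hh (dst i))"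
    "set (arcs_of (?W m)) = labset (e # ls) \<union> set (arcs_of (suf (dst j)))"
    using f(1-3)[OF mw] I(2) Cc labset_Cons(1)[OF l(1) hy(4)] by auto
  have n2: "\<not> set (arcs_of (?W m)) \<subseteq> De" using W(3) nDe labset_Cons(1)[OF l(1) hy(4)] by auto
  have "distinct (?W m) \<or> (\<exists>N. path E s N t \<and> \<not> set (arcs_of N) \<subseteq> De \<and> cost w N < C + (wt e + hh (dst i)))"
  proof (cases "distinct m")
    case True
    then show ?thesis using f(4)[OF mw] by auto
  next
    case False
    \<comment> \<open>The inner walk is shortened to a path. The result is strictly cheaper, simple
      by \<open>inv_fin\<close>, and still not shortest because the closing arc \<open>e\<close>
      remains.\<close>
    then have "\<not> distinct (m @ [hd B])" by auto
    then obtain ys where ys: "path E c ys (hd B)" "set ys \<subseteq> set (m @ [hd B])" "cost w ys < cost w (m @ [hd B])"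
      using walk_to_path[OF mw wpos] by blast
    then have ysd: "ys = butlast ys @ [hd B]" "distinct ys" using append_butlast_last_id[of ys] by (auto simp: path_def walk_def)
    then have "hd B \<notin> set (butlast ys)" by (metis distinct_append disjoint_iff list.set_intros(1))
    then have sub: "set (butlast ys) \<subseteq> set m" using ys(2) by (auto dest: in_set_butlastD)
    have m': "walk E c (butlast ys @ [hd B]) (hd B)" using ys(1) ysd by (simp add: path_def)
    have g: "walk E s (?W (butlast ys)) t" "cost w (?W (butlast ys)) < C + (wt e + hh (dst i))" "distinct (?W (butlast ys))"
      "\<not> set (arcs_of (?W (butlast ys))) \<subseteq> De"
      using f[OF m' sub] Cc ys(3) ysd nDe distinct_butlast[of ys] by auto
    then show ?thesis unfolding path_def by blast
  qed
  then show ?case unfolding state_inv.simps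
    using l W n2 dE_dv[OF ij] by (intro conjI exI[of _ "?W m"] exI[of _ "dst j"]) (simp_all)
qed auto

lemma run_inv: "run u C ls \<Longrightarrow> state_inv u C ls"
  by (induction rule: run.induct) (auto intro: state_inv_tr)

end

section \<open>Completeness of the game\<close>

locale dp_opt = dp N M src dst wt dE rc hh gg E De w s t pre suf + opt E De w hh s t P
  for N M src dst wt dE rc hh gg E De w s t pre suf P
begin

definition ed :: "nat \<Rightarrow> nat" where "ed r = (SOME e. e < M \<and> arc e = (P ! r, P ! Suc r))"

lemma ed:
  assumes "Suc r < length P"
  shows "ed r < M" "src (ed r) = P ! r" "dst (ed r) = P ! Suc r" "dE (ed r) \<longleftrightarrow> \<not> bad r" "wt (ed r) = w (P ! r, P ! Suc r)"
proof -
  have "\<exists>e. e < M \<and> arc e = (P ! r, P ! Suc r)" using P_arc[OF assms] unfolding E_def by force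
  then have *: "ed r < M \<and> arc (ed r) = (P ! r, P ! Suc r)" unfolding ed_def by (rule someI_ex)
  then show "ed r < M" "src (ed r) = P ! r" "dst (ed r) = P ! Suc r" by auto
  show "dE (ed r) \<longleftrightarrow> \<not> bad r" using De_dE[of "ed r"] * assms unfolding bad_def by auto
  show "wt (ed r) = w (P ! r, P ! Suc r)" using w_wt[of "ed r"] * by auto
qed

lemma P_lt_N: "r < length P \<Longrightarrow> P ! r < N"
proof -
  assume r: "r < length P"
  show "P ! r < N"
  proof (cases "Suc r < length P")
    case True
    then show ?thesis using ed[OF True] src_dst by metis
  next
    case False
    then have "Suc (r - 1) < length P" "Suc (r - 1) = r" using r len2 by auto
    then show ?thesis using ed[of "r - 1"] src_dst by metis
  qed
qed

text \<open>The cost of the run at the moment when the inner part has been built back to position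
  \<open>k\<close>; the final segment has been charged in full by then.\<close>

definition Wp :: "nat \<Rightarrow> real" where "Wp k = cost w (drop k P)"

lemma Wp_Suc: "Suc k < length P \<Longrightarrow> Wp k = w (P ! k, P ! Suc k) + Wp (Suc k)"
  unfolding Wp_def by (metis Cons_nth_drop_Suc Suc_lessD cost_simps(3))

text \<open>Positions \<open>r\<close> and \<open>q\<close> are the next vertices on the first and on the last segment, \<open>U\<close> is
  the set of positions in between that are still to be processed.\<close>

definition ok :: "nat \<Rightarrow> nat \<Rightarrow> nat set \<Rightarrow> bool" where
  "ok r q U \<longleftrightarrow> 0 < r \<and> r \<le> fb \<and> lb < q \<and> q < length P \<and>
     (\<forall>u\<in>U. \<forall>e<r. \<not> reach (P ! u) (P ! e)) \<and> (\<forall>u\<in>U. \<forall>e<q. lb \<le> e \<longrightarrow> \<not> reach (P ! u) (P ! e)) \<and>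
     (\<not> reach (P ! r) (P ! (q - 1)) \<or> r = fb \<and> reach z1 yk)"

lemma ok_bounds: "ok r q U \<Longrightarrow> 0 < r \<and> r \<le> fb \<and> lb < q \<and> q < length P"
  by (simp add: ok_def)

lemma ok_subset: "ok r q U \<Longrightarrow> V \<subseteq> U \<Longrightarrow> ok r q V"
  unfolding ok_def by blast

text \<open>The outer pebbles stand on positions \<open>r\<close> and \<open>q\<close>, so the arcs
  traversed last are those at \<open>r - 1\<close> and \<open>q - 1\<close>. The number of
  transitions is \<open>n\<close>.\<close>

definition tok :: "(nat \<Rightarrow> nat \<Rightarrow> node) \<Rightarrow> nat \<Rightarrow> nat \<Rightarrow> real \<Rightarrow> nat \<Rightarrow> bool" where
  "tok f r q C n \<longleftrightarrow> (\<exists>ls. run (f (ed (r - 1)) (ed (q - 1))) C ls \<and> length ls = n)"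

lemma tok_step:
  assumes "tok f r q C n" "tr (f (ed (r - 1)) (ed (q - 1))) (f' (ed (r' - 1)) (ed (q' - 1))) d l"
  shows "tok f' r' q' (C + d) (Suc n)"
  using assms run_step unfolding tok_def by fastforce

lemma ed_tok:
  assumes "0 < r" "r \<le> fb"
  shows "ed (r - 1) < M" "src (ed (r - 1)) = P ! (r - 1)" "dst (ed (r - 1)) = P ! r" "dE (ed (r - 1))"
proof -
  have "Suc (r - 1) < length P" "Suc (r - 1) = r" using assms fb(3) by auto
  moreover have "\<not> bad (r - 1)" using bad_ge_fb[of "r - 1"] assms by auto
  ultimately show "ed (r - 1) < M" "src (ed (r - 1)) = P ! (r - 1)" "dst (ed (r - 1)) = P ! r" "dE (ed (r - 1))"
    using ed[of "r - 1"] by auto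
qed

lemma ed_tok2:
  assumes "lb < q" "q < length P"
  shows "ed (q - 1) < M" "src (ed (q - 1)) = P ! (q - 1)" "dst (ed (q - 1)) = P ! q" "dE (ed (q - 1))"
proof -
  have "Suc (q - 1) < length P" "Suc (q - 1) = q" using assms by auto
  moreover have "\<not> bad (q - 1)" using bad_lt_lb[of "q - 1"] assms by auto
  ultimately show "ed (q - 1) < M" "src (ed (q - 1)) = P ! (q - 1)" "dst (ed (q - 1)) = P ! q" "dE (ed (q - 1))"
    using ed[of "q - 1"] by auto
qed

lemma P_eq: "i < length P \<Longrightarrow> j < length P \<Longrightarrow> P ! i = P ! j \<longleftrightarrow> i = j"
  using P_dist by (simp add: nth_eq_iff_index_eq)

lemma fb_lt_lb: "fb < lb" using bad_lt_lb[OF fb(1)] .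

lemma mid_reach:
  assumes "fb < x" "x < lb" "dv (P ! x)"
  shows "reach yk (P ! x)" "reach (P ! x) z1"
proof -
  have x: "P ! x \<in> set P" "pos (P ! x) = x" using assms lb(3) by auto
  have "0 < seg (P ! x)" "seg (P ! x) < K" using nd_pos[OF assms(1)] nd_lt_K[OF assms(2)] x by auto
  then show "reach yk (P ! x)" "reach (P ! x) z1"
    using inside_reach[OF mid_from_yk[OF x(1) assms(3)]] inside_reach[OF mid_to_z1[OF x(1) assms(3)]] by auto
qed

text \<open>The third pebble may leave \<open>P ! x\<close> only when neither outer pebble can still
  come there, so these are moved on until that holds. One stops at \<open>z1\<close> at the latest,
  since \<open>P ! x\<close> reaches \<open>z1\<close> if it lies in \<open>dv\<close>; the other
  stops at \<open>t\<close>. The hypothesis on \<open>U\<close> preserves \<open>ok\<close>: an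
  unprocessed vertex that reached a vertex passed here would reach \<open>P ! x\<close> as well,
  hence be \<open>P ! x\<close>, and close a cycle.\<close>

lemma at_advance:
  assumes a: "tok (\<lambda>i j. Gn i j a (P ! x) c) r q C n" "ok r q U" "a < N" "c < N"
    and x: "fb < x" "x < lb" and U: "\<And>u. u \<in> U \<Longrightarrow> u < length P \<and> (reach (P ! u) (P ! x) \<longrightarrow> u = x)"
  shows "\<exists>r' q'. tok (\<lambda>i j. Gn i j a (P ! x) c) r' q' C (n + (r' - r) + (q' - q)) \<and> ok r' q' U \<and> r \<le> r' \<and> q \<le> q' \<and>
     \<not> reach (P ! r') (P ! x) \<and> \<not> reach (P ! q') (P ! x)"
  using a(1,2)
proof (induction "(fb - r) + (length P - q)" arbitrary: r q n rule: less_induct)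
  case less
  note at = less.prems(1) and ok = less.prems(2)
  have r: "0 < r" "r \<le> fb" and q: "lb < q" "q < length P" using ok_bounds[OF ok] by auto
  note tr1 = ed_tok[OF r] and tr2 = ed_tok2[OF q]
  have xl: "x < length P" using x lb(3) by simp
  have xN: "P ! x < N" using P_lt_N xl by simp
  have rl: "r < length P" using r fb by simp
  have ne: "P ! r \<noteq> P ! x" "P ! q \<noteq> P ! x" "P ! r \<noteq> P ! q"
    using P_eq r q x xl rl fb_lt_lb by auto
  have lts: "P ! r < N" "P ! (r - 1) < N" "P ! q < N" "P ! (q - 1) < N" using P_lt_N rl q by auto
  \<comment> \<open>The pebble to be moved must not be reachable from the other one. If the other
    one reaches it, the other one reaches \<open>P ! x\<close> too and is moved instead; acyclicity
    ensures that one of them qualifies.\<close>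
  consider "\<not> reach (P ! r) (P ! x)" "\<not> reach (P ! q) (P ! x)"
    | "reach (P ! r) (P ! x)" "\<not> reach (P ! q) (P ! r)"
    | "reach (P ! q) (P ! x)" "\<not> reach (P ! r) (P ! q)"
    using reach_antisym ne(3) by (meson rtrancl_trans)
  then show ?case
  proof cases
    case 1
    then show ?thesis using at ok by - (rule exI[of _ r], rule exI[of _ q], auto)
  next
    case 2
    have dvx: "dv (P ! x)" using reach_dv[OF 2(1) ne(1)] by simp
    note mx = mid_reach[OF x dvx]
    have nx: "\<not> reach (P ! x) (P ! r)" using 2(1) reach_antisym ne(1) by blast
    have rf: "r \<noteq> fb" using nx mx(2) by auto
    \<comment> \<open>This discards the exceptional alternative in \<open>ok\<close>: otherwise
      \<open>z1\<close>, \<open>yk\<close> and \<open>P ! x\<close> would lie on a cycle.\<close>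
    have nzy: "\<not> reach z1 yk"
    proof
      assume "reach z1 yk"
      then have "z1 = yk" using mx reach_antisym by (meson rtrancl_trans)
      then show False using P_eq fb(3) lb(3) fb_lt_lb by auto
    qed
    have c2: "\<not> reach (P ! r) (P ! (q - 1))" using ok nzy by (auto simp: ok_def)
    have r': "Suc r \<le> fb" "0 < Suc r" using r rf by auto
    have tr: "tr (Gn (ed (r - 1)) (ed (q - 1)) a (P ! x) c) (Gn (ed (Suc r - 1)) (ed (q - 1)) a (P ! x) c) 0 (ed r)"
      using tr_G1[of "ed (r - 1)" "ed (q - 1)" a "P ! x" c "ed r"] tr1 tr2 a(3,4) xN ed_tok[OF r'(2,1)] 2(2) c2 nx lts rc by auto
    have at': "tok (\<lambda>i j. Gn i j a (P ! x) c) (Suc r) q C (Suc n)"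
      using tok_step[OF at, of "\<lambda>i j. Gn i j a (P ! x) c" "Suc r" q 0 "ed r"] tr by simp
    have nU: "\<not> reach (P ! u) (P ! r)" if "u \<in> U" for u
    proof
      assume r1: "reach (P ! u) (P ! r)"
      then have "u = x" using U[OF that] 2(1) by (meson rtrancl_trans)
      then show False using nx r1 by blast
    qed
    have "(P ! r, P ! Suc r) \<in> De" using not_bad_De[of r] bad_ge_fb[of r] r rf fb(3) by auto
    then have c3: "\<not> reach (P ! Suc r) (P ! (q - 1))" using c2 De_step by blast
    have "ok (Suc r) q U"
      using ok r' nU c3 unfolding ok_def by (auto simp: less_Suc_eq)
    moreover have "(fb - Suc r) + (length P - q) < (fb - r) + (length P - q)" using r' by simp
    ultimately obtain r2 q2 where *: "tok (\<lambda>i j. Gn i j a (P ! x) c) r2 q2 C (Suc n + (r2 - Suc r) + (q2 - q))" "ok r2 q2 U"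
      "Suc r \<le> r2" "q \<le> q2" "\<not> reach (P ! r2) (P ! x)" "\<not> reach (P ! q2) (P ! x)"
      using less.hyps[OF _ at'] by blast
    have "Suc n + (r2 - Suc r) + (q2 - q) = n + (r2 - r) + (q2 - q)" using *(3) by simp
    then show ?thesis using * by - (rule exI[of _ r2], rule exI[of _ q2], auto)
  next
    case 3
    have nx: "\<not> reach (P ! x) (P ! q)" using 3(1) reach_antisym ne(2) by blast
    have qt: "Suc q < length P"
    proof (rule ccontr)
      assume "\<not> Suc q < length P"
      then have "q = length P - 1" using q by simp
      then have "P ! q = t" using P_last by simp
      then show False using reach_t 3(1) ne(2) by metis
    qed
    have q': "lb < Suc q" using q by simp
    have tr: "tr (Gn (ed (r - 1)) (ed (q - 1)) a (P ! x) c) (Gn (ed (r - 1)) (ed (Suc q - 1)) a (P ! x) c) 0 (ed q)"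
      using tr_G2[of "ed (r - 1)" "ed (q - 1)" a "P ! x" c "ed q"] tr1 tr2 a(3,4) xN ed_tok2[OF q' qt] 3(2) nx lts rc by auto
    have at': "tok (\<lambda>i j. Gn i j a (P ! x) c) r (Suc q) C (Suc n)"
      using tok_step[OF at, of "\<lambda>i j. Gn i j a (P ! x) c" r "Suc q" 0 "ed q"] tr by simp
    have nU: "\<not> reach (P ! u) (P ! q)" if "u \<in> U" for u
    proof
      assume r1: "reach (P ! u) (P ! q)"
      then have "u = x" using U[OF that] 3(1) by (meson rtrancl_trans)
      then show False using nx r1 by blast
    qed
    have "ok r (Suc q) U" using ok q' qt nU 3(2) unfolding ok_def by (auto simp: less_Suc_eq)
    moreover have "(fb - r) + (length P - Suc q) < (fb - r) + (length P - q)" using qt by simp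
    ultimately obtain r2 q2 where *: "tok (\<lambda>i j. Gn i j a (P ! x) c) r2 q2 C (Suc n + (r2 - r) + (q2 - Suc q))" "ok r2 q2 U"
      "r \<le> r2" "Suc q \<le> q2" "\<not> reach (P ! r2) (P ! x)" "\<not> reach (P ! q2) (P ! x)"
      using less.hyps[OF _ at'] by blast
    have "Suc n + (r2 - r) + (q2 - Suc q) = n + (r2 - r) + (q2 - q)" using *(4) by simp
    then show ?thesis using * by - (rule exI[of _ r2], rule exI[of _ q2], auto)
  qed
qed

text \<open>The pebble on the final segment moves whenever it can still come to the vertex of the
  other one. Otherwise the pebble on the initial segment moves, until it stands on
  \<open>z1\<close>, from where the first arc of \<open>P\<close> outside \<open>De\<close> closes
  the path.\<close>

lemma at_finish:
  assumes a: "tok (\<lambda>i j. Ln i j (P ! Suc fb)) r q C n" "ok r q {}"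
  shows "\<exists>ls. run Fin (C + (w (z1, P ! Suc fb) + hh z1)) ls \<and> length ls \<le> Suc n + (fb - r) + (length P - q)"
  using a
proof (induction "(fb - r) + (length P - q)" arbitrary: r q n rule: less_induct)
  case less
  note at = less.prems(1) and ok = less.prems(2)
  have r: "0 < r" "r \<le> fb" and q: "lb < q" "q < length P" using ok_bounds[OF ok] by auto
  note tr1 = ed_tok[OF r] and tr2 = ed_tok2[OF q]
  have rl: "r < length P" and fl: "Suc fb < length P" using r fb fb_lt_lb lb by auto
  have ne: "P ! r \<noteq> P ! q" using P_eq r q rl fb_lt_lb by auto
  have lts: "P ! r < N" "P ! (r - 1) < N" "P ! q < N" "P ! (q - 1) < N" "P ! Suc fb < N" using P_lt_N rl q fl by auto
  consider "reach (P ! q) (P ! r)" | "\<not> reach (P ! q) (P ! r)" "r \<noteq> fb" | "\<not> reach (P ! q) (P ! r)" "r = fb" by blast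
  then show ?case
  proof cases
    case 1
    have nr: "\<not> reach (P ! r) (P ! q)" using 1 reach_antisym ne by blast
    have qt: "Suc q < length P"
    proof (rule ccontr)
      assume "\<not> Suc q < length P"
      then have "q = length P - 1" using q by simp
      then have "P ! q = t" using P_last by simp
      then show False using reach_t 1 ne by metis
    qed
    have q': "lb < Suc q" using q by simp
    have tr: "tr (Ln (ed (r - 1)) (ed (q - 1)) (P ! Suc fb)) (Ln (ed (r - 1)) (ed (Suc q - 1)) (P ! Suc fb)) 0 (ed q)"
      using tr_L2[of "ed (r - 1)" "ed (q - 1)" "P ! Suc fb" "ed q"] tr1 tr2 ed_tok2[OF q' qt] nr lts rc by auto
    have at': "tok (\<lambda>i j. Ln i j (P ! Suc fb)) r (Suc q) C (Suc n)"
      using tok_step[OF at, of "\<lambda>i j. Ln i j (P ! Suc fb)" r "Suc q" 0 "ed q"] tr by simp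
    have "ok r (Suc q) {}" using ok q' qt nr unfolding ok_def by auto
    moreover have "(fb - r) + (length P - Suc q) < (fb - r) + (length P - q)" using qt by simp
    ultimately show ?thesis using less.hyps[OF _ at'] qt by fastforce
  next
    case 2
    have c2: "\<not> reach (P ! r) (P ! (q - 1))" using ok 2(2) by (auto simp: ok_def)
    have r': "Suc r \<le> fb" "0 < Suc r" using r 2 by auto
    have tr: "tr (Ln (ed (r - 1)) (ed (q - 1)) (P ! Suc fb)) (Ln (ed (Suc r - 1)) (ed (q - 1)) (P ! Suc fb)) 0 (ed r)"
      using tr_L1[of "ed (r - 1)" "ed (q - 1)" "P ! Suc fb" "ed r"] tr1 tr2 ed_tok[OF r'(2,1)] 2 c2 lts rc by auto
    have at': "tok (\<lambda>i j. Ln i j (P ! Suc fb)) (Suc r) q C (Suc n)"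
      using tok_step[OF at, of "\<lambda>i j. Ln i j (P ! Suc fb)" "Suc r" q 0 "ed r"] tr by simp
    have "(P ! r, P ! Suc r) \<in> De" using not_bad_De[of r] bad_ge_fb[of r] r 2 fb(3) by auto
    then have c3: "\<not> reach (P ! Suc r) (P ! (q - 1))" using c2 De_step by blast
    have "ok (Suc r) q {}"
      using ok r' c3 unfolding ok_def by (auto simp: less_Suc_eq)
    moreover have "(fb - Suc r) + (length P - q) < (fb - r) + (length P - q)" using r' by simp
    ultimately show ?thesis using less.hyps[OF _ at'] r' by fastforce
  next
    case 3
    have "tr (Ln (ed (r - 1)) (ed (q - 1)) (P ! Suc fb)) Fin (wt (ed fb) + hh (dst (ed (r - 1)))) (ed fb)"
      using tr_fin[of "ed (r - 1)" "ed (q - 1)" "P ! Suc fb" "ed fb"] tr1 tr2 ed[OF fl] 3 lts rc fb(1) by auto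
    then have "tr (Ln (ed (r - 1)) (ed (q - 1)) (P ! Suc fb)) Fin (w (z1, P ! Suc fb) + hh z1) (ed fb)"
      using ed[OF fl] tr1 3(2) by simp
    then show ?thesis using at run_step unfolding tok_def by fastforce
  qed
qed

text \<open>The segment ending in \<open>k - 1\<close> is traversed from its start \<open>l\<close>.
  By \<open>no_rise\<close> no vertex of an earlier inner segment reaches the vertex to be left, and
  by acyclicity no later vertex of the same segment does; this is what \<open>at_advance\<close>
  asks for. Opening a segment takes a step of its own, hence the bound of twice the length.\<close>

lemma segment:
  assumes "tok (\<lambda>i j. Ln i j (P ! k)) r q (Wp k) n" "ok r q {u. fb < u \<and> u < k}" "Suc fb < k" "k \<le> lb"
  shows "\<exists>l r' q' n'. fb < l \<and> l < k \<and> tok (\<lambda>i j. Ln i j (P ! l)) r' q' (Wp l) n' \<and> ok r' q' {u. fb < u \<and> u < l} \<and>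
     r \<le> r' \<and> q \<le> q' \<and> n' \<le> n + (r' - r) + (q' - q) + 2 * (k - l)"
proof -
  define l where "l = (LEAST l. nd l = nd (k - 1))"
  have nl: "nd l = nd (k - 1)" unfolding l_def by (rule LeastI) simp
  have lk: "l \<le> k - 1" unfolding l_def by (rule Least_le) simp
  have fl: "fb < l"
  proof -
    have "0 < nd (k - 1)" using nd_pos[of "k - 1"] assms(3) by simp
    then show ?thesis using nl nd_pos_iff[of l] by simp
  qed
  have below: "nd u < nd l" if "u < l" for u
    using not_less_Least[of u "\<lambda>l. nd l = nd (k - 1)"] that nl nd_mono[of u l] unfolding l_def[symmetric] by simp
  have kl: "k < length P" "l < length P" using assms(4) lb(3) lk by auto
  have lts: "P ! k < N" "P ! l < N" using P_lt_N kl by auto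
  have nb: "\<not> bad x" if "l \<le> x" "x < k - 1" for x
    using bad_nd_lt[OF _ that] nl by auto
  have r: "0 < r" "r \<le> fb" and q: "lb < q" "q < length P" using ok_bounds[OF assms(2)] by auto
  note tr1 = ed_tok[OF r] and tr2 = ed_tok2[OF q]
  have lts2: "P ! (r - 1) < N" "P ! (q - 1) < N" using P_lt_N[of "r - 1"] P_lt_N[of "q - 1"] r q fb(3) by auto
  have lU: "l \<in> {u. fb < u \<and> u < k}" using fl lk assms(3) by auto
  have q1: "q - 1 < q" "lb \<le> q - 1" and r1: "r - 1 < r" using q r by auto
  have c: "\<not> reach (P ! l) (P ! (r - 1))" "\<not> reach (P ! l) (P ! (q - 1))"
    using assms(2) lU q1 r1 unfolding ok_def by blast+
  have "tr (Ln (ed (r - 1)) (ed (q - 1)) (P ! k)) (Gn (ed (r - 1)) (ed (q - 1)) (P ! l) (P ! l) (P ! k)) 0 M"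
    using tr_open[of "ed (r - 1)" "ed (q - 1)" "P ! l" "P ! k"] tr1 tr2 lts lts2 c rc by auto
  then have at0: "tok (\<lambda>i j. Gn i j (P ! l) (P ! l) (P ! k)) r q (Wp k + (Wp l - Wp l)) (Suc n)"
    using tok_step[OF assms(1), of "\<lambda>i j. Gn i j (P ! l) (P ! l) (P ! k)" r q 0 M] by simp
  have Uprop: "u < length P \<and> (reach (P ! u) (P ! x) \<longrightarrow> u = x)"
    if x: "l \<le> x" "x \<le> k - 1" and u: "u \<in> {u. fb < u \<and> (u < l \<or> x \<le> u \<and> u \<le> k - 1)}" for x u
  proof (intro conjI impI)
    show ul: "u < length P" using u kl lk by auto
    assume re: "reach (P ! u) (P ! x)"
    have xl: "x < length P" using x kl by simp
    have nx: "nd x = nd l" using nd_mono[OF x(1)] nd_mono[OF x(2)] nl by simp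
    show "u = x"
    proof (cases "u < l")
      case True
      then have "nd u < nd x" using below nx by simp
      moreover have "0 < nd u" using nd_pos[of u] u by simp
      moreover have "nd x < K" using nd_lt_K[of x] x assms(3,4) by simp
      ultimately have False using no_rise[of "P ! u" "P ! x"] re ul xl by auto
      then show ?thesis ..
    next
      case False
      then have "nd u = nd x" "x \<le> u" using u nx nl x nd_mono[of x u] nd_mono[of u "k - 1"] by auto
      then have "reach (P ! x) (P ! u)" using inside_reach[OF same_seg[of x u]] ul by auto
      then have "P ! u = P ! x" using re reach_antisym by blast
      then show ?thesis using P_eq ul xl by simp
    qed
  qed
  have step: "\<exists>r' q' n'. tok (\<lambda>i j. Gn i j (P ! l) (P ! x) (P ! k)) r' q' (Wp k + (Wp l - Wp x)) n' \<and>
      ok r' q' {u. fb < u \<and> (u < l \<or> x \<le> u \<and> u \<le> k - 1)} \<and> r \<le> r' \<and> q \<le> q' \<and> n' \<le> Suc n + (r' - r) + (q' - q) + (x - l)"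
    if "l \<le> x" "x \<le> k - 1" for x
    using that
  proof (induction x rule: dec_induct)
    case base
    have "ok r q {u. fb < u \<and> (u < l \<or> l \<le> u \<and> u \<le> k - 1)}"
      by (rule ok_subset[OF assms(2)]) (use lk assms(3) in auto)
    then show ?case using at0 by - (rule exI[of _ r], rule exI[of _ q], rule exI[of _ "Suc n"], auto)
  next
    case (step x)
    then obtain r1 q1 n1 where 1: "tok (\<lambda>i j. Gn i j (P ! l) (P ! x) (P ! k)) r1 q1 (Wp k + (Wp l - Wp x)) n1"
      "ok r1 q1 {u. fb < u \<and> (u < l \<or> x \<le> u \<and> u \<le> k - 1)}" "r \<le> r1" "q \<le> q1" "n1 \<le> Suc n + (r1 - r) + (q1 - q) + (x - l)"
      by auto
    have xb: "fb < x" "x < lb" using step fl assms(3,4) by auto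
    obtain r2 q2 where 2: "tok (\<lambda>i j. Gn i j (P ! l) (P ! x) (P ! k)) r2 q2 (Wp k + (Wp l - Wp x)) (n1 + (r2 - r1) + (q2 - q1))"
      "ok r2 q2 {u. fb < u \<and> (u < l \<or> x \<le> u \<and> u \<le> k - 1)}" "r1 \<le> r2" "q1 \<le> q2"
      "\<not> reach (P ! r2) (P ! x)" "\<not> reach (P ! q2) (P ! x)"
      using at_advance[OF 1(1,2) lts(2,1) xb Uprop] step by auto
    have rq: "0 < r2" "r2 \<le> fb" "lb < q2" "q2 < length P" using ok_bounds[OF 2(2)] by auto
    have sx: "Suc x < length P" using step kl by simp
    note t1 = ed_tok[OF rq(1,2)] and t2 = ed_tok2[OF rq(3,4)]
    have "tr (Gn (ed (r2 - 1)) (ed (q2 - 1)) (P ! l) (P ! x) (P ! k)) (Gn (ed (r2 - 1)) (ed (q2 - 1)) (P ! l) (dst (ed x)) (P ! k)) (wt (ed x)) (ed x)"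
      using tr_step[of "ed (r2 - 1)" "ed (q2 - 1)" "P ! l" "P ! x" "P ! k" "ed x"] t1 t2 ed[OF sx] nb[of x] step lts
        P_lt_N[of x] P_lt_N[of r2] P_lt_N[of q2] 2(5,6) rc sx rq fb(3) by auto
    then have "tok (\<lambda>i j. Gn i j (P ! l) (P ! Suc x) (P ! k)) r2 q2 (Wp k + (Wp l - Wp x) + wt (ed x)) (Suc (n1 + (r2 - r1) + (q2 - q1)))"
      using tok_step[OF 2(1), of "\<lambda>i j. Gn i j (P ! l) (P ! Suc x) (P ! k)" r2 q2] ed[OF sx] by simp
    then have "tok (\<lambda>i j. Gn i j (P ! l) (P ! Suc x) (P ! k)) r2 q2 (Wp k + (Wp l - Wp (Suc x))) (Suc (n1 + (r2 - r1) + (q2 - q1)))"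
      using Wp_Suc[OF sx] ed[OF sx] by (simp add: algebra_simps)
    moreover have "ok r2 q2 {u. fb < u \<and> (u < l \<or> Suc x \<le> u \<and> u \<le> k - 1)}" by (rule ok_subset[OF 2(2)]) auto
    moreover have "Suc (n1 + (r2 - r1) + (q2 - q1)) \<le> Suc n + (r2 - r) + (q2 - q) + (Suc x - l)"
      using 1 2(3,4) step(1) by linarith
    ultimately show ?case using 1(3,4) 2(3,4) by (meson le_trans)
  qed
  obtain r1 q1 n1 where 1: "tok (\<lambda>i j. Gn i j (P ! l) (P ! (k - 1)) (P ! k)) r1 q1 (Wp k + (Wp l - Wp (k - 1))) n1"
      "ok r1 q1 {u. fb < u \<and> (u < l \<or> k - 1 \<le> u \<and> u \<le> k - 1)}" "r \<le> r1" "q \<le> q1" "n1 \<le> Suc n + (r1 - r) + (q1 - q) + (k - 1 - l)"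
    using step[OF lk] by auto
  have xb: "fb < k - 1" "k - 1 < lb" using assms(3,4) by auto
  obtain r2 q2 where 2: "tok (\<lambda>i j. Gn i j (P ! l) (P ! (k - 1)) (P ! k)) r2 q2 (Wp k + (Wp l - Wp (k - 1))) (n1 + (r2 - r1) + (q2 - q1))"
      "ok r2 q2 {u. fb < u \<and> (u < l \<or> k - 1 \<le> u \<and> u \<le> k - 1)}" "r1 \<le> r2" "q1 \<le> q2"
      "\<not> reach (P ! r2) (P ! (k - 1))" "\<not> reach (P ! q2) (P ! (k - 1))"
    using at_advance[OF 1(1,2) lts(2,1) xb Uprop] lk by auto
  have rq: "0 < r2" "r2 \<le> fb" "lb < q2" "q2 < length P" using ok_bounds[OF 2(2)] by auto
  have sx: "Suc (k - 1) < length P" "Suc (k - 1) = k" using assms(3) kl by auto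
  note t1 = ed_tok[OF rq(1,2)] and t2 = ed_tok2[OF rq(3,4)]
  obtain k1 where k1: "k = Suc k1" using assms(3) by (cases k) auto
  have k1': "k - 1 = k1" using k1 by simp
  have sk: "Suc k1 < length P" using sx k1 by simp
  have nr: "\<not> reach (P ! r2) (P ! k1)" "\<not> reach (P ! q2) (P ! k1)" using 2(5,6) k1' by auto
  have "tr (Gn (ed (r2 - 1)) (ed (q2 - 1)) (P ! l) (P ! k1) (P ! Suc k1)) (Ln (ed (r2 - 1)) (ed (q2 - 1)) (P ! l)) (wt (ed k1)) (ed k1)"
    using tr_close[of "ed (r2 - 1)" "ed (q2 - 1)" "P ! l" "P ! k1" "P ! Suc k1" "ed k1"] t1 t2 ed[OF sk] lts(2)
      P_lt_N[of k1] P_lt_N[of "Suc k1"] P_lt_N[of r2] P_lt_N[of q2] nr rc rq fb(3) sk by auto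
  then have "tok (\<lambda>i j. Ln i j (P ! l)) r2 q2 (Wp k + (Wp l - Wp (k - 1)) + wt (ed k1)) (Suc (n1 + (r2 - r1) + (q2 - q1)))"
    using tok_step[OF 2(1), of "\<lambda>i j. Ln i j (P ! l)" r2 q2] unfolding k1 by simp
  then have "tok (\<lambda>i j. Ln i j (P ! l)) r2 q2 (Wp l) (Suc (n1 + (r2 - r1) + (q2 - q1)))"
    using Wp_Suc[OF sk] ed[OF sk] unfolding k1 by (simp add: algebra_simps)
  moreover have "ok r2 q2 {u. fb < u \<and> u < l}" by (rule ok_subset[OF 2(2)]) auto
  moreover have "Suc (n1 + (r2 - r1) + (q2 - q1)) \<le> n + (r2 - r) + (q2 - q) + 2 * (k - l)"
    using 1 2(3,4) lk assms(3) by linarith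
  ultimately show ?thesis using fl lk assms(3) 1(3,4) 2(3,4)
    by - (rule exI[of _ l], rule exI[of _ r2], rule exI[of _ q2], rule exI[of _ "Suc (n1 + (r2 - r1) + (q2 - q1))"], auto)
qed

lemma all_segments:
  assumes "tok (\<lambda>i j. Ln i j (P ! k)) r q (Wp k) n" "ok r q {u. fb < u \<and> u < k}" "fb < k" "k \<le> lb"
  shows "\<exists>r' q' n'. tok (\<lambda>i j. Ln i j (P ! Suc fb)) r' q' (Wp (Suc fb)) n' \<and> ok r' q' {} \<and>
     r \<le> r' \<and> q \<le> q' \<and> n' \<le> n + (r' - r) + (q' - q) + 2 * (k - Suc fb)"
  using assms
proof (induction k arbitrary: r q n rule: less_induct)
  case (less k)
  show ?case
  proof (cases "k = Suc fb")
    case True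
    have "ok r q {}" by (rule ok_subset[OF less.prems(2)]) simp
    then show ?thesis using less.prems(1) True by - (rule exI[of _ r], rule exI[of _ q], rule exI[of _ n], auto)
  next
    case False
    then have "Suc fb < k" using less.prems by simp
    then obtain l r1 q1 n1 where 1: "fb < l" "l < k" "tok (\<lambda>i j. Ln i j (P ! l)) r1 q1 (Wp l) n1" "ok r1 q1 {u. fb < u \<and> u < l}"
      "r \<le> r1" "q \<le> q1" "n1 \<le> n + (r1 - r) + (q1 - q) + 2 * (k - l)"
      using segment[OF less.prems(1,2)] less.prems(4) by blast
    obtain r2 q2 n2 where 2: "tok (\<lambda>i j. Ln i j (P ! Suc fb)) r2 q2 (Wp (Suc fb)) n2" "ok r2 q2 {}" "r1 \<le> r2" "q1 \<le> q2"
      "n2 \<le> n1 + (r2 - r1) + (q2 - q1) + 2 * (l - Suc fb)"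
      using less.IH[OF 1(2,3,4,1)] 1(2) less.prems(4) by auto
    have "n2 \<le> n + (r2 - r) + (q2 - q) + 2 * (k - Suc fb)" using 1 2 by linarith
    then show ?thesis using 1 2 by - (rule exI[of _ r2], rule exI[of _ q2], rule exI[of _ n2], auto)
  qed
qed

text \<open>A vertex of the initial segment that still reaches \<open>yk\<close> could not be left
  by \<open>tr_L1\<close>, which tests against \<open>src j\<close>. So the guess of
  \<open>tr_src\<close> puts the pebble on the first position after 0 that does not reach
  \<open>yk\<close>, or on \<open>fb\<close>. The part before it is never played.\<close>

lemma start:
  "\<exists>r. tok (\<lambda>i j. Ln i j yk) r (Suc lb) (Wp lb) 2 \<and> ok r (Suc lb) {u. fb < u \<and> u < lb}"
proof -
  define r where "r = (LEAST r. 0 < r \<and> (r = fb \<or> \<not> reach (P ! r) yk))"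
  have r: "0 < r \<and> (r = fb \<or> \<not> reach (P ! r) yk)" unfolding r_def by (rule LeastI[of _ fb]) (use fb_pos in simp)
  have rf: "r \<le> fb" unfolding r_def by (rule Least_le) (use fb_pos in simp)
  have below: "reach (P ! e) yk" if "0 < e" "e < r" for e
    using not_less_Least[of e "\<lambda>r. 0 < r \<and> (r = fb \<or> \<not> reach (P ! r) yk)"] that unfolding r_def[symmetric] by auto
  have ll: "Suc lb < length P" using lb_lt by simp
  have yl: "yk \<noteq> P ! e" if "e \<le> fb" for e using P_eq[of lb e] that fb_lt_lb lb(3) by auto
  have nyk: "\<not> reach yk (P ! e)" if "e < r" for e
  proof
    assume a: "reach yk (P ! e)"
    show False
    proof (cases "e = 0")
      case True
      then show False using a reach_s[of yk] yl[of 0] P_hd by auto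
    next
      case False
      then show False using below[of e] that reach_antisym[OF a] yl[of e] rf by auto
    qed
  qed
  note t1 = ed_tok[of r] and t2 = ed_tok2[of "Suc lb"]
  have q: "lb < Suc lb" by simp
  have c: "\<not> rc yk (P ! (r - 1))" using nyk[of "r - 1"] r rc P_lt_N[of "r - 1"] P_lt_N[of lb] rf fb(3) lb(3) by auto
  have run1: "run (An (ed (r - 1))) 0 [ed (r - 1)]"
    using run_step[OF run_src tr_src[of "ed (r - 1)"]] t1 r rf by simp
  have "tr (An (ed (r - 1))) (Ln (ed (r - 1)) (ed (Suc lb - 1)) (src (ed (Suc lb - 1)))) (gg (src (ed (Suc lb - 1)))) (ed (Suc lb - 1))"
    using tr_start[of "ed (r - 1)" "ed (Suc lb - 1)"] t1 t2[OF q ll] r rf c yl[of r] by auto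
  then have "run (Ln (ed (r - 1)) (ed (Suc lb - 1)) yk) (gg yk) [ed (Suc lb - 1), ed (r - 1)]"
    using run_step[OF run1] t2[OF q ll] by fastforce
  moreover have "gg yk = Wp lb"
  proof -
    have "set (arcs_of (drop lb P)) \<subseteq> De"
    proof
      fix e assume "e \<in> set (arcs_of (drop lb P))"
      then obtain r where "r \<ge> lb" "Suc r < length P" "e = (P ! r, P ! Suc r)" using arcs_drop by blast
      then show "e \<in> De" using bad_lt_lb[of r] not_bad_De[of r] by auto
    qed
    moreover have "drop lb P \<noteq> []" "last (drop lb P) = t" "hd (drop lb P) = yk"
      using lb(3) P_last P_nz by (auto simp: last_conv_nth hd_drop_conv_nth)
    ultimately show ?thesis unfolding Wp_def using cost_De[of "drop lb P"] gg[OF dv_yk(1)] by simp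
  qed
  ultimately have "tok (\<lambda>i j. Ln i j yk) r (Suc lb) (Wp lb) 2" unfolding tok_def by fastforce
  moreover have "ok r (Suc lb) {u. fb < u \<and> u < lb}"
  proof -
    have nmy: "\<not> reach (P ! u) yk" if u: "fb < u" "u < lb" for u
    proof
      assume a: "reach (P ! u) yk"
      have ne: "P ! u \<noteq> yk" using P_eq[of u lb] u lb(3) by auto
      then have "dv (P ! u)" using reach_dv[OF a] by simp
      then show False using mid_reach(1)[OF u] reach_antisym[OF a] ne by auto
    qed
    have "\<not> reach (P ! u) (P ! e)" if u: "fb < u" "u < lb" "e < r" for u e
    proof (cases "e = 0")
      case True
      then show ?thesis using reach_s[of "P ! u"] P_hd P_eq[of u 0] u lb(3) P_nz by auto
    next
      case False
      then show ?thesis using below[of e] u(3) nmy[OF u(1,2)] by (meson gr0I rtrancl_trans)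
    qed
    then show ?thesis using nmy r rf ll unfolding ok_def by (auto simp: less_Suc_eq)
  qed
  ultimately show ?thesis by blast
qed

text \<open>Each outer pebble moves at most once per position of its segment, an inner position
  accounts for at most two steps, and a few more are spent at the start and the end. The factor 4
  leaves room for this and reappears as the number of rounds.\<close>

theorem run_complete:
  "\<exists>ls. run Fin (cost w P) ls \<and> length ls \<le> 4 * length P"
proof -
  obtain r where 1: "tok (\<lambda>i j. Ln i j yk) r (Suc lb) (Wp lb) 2" "ok r (Suc lb) {u. fb < u \<and> u < lb}" using start by blast
  obtain r' q' n' where 2: "tok (\<lambda>i j. Ln i j (P ! Suc fb)) r' q' (Wp (Suc fb)) n'" "ok r' q' {}"
    "r \<le> r'" "Suc lb \<le> q'" "n' \<le> 2 + (r' - r) + (q' - Suc lb) + 2 * (lb - Suc fb)"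
    using all_segments[OF 1 fb_lt_lb order_refl] by blast
  obtain ls where 3: "run Fin (Wp (Suc fb) + (w (z1, P ! Suc fb) + hh z1)) ls" "length ls \<le> Suc n' + (fb - r') + (length P - q')"
    using at_finish[OF 2(1,2)] by blast
  have rq: "0 < r" "r' \<le> fb" "q' < length P" using ok_bounds[OF 1(2)] ok_bounds[OF 2(2)] by auto
  have fl: "Suc fb < length P" using fb_lt_lb lb(3) by simp
  have "cost w P = Wp fb + hh z1"
  proof -
    have P1: "P = take fb P @ z1 # drop (Suc fb) P" using fb(3) by (rule id_take_nth_drop)
    have P2: "take fb P @ [z1] = take (Suc fb) P" using fb(3) by (simp add: take_Suc_conv_app_nth)
    have P3: "z1 # drop (Suc fb) P = drop fb P" using fb(3) by (simp add: Cons_nth_drop_Suc)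
    have "cost w P = cost w (take (Suc fb) P) + Wp fb"
      using cost_split[of w "take fb P" z1 "drop (Suc fb) P"] P1 unfolding P2 P3 Wp_def by simp
    moreover have "set (arcs_of (take (Suc fb) P)) \<subseteq> De"
    proof
      fix e assume "e \<in> set (arcs_of (take (Suc fb) P))"
      then obtain r where "r < fb" "e = (P ! r, P ! Suc r)" using arcs_take fb(3) by blast
      then show "e \<in> De" using bad_ge_fb[of r] not_bad_De[of r] fb(3) by auto
    qed
    then have "cost w (take (Suc fb) P) = hh z1"
      using cost_De[of "take (Suc fb) P"] fb(3) P_hd P_nz hh_s by (auto simp: hd_conv_nth last_conv_nth)
    ultimately show ?thesis by simp
  qed
  then have "run Fin (cost w P) ls" using 3(1) Wp_Suc[OF fl] by (simp add: algebra_simps)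
  moreover have "length ls \<le> 4 * length P"
    using 2(3-5) 3(2) rq fb_lt_lb lb(3) by linarith
  ultimately show ?thesis by blast
qed

end

section \<open>Reasoning about programs\<close>

text \<open>Total correctness with a time bound; by \<open>exec_deterministic\<close> the execution
  that exists is the only one.\<close>

definition runs :: "com \<Rightarrow> state \<Rightarrow> nat \<Rightarrow> (state \<Rightarrow> bool) \<Rightarrow> bool" where
  "runs c \<sigma> T Q \<longleftrightarrow> (\<exists>k \<tau>. exec c \<sigma> k \<tau> \<and> k \<le> T \<and> Q \<tau>)"

lemma runs_weaken: "runs c \<sigma> T Q \<Longrightarrow> T \<le> T' \<Longrightarrow> (\<And>\<tau>. Q \<tau> \<Longrightarrow> Q' \<tau>) \<Longrightarrow> runs c \<sigma> T' Q'"
  unfolding runs_def by (meson le_trans)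

lemma runs_Seq: "runs c1 \<sigma> T1 Q1 \<Longrightarrow> (\<And>\<tau>. Q1 \<tau> \<Longrightarrow> runs c2 \<tau> T2 Q2) \<Longrightarrow> runs (Seq c1 c2) \<sigma> (T1 + T2) Q2"
  unfolding runs_def by (meson add_mono exec.Seq)

lemma runs_Cond:
  assumes "bval b \<sigma> \<Longrightarrow> runs c1 \<sigma> T Q" "\<not> bval b \<sigma> \<Longrightarrow> runs c2 \<sigma> T Q"
  shows "runs (Cond b c1 c2) \<sigma> (1 + bcost b + T) Q"
proof (cases "bval b \<sigma>")
  case True
  then obtain k \<tau> where "exec c1 \<sigma> k \<tau>" "k \<le> T" "Q \<tau>" using assms(1) by (auto simp: runs_def)
  then show ?thesis using exec.CondTrue[OF True, of c1 k \<tau> c2] unfolding runs_def by (meson add_left_mono)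
next
  case False
  then obtain k \<tau> where "exec c2 \<sigma> k \<tau>" "k \<le> T" "Q \<tau>" using assms(2) by (auto simp: runs_def)
  then show ?thesis using exec.CondFalse[OF False, of c2 k \<tau> c1] unfolding runs_def by (meson add_left_mono)
qed

section \<open>Programs without loops\<close>

fun straight :: "com \<Rightarrow> bool" where
  "straight (While b c) = False"
| "straight (Seq c1 c2) = (straight c1 \<and> straight c2)"
| "straight (Cond b c1 c2) = (straight c1 \<and> straight c2)"
| "straight _ = True"

fun den :: "com \<Rightarrow> state \<Rightarrow> state" where
  "den Skip \<sigma> = \<sigma>"
| "den (NWrite x i a) \<sigma> = nwrite x (nval i \<sigma>) (nval a \<sigma>) \<sigma>"
| "den (RWrite x i a) \<sigma> = rwrite x (nval i \<sigma>) (rval a \<sigma>) \<sigma>"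
| "den (Seq c1 c2) \<sigma> = den c2 (den c1 \<sigma>)"
| "den (Cond b c1 c2) \<sigma> = (if bval b \<sigma> then den c1 \<sigma> else den c2 \<sigma>)"
| "den (While b c) \<sigma> = \<sigma>"

text \<open>Only an upper bound: a conditional is charged for both branches, which keeps the bounds
  free of maxima. Loops get a dummy value and are excluded by \<open>straight\<close>.\<close>

fun ctime :: "com \<Rightarrow> nat" where
  "ctime Skip = 1"
| "ctime (NWrite x i a) = 1 + ncost i + ncost a"
| "ctime (RWrite x i a) = 1 + ncost i + rcost a"
| "ctime (Seq c1 c2) = ctime c1 + ctime c2"
| "ctime (Cond b c1 c2) = 1 + bcost b + (ctime c1 + ctime c2)"
| "ctime (While b c) = 0"

lemma runs_straight: "straight c \<Longrightarrow> runs c \<sigma> (ctime c) (\<lambda>\<tau>. \<tau> = den c \<sigma>)"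
proof (induction c arbitrary: \<sigma>)
  case Skip
  then show ?case using exec.Skip by (auto simp: runs_def)
next
  case (NWrite x i a)
  then show ?case using exec.NWrite by (fastforce simp: runs_def)
next
  case (RWrite x i a)
  then show ?case using exec.RWrite by (fastforce simp: runs_def)
next
  case (Seq c1 c2)
  have "runs c1 \<sigma> (ctime c1) (\<lambda>\<tau>. \<tau> = den c1 \<sigma>)" using Seq by simp
  then have "runs (Seq c1 c2) \<sigma> (ctime c1 + ctime c2) (\<lambda>\<tau>. \<tau> = den c2 (den c1 \<sigma>))"
    by (rule runs_Seq) (use Seq in simp)
  then show ?case by simp
next
  case (Cond b c1 c2)
  have "runs (Cond b c1 c2) \<sigma> (1 + bcost b + (ctime c1 + ctime c2)) (\<lambda>\<tau>. \<tau> = den (Cond b c1 c2) \<sigma>)"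
  proof (rule runs_Cond)
    assume "bval b \<sigma>"
    then show "runs c1 \<sigma> (ctime c1 + ctime c2) (\<lambda>\<tau>. \<tau> = den (Cond b c1 c2) \<sigma>)"
      using runs_weaken[OF Cond.IH(1)[of \<sigma>]] Cond.prems by auto
  next
    assume "\<not> bval b \<sigma>"
    then show "runs c2 \<sigma> (ctime c1 + ctime c2) (\<lambda>\<tau>. \<tau> = den (Cond b c1 c2) \<sigma>)"
      using runs_weaken[OF Cond.IH(2)[of \<sigma>]] Cond.prems by auto
  qed
  then show ?case by simp
qed simp

lemma runs_straightI: "straight c \<Longrightarrow> ctime c \<le> T \<Longrightarrow> Q (den c \<sigma>) \<Longrightarrow> runs c \<sigma> T Q"
  using runs_weaken[OF runs_straight] by blast

lemma mem_simps [simp]: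
  "nmem (nwrite x i k \<sigma>) = (nmem \<sigma>)(x := (nmem \<sigma> x)(i := k))" "rmem (nwrite x i k \<sigma>) = rmem \<sigma>"
  "rmem (rwrite x i r \<sigma>) = (rmem \<sigma>)(x := (rmem \<sigma> x)(i := r))" "nmem (rwrite x i r \<sigma>) = nmem \<sigma>"
  by (auto simp: nwrite_def rwrite_def)

abbreviation NV :: "mem_name \<Rightarrow> nexp" where "NV x \<equiv> NRead x (NConst 0)"
abbreviation NSet :: "mem_name \<Rightarrow> nexp \<Rightarrow> com" where "NSet x a \<equiv> NWrite x (NConst 0) a"

definition For :: "mem_name \<Rightarrow> mem_name \<Rightarrow> com \<Rightarrow> com" where
  "For x y c = Seq (NSet x (NConst 0)) (While (NLess (NV x) (NV y)) (Seq c (NSet x (NAdd (NV x) (NConst 1)))))"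

text \<open>Initialisation takes 3 units and the last test 6, together 9. Every iteration adds 6 for
  its test and 6 for the increment, together 12. The invariant is taken after the counter has been
  written, and the body has to leave counter and bound as they were.\<close>

lemma runs_For:
  assumes xy: "x \<noteq> y" and B: "nmem \<sigma> y 0 = B"
    and base: "I 0 (nwrite x 0 0 \<sigma>)"
    and step: "\<And>k \<sigma>'. k < B \<Longrightarrow> I k \<sigma>' \<Longrightarrow> nmem \<sigma>' x 0 = k \<Longrightarrow> nmem \<sigma>' y 0 = B \<Longrightarrow>
      runs c \<sigma>' T (\<lambda>\<tau>. nmem \<tau> x 0 = k \<and> nmem \<tau> y 0 = B \<and> I (Suc k) (nwrite x 0 (Suc k) \<tau>))"
  shows "runs (For x y c) \<sigma> (9 + B * (T + 12)) (\<lambda>\<tau>. I B \<tau> \<and> nmem \<tau> x 0 = B \<and> nmem \<tau> y 0 = B)"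
proof -
  let ?W = "While (NLess (NV x) (NV y)) (Seq c (NSet x (NAdd (NV x) (NConst 1))))"
  have loop: "runs ?W \<sigma>' (6 + (B - k) * (T + 12)) (\<lambda>\<tau>. I B \<tau> \<and> nmem \<tau> x 0 = B \<and> nmem \<tau> y 0 = B)"
    if "k \<le> B" "I k \<sigma>'" "nmem \<sigma>' x 0 = k" "nmem \<sigma>' y 0 = B" for k \<sigma>'
    using that
  proof (induction "B - k" arbitrary: k \<sigma>')
    case 0
    then have "\<not> bval (NLess (NV x) (NV y)) \<sigma>'" by simp
    from exec.WhileFalse[OF this] 0 show ?case by (fastforce simp: runs_def)
  next
    case (Suc d)
    then have kB: "k < B" by simp
    obtain k1 \<tau> where 1: "exec c \<sigma>' k1 \<tau>" "k1 \<le> T" "nmem \<tau> x 0 = k" "nmem \<tau> y 0 = B" "I (Suc k) (nwrite x 0 (Suc k) \<tau>)"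
      using step[OF kB Suc.prems(2-4)] by (auto simp: runs_def)
    have "exec (NSet x (NAdd (NV x) (NConst 1))) \<tau> 6 (nwrite x 0 (Suc k) \<tau>)"
      using exec.NWrite[of x "NConst 0" "NAdd (NV x) (NConst 1)" \<tau>] 1(3) by (simp add: eval_nat_numeral)
    from exec.Seq[OF 1(1) this] have 2: "exec (Seq c (NSet x (NAdd (NV x) (NConst 1)))) \<sigma>' (k1 + 6) (nwrite x 0 (Suc k) \<tau>)" .
    have "runs ?W (nwrite x 0 (Suc k) \<tau>) (6 + (B - Suc k) * (T + 12)) (\<lambda>\<tau>. I B \<tau> \<and> nmem \<tau> x 0 = B \<and> nmem \<tau> y 0 = B)"
      using Suc.hyps(1)[of "Suc k" "nwrite x 0 (Suc k) \<tau>"] Suc.hyps(2) kB 1 xy by auto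
    then obtain k2 \<rho> where 3: "exec ?W (nwrite x 0 (Suc k) \<tau>) k2 \<rho>" "k2 \<le> 6 + (B - Suc k) * (T + 12)"
      "I B \<rho>" "nmem \<rho> x 0 = B" "nmem \<rho> y 0 = B" by (auto simp: runs_def)
    have b: "bval (NLess (NV x) (NV y)) \<sigma>'" using Suc.prems kB by simp
    have bk: "B - k = Suc (B - Suc k)" using kB by simp
    show ?case using exec.WhileTrue[OF b 2 3(1)] 3 1(2) unfolding runs_def bk
      by (intro exI conjI) (auto simp: algebra_simps)
  qed
  have "exec (NSet x (NConst 0)) \<sigma> 3 (nwrite x 0 0 \<sigma>)" using exec.NWrite[of x "NConst 0" "NConst 0" \<sigma>] by (simp add: eval_nat_numeral)
  then have "runs (NSet x (NConst 0)) \<sigma> 3 (\<lambda>\<tau>. \<tau> = nwrite x 0 0 \<sigma>)" unfolding runs_def by blast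
  from runs_Seq[OF this, of ?W "6 + B * (T + 12)"] loop[of 0 "nwrite x 0 0 \<sigma>"] base B xy
  show ?thesis unfolding For_def by (auto simp: add.assoc elim!: runs_weaken)
qed

section \<open>Footprints of programs\<close>

abbreviation rnames :: "mem_name set" where "rnames \<equiv> {''TC'', ''wt'', ''bv'', ''h'', ''g''}"

text \<open>A name denotes an array of naturals and an array of reals, and a single set
  \<open>W\<close> describes the writes to both. Outside \<open>rnames\<close> the reals never
  change.\<close>

definition same :: "(mem_name \<times> nat) set \<Rightarrow> state \<Rightarrow> state \<Rightarrow> bool" where
  "same W \<sigma> \<tau> \<longleftrightarrow> (\<forall>x i. (x, i) \<notin> W \<longrightarrow> nmem \<tau> x i = nmem \<sigma> x i) \<and>
     (\<forall>x i. (x, i) \<notin> W \<or> x \<notin> rnames \<longrightarrow> rmem \<tau> x i = rmem \<sigma> x i)"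

lemma same_refl [simp]: "same W \<sigma> \<sigma>" by (simp add: same_def)

lemma same_trans: "same W \<sigma> \<tau> \<Longrightarrow> same W \<tau> \<rho> \<Longrightarrow> same W \<sigma> \<rho>" by (simp add: same_def)

lemma same_mono: "same W \<sigma> \<tau> \<Longrightarrow> W \<subseteq> V \<Longrightarrow> same V \<sigma> \<tau>" unfolding same_def by blast

lemma same_nwrite: "same W \<sigma> \<tau> \<Longrightarrow> (x, i) \<in> W \<Longrightarrow> same W \<sigma> (nwrite x i k \<tau>)" by (auto simp: same_def)

lemma same_rwrite: "same W \<sigma> \<tau> \<Longrightarrow> (x, i) \<in> W \<Longrightarrow> x \<in> rnames \<Longrightarrow> same W \<sigma> (rwrite x i k \<tau>)" by (auto simp: same_def)

lemma sameN': "same W \<sigma> \<tau> \<Longrightarrow> (\<And>i. (x, i) \<notin> W) \<Longrightarrow> nmem \<tau> x = nmem \<sigma> x" by (auto simp: same_def)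

lemma sameR': "same W \<sigma> \<tau> \<Longrightarrow> (\<And>i. (x, i) \<notin> W) \<Longrightarrow> rmem \<tau> x = rmem \<sigma> x" by (auto simp: same_def)

primrec nvars :: "nexp \<Rightarrow> mem_name set" where
  "nvars (NConst k) = {}"
| "nvars (NRead x i) = insert x (nvars i)"
| "nvars (NAdd a b) = nvars a \<union> nvars b"
| "nvars (NSub a b) = nvars a \<union> nvars b"

primrec rvars :: "rexp \<Rightarrow> mem_name set" where
  "rvars RZero = {}"
| "rvars (RRead x i) = insert x (nvars i)"
| "rvars (RAdd a b) = rvars a \<union> rvars b"
| "rvars (RSub a b) = rvars a \<union> rvars b"

primrec bvars :: "bexp \<Rightarrow> mem_name set" where
  "bvars (NLess a b) = nvars a \<union> nvars b"
| "bvars (RLess a b) = rvars a \<union> rvars b"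
| "bvars (BNot b) = bvars b"
| "bvars (BAnd a b) = bvars a \<union> bvars b"

lemma nval_same: "same W \<sigma> \<tau> \<Longrightarrow> nvars e \<inter> fst ` W = {} \<Longrightarrow> nval e \<tau> = nval e \<sigma>"
proof (induction e)
  case (NRead x i)
  then have "(x, nval i \<sigma>) \<notin> W" by force
  then show ?case using NRead by (auto simp: same_def)
qed (auto simp: Int_Un_distrib2)

lemma rval_same: "same W \<sigma> \<tau> \<Longrightarrow> rvars e \<inter> fst ` W = {} \<Longrightarrow> rval e \<tau> = rval e \<sigma>"
proof (induction e)
  case (RRead x i)
  then have "(x, nval i \<sigma>) \<notin> W" "nval i \<tau> = nval i \<sigma>" using nval_same[of W \<sigma> \<tau> i] by force+
  then show ?case using RRead by (auto simp: same_def)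
qed (auto simp: Int_Un_distrib2)

lemma bval_same: "same W \<sigma> \<tau> \<Longrightarrow> bvars e \<inter> fst ` W = {} \<Longrightarrow> bval e \<tau> = bval e \<sigma>"
proof (induction e)
  case (NLess a b)
  then show ?case using nval_same[of W \<sigma> \<tau> a] nval_same[of W \<sigma> \<tau> b] by (auto simp: Int_Un_distrib2)
next
  case (RLess a b)
  then show ?case using rval_same[of W \<sigma> \<tau> a] rval_same[of W \<sigma> \<tau> b] by (auto simp: Int_Un_distrib2)
qed (auto simp: Int_Un_distrib2)

section \<open>Programs that append to the list of transitions\<close>

type_synonym trans = "nat \<times> nat \<times> real \<times> nat"

definition tlist :: "state \<Rightarrow> trans list" where
  "tlist \<sigma> = map (\<lambda>k. (nmem \<sigma> ''TF'' k, nmem \<sigma> ''TT'' k, rmem \<sigma> ''TC'' k, nmem \<sigma> ''TL'' k)) [0..<nmem \<sigma> ''tk'' 0]"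

abbreviation tnames :: "mem_name set" where "tnames \<equiv> {''TF'', ''TT'', ''TC'', ''TL'', ''tk''}"

definition tcells :: "(mem_name \<times> nat) set" where "tcells = tnames \<times> UNIV"

definition app :: "nexp \<Rightarrow> nexp \<Rightarrow> rexp \<Rightarrow> nexp \<Rightarrow> com" where
  "app f t c l = Seq (NWrite ''TF'' (NV ''tk'') f) (Seq (NWrite ''TT'' (NV ''tk'') t) (Seq (RWrite ''TC'' (NV ''tk'') c)
     (Seq (NWrite ''TL'' (NV ''tk'') l) (NSet ''tk'' (NAdd (NV ''tk'') (NConst 1))))))"

lemma den_app:
  assumes "(nvars f \<union> nvars t \<union> rvars c \<union> nvars l) \<inter> tnames = {}"
  shows "tlist (den (app f t c l) \<sigma>) = tlist \<sigma> @ [(nval f \<sigma>, nval t \<sigma>, rval c \<sigma>, nval l \<sigma>)]"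
    and "same tcells \<sigma> (den (app f t c l) \<sigma>)"
proof -
  let ?k = "nmem \<sigma> ''tk'' 0"
  let ?s1 = "nwrite ''TF'' ?k (nval f \<sigma>) \<sigma>"
  have s1: "same tcells \<sigma> ?s1" by (auto intro!: same_nwrite simp: tcells_def)
  have t: "nval t ?s1 = nval t \<sigma>" by (rule nval_same[OF s1]) (use assms in \<open>auto simp: tcells_def\<close>)
  let ?s2 = "nwrite ''TT'' ?k (nval t \<sigma>) ?s1"
  have s2: "same tcells \<sigma> ?s2" using s1 by (auto intro!: same_nwrite simp: tcells_def)
  have c: "rval c ?s2 = rval c \<sigma>" by (rule rval_same[OF s2]) (use assms in \<open>auto simp: tcells_def\<close>)
  let ?s3 = "rwrite ''TC'' ?k (rval c \<sigma>) ?s2"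
  have s3: "same tcells \<sigma> ?s3" using s2 by (auto intro!: same_rwrite simp: tcells_def)
  have l: "nval l ?s3 = nval l \<sigma>" by (rule nval_same[OF s3]) (use assms in \<open>auto simp: tcells_def\<close>)
  let ?s4 = "nwrite ''TL'' ?k (nval l \<sigma>) ?s3"
  have d: "den (app f t c l) \<sigma> = nwrite ''tk'' 0 (Suc ?k) ?s4"
    unfolding app_def using t c l by simp
  show "same tcells \<sigma> (den (app f t c l) \<sigma>)"
    unfolding d using s3 by (auto intro!: same_nwrite simp: tcells_def)
  show "tlist (den (app f t c l) \<sigma>) = tlist \<sigma> @ [(nval f \<sigma>, nval t \<sigma>, rval c \<sigma>, nval l \<sigma>)]"
    unfolding d tlist_def by simp
qed

locale frame =
  fixes \<sigma>0 :: state and X :: "(mem_name \<times> nat) set"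
begin

text \<open>The output \<open>g\<close> must not depend on anything the program may write, so a
  sequence or a loop can evaluate every contribution in the starting state. The bound on the length
  of the output is carried along so that the number of transitions comes with the time
  bound.\<close>

definition apps :: "com \<Rightarrow> (mem_name \<times> nat) set \<Rightarrow> nat \<Rightarrow> (state \<Rightarrow> trans list) \<Rightarrow> bool" where
  "apps c W T g \<longleftrightarrow> W \<union> tcells \<subseteq> X \<and> (\<forall>\<sigma> \<tau>. same (W \<union> tcells) \<sigma> \<tau> \<longrightarrow> g \<tau> = g \<sigma>) \<and>
     (\<forall>\<sigma>. length (g \<sigma>) \<le> T) \<and>
     (\<forall>\<sigma>. same X \<sigma>0 \<sigma> \<longrightarrow> runs c \<sigma> T (\<lambda>\<tau>. tlist \<tau> = tlist \<sigma> @ g \<sigma> \<and> same (W \<union> tcells) \<sigma> \<tau>))"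

lemma apps_if:
  assumes "(bvars b \<union> nvars f \<union> nvars t \<union> rvars c \<union> nvars l) \<inter> tnames = {}" "tcells \<subseteq> X"
  shows "apps (Cond b (app f t c l) Skip) {} (ctime (Cond b (app f t c l) Skip))
    (\<lambda>\<sigma>. if bval b \<sigma> then [(nval f \<sigma>, nval t \<sigma>, rval c \<sigma>, nval l \<sigma>)] else [])"
  unfolding apps_def
proof (intro conjI allI impI)
  fix \<sigma> \<tau> assume a: "same ({} \<union> tcells) \<sigma> \<tau>"
  have i: "fst ` ({} \<union> tcells) = tnames" by (force simp: tcells_def)
  have "bval b \<tau> = bval b \<sigma>" by (rule bval_same[OF a]) (use assms i in auto)
  moreover have "nval f \<tau> = nval f \<sigma>" by (rule nval_same[OF a]) (use assms i in auto)
  moreover have "nval t \<tau> = nval t \<sigma>" by (rule nval_same[OF a]) (use assms i in auto)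
  moreover have "rval c \<tau> = rval c \<sigma>" by (rule rval_same[OF a]) (use assms i in auto)
  moreover have "nval l \<tau> = nval l \<sigma>" by (rule nval_same[OF a]) (use assms i in auto)
  ultimately show "(if bval b \<tau> then [(nval f \<tau>, nval t \<tau>, rval c \<tau>, nval l \<tau>)] else []) =
    (if bval b \<sigma> then [(nval f \<sigma>, nval t \<sigma>, rval c \<sigma>, nval l \<sigma>)] else [])" by simp
next
  fix \<sigma>
  show "runs (Cond b (app f t c l) Skip) \<sigma> (ctime (Cond b (app f t c l) Skip))
    (\<lambda>\<tau>. tlist \<tau> = tlist \<sigma> @ (if bval b \<sigma> then [(nval f \<sigma>, nval t \<sigma>, rval c \<sigma>, nval l \<sigma>)] else []) \<and> same ({} \<union> tcells) \<sigma> \<tau>)"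
    by (rule runs_straightI) (use den_app[of f t c l \<sigma>] assms(1) in \<open>auto simp: app_def\<close>)
next
  fix \<sigma>
  show "length (if bval b \<sigma> then [(nval f \<sigma>, nval t \<sigma>, rval c \<sigma>, nval l \<sigma>)] else []) \<le> ctime (Cond b (app f t c l) Skip)" by simp
qed (use assms in auto)

lemma apps_Seq:
  assumes "apps c1 W T1 g1" "apps c2 W T2 g2"
  shows "apps (Seq c1 c2) W (T1 + T2) (\<lambda>\<sigma>. g1 \<sigma> @ g2 \<sigma>)"
  unfolding apps_def
proof (intro conjI allI impI)
  fix \<sigma> assume s: "same X \<sigma>0 \<sigma>"
  show "runs (Seq c1 c2) \<sigma> (T1 + T2) (\<lambda>\<tau>. tlist \<tau> = tlist \<sigma> @ g1 \<sigma> @ g2 \<sigma> \<and> same (W \<union> tcells) \<sigma> \<tau>)"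
  proof (rule runs_Seq)
    show "runs c1 \<sigma> T1 (\<lambda>\<tau>. tlist \<tau> = tlist \<sigma> @ g1 \<sigma> \<and> same (W \<union> tcells) \<sigma> \<tau>)" using assms(1) s by (simp add: apps_def)
    fix \<tau> assume t: "tlist \<tau> = tlist \<sigma> @ g1 \<sigma> \<and> same (W \<union> tcells) \<sigma> \<tau>"
    have WX: "W \<union> tcells \<subseteq> X" using assms by (simp add: apps_def)
    then have "same X \<sigma>0 \<tau>" using s t same_mono same_trans by blast
    moreover have "g2 \<tau> = g2 \<sigma>" using assms(2) t by (simp add: apps_def)
    ultimately show "runs c2 \<tau> T2 (\<lambda>\<tau>. tlist \<tau> = tlist \<sigma> @ g1 \<sigma> @ g2 \<sigma> \<and> same (W \<union> tcells) \<sigma> \<tau>)"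
      using assms(2) t by (auto simp: apps_def elim!: runs_weaken intro: same_trans)
  qed
qed (use assms in \<open>auto simp: apps_def intro: add_mono\<close>)

lemma apps_widen:
  assumes "apps c W T g" "W \<subseteq> V" "V \<subseteq> X" "\<And>\<sigma> \<tau>. same (V \<union> tcells) \<sigma> \<tau> \<Longrightarrow> g \<tau> = g \<sigma>"
  shows "apps c V T g"
proof -
  have "same (W \<union> tcells) \<sigma> \<tau> \<Longrightarrow> same (V \<union> tcells) \<sigma> \<tau>" for \<sigma> \<tau> using assms(2) by (auto elim: same_mono)
  then show ?thesis using assms unfolding apps_def by (auto elim!: runs_weaken)
qed

lemma apps_For:
  \<comment> \<open>The counter is the only changing cell on which \<open>g\<close> may depend, so
    iteration \<open>k\<close> contributes \<open>g\<close> of the starting state with the counter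
    set to \<open>k\<close>.\<close>
  assumes c: "apps c W T g" and x: "x \<noteq> y" "(x, 0) \<in> X" "(y, 0) \<notin> X" "(x, 0) \<notin> W \<union> tcells" "x \<notin> rnames" and B: "nmem \<sigma>0 y 0 = B"
  shows "apps (For x y c) (insert (x, 0) W) (9 + B * (T + 12)) (\<lambda>\<sigma>. concat (map (\<lambda>k. g (nwrite x 0 k \<sigma>)) [0..<B]))"
  unfolding apps_def
proof (intro conjI allI impI)
  have WX: "W \<union> tcells \<subseteq> X" using c by (simp add: apps_def)
  then show "insert (x, 0) W \<union> tcells \<subseteq> X" using x by auto
  have key: "g \<tau> = g (nwrite x 0 k \<sigma>)" if "same (insert (x, 0) W \<union> tcells) \<sigma> \<tau>" "nmem \<tau> x 0 = k" for \<sigma> \<tau> k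
  proof -
    have "same (W \<union> tcells) (nwrite x 0 k \<sigma>) \<tau>" using that x(5) unfolding same_def by auto
    then show ?thesis using c by (simp add: apps_def)
  qed
  show "length (concat (map (\<lambda>k. g (nwrite x 0 k \<sigma>)) [0..<B])) \<le> 9 + B * (T + 12)" for \<sigma>
  proof -
    have "length (concat (map (\<lambda>k. g (nwrite x 0 k \<sigma>)) [0..<B])) \<le> B * T"
    proof (induction B)
      case (Suc B)
      have "length (g (nwrite x 0 B \<sigma>)) \<le> T" using c by (simp add: apps_def)
      then show ?case using Suc by simp
    qed simp
    then show ?thesis by (simp add: algebra_simps)
  qed
  show "concat (map (\<lambda>k. g (nwrite x 0 k \<tau>)) [0..<B]) = concat (map (\<lambda>k. g (nwrite x 0 k \<sigma>)) [0..<B])"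
    if s: "same (insert (x, 0) W \<union> tcells) \<sigma> \<tau>" for \<sigma> \<tau>
  proof -
    have "g (nwrite x 0 k \<tau>) = g (nwrite x 0 k \<sigma>)" for k
      using key[of \<sigma> "nwrite x 0 k \<tau>" k] s by (auto intro: same_nwrite)
    then show ?thesis by simp
  qed
  fix \<sigma> assume s: "same X \<sigma>0 \<sigma>"
  let ?I = "\<lambda>k \<tau>. tlist \<tau> = tlist \<sigma> @ concat (map (\<lambda>k. g (nwrite x 0 k \<sigma>)) [0..<k]) \<and> same (insert (x, 0) W \<union> tcells) \<sigma> \<tau>"
  have tk: "(x, i) \<notin> tcells" for i using x(4) by (auto simp: tcells_def)
  have xt: "tlist (nwrite x 0 k \<tau>) = tlist \<tau>" for k \<tau> using tk[of 0] by (auto simp: tlist_def tcells_def)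
  have "runs (For x y c) \<sigma> (9 + B * (T + 12)) (\<lambda>\<tau>. ?I B \<tau> \<and> nmem \<tau> x 0 = B \<and> nmem \<tau> y 0 = B)"
  proof (rule runs_For[OF x(1)])
    show "nmem \<sigma> y 0 = B" using s x(3) B by (simp add: same_def)
    show "?I 0 (nwrite x 0 0 \<sigma>)" using xt by (auto intro: same_nwrite)
    fix k \<sigma>' assume k: "k < B" "?I k \<sigma>'" "nmem \<sigma>' x 0 = k" "nmem \<sigma>' y 0 = B"
    have "same X \<sigma> \<sigma>'" by (rule same_mono[of "insert (x, 0) W \<union> tcells"]) (use k(2) WX x(2) in auto)
    then have sX: "same X \<sigma>0 \<sigma>'" using s same_trans by blast
    have gk: "g \<sigma>' = g (nwrite x 0 k \<sigma>)" using key k by blast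
    have "runs c \<sigma>' T (\<lambda>\<tau>. tlist \<tau> = tlist \<sigma>' @ g \<sigma>' \<and> same (W \<union> tcells) \<sigma>' \<tau>)" using c sX by (simp add: apps_def)
    then show "runs c \<sigma>' T (\<lambda>\<tau>. nmem \<tau> x 0 = k \<and> nmem \<tau> y 0 = B \<and> ?I (Suc k) (nwrite x 0 (Suc k) \<tau>))"
    proof (rule runs_weaken)
      fix \<tau> assume t: "tlist \<tau> = tlist \<sigma>' @ g \<sigma>' \<and> same (W \<union> tcells) \<sigma>' \<tau>"
      have "nmem \<tau> x 0 = k" "nmem \<tau> y 0 = B" using t k x WX by (auto simp: same_def)
      moreover have "same (insert (x, 0) W \<union> tcells) \<sigma> \<tau>" using k(2) t by (auto intro: same_trans same_mono)
      ultimately show "nmem \<tau> x 0 = k \<and> nmem \<tau> y 0 = B \<and> ?I (Suc k) (nwrite x 0 (Suc k) \<tau>)"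
        using t k(2) xt gk by (auto intro: same_nwrite)
    qed simp
  qed
  then show "runs (For x y c) \<sigma> (9 + B * (T + 12)) (\<lambda>\<tau>. tlist \<tau> = tlist \<sigma> @ concat (map (\<lambda>k. g (nwrite x 0 k \<sigma>)) [0..<B]) \<and>
      same (insert (x, 0) W \<union> tcells) \<sigma> \<tau>)"
    by (rule runs_weaken) auto
qed

end

section \<open>Layered shortest path computation\<close>

type_synonym layer = "nat \<Rightarrow> (real \<times> nat) option"

text \<open>
  The second component of a layer entry is \<open>0\<close> if the entry was carried over from the previous round
  and \<open>Suc k\<close> if it was set by transition \<open>k\<close>. All layers are kept, so that pointers can be followed
  back round by round.
\<close>

definition relax :: "trans list \<Rightarrow> layer \<Rightarrow> nat \<Rightarrow> layer \<Rightarrow> layer" where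
  "relax ts L k N = (case ts ! k of (f, t, c, l) \<Rightarrow> (case L f of None \<Rightarrow> N
     | Some (d, _) \<Rightarrow> (case N t of None \<Rightarrow> N(t := Some (d + c, Suc k))
        | Some (d', _) \<Rightarrow> if d + c < d' then N(t := Some (d + c, Suc k)) else N)))"

definition carry :: "layer \<Rightarrow> layer" where "carry L v = map_option (\<lambda>(c, p). (c, 0)) (L v)"

definition relaxes :: "trans list \<Rightarrow> layer \<Rightarrow> nat \<Rightarrow> layer" where
  "relaxes ts L k = fold (relax ts L) [0..<k] (carry L)"

primrec lay :: "trans list \<Rightarrow> nat \<Rightarrow> nat \<Rightarrow> layer" where
  "lay ts z 0 = (\<lambda>v. if v = z then Some (0, 0) else None)"
| "lay ts z (Suc r) = relaxes ts (lay ts z r) (length ts)"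

lemma relaxes_0: "relaxes ts L 0 = carry L" by (simp add: relaxes_def)

lemma relaxes_Suc: "relaxes ts L (Suc k) = relax ts L k (relaxes ts L k)" by (simp add: relaxes_def)

lemma relax_inv:
  assumes "relax ts L k N v = Some (c, p)"
  shows "N v = Some (c, p) \<or> (\<exists>f d q l b. ts ! k = (f, v, d, l) \<and> L f = Some (b, q) \<and> c = b + d \<and> p = Suc k)"
  using assms unfolding relax_def by (auto split: prod.splits option.splits if_splits)

lemma relaxes_inv:
  assumes "relaxes ts L n v = Some (c, p)"
  shows "(p = 0 \<and> (\<exists>q. L v = Some (c, q))) \<or>
    (\<exists>k<n. \<exists>f d q l b. p = Suc k \<and> ts ! k = (f, v, d, l) \<and> L f = Some (b, q) \<and> c = b + d)"
  using assms
proof (induction n)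
  case 0
  then show ?case by (auto simp: relaxes_0 carry_def)
next
  case (Suc n)
  from relax_inv[OF Suc.prems[unfolded relaxes_Suc]] show ?case
  proof
    assume "relaxes ts L n v = Some (c, p)"
    from Suc.IH[OF this] show ?thesis by (metis (no_types, lifting) less_Suc_eq)
  qed blast
qed

definition le_opt :: "(real \<times> nat) option \<Rightarrow> real \<Rightarrow> bool" where
  "le_opt x c \<longleftrightarrow> (\<exists>d p. x = Some (d, p) \<and> d \<le> c)"

lemma relax_mono: "le_opt (N v) c \<Longrightarrow> le_opt (relax ts L k N v) c"
  unfolding relax_def le_opt_def by (auto split: prod.splits option.splits)

lemma relaxes_mono: "le_opt (carry L v) c \<Longrightarrow> le_opt (relaxes ts L n v) c"
  by (induction n) (auto simp: relaxes_0 relaxes_Suc relax_mono)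

lemma relaxes_le:
  assumes "k < n" "ts ! k = (f, v, d, l)" "le_opt (L f) c"
  shows "le_opt (relaxes ts L n v) (c + d)"
  using assms(1)
proof (induction n)
  case (Suc n)
  show ?case
  proof (cases "k = n")
    case True
    then show ?thesis using assms unfolding relaxes_Suc relax_def le_opt_def by (force split: option.splits)
  next
    case False
    then show ?thesis using Suc unfolding relaxes_Suc by (simp add: relax_mono)
  qed
qed simp

inductive brun :: "trans list \<Rightarrow> nat \<Rightarrow> nat \<Rightarrow> real \<Rightarrow> nat list \<Rightarrow> bool" for ts z where
  brun_0: "brun ts z z 0 []"
| brun_Suc: "brun ts z u c ks \<Longrightarrow> (u, v, d, l) \<in> set ts \<Longrightarrow> brun ts z v (c + d) (l # ks)"

text \<open>Since entries are carried over, \<open>r\<close> rounds cover the walks with at most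
  \<open>r\<close> transitions and not only those with exactly \<open>r\<close>.\<close>

lemma lay_le: "brun ts z v c ks \<Longrightarrow> length ks \<le> r \<Longrightarrow> le_opt (lay ts z r v) c"
proof (induction arbitrary: r rule: brun.induct)
  case brun_0
  show ?case
  proof (induction r)
    case (Suc r)
    then have "le_opt (carry (lay ts z r) z) 0" by (auto simp: le_opt_def carry_def)
    then show ?case by (simp add: relaxes_mono)
  qed (simp add: le_opt_def)
next
  case (brun_Suc u c ks v d l)
  obtain r' where r: "r = Suc r'" using brun_Suc by (cases r) auto
  have "le_opt (lay ts z r' u) c" using brun_Suc r by simp
  moreover obtain k where "k < length ts" "ts ! k = (u, v, d, l)" using brun_Suc(2) by (metis in_set_conv_nth)
  ultimately show ?case unfolding r by (simp add: relaxes_le)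
qed

fun trace :: "trans list \<Rightarrow> nat \<Rightarrow> nat \<Rightarrow> nat \<Rightarrow> nat list" where
  "trace ts z 0 v = []"
| "trace ts z (Suc r) v = (case lay ts z (Suc r) v of
     Some (c, Suc k) \<Rightarrow> snd (snd (snd (ts ! k))) # trace ts z r (fst (ts ! k)) | _ \<Rightarrow> trace ts z r v)"

text \<open>A round reads costs of tails only from the previous layer. So the tail of a recorded
  transition has, one layer down, precisely the value that was added, and the costs along the trace
  sum up exactly. With updates in place that value might have been improved afterwards.\<close>

lemma lay_trace: "lay ts z r v = Some (c, p) \<Longrightarrow> brun ts z v c (trace ts z r v)"
proof (induction r arbitrary: v c p)
  case 0
  then show ?case by (auto split: if_splits intro: brun_0)
next
  case (Suc r)
  note L = Suc.prems
  from relaxes_inv[OF L[unfolded lay.simps]] show ?case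
  proof
    assume "p = 0 \<and> (\<exists>q. lay ts z r v = Some (c, q))"
    then show ?thesis using Suc.IH L by (auto simp del: lay.simps)
  next
    assume "\<exists>k<length ts. \<exists>f d q l b. p = Suc k \<and> ts ! k = (f, v, d, l) \<and> lay ts z r f = Some (b, q) \<and> c = b + d"
    then obtain k f d q l b where k: "k < length ts" "p = Suc k" "ts ! k = (f, v, d, l)" "lay ts z r f = Some (b, q)" "c = b + d"
      by blast
    have "(f, v, d, l) \<in> set ts" using k by (metis nth_mem)
    from brun_Suc[OF Suc.IH[OF k(4)] this] show ?thesis using L k by (simp del: lay.simps)
  qed
qed

section \<open>The layered computation on the machine\<close>

definition rep :: "state \<Rightarrow> nat \<Rightarrow> nat \<Rightarrow> layer \<Rightarrow> bool" where
  "rep \<sigma> b n L \<longleftrightarrow> (\<forall>v<n. (case L v of None \<Rightarrow> nmem \<sigma> ''bf'' (b + v) = 0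
     | Some (c, p) \<Rightarrow> nmem \<sigma> ''bf'' (b + v) = 1 \<and> rmem \<sigma> ''bv'' (b + v) = c \<and> nmem \<sigma> ''bp'' (b + v) = p))"

definition bfcells :: "(mem_name \<times> nat) set" where
  "bfcells = {''bf'', ''bv'', ''bp'', ''bb'', ''nb'', ''br'', ''bk''} \<times> UNIV"

definition bf_init :: com where
  "bf_init = Seq (For ''bk'' ''nn'' (Seq (NWrite ''bf'' (NV ''bk'') (NConst 0)) (NWrite ''bp'' (NV ''bk'') (NConst 0))))
     (Seq (NWrite ''bf'' (NV ''z'') (NConst 1)) (Seq (RWrite ''bv'' (NV ''z'') RZero) (NSet ''bb'' (NConst 0))))"

definition bf_copy :: com where
  "bf_copy = Seq (NWrite ''bf'' (NAdd (NV ''nb'') (NV ''bk'')) (NRead ''bf'' (NAdd (NV ''bb'') (NV ''bk''))))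
     (Seq (RWrite ''bv'' (NAdd (NV ''nb'') (NV ''bk'')) (RRead ''bv'' (NAdd (NV ''bb'') (NV ''bk''))))
       (NWrite ''bp'' (NAdd (NV ''nb'') (NV ''bk'')) (NConst 0)))"

definition bf_relax :: com where
  "bf_relax = (let f = NAdd (NV ''bb'') (NRead ''TF'' (NV ''bk'')); t = NAdd (NV ''nb'') (NRead ''TT'' (NV ''bk''));
       c = RAdd (RRead ''bv'' f) (RRead ''TC'' (NV ''bk'')) in
     Cond (BAnd (NLess (NConst 0) (NRead ''bf'' f)) (BNot (BAnd (NLess (NConst 0) (NRead ''bf'' t)) (BNot (RLess c (RRead ''bv'' t))))))
       (Seq (RWrite ''bv'' t c) (Seq (NWrite ''bf'' t (NConst 1)) (NWrite ''bp'' t (NAdd (NV ''bk'') (NConst 1))))) Skip)"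

definition bf_round :: com where
  "bf_round = Seq (NSet ''nb'' (NAdd (NV ''bb'') (NV ''nn''))) (Seq (For ''bk'' ''nn'' bf_copy)
     (Seq (For ''bk'' ''tk'' bf_relax) (NSet ''bb'' (NV ''nb''))))"

definition bellman :: com where "bellman = Seq bf_init (For ''br'' ''rr'' bf_round)"

text \<open>Layers are stored one behind the other, so a round must preserve everything below the
  base of the layer it writes.\<close>

definition lower :: "nat \<Rightarrow> state \<Rightarrow> state \<Rightarrow> bool" where
  "lower b \<sigma> \<tau> \<longleftrightarrow> (\<forall>a<b. nmem \<tau> ''bf'' a = nmem \<sigma> ''bf'' a \<and> rmem \<tau> ''bv'' a = rmem \<sigma> ''bv'' a \<and> nmem \<tau> ''bp'' a = nmem \<sigma> ''bp'' a)"

lemma rep_nwrite [simp]: "x \<notin> {''bf'', ''bp''} \<Longrightarrow> rep (nwrite x i k \<sigma>) b n L = rep \<sigma> b n L"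
  by (auto simp: rep_def split: option.splits)

lemma lower_nwrite [simp]: "x \<notin> {''bf'', ''bp''} \<Longrightarrow> lower b \<sigma> (nwrite x i k \<tau>) = lower b \<sigma> \<tau>"
  by (auto simp: lower_def)

lemma lower_refl [simp]: "lower b \<sigma> \<sigma>" by (simp add: lower_def)

lemma rep_lower: "rep \<sigma> b n L \<Longrightarrow> lower c \<sigma> \<tau> \<Longrightarrow> b + n \<le> c \<Longrightarrow> rep \<tau> b n L"
  unfolding rep_def lower_def by (auto split: option.splits)

lemma lower_trans: "lower b \<sigma> \<tau> \<Longrightarrow> lower b \<tau> \<rho> \<Longrightarrow> lower b \<sigma> \<rho>"
  by (simp add: lower_def)

lemma bfcells_same: "same bfcells \<sigma> \<tau> \<Longrightarrow> x \<notin> {''bf'', ''bv'', ''bp'', ''bb'', ''nb'', ''br'', ''bk''} \<Longrightarrow>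
    nmem \<tau> x = nmem \<sigma> x \<and> rmem \<tau> x = rmem \<sigma> x"
  by (auto intro!: sameN' sameR' simp: bfcells_def)

text \<open>The cells written by the inner loops of a round. In contrast to \<open>bfcells\<close>
  it leaves out \<open>bb\<close>, \<open>nb\<close> and \<open>br\<close>, on which the rest of the
  round relies.\<close>

definition bfc0 :: "(mem_name \<times> nat) set" where "bfc0 = {''bf'', ''bv'', ''bp'', ''bk''} \<times> UNIV"

lemma bfc0_same: "same bfc0 \<sigma> \<tau> \<Longrightarrow> x \<notin> {''bf'', ''bv'', ''bp'', ''bk''} \<Longrightarrow>
    nmem \<tau> x = nmem \<sigma> x \<and> rmem \<tau> x = rmem \<sigma> x"
  by (auto intro!: sameN' sameR' simp: bfc0_def)

lemma bfc0_bfcells: "same bfc0 \<sigma> \<tau> \<Longrightarrow> same bfcells \<sigma> \<tau>"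
  by (erule same_mono) (auto simp: bfc0_def bfcells_def)

lemma runs_bf_init:
  assumes n: "nmem \<sigma> ''nn'' 0 = n" and z: "nmem \<sigma> ''z'' 0 = z" "z < n"
  shows "runs bf_init \<sigma> (100 * (n + 1)) (\<lambda>\<tau>. same bfcells \<sigma> \<tau> \<and> nmem \<tau> ''bb'' 0 = 0 \<and> rep \<tau> 0 n (lay ts z 0))"
proof -
  let ?I = "\<lambda>k \<tau>. same bfcells \<sigma> \<tau> \<and> (\<forall>v<k. nmem \<tau> ''bf'' v = 0 \<and> nmem \<tau> ''bp'' v = 0)"
  let ?c = "Seq (NWrite ''bf'' (NV ''bk'') (NConst 0)) (NWrite ''bp'' (NV ''bk'') (NConst 0))"
  have 1: "runs (For ''bk'' ''nn'' ?c) \<sigma> (9 + n * (20 + 12)) (\<lambda>\<tau>. ?I n \<tau> \<and> nmem \<tau> ''bk'' 0 = n \<and> nmem \<tau> ''nn'' 0 = n)"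
  proof (rule runs_For[where I = ?I])
    show "?I 0 (nwrite ''bk'' 0 0 \<sigma>)" by (auto intro!: same_nwrite simp: bfcells_def)
    fix k \<sigma>' assume k: "k < n" "?I k \<sigma>'" "nmem \<sigma>' ''bk'' 0 = k" "nmem \<sigma>' ''nn'' 0 = n"
    show "runs ?c \<sigma>' 20 (\<lambda>\<tau>. nmem \<tau> ''bk'' 0 = k \<and> nmem \<tau> ''nn'' 0 = n \<and> ?I (Suc k) (nwrite ''bk'' 0 (Suc k) \<tau>))"
      by (rule runs_straightI) (use k in \<open>auto intro!: same_nwrite simp: bfcells_def less_Suc_eq\<close>)
  qed (use n in auto)
  have 2: "runs bf_init \<sigma> ((9 + n * (20 + 12)) + 40) (\<lambda>\<tau>. same bfcells \<sigma> \<tau> \<and> nmem \<tau> ''bb'' 0 = 0 \<and> rep \<tau> 0 n (lay ts z 0))"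
    unfolding bf_init_def
  proof (rule runs_Seq[OF 1])
    fix \<tau> assume t: "?I n \<tau> \<and> nmem \<tau> ''bk'' 0 = n \<and> nmem \<tau> ''nn'' 0 = n"
    have zz: "nmem \<tau> ''z'' 0 = z" using t z bfcells_same[of \<sigma> \<tau> "''z''"] by simp
    show "runs (Seq (NWrite ''bf'' (NV ''z'') (NConst 1)) (Seq (RWrite ''bv'' (NV ''z'') RZero) (NSet ''bb'' (NConst 0)))) \<tau> 40
      (\<lambda>\<tau>. same bfcells \<sigma> \<tau> \<and> nmem \<tau> ''bb'' 0 = 0 \<and> rep \<tau> 0 n (lay ts z 0))"
      by (rule runs_straightI) (use t z zz in \<open>auto intro!: same_nwrite same_rwrite simp: bfcells_def rep_def\<close>)
  qed
  show ?thesis by (rule runs_weaken[OF 2]) auto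
qed

lemma runs_bf_copy:
  assumes b: "nmem \<sigma> ''bb'' 0 = b" "nmem \<sigma> ''nb'' 0 = b + n" "nmem \<sigma> ''nn'' 0 = n" and L: "rep \<sigma> b n L"
  shows "runs (For ''bk'' ''nn'' bf_copy) \<sigma> (9 + n * (60 + 12)) (\<lambda>\<tau>. same bfc0 \<sigma> \<tau> \<and> lower (b + n) \<sigma> \<tau> \<and>
     nmem \<tau> ''bb'' 0 = b \<and> nmem \<tau> ''nb'' 0 = b + n \<and> rep \<tau> (b + n) n (carry L))"
proof -
  let ?I = "\<lambda>k \<tau>. same bfc0 \<sigma> \<tau> \<and> lower (b + n) \<sigma> \<tau> \<and> nmem \<tau> ''bb'' 0 = b \<and> nmem \<tau> ''nb'' 0 = b + n \<and>
    rep \<tau> (b + n) k (carry L)"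
  have "runs (For ''bk'' ''nn'' bf_copy) \<sigma> (9 + n * (60 + 12)) (\<lambda>\<tau>. ?I n \<tau> \<and> nmem \<tau> ''bk'' 0 = n \<and> nmem \<tau> ''nn'' 0 = n)"
  proof (rule runs_For[where I = ?I])
    show "?I 0 (nwrite ''bk'' 0 0 \<sigma>)" using b by (auto intro!: same_nwrite simp: bfc0_def) (simp add: rep_def)
    fix k \<sigma>' assume k: "k < n" "?I k \<sigma>'" "nmem \<sigma>' ''bk'' 0 = k" "nmem \<sigma>' ''nn'' 0 = n"
    let ?\<tau> = "den bf_copy \<sigma>'"
    have low: "nmem \<sigma>' ''bf'' (b + k) = nmem \<sigma> ''bf'' (b + k)" "rmem \<sigma>' ''bv'' (b + k) = rmem \<sigma> ''bv'' (b + k)"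
      using k by (auto simp: lower_def)
    have t: "?\<tau> = nwrite ''bp'' (b + n + k) 0 (rwrite ''bv'' (b + n + k) (rmem \<sigma> ''bv'' (b + k)) (nwrite ''bf'' (b + n + k) (nmem \<sigma> ''bf'' (b + k)) \<sigma>'))"
      using k low unfolding bf_copy_def by simp
    have "rep ?\<tau> (b + n) (Suc k) (carry L)"
      using k(1,2) L unfolding rep_def t carry_def by (auto simp: less_Suc_eq split: option.splits)
    moreover have "same bfc0 \<sigma> ?\<tau>" unfolding t using k(2) by (auto intro!: same_nwrite same_rwrite simp: bfc0_def)
    moreover have "lower (b + n) \<sigma> ?\<tau>" unfolding t using k(2) by (auto simp: lower_def)
    moreover have "nmem ?\<tau> ''bb'' 0 = b" "nmem ?\<tau> ''nb'' 0 = b + n" "nmem ?\<tau> ''bk'' 0 = k" "nmem ?\<tau> ''nn'' 0 = n"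
      unfolding t using k by auto
    ultimately show "runs bf_copy \<sigma>' 60 (\<lambda>\<tau>. nmem \<tau> ''bk'' 0 = k \<and> nmem \<tau> ''nn'' 0 = n \<and> ?I (Suc k) (nwrite ''bk'' 0 (Suc k) \<tau>))"
    proof (intro runs_straightI)
      show "straight bf_copy" "ctime bf_copy \<le> 60" by (simp_all add: bf_copy_def)
    qed (auto intro!: same_nwrite simp: bfc0_def)
  qed (use b in auto)
  then show ?thesis by (rule runs_weaken) auto
qed

lemma runs_bf_relax:
  assumes b: "nmem \<sigma> ''bb'' 0 = b" "nmem \<sigma> ''nb'' 0 = b + n" and L: "rep \<sigma> b n L" "rep \<sigma> (b + n) n (carry L)"
    and ts: "tlist \<sigma> = ts" "\<And>f t c l. (f, t, c, l) \<in> set ts \<Longrightarrow> f < n \<and> t < n"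
  shows "runs (For ''bk'' ''tk'' bf_relax) \<sigma> (9 + length ts * (200 + 12)) (\<lambda>\<tau>. same bfc0 \<sigma> \<tau> \<and> lower (b + n) \<sigma> \<tau> \<and>
     nmem \<tau> ''bb'' 0 = b \<and> nmem \<tau> ''nb'' 0 = b + n \<and> rep \<tau> (b + n) n (relaxes ts L (length ts)))"
proof -
  let ?I = "\<lambda>k \<tau>. same bfc0 \<sigma> \<tau> \<and> lower (b + n) \<sigma> \<tau> \<and> nmem \<tau> ''bb'' 0 = b \<and> nmem \<tau> ''nb'' 0 = b + n \<and>
    rep \<tau> (b + n) n (relaxes ts L k)"
  have tk: "nmem \<sigma> ''tk'' 0 = length ts" using ts(1) by (auto simp: tlist_def)
  have "runs (For ''bk'' ''tk'' bf_relax) \<sigma> (9 + length ts * (200 + 12)) (\<lambda>\<tau>. ?I (length ts) \<tau> \<and> nmem \<tau> ''bk'' 0 = length ts \<and> nmem \<tau> ''tk'' 0 = length ts)"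
  proof (rule runs_For[where I = ?I])
    show "?I 0 (nwrite ''bk'' 0 0 \<sigma>)" using b L by (auto intro!: same_nwrite simp: bfc0_def relaxes_0)
    fix k \<sigma>' assume k: "k < length ts" "?I k \<sigma>'" "nmem \<sigma>' ''bk'' 0 = k" "nmem \<sigma>' ''tk'' 0 = length ts"
    obtain f t c l where tsk: "ts ! k = (f, t, c, l)" by (cases "ts ! k") auto
    then have ft: "f < n" "t < n" using ts(2) k(1) by (metis nth_mem)+
    have T: "nmem \<sigma> ''TF'' k = f" "nmem \<sigma> ''TT'' k = t" "rmem \<sigma> ''TC'' k = c"
      using arg_cong[OF ts(1), of "\<lambda>l. l ! k"] tsk k(1) tk unfolding tlist_def by auto
    have T': "nmem \<sigma>' ''TF'' k = f" "nmem \<sigma>' ''TT'' k = t" "rmem \<sigma>' ''TC'' k = c"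
      using T k(2) bfc0_same[of \<sigma> \<sigma>' "''TF''"] bfc0_same[of \<sigma> \<sigma>' "''TT''"] bfc0_same[of \<sigma> \<sigma>' "''TC''"] by auto
    have low: "nmem \<sigma>' ''bf'' (b + f) = nmem \<sigma> ''bf'' (b + f)" "rmem \<sigma>' ''bv'' (b + f) = rmem \<sigma> ''bv'' (b + f)"
      using k ft by (auto simp: lower_def)
    let ?N = "relaxes ts L k" and ?\<tau> = "den bf_relax \<sigma>'"
    have Lf: "case L f of None \<Rightarrow> nmem \<sigma>' ''bf'' (b + f) = 0 | Some (c, p) \<Rightarrow> nmem \<sigma>' ''bf'' (b + f) = 1 \<and> rmem \<sigma>' ''bv'' (b + f) = c"
      using L(1) ft low by (auto simp: rep_def split: option.splits)
    have Nt: "case ?N t of None \<Rightarrow> nmem \<sigma>' ''bf'' (b + n + t) = 0 | Some (c, p) \<Rightarrow> nmem \<sigma>' ''bf'' (b + n + t) = 1 \<and> rmem \<sigma>' ''bv'' (b + n + t) = c"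
      using k(2) ft by (auto simp: rep_def split: option.splits)
    let ?upd = "nwrite ''bp'' (b + n + t) (Suc k) (nwrite ''bf'' (b + n + t) 1 (rwrite ''bv'' (b + n + t) (rmem \<sigma>' ''bv'' (b + f) + c) \<sigma>'))"
    have den: "?\<tau> = (if nmem \<sigma>' ''bf'' (b + f) > 0 \<and> \<not> (nmem \<sigma>' ''bf'' (b + n + t) > 0 \<and> \<not> rmem \<sigma>' ''bv'' (b + f) + c < rmem \<sigma>' ''bv'' (b + n + t))
      then ?upd else \<sigma>')"
      using k T' unfolding bf_relax_def Let_def by (simp add: add.assoc)
    have repu: "rep ?upd (b + n) n (?N(t := Some (rmem \<sigma>' ''bv'' (b + f) + c, Suc k)))"
      using k(2) ft unfolding rep_def by (auto split: option.splits)
    have "rep ?\<tau> (b + n) n (relaxes ts L (Suc k))"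
    proof (cases "L f")
      case None
      then have "relaxes ts L (Suc k) = ?N" "?\<tau> = \<sigma>'" using Lf tsk by (auto simp: relaxes_Suc relax_def den)
      then show ?thesis using k(2) by simp
    next
      case (Some dp)
      obtain d p where dp: "L f = Some (d, p)" using Some by (cases dp) auto
      have d: "nmem \<sigma>' ''bf'' (b + f) = 1" "rmem \<sigma>' ''bv'' (b + f) = d" using Lf dp by auto
      show ?thesis
      proof (cases "?N t")
        case None
        then have "relaxes ts L (Suc k) = ?N(t := Some (d + c, Suc k))" "?\<tau> = ?upd"
          using dp tsk Nt d by (auto simp: relaxes_Suc relax_def den)
        then show ?thesis using repu d by simp
      next
        case (Some ep)
        obtain d' p' where ep: "?N t = Some (d', p')" using Some by (cases ep) auto
        have d': "nmem \<sigma>' ''bf'' (b + n + t) = 1" "rmem \<sigma>' ''bv'' (b + n + t) = d'" using Nt ep by auto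
        show ?thesis
        proof (cases "d + c < d'")
          case True
          then have "relaxes ts L (Suc k) = ?N(t := Some (d + c, Suc k))" "?\<tau> = ?upd"
            using dp tsk ep d d' by (auto simp: relaxes_Suc relax_def den)
          then show ?thesis using repu d by simp
        next
          case False
          then have "relaxes ts L (Suc k) = ?N" "?\<tau> = \<sigma>'"
            using dp tsk ep d d' by (auto simp: relaxes_Suc relax_def den)
          then show ?thesis using k(2) by simp
        qed
      qed
    qed
    moreover have "same bfc0 \<sigma> ?\<tau>" unfolding den using k(2) by (auto intro!: same_nwrite same_rwrite simp: bfc0_def)
    moreover have "lower (b + n) \<sigma> ?\<tau>" unfolding den using k(2) by (auto simp: lower_def)
    moreover have "nmem ?\<tau> ''bb'' 0 = b" "nmem ?\<tau> ''nb'' 0 = b + n" "nmem ?\<tau> ''bk'' 0 = k" "nmem ?\<tau> ''tk'' 0 = length ts"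
      unfolding den using k by auto
    ultimately show "runs bf_relax \<sigma>' 200 (\<lambda>\<tau>. nmem \<tau> ''bk'' 0 = k \<and> nmem \<tau> ''tk'' 0 = length ts \<and> ?I (Suc k) (nwrite ''bk'' 0 (Suc k) \<tau>))"
    proof (intro runs_straightI)
      show "straight bf_relax" "ctime bf_relax \<le> 200" by (simp_all add: bf_relax_def Let_def)
    qed (auto intro!: same_nwrite simp: bfc0_def)
  qed (use tk in auto)
  then show ?thesis by (rule runs_weaken) auto
qed

lemma runs_bellman:
  assumes n: "nmem \<sigma> ''nn'' 0 = n" and z: "nmem \<sigma> ''z'' 0 = z" "z < n" and R: "nmem \<sigma> ''rr'' 0 = R"
    and ts: "tlist \<sigma> = ts" "\<And>f t c l. (f, t, c, l) \<in> set ts \<Longrightarrow> f < n \<and> t < n"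
  shows "runs bellman \<sigma> (400 * (R + 1) * (n + length ts + 1)) (\<lambda>\<tau>. same bfcells \<sigma> \<tau> \<and> nmem \<tau> ''bb'' 0 = R * n \<and>
     (\<forall>r\<le>R. rep \<tau> (r * n) n (lay ts z r)))"
proof -
  let ?I = "\<lambda>k \<tau>. same bfcells \<sigma> \<tau> \<and> nmem \<tau> ''bb'' 0 = k * n \<and> (\<forall>r\<le>k. rep \<tau> (r * n) n (lay ts z r))"
  let ?T = "(15 + ((9 + n * (60 + 12)) + ((9 + length ts * (200 + 12)) + 15)))"
  have 2: "runs (For ''br'' ''rr'' bf_round) \<tau> (9 + R * (?T + 12)) (\<lambda>\<tau>. ?I R \<tau> \<and> nmem \<tau> ''br'' 0 = R \<and> nmem \<tau> ''rr'' 0 = R)"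
    if t: "same bfcells \<sigma> \<tau> \<and> nmem \<tau> ''bb'' 0 = 0 \<and> rep \<tau> 0 n (lay ts z 0)" for \<tau>
  proof (rule runs_For[where I = ?I])
    show "nmem \<tau> ''rr'' 0 = R" using t R bfcells_same[of \<sigma> \<tau> "''rr''"] by simp
    show "?I 0 (nwrite ''br'' 0 0 \<tau>)" using t by (auto intro!: same_nwrite simp: bfcells_def rep_def)
    fix k \<sigma>' assume k: "k < R" "?I k \<sigma>'" "nmem \<sigma>' ''br'' 0 = k" "nmem \<sigma>' ''rr'' 0 = R"
    let ?L = "lay ts z k" and ?b = "k * n"
    have env: "nmem x ''nn'' 0 = n" "tlist x = ts" if "same bfcells \<sigma> x" for x
      using bfcells_same[OF that] n ts(1) unfolding tlist_def by auto
    have mono: "rep x (r * n) n L" if "r \<le> k" "rep \<sigma>' (r * n) n L" "lower (?b + n) \<sigma>' x" for x r L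
    proof (rule rep_lower[OF that(2,3)])
      have "r * n + n = Suc r * n" by simp
      also have "\<dots> \<le> Suc k * n" using that(1) by (intro mult_le_mono1) simp
      finally show "r * n + n \<le> ?b + n" by simp
    qed
    show "runs bf_round \<sigma>' ?T (\<lambda>\<tau>. nmem \<tau> ''br'' 0 = k \<and> nmem \<tau> ''rr'' 0 = R \<and> ?I (Suc k) (nwrite ''br'' 0 (Suc k) \<tau>))"
      unfolding bf_round_def
    proof (rule runs_Seq[where ?Q1.0 = "\<lambda>x. same bfcells \<sigma> x \<and> lower (?b + n) \<sigma>' x \<and> nmem x ''bb'' 0 = ?b \<and> nmem x ''nb'' 0 = ?b + n \<and> nmem x ''br'' 0 = k"])
      show "runs (NSet ''nb'' (NAdd (NV ''bb'') (NV ''nn''))) \<sigma>' 15 (\<lambda>x. same bfcells \<sigma> x \<and> lower (?b + n) \<sigma>' x \<and> nmem x ''bb'' 0 = ?b \<and> nmem x ''nb'' 0 = ?b + n \<and> nmem x ''br'' 0 = k)"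
        by (rule runs_straightI) (use k env[of \<sigma>'] in \<open>auto intro!: same_nwrite simp: bfcells_def lower_def\<close>)
      fix x assume x: "same bfcells \<sigma> x \<and> lower (?b + n) \<sigma>' x \<and> nmem x ''bb'' 0 = ?b \<and> nmem x ''nb'' 0 = ?b + n \<and> nmem x ''br'' 0 = k"
      have Lx: "rep x ?b n ?L" using mono[of k] k(2) x by simp
      show "runs (Seq (For ''bk'' ''nn'' bf_copy) (Seq (For ''bk'' ''tk'' bf_relax) (NSet ''bb'' (NV ''nb'')))) x
        ((9 + n * (60 + 12)) + ((9 + length ts * (200 + 12)) + 15)) (\<lambda>\<tau>. nmem \<tau> ''br'' 0 = k \<and> nmem \<tau> ''rr'' 0 = R \<and> ?I (Suc k) (nwrite ''br'' 0 (Suc k) \<tau>))"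
      proof (rule runs_Seq[OF runs_bf_copy[OF _ _ _ Lx]])
        show "nmem x ''bb'' 0 = ?b" "nmem x ''nb'' 0 = ?b + n" "nmem x ''nn'' 0 = n" using x env[of x] by auto
        fix y assume y: "same bfc0 x y \<and> lower (?b + n) x y \<and> nmem y ''bb'' 0 = ?b \<and> nmem y ''nb'' 0 = ?b + n \<and> rep y (?b + n) n (carry ?L)"
        have Ly: "rep y ?b n ?L" using rep_lower[OF Lx, of "?b + n" y] y by simp
        have sy: "same bfcells \<sigma> y" using x y bfc0_bfcells same_trans by blast
        show "runs (Seq (For ''bk'' ''tk'' bf_relax) (NSet ''bb'' (NV ''nb''))) y ((9 + length ts * (200 + 12)) + 15)
          (\<lambda>\<tau>. nmem \<tau> ''br'' 0 = k \<and> nmem \<tau> ''rr'' 0 = R \<and> ?I (Suc k) (nwrite ''br'' 0 (Suc k) \<tau>))"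
        proof (rule runs_Seq[OF runs_bf_relax[OF _ _ Ly, of ts]])
          show "nmem y ''bb'' 0 = ?b" "nmem y ''nb'' 0 = ?b + n" "rep y (?b + n) n (carry ?L)" using y by auto
          show "tlist y = ts" using env[OF sy] by simp
          fix u assume u: "same bfc0 y u \<and> lower (?b + n) y u \<and> nmem u ''bb'' 0 = ?b \<and> nmem u ''nb'' 0 = ?b + n \<and>
            rep u (?b + n) n (relaxes ts ?L (length ts))"
          have su: "same bfcells \<sigma> u" using sy u bfc0_bfcells same_trans by blast
          have low: "lower (?b + n) \<sigma>' u" using x y u lower_trans by blast
          have br: "nmem u ''br'' 0 = k" using x y u bfc0_same[of x y "''br''"] bfc0_same[of y u "''br''"] by simp
          have rr: "nmem u ''rr'' 0 = R" using su R bfcells_same[of \<sigma> u "''rr''"] by simp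
          have rp: "rep u (r * n) n (lay ts z r)" if "r \<le> Suc k" for r
          proof (cases "r = Suc k")
            case True
            then show ?thesis using u by (simp add: add.commute)
          next
            case False
            then show ?thesis using mono[OF _ _ low, of r] k(2) that by simp
          qed
          show "runs (NSet ''bb'' (NV ''nb'')) u 15 (\<lambda>\<tau>. nmem \<tau> ''br'' 0 = k \<and> nmem \<tau> ''rr'' 0 = R \<and> ?I (Suc k) (nwrite ''br'' 0 (Suc k) \<tau>))"
            by (rule runs_straightI) (use su u br rr rp in \<open>auto intro!: same_nwrite simp: bfcells_def\<close>)
        qed (use ts(2) in auto)
      qed
    qed
  qed simp
  have 3: "runs bellman \<sigma> (100 * (n + 1) + (9 + R * (?T + 12))) (\<lambda>\<tau>. ?I R \<tau>)"
    unfolding bellman_def by (rule runs_Seq[OF runs_bf_init[OF n z, of ts]]) (rule runs_weaken[OF 2], auto)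
  show ?thesis by (rule runs_weaken[OF 3]) (auto simp: algebra_simps)
qed

section \<open>Encoding the game\<close>

lemma radix_inj:
  fixes b :: nat
  assumes "q1 * b + r1 = q2 * b + r2" "r1 < b" "r2 < b"
  shows "q1 = q2 \<and> r1 = r2"
proof -
  have "(q1 * b + r1) div b = q1" "(q2 * b + r2) div b = q2" using assms(2,3) by auto
  then show ?thesis using assms(1) by auto
qed

lemma radix_lt:
  fixes b :: nat
  assumes "q < Q" "r < b" shows "q * b + r < Q * b"
proof -
  have "q * b + r < Suc q * b" using assms(2) by simp
  also have "\<dots> \<le> Q * b" using assms(1) by (intro mult_le_mono1) simp
  finally show ?thesis .
qed

locale coding = fixes N M :: nat
begin

text \<open>\<open>SA\<close>, \<open>SJ\<close> and \<open>SI\<close> are place values of a mixed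
  radix notation and \<open>TOT\<close> is the size of its range. The program obtains them by
  repeated addition, see \<open>tables_prog\<close>.\<close>

definition SA :: nat where "SA = Suc N * N"
definition SJ :: nat where "SJ = Suc N * SA"
definition SI :: nat where "SI = M * SJ"
definition TOT :: nat where "TOT = M * SI"

text \<open>States \<open>Ln\<close> are coded like states \<open>Gn\<close>, with the impossible vertex \<open>N\<close> for \<open>a\<close> and \<open>x\<close>.\<close>

definition enc5 :: "nat \<Rightarrow> nat \<Rightarrow> nat \<Rightarrow> nat \<Rightarrow> nat \<Rightarrow> nat" where
  "enc5 i j a x c = i * SI + (j * SJ + (a * SA + (x * N + c)))"

fun enc :: "node \<Rightarrow> nat" where
  "enc (Gn i j a x c) = enc5 i j a x c"
| "enc (Ln i j c) = enc5 i j N N c"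
| "enc (An i) = TOT + i"
| "enc Src = TOT + M"
| "enc Fin = TOT + M + 1"

fun valid :: "node \<Rightarrow> bool" where
  "valid (Gn i j a x c) \<longleftrightarrow> i < M \<and> j < M \<and> a < N \<and> x < N \<and> c < N"
| "valid (Ln i j c) \<longleftrightarrow> i < M \<and> j < M \<and> c < N"
| "valid (An i) \<longleftrightarrow> i < M"
| "valid _ \<longleftrightarrow> True"

lemma enc5_lt:
  assumes "i < M" "j < M" "a \<le> N" "x \<le> N" "c < N"
  shows "x * N + c < SA" "a * SA + (x * N + c) < SJ" "j * SJ + (a * SA + (x * N + c)) < SI" "enc5 i j a x c < TOT"
proof -
  show 1: "x * N + c < SA" unfolding SA_def using radix_lt[of x "Suc N" c N] assms by simp
  show 2: "a * SA + (x * N + c) < SJ" unfolding SJ_def using radix_lt[of a "Suc N" _ SA] 1 assms by simp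
  show 3: "j * SJ + (a * SA + (x * N + c)) < SI" unfolding SI_def using radix_lt[of j M _ SJ] 2 assms by simp
  show "enc5 i j a x c < TOT" unfolding TOT_def enc5_def using radix_lt[of i M _ SI] 3 assms by simp
qed

lemma enc5_inj:
  assumes "enc5 i j a x c = enc5 i' j' a' x' c'" "i < M" "j < M" "a \<le> N" "x \<le> N" "c < N"
    "i' < M" "j' < M" "a' \<le> N" "x' \<le> N" "c' < N"
  shows "i = i' \<and> j = j' \<and> a = a' \<and> x = x' \<and> c = c'"
  using assms enc5_lt[OF assms(2-6)] enc5_lt[OF assms(7-11)] radix_inj[of i SI _ i'] radix_inj[of j SJ _ j']
    radix_inj[of a SA _ a'] radix_inj[of x N c x' c'] unfolding enc5_def by metis

lemma enc5_ltL: "i < M \<and> j < M \<and> c < N \<Longrightarrow> enc5 i j N N c < TOT"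
  using enc5_lt(4) by simp

lemma enc5_ltG: "i < M \<and> j < M \<and> a < N \<and> x < N \<and> c < N \<Longrightarrow> enc5 i j a x c < TOT"
  using enc5_lt(4) by simp

lemma enc_inj: "valid u \<Longrightarrow> valid v \<Longrightarrow> enc u = enc v \<Longrightarrow> u = v"
proof (cases u; cases v; simp)
  fix i j c i' j' c'
  assume *: "i < M \<and> j < M \<and> c < N" "i' < M \<and> j' < M \<and> c' < N" "enc5 i j N N c = enc5 i' j' N N c'"
  show "i = i' \<and> j = j' \<and> c = c'" using enc5_inj[OF *(3)] * by auto
next
  fix i j c i' j' a' x' c'
  assume *: "i < M \<and> j < M \<and> c < N" "i' < M \<and> j' < M \<and> a' < N \<and> x' < N \<and> c' < N" "enc5 i j N N c = enc5 i' j' a' x' c'"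
  show False using enc5_inj[OF *(3)] * by auto
next
  fix i j a x c i' j' c'
  assume *: "i < M \<and> j < M \<and> a < N \<and> x < N \<and> c < N" "i' < M \<and> j' < M \<and> c' < N" "enc5 i j a x c = enc5 i' j' N N c'"
  show False using enc5_inj[OF *(3)] * by auto
next
  fix i j a x c i' j' a' x' c'
  assume *: "i < M \<and> j < M \<and> a < N \<and> x < N \<and> c < N" "i' < M \<and> j' < M \<and> a' < N \<and> x' < N \<and> c' < N" "enc5 i j a x c = enc5 i' j' a' x' c'"
  show "i = i' \<and> j = j' \<and> a = a' \<and> x = x' \<and> c = c'" using enc5_inj[OF *(3)] * by auto
qed (auto dest!: enc5_ltL enc5_ltG)

lemma enc_lt: "valid u \<Longrightarrow> enc u < TOT + M + 2"
proof (cases u)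
  case (Ln i j c)
  moreover assume "valid u"
  ultimately show ?thesis using enc5_lt(4)[of i j N N c] by simp
next
  case (Gn i j a x c)
  moreover assume "valid u"
  ultimately show ?thesis using enc5_lt(4)[of i j a x c] by simp
qed auto

end

locale game = dp_data N M src dst wt dE rc hh gg + coding N M for N M src dst wt dE rc hh gg +
  assumes src_dst_lt: "e < M \<Longrightarrow> src e < N \<and> dst e < N"
begin

definition tSrc :: "nat \<Rightarrow> trans list" where
  "tSrc i = (if dE i then [(enc Src, enc (An i), 0, i)] else [])"

definition tStart :: "nat \<Rightarrow> nat \<Rightarrow> trans list" where
  "tStart i j = (if dE i \<and> dE j \<and> \<not> rc (src j) (src i) \<and> dst i \<noteq> src j
     then [(enc (An i), enc (Ln i j (src j)), gg (src j), j)] else [])"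

definition tL :: "nat \<Rightarrow> nat \<Rightarrow> nat \<Rightarrow> nat \<Rightarrow> trans list" where
  "tL i j c e =
    (if dE e \<and> src e = dst i \<and> \<not> rc (dst j) (dst i) \<and> \<not> rc (dst i) (src j) then [(enc (Ln i j c), enc (Ln e j c), 0, e)] else []) @
    (if dE e \<and> src e = dst j \<and> \<not> rc (dst i) (dst j) then [(enc (Ln i j c), enc (Ln i e c), 0, e)] else []) @
    (if src e = dst i \<and> dst e = c \<and> \<not> dE e \<and> \<not> rc (dst j) (dst i) then [(enc (Ln i j c), enc Fin, wt e + hh (dst i), e)] else [])"

definition tOpen :: "nat \<Rightarrow> nat \<Rightarrow> nat \<Rightarrow> nat \<Rightarrow> trans list" where
  "tOpen i j c a = (if \<not> rc a (src i) \<and> \<not> rc a (src j) then [(enc (Ln i j c), enc (Gn i j a a c), 0, M)] else [])"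

definition tG :: "nat \<Rightarrow> nat \<Rightarrow> nat \<Rightarrow> nat \<Rightarrow> nat \<Rightarrow> nat \<Rightarrow> trans list" where
  "tG i j c a x e =
    (if dE e \<and> src e = dst i \<and> \<not> rc (dst j) (dst i) \<and> \<not> rc (dst i) (src j) \<and> \<not> rc x (dst i)
      then [(enc (Gn i j a x c), enc (Gn e j a x c), 0, e)] else []) @
    (if dE e \<and> src e = dst j \<and> \<not> rc (dst i) (dst j) \<and> \<not> rc x (dst j)
      then [(enc (Gn i j a x c), enc (Gn i e a x c), 0, e)] else []) @
    (if dE e \<and> src e = x \<and> \<not> rc (dst i) x \<and> \<not> rc (dst j) x
      then [(enc (Gn i j a x c), enc (Gn i j a (dst e) c), wt e, e)] else []) @
    (if src e = x \<and> dst e = c \<and> \<not> rc (dst i) x \<and> \<not> rc (dst j) x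
      then [(enc (Gn i j a x c), enc (Ln i j a), wt e, e)] else [])"

text \<open>The nesting is that of the loops of \<open>game_list\<close>, so the emitted list equals
  this one literally and not just as a set.\<close>

definition tAll :: "trans list" where
  "tAll = concat (map (\<lambda>i. tSrc i @ concat (map (\<lambda>j. tStart i j @ concat (map (\<lambda>c.
     concat (map (\<lambda>e. tL i j c e) [0..<M]) @ concat (map (\<lambda>a. tOpen i j c a @ concat (map (\<lambda>x.
       concat (map (\<lambda>e. tG i j c a x e) [0..<M])) [0..<N])) [0..<N])) [0..<N])) [0..<M])) [0..<M])"

lemma set_tAll:
  "z \<in> set tAll \<longleftrightarrow> (\<exists>i<M. z \<in> set (tSrc i) \<or> (\<exists>j<M. z \<in> set (tStart i j) \<or> (\<exists>c<N. (\<exists>e<M. z \<in> set (tL i j c e)) \<or>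
     (\<exists>a<N. z \<in> set (tOpen i j c a) \<or> (\<exists>x<N. \<exists>e<M. z \<in> set (tG i j c a x e))))))"
  unfolding tAll_def by (auto simp: atLeast0LessThan) blast+

lemma tr_valid: "tr u v d l \<Longrightarrow> valid u \<and> valid v"
  by (induction rule: tr.induct) (auto simp: src_dst_lt)

lemma tAll_tr: "z \<in> set tAll \<Longrightarrow> \<exists>u v d l. tr u v d l \<and> z = (enc u, enc v, d, l)"
  unfolding set_tAll
proof (elim exE conjE disjE)
  fix i assume "i < M" "z \<in> set (tSrc i)"
  then show ?thesis using tr_src[of i] unfolding tSrc_def by (auto split: if_splits simp del: enc.simps)
next
  fix i j assume "i < M" "j < M" "z \<in> set (tStart i j)"
  then show ?thesis using tr_start[of i j] unfolding tStart_def by (auto split: if_splits simp del: enc.simps)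
next
  fix i j c e assume a: "i < M" "j < M" "c < N" "e < M" and "z \<in> set (tL i j c e)"
  then consider "z = (enc (Ln i j c), enc (Ln e j c), 0, e)" "dE e \<and> src e = dst i \<and> \<not> rc (dst j) (dst i) \<and> \<not> rc (dst i) (src j)"
    | "z = (enc (Ln i j c), enc (Ln i e c), 0, e)" "dE e \<and> src e = dst j \<and> \<not> rc (dst i) (dst j)"
    | "z = (enc (Ln i j c), enc Fin, wt e + hh (dst i), e)" "src e = dst i \<and> dst e = c \<and> \<not> dE e \<and> \<not> rc (dst j) (dst i)"
    unfolding tL_def by (auto split: if_splits simp del: enc.simps)
  then show ?thesis
  proof cases
    case 1
    then show ?thesis using tr_L1[OF a] by blast
  next
    case 2
    then show ?thesis using tr_L2[OF a] by blast
  next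
    case 3
    then show ?thesis using tr_fin[OF a] by blast
  qed
next
  fix i j c a assume "i < M" "j < M" "c < N" "a < N" "z \<in> set (tOpen i j c a)"
  then show ?thesis using tr_open[of i j a c] unfolding tOpen_def by (auto split: if_splits simp del: enc.simps)
next
  fix i j c a x e assume r: "i < M" "j < M" "c < N" "a < N" "x < N" "e < M" and "z \<in> set (tG i j c a x e)"
  then consider "z = (enc (Gn i j a x c), enc (Gn e j a x c), 0, e)"
        "dE e \<and> src e = dst i \<and> \<not> rc (dst j) (dst i) \<and> \<not> rc (dst i) (src j) \<and> \<not> rc x (dst i)"
    | "z = (enc (Gn i j a x c), enc (Gn i e a x c), 0, e)" "dE e \<and> src e = dst j \<and> \<not> rc (dst i) (dst j) \<and> \<not> rc x (dst j)"
    | "z = (enc (Gn i j a x c), enc (Gn i j a (dst e) c), wt e, e)" "dE e \<and> src e = x \<and> \<not> rc (dst i) x \<and> \<not> rc (dst j) x"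
    | "z = (enc (Gn i j a x c), enc (Ln i j a), wt e, e)" "src e = x \<and> dst e = c \<and> \<not> rc (dst i) x \<and> \<not> rc (dst j) x"
    unfolding tG_def by (auto split: if_splits simp del: enc.simps)
  then show ?thesis
  proof cases
    case 1
    then show ?thesis using tr_G1[OF r(1,2,4,5,3,6)] by blast
  next
    case 2
    then show ?thesis using tr_G2[OF r(1,2,4,5,3,6)] by blast
  next
    case 3
    then show ?thesis using tr_step[OF r(1,2,4,5,3,6)] by blast
  next
    case 4
    then show ?thesis using tr_close[OF r(1,2,4,5,3,6)] by blast
  qed
qed

lemma tr_tAll: "tr u v d l \<Longrightarrow> (enc u, enc v, d, l) \<in> set tAll"
proof (induction rule: tr.induct)
  case (tr_src i)
  then show ?case unfolding set_tAll tSrc_def by auto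
next
  case (tr_start i j)
  then have "(enc (An i), enc (Ln i j (src j)), gg (src j), j) \<in> set (tStart i j)" unfolding tStart_def by simp
  then show ?case unfolding set_tAll using tr_start by blast
next
  case (tr_L1 i j c e)
  then have "(enc (Ln i j c), enc (Ln e j c), 0, e) \<in> set (tL i j c e)" unfolding tL_def by simp
  then show ?case unfolding set_tAll using tr_L1 by blast
next
  case (tr_L2 i j c e)
  then have "(enc (Ln i j c), enc (Ln i e c), 0, e) \<in> set (tL i j c e)" unfolding tL_def by simp
  then show ?case unfolding set_tAll using tr_L2 by blast
next
  case (tr_G1 i j a x c e)
  then have "(enc (Gn i j a x c), enc (Gn e j a x c), 0, e) \<in> set (tG i j c a x e)" unfolding tG_def by simp
  then show ?case unfolding set_tAll using tr_G1 by blast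
next
  case (tr_G2 i j a x c e)
  then have "(enc (Gn i j a x c), enc (Gn i e a x c), 0, e) \<in> set (tG i j c a x e)" unfolding tG_def by simp
  then show ?case unfolding set_tAll using tr_G2 by blast
next
  case (tr_open i j a c)
  then have "(enc (Ln i j c), enc (Gn i j a a c), 0, M) \<in> set (tOpen i j c a)" unfolding tOpen_def by simp
  then show ?case unfolding set_tAll using tr_open by blast
next
  case (tr_step i j a x c e)
  then have "(enc (Gn i j a x c), enc (Gn i j a (dst e) c), wt e, e) \<in> set (tG i j c a x e)" unfolding tG_def by simp
  then show ?case unfolding set_tAll using tr_step by blast
next
  case (tr_close i j a x c e)
  then have "(enc (Gn i j a x c), enc (Ln i j a), wt e, e) \<in> set (tG i j c a x e)" unfolding tG_def by simp
  then show ?case unfolding set_tAll using tr_close by blast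
next
  case (tr_fin i j c e)
  then have "(enc (Ln i j c), enc Fin, wt e + hh (dst i), e) \<in> set (tL i j c e)" unfolding tL_def by simp
  then show ?case unfolding set_tAll using tr_fin by blast
qed

lemma run_brun: "run u c ls \<Longrightarrow> brun tAll (enc Src) (enc u) c ls"
  by (induction rule: run.induct) (auto intro: brun_0 brun_Suc tr_tAll simp del: enc.simps)

lemma run_valid: "run u c ls \<Longrightarrow> valid u"
  by (induction rule: run.induct) (auto dest: tr_valid)

text \<open>Emitted transitions connect valid states, on which \<open>enc\<close> is injective, so
  consecutive coded steps are consecutive steps of the game.\<close>

lemma brun_run: "brun tAll (enc Src) v c ls \<Longrightarrow> \<exists>u. v = enc u \<and> run u c ls"
proof (induction rule: brun.induct)
  case brun_0
  then show ?case using run_src by blast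
next
  case (brun_Suc u c ks v d l)
  then obtain u0 where u0: "u = enc u0" "run u0 c ks" by blast
  obtain u1 v1 where 1: "tr u1 v1 d l" "u = enc u1" "v = enc v1" using tAll_tr[OF brun_Suc(2)] by auto
  have "u1 = u0" using enc_inj[of u1 u0] tr_valid[OF 1(1)] run_valid[OF u0(2)] u0 1 by simp
  then show ?case using run_step[OF u0(2), of v1 d l] 1 by blast
qed

lemma brun_run_Fin: "brun tAll (enc Src) (enc Fin) c ls \<Longrightarrow> run Fin c ls"
proof -
  assume "brun tAll (enc Src) (enc Fin) c ls"
  then obtain u where "enc Fin = enc u" "run u c ls" using brun_run by blast
  then show ?thesis using enc_inj[of Fin u] run_valid[of u] by (simp del: enc.simps)
qed

lemma tAll_lt: "(f, t, c, l) \<in> set tAll \<Longrightarrow> f < TOT + M + 2 \<and> t < TOT + M + 2"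
proof -
  assume "(f, t, c, l) \<in> set tAll"
  then obtain u v where "tr u v c l" "f = enc u" "t = enc v" using tAll_tr by blast
  then show ?thesis using tr_valid[of u v] enc_lt by blast
qed

lemma tAll_label: "(f, t, c, l) \<in> set tAll \<Longrightarrow> l \<le> M"
proof -
  assume "(f, t, c, l) \<in> set tAll"
  then obtain u v where "tr u v c l" using tAll_tr by blast
  then show ?thesis by (induction rule: tr.induct) auto
qed

end

section \<open>The stages of the program\<close>

abbreviation scratch :: "mem_name set" where
  "scratch \<equiv> {''TF'', ''TT'', ''TC'', ''TL'', ''tk'', ''nn'', ''z'', ''rr'', ''bf'', ''bv'', ''bp'', ''bb'', ''nb'', ''br'', ''bk'',
     ''e'', ''v'', ''i'', ''j'', ''c'', ''a'', ''x''}"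

text \<open>All scratch memories may change, so that a stage has to list only the memories that
  carry its results.\<close>

definition keeps :: "mem_name set \<Rightarrow> state \<Rightarrow> state \<Rightarrow> bool" where
  "keeps A \<sigma> \<tau> \<longleftrightarrow> same ((scratch \<union> A) \<times> UNIV) \<sigma> \<tau>"

lemma keeps_refl [simp]: "keeps A \<sigma> \<sigma>" by (simp add: keeps_def)

lemma keeps_trans: "keeps A \<sigma> \<tau> \<Longrightarrow> keeps A \<tau> \<rho> \<Longrightarrow> keeps A \<sigma> \<rho>"
  unfolding keeps_def by (rule same_trans)

lemma keeps_mono: "keeps A \<sigma> \<tau> \<Longrightarrow> A \<subseteq> B \<Longrightarrow> keeps B \<sigma> \<tau>"
  unfolding keeps_def by (erule same_mono) auto

lemma keeps_same: "same W \<sigma> \<tau> \<Longrightarrow> fst ` W \<subseteq> scratch \<union> A \<Longrightarrow> keeps A \<sigma> \<tau>"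
  unfolding keeps_def by (erule same_mono) force

lemma keepsN: "keeps A \<sigma> \<tau> \<Longrightarrow> x \<notin> scratch \<union> A \<Longrightarrow> nmem \<tau> x = nmem \<sigma> x"
  unfolding keeps_def by (erule sameN') auto

lemma keepsR: "keeps A \<sigma> \<tau> \<Longrightarrow> x \<notin> scratch \<union> A \<Longrightarrow> rmem \<tau> x = rmem \<sigma> x"
  unfolding keeps_def by (erule sameR') auto

lemma keeps_nwrite: "keeps A \<sigma> \<tau> \<Longrightarrow> x \<in> scratch \<union> A \<Longrightarrow> keeps A \<sigma> (nwrite x i k \<tau>)"
  unfolding keeps_def by (rule same_nwrite) auto

lemma keeps_rwrite: "keeps A \<sigma> \<tau> \<Longrightarrow> x \<in> scratch \<union> A \<Longrightarrow> x \<in> rnames \<Longrightarrow> keeps A \<sigma> (rwrite x i k \<tau>)"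
  unfolding keeps_def by (rule same_rwrite) auto

lemma keeps_bfcells: "same bfcells \<sigma> \<tau> \<Longrightarrow> keeps A \<sigma> \<tau>"
  by (erule keeps_same) (auto simp: bfcells_def)

lemma For_time: "1 \<le> B \<Longrightarrow> 9 + B * (T + 12) \<le> B * (T + 21)" for B T :: nat
  by (cases B) auto

text \<open>Multiples by repeated addition, as the machine cannot multiply. Codes of states are then
  computed by table lookups and sums in constant time.\<close>

definition table :: "mem_name \<Rightarrow> mem_name \<Rightarrow> mem_name \<Rightarrow> com" where
  "table x y d = Seq (NWrite x (NConst 0) (NConst 0))
     (For ''v'' y (NWrite x (NAdd (NV ''v'') (NConst 1)) (NAdd (NRead x (NV ''v'')) (NV d))))"

lemma runs_table:
  assumes "x \<notin> {y, d, ''v''}" "y \<noteq> ''v''" "d \<noteq> ''v''" and B: "nmem \<sigma> y 0 = B" and D: "nmem \<sigma> d 0 = D"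
  shows "runs (table x y d) \<sigma> (20 + B * 40) (\<lambda>\<tau>. keeps {x} \<sigma> \<tau> \<and> (\<forall>v\<le>B. nmem \<tau> x v = v * D))"
proof -
  let ?\<sigma> = "nwrite x 0 0 \<sigma>"
  let ?c = "NWrite x (NAdd (NV ''v'') (NConst 1)) (NAdd (NRead x (NV ''v'')) (NV d))"
  let ?I = "\<lambda>k \<tau>. keeps {x} \<sigma> \<tau> \<and> (\<forall>v\<le>k. nmem \<tau> x v = v * D) \<and> nmem \<tau> d 0 = D"
  have 0: "runs (NWrite x (NConst 0) (NConst 0)) \<sigma> 3 (\<lambda>\<tau>. \<tau> = ?\<sigma>)" by (rule runs_straightI) auto
  have 1: "runs (For ''v'' y ?c) ?\<sigma> (9 + B * (20 + 12)) (\<lambda>\<tau>. ?I B \<tau> \<and> nmem \<tau> ''v'' 0 = B \<and> nmem \<tau> y 0 = B)"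
  proof (rule runs_For[where I = ?I])
    show "?I 0 (nwrite ''v'' 0 0 ?\<sigma>)" using assms by (auto intro!: keeps_nwrite)
    fix k \<sigma>' assume k: "k < B" "?I k \<sigma>'" "nmem \<sigma>' ''v'' 0 = k" "nmem \<sigma>' y 0 = B"
    show "runs ?c \<sigma>' 20 (\<lambda>\<tau>. nmem \<tau> ''v'' 0 = k \<and> nmem \<tau> y 0 = B \<and> ?I (Suc k) (nwrite ''v'' 0 (Suc k) \<tau>))"
      by (rule runs_straightI) (use k assms in \<open>auto intro!: keeps_nwrite simp: le_Suc_eq\<close>)
  qed (use assms in auto)
  have 2: "runs (table x y d) \<sigma> (3 + (9 + B * (20 + 12))) (\<lambda>\<tau>. keeps {x} \<sigma> \<tau> \<and> (\<forall>v\<le>B. nmem \<tau> x v = v * D))"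
    unfolding table_def by (rule runs_Seq[OF 0], hypsubst, rule runs_weaken[OF 1]) auto
  show ?thesis by (rule runs_weaken[OF 2]) auto
qed

text \<open>The test is always true; it gives the body the guarded form for which
  \<open>apps_if\<close> is proved.\<close>

definition dist_list :: "mem_name \<Rightarrow> mem_name \<Rightarrow> com" where
  "dist_list a b = For ''e'' ''M'' (Cond (NLess (NConst 0) (NConst 1)) (app (NRead a (NV ''e'')) (NRead b (NV ''e'')) (RRead ''wt'' (NV ''e'')) (NV ''e'')) Skip)"

definition dist_copy :: "mem_name \<Rightarrow> mem_name \<Rightarrow> com" where
  "dist_copy hf h = For ''v'' ''N'' (Seq (NWrite hf (NV ''v'') (NRead ''bf'' (NAdd (NV ''bb'') (NV ''v''))))
     (RWrite h (NV ''v'') (RRead ''bv'' (NAdd (NV ''bb'') (NV ''v'')))))"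

definition dist_prog :: "mem_name \<Rightarrow> mem_name \<Rightarrow> mem_name \<Rightarrow> mem_name \<Rightarrow> mem_name \<Rightarrow> com" where
  "dist_prog a b z hf h = Seq (NSet ''tk'' (NConst 0)) (Seq (dist_list a b)
     (Seq (Seq (NSet ''nn'' (NV ''N'')) (Seq (NSet ''z'' (NV z)) (NSet ''rr'' (NV ''N'')))) (Seq bellman (dist_copy hf h))))"

locale machine =
  fixes N M S T :: nat and src dst :: "nat \<Rightarrow> nat" and wt :: "nat \<Rightarrow> real"
  assumes NM: "3 \<le> N" "3 \<le> M" and ST: "S < N" "T < N"
    and ends_lt: "e < M \<Longrightarrow> src e < N \<and> dst e < N"
    and dummy: "src M = N" "dst M = N"
begin

definition env :: "state \<Rightarrow> bool" where
  "env \<sigma> \<longleftrightarrow> nmem \<sigma> ''N'' 0 = N \<and> nmem \<sigma> ''M'' 0 = M \<and> nmem \<sigma> ''S'' 0 = S \<and> nmem \<sigma> ''T'' 0 = T \<and>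
     (\<forall>e\<le>M. nmem \<sigma> ''src'' e = src e \<and> nmem \<sigma> ''dst'' e = dst e) \<and> (\<forall>e<M. rmem \<sigma> ''wt'' e = wt e)"

lemma env_keeps: "env \<sigma> \<Longrightarrow> keeps A \<sigma> \<tau> \<Longrightarrow> A \<inter> {''N'', ''M'', ''S'', ''T'', ''src'', ''dst'', ''wt''} = {} \<Longrightarrow> env \<tau>"
  using keepsN[of A \<sigma> \<tau> "''N''"] keepsN[of A \<sigma> \<tau> "''M''"] keepsN[of A \<sigma> \<tau> "''S''"] keepsN[of A \<sigma> \<tau> "''T''"]
    keepsN[of A \<sigma> \<tau> "''src''"] keepsN[of A \<sigma> \<tau> "''dst''"] keepsR[of A \<sigma> \<tau> "''wt''"]
  unfolding env_def by auto

definition arclist :: "(nat \<Rightarrow> nat) \<Rightarrow> (nat \<Rightarrow> nat) \<Rightarrow> trans list" where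
  "arclist p q = map (\<lambda>e. (p e, q e, wt e, e)) [0..<M]"

definition repd :: "state \<Rightarrow> mem_name \<Rightarrow> mem_name \<Rightarrow> layer \<Rightarrow> bool" where
  "repd \<sigma> hf h L \<longleftrightarrow> (\<forall>v<N. case L v of None \<Rightarrow> nmem \<sigma> hf v = 0 | Some (c, p) \<Rightarrow> nmem \<sigma> hf v = 1 \<and> rmem \<sigma> h v = c)"

lemma runs_dist_list:
  assumes e: "env \<sigma>" and ab: "a = ''src'' \<and> p = src \<and> b = ''dst'' \<and> q = dst \<or> a = ''dst'' \<and> p = dst \<and> b = ''src'' \<and> q = src"
    and tk: "nmem \<sigma> ''tk'' 0 = 0"
  shows "runs (dist_list a b) \<sigma> (M * 100) (\<lambda>\<tau>. keeps {} \<sigma> \<tau> \<and> tlist \<tau> = arclist p q)"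
proof -
  interpret frame \<sigma> "insert (''e'', 0) tcells" .
  let ?c = "Cond (NLess (NConst 0) (NConst 1)) (app (NRead a (NV ''e'')) (NRead b (NV ''e'')) (RRead ''wt'' (NV ''e'')) (NV ''e'')) Skip"
  let ?g = "\<lambda>\<sigma>. if bval (NLess (NConst 0) (NConst 1)) \<sigma> then [(nval (NRead a (NV ''e'')) \<sigma>, nval (NRead b (NV ''e'')) \<sigma>, rval (RRead ''wt'' (NV ''e'')) \<sigma>, nval (NV ''e'') \<sigma>)] else []"
  have "apps ?c {} (ctime ?c) ?g" by (rule apps_if) (use ab in auto)
  from apps_For[OF this, of "''e''" "''M''" M]
  have 1: "apps (dist_list a b) {(''e'', 0)} (9 + M * (ctime ?c + 12)) (\<lambda>\<sigma>. concat (map (\<lambda>k. ?g (nwrite ''e'' 0 k \<sigma>)) [0..<M]))"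
    unfolding dist_list_def using e by (auto simp: tcells_def env_def)
  have 2: "runs (dist_list a b) \<sigma> (9 + M * (ctime ?c + 12)) (\<lambda>\<tau>. tlist \<tau> = tlist \<sigma> @ concat (map (\<lambda>k. ?g (nwrite ''e'' 0 k \<sigma>)) [0..<M]) \<and> same ({(''e'', 0)} \<union> tcells) \<sigma> \<tau>)"
    using 1 unfolding apps_def by simp
  have "concat (map (\<lambda>k. ?g (nwrite ''e'' 0 k \<sigma>)) [0..<M]) = concat (map (\<lambda>e. [(p e, q e, wt e, e)]) [0..<M])"
    by (intro arg_cong[of _ _ concat] map_cong refl) (use e ab in \<open>auto simp: env_def\<close>)
  then have 3: "tlist \<sigma> @ concat (map (\<lambda>k. ?g (nwrite ''e'' 0 k \<sigma>)) [0..<M]) = arclist p q"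
    using tk by (simp add: tlist_def arclist_def concat_map_singleton)
  show ?thesis
  proof (rule runs_weaken[OF 2])
    show "9 + M * (ctime ?c + 12) \<le> M * 100" using NM by (simp add: app_def)
    fix \<tau> assume "tlist \<tau> = tlist \<sigma> @ concat (map (\<lambda>k. ?g (nwrite ''e'' 0 k \<sigma>)) [0..<M]) \<and> same ({(''e'', 0)} \<union> tcells) \<sigma> \<tau>"
    then show "keeps {} \<sigma> \<tau> \<and> tlist \<tau> = arclist p q" using 3 by (auto elim!: keeps_same simp: tcells_def)
  qed
qed

lemma runs_dist_copy:
  assumes h: "hf = ''hf'' \<and> h = ''h'' \<or> hf = ''gf'' \<and> h = ''g''" and N: "nmem \<sigma> ''N'' 0 = N" and L: "rep \<sigma> (nmem \<sigma> ''bb'' 0) N L"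
  shows "runs (dist_copy hf h) \<sigma> (N * 100) (\<lambda>\<tau>. keeps {hf, h} \<sigma> \<tau> \<and> repd \<tau> hf h L)"
proof -
  define b where "b = nmem \<sigma> ''bb'' 0"
  let ?c = "Seq (NWrite hf (NV ''v'') (NRead ''bf'' (NAdd (NV ''bb'') (NV ''v'')))) (RWrite h (NV ''v'') (RRead ''bv'' (NAdd (NV ''bb'') (NV ''v''))))"
  let ?I = "\<lambda>k \<tau>. keeps {hf, h} \<sigma> \<tau> \<and> nmem \<tau> ''bb'' 0 = b \<and> nmem \<tau> ''bf'' = nmem \<sigma> ''bf'' \<and> rmem \<tau> ''bv'' = rmem \<sigma> ''bv'' \<and>
    (\<forall>v<k. nmem \<tau> hf v = nmem \<sigma> ''bf'' (b + v) \<and> rmem \<tau> h v = rmem \<sigma> ''bv'' (b + v))"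
  have 1: "runs (dist_copy hf h) \<sigma> (9 + N * (30 + 12)) (\<lambda>\<tau>. ?I N \<tau> \<and> nmem \<tau> ''v'' 0 = N \<and> nmem \<tau> ''N'' 0 = N)"
    unfolding dist_copy_def
  proof (rule runs_For[where I = ?I])
    show "?I 0 (nwrite ''v'' 0 0 \<sigma>)" by (auto intro!: keeps_nwrite simp: b_def)
    fix k \<sigma>' assume k: "k < N" "?I k \<sigma>'" "nmem \<sigma>' ''v'' 0 = k" "nmem \<sigma>' ''N'' 0 = N"
    show "runs ?c \<sigma>' 30 (\<lambda>\<tau>. nmem \<tau> ''v'' 0 = k \<and> nmem \<tau> ''N'' 0 = N \<and> ?I (Suc k) (nwrite ''v'' 0 (Suc k) \<tau>))"
    proof (rule runs_straightI)
      have hs: "hf \<notin> {''v'', ''N'', ''bb'', ''bf'', ''bv''}" "h \<notin> {''v'', ''N'', ''bb'', ''bf'', ''bv''}" "h \<in> rnames"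
        "''v'' \<noteq> hf" "''N'' \<noteq> hf" "''bb'' \<noteq> hf" "''bf'' \<noteq> hf" "''v'' \<noteq> h" "''bv'' \<noteq> h" using h by auto
      have d: "den ?c \<sigma>' = rwrite h k (rmem \<sigma> ''bv'' (b + k)) (nwrite hf k (nmem \<sigma> ''bf'' (b + k)) \<sigma>')" using k hs by simp
      show "nmem (den ?c \<sigma>') ''v'' 0 = k \<and> nmem (den ?c \<sigma>') ''N'' 0 = N \<and> ?I (Suc k) (nwrite ''v'' 0 (Suc k) (den ?c \<sigma>'))"
      proof (intro conjI)
        show "keeps {hf, h} \<sigma> (nwrite ''v'' 0 (Suc k) (den ?c \<sigma>'))"
          unfolding d by (intro keeps_nwrite keeps_rwrite) (use k hs in auto)
      qed (unfold d, use k hs in \<open>auto simp: less_Suc_eq\<close>)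
    qed simp_all
  qed (use N in auto)
  show ?thesis
  proof (rule runs_weaken[OF 1])
    show "9 + N * (30 + 12) \<le> N * 100" using NM by simp
    fix \<tau> assume t: "?I N \<tau> \<and> nmem \<tau> ''v'' 0 = N \<and> nmem \<tau> ''N'' 0 = N"
    have "repd \<tau> hf h L" unfolding repd_def
    proof (intro allI impI)
      fix v assume "v < N"
      then show "case L v of None \<Rightarrow> nmem \<tau> hf v = 0 | Some (c, p) \<Rightarrow> nmem \<tau> hf v = 1 \<and> rmem \<tau> h v = c"
        using L t unfolding rep_def b_def[symmetric] by (auto split: option.splits)
    qed
    then show "keeps {hf, h} \<sigma> \<tau> \<and> repd \<tau> hf h L" using t by simp
  qed
qed

lemma runs_dist_prog:
  assumes e: "env \<sigma>" and ab: "a = ''src'' \<and> p = src \<and> b = ''dst'' \<and> q = dst \<or> a = ''dst'' \<and> p = dst \<and> b = ''src'' \<and> q = src"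
    and h: "hf = ''hf'' \<and> h = ''h'' \<or> hf = ''gf'' \<and> h = ''g''" and z: "z = ''S'' \<and> zz = S \<or> z = ''T'' \<and> zz = T"
  shows "runs (dist_prog a b z hf h) \<sigma> (1000 * (N + 1) * (N + M + 1)) (\<lambda>\<tau>. keeps {hf, h} \<sigma> \<tau> \<and> repd \<tau> hf h (lay (arclist p q) zz N))"
proof -
  have 1: "runs (NSet ''tk'' (NConst 0)) \<sigma> 3 (\<lambda>\<tau>. keeps {} \<sigma> \<tau> \<and> nmem \<tau> ''tk'' 0 = 0)"
    by (rule runs_straightI) (auto intro!: keeps_nwrite)
  have 2: "runs (dist_list a b) \<tau> (M * 100) (\<lambda>\<rho>. keeps {} \<sigma> \<rho> \<and> tlist \<rho> = arclist p q)"
    if t: "keeps {} \<sigma> \<tau> \<and> nmem \<tau> ''tk'' 0 = 0" for \<tau>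
    by (rule runs_weaken[OF runs_dist_list[OF _ ab]]) (use t env_keeps[OF e, of "{}" \<tau>] keeps_trans in auto)
  let ?c = "Seq (NSet ''nn'' (NV ''N'')) (Seq (NSet ''z'' (NV z)) (NSet ''rr'' (NV ''N'')))"
  have 3: "runs ?c \<tau> 12 (\<lambda>\<rho>. keeps {} \<sigma> \<rho> \<and> tlist \<rho> = arclist p q \<and> nmem \<rho> ''nn'' 0 = N \<and> nmem \<rho> ''z'' 0 = zz \<and> nmem \<rho> ''rr'' 0 = N)"
    if t: "keeps {} \<sigma> \<tau> \<and> tlist \<tau> = arclist p q" for \<tau>
  proof (rule runs_straightI)
    have "env \<tau>" using env_keeps[OF e, of "{}" \<tau>] t by simp
    then show "keeps {} \<sigma> (den ?c \<tau>) \<and> tlist (den ?c \<tau>) = arclist p q \<and> nmem (den ?c \<tau>) ''nn'' 0 = N \<and> nmem (den ?c \<tau>) ''z'' 0 = zz \<and> nmem (den ?c \<tau>) ''rr'' 0 = N"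
      using t z by (auto intro!: keeps_nwrite simp: env_def tlist_def)
  qed auto
  let ?L = "lay (arclist p q) zz N"
  have len: "length (arclist p q) = M" by (simp add: arclist_def)
  have 4: "runs bellman \<tau> (400 * (N + 1) * (N + M + 1)) (\<lambda>\<rho>. keeps {} \<sigma> \<rho> \<and> rep \<rho> (nmem \<rho> ''bb'' 0) N ?L)"
    if t: "keeps {} \<sigma> \<tau> \<and> tlist \<tau> = arclist p q \<and> nmem \<tau> ''nn'' 0 = N \<and> nmem \<tau> ''z'' 0 = zz \<and> nmem \<tau> ''rr'' 0 = N" for \<tau>
  proof -
    have lt: "f < N \<and> u < N" if "(f, u, c, l) \<in> set (arclist p q)" for f u c l
      using that ab ends_lt by (auto simp: arclist_def)
    have zl: "zz < N" using z ST by auto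
    have "runs bellman \<tau> (400 * (N + 1) * (N + length (arclist p q) + 1)) (\<lambda>\<rho>. same bfcells \<tau> \<rho> \<and> nmem \<rho> ''bb'' 0 = N * N \<and>
       (\<forall>r\<le>N. rep \<rho> (r * N) N (lay (arclist p q) zz r)))"
      using runs_bellman[of \<tau> N zz N "arclist p q"] t zl lt by blast
    then show ?thesis unfolding len using t by (auto elim!: runs_weaken intro: keeps_trans keeps_bfcells)
  qed
  have 5: "runs (dist_copy hf h) \<tau> (N * 100) (\<lambda>\<rho>. keeps {hf, h} \<sigma> \<rho> \<and> repd \<rho> hf h ?L)"
    if t: "keeps {} \<sigma> \<tau> \<and> rep \<tau> (nmem \<tau> ''bb'' 0) N ?L" for \<tau>
  proof -
    have "nmem \<tau> ''N'' 0 = N" using env_keeps[OF e, of "{}" \<tau>] t by (auto simp: env_def)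
    from runs_dist_copy[OF h this, of ?L] t show ?thesis
      by (auto elim!: runs_weaken intro: keeps_trans keeps_mono[of "{}"])
  qed
  have "runs (dist_prog a b z hf h) \<sigma> (3 + (M * 100 + (12 + (400 * (N + 1) * (N + M + 1) + N * 100)))) (\<lambda>\<tau>. keeps {hf, h} \<sigma> \<tau> \<and> repd \<tau> hf h ?L)"
    unfolding dist_prog_def by (rule runs_Seq[OF 1], rule runs_Seq[OF 2], assumption, rule runs_Seq[OF 3], assumption, rule runs_Seq[OF 4], assumption, erule 5)
  then show ?thesis by (rule runs_weaken) (auto simp: algebra_simps)
qed

end

section \<open>Tight arcs and address tables\<close>

abbreviation nrd :: "mem_name \<Rightarrow> mem_name \<Rightarrow> nexp" where "nrd x y \<equiv> NRead x (NV y)"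

definition isd :: "nexp \<Rightarrow> bexp" where "isd e = NLess (NConst 0) (NRead ''dE'' e)"
definition nrc :: "nexp \<Rightarrow> nexp \<Rightarrow> bexp" where "nrc u v = BNot (NLess (NConst 0) (NRead ''rc'' (NAdd (NRead ''offX'' u) v)))"
definition BEq :: "nexp \<Rightarrow> nexp \<Rightarrow> bexp" where "BEq a b = BAnd (BNot (NLess a b)) (BNot (NLess b a))"
definition BTrue :: bexp where "BTrue = NLess (NConst 0) (NConst 1)"

text \<open>Reals can only be compared by \<open><\<close>, so equality is expressed by two negated
  comparisons. The flags come first because a distance is meaningful only where its flag is
  set.\<close>

definition dE_prog :: com where
  "dE_prog = For ''e'' ''M'' (Cond
     (BAnd (NLess (NConst 0) (NRead ''hf'' (nrd ''src'' ''e''))) (BAnd (NLess (NConst 0) (NRead ''gf'' (nrd ''dst'' ''e'')))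
       (BAnd (NLess (NConst 0) (nrd ''hf'' ''T''))
       (BAnd (BNot (RLess (RAdd (RAdd (RRead ''h'' (nrd ''src'' ''e'')) (RRead ''wt'' (NV ''e''))) (RRead ''g'' (nrd ''dst'' ''e''))) (RRead ''h'' (NV ''T''))))
         (BNot (RLess (RRead ''h'' (NV ''T'')) (RAdd (RAdd (RRead ''h'' (nrd ''src'' ''e'')) (RRead ''wt'' (NV ''e''))) (RRead ''g'' (nrd ''dst'' ''e'')))))))))
     (NWrite ''dE'' (NV ''e'') (NConst 1)) (NWrite ''dE'' (NV ''e'') (NConst 0)))"

definition tables_prog :: com where
  "tables_prog = Seq (NSet ''N1'' (NAdd (NV ''N'') (NConst 1))) (Seq (table ''offX'' ''N1'' ''N'')
     (Seq (NSet ''sA'' (nrd ''offX'' ''N1'')) (Seq (table ''offA'' ''N1'' ''sA'')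
     (Seq (NSet ''sJ'' (nrd ''offA'' ''N1'')) (Seq (table ''offJ'' ''M'' ''sJ'')
     (Seq (NSet ''sI'' (nrd ''offJ'' ''M'')) (Seq (table ''offI'' ''M'' ''sI'') (NSet ''TOT'' (nrd ''offI'' ''M'')))))))))"

context machine begin

definition tight :: "state \<Rightarrow> nat \<Rightarrow> bool" where
  "tight \<sigma> e \<longleftrightarrow> 0 < nmem \<sigma> ''hf'' (src e) \<and> 0 < nmem \<sigma> ''gf'' (dst e) \<and> 0 < nmem \<sigma> ''hf'' T \<and>
     rmem \<sigma> ''h'' (src e) + wt e + rmem \<sigma> ''g'' (dst e) = rmem \<sigma> ''h'' T"

lemma runs_dE_prog:
  assumes e: "env \<sigma>"
  shows "runs dE_prog \<sigma> (M * 200) (\<lambda>\<tau>. keeps {''dE''} \<sigma> \<tau> \<and> (\<forall>e<M. nmem \<tau> ''dE'' e = (if tight \<sigma> e then 1 else 0)))"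
proof -
  let ?I = "\<lambda>k \<tau>. keeps {''dE''} \<sigma> \<tau> \<and> (\<forall>e<k. nmem \<tau> ''dE'' e = (if tight \<sigma> e then 1 else 0))"
  have 1: "runs dE_prog \<sigma> (9 + M * (90 + 12)) (\<lambda>\<tau>. ?I M \<tau> \<and> nmem \<tau> ''e'' 0 = M \<and> nmem \<tau> ''M'' 0 = M)"
    unfolding dE_prog_def
  proof (rule runs_For[where I = ?I])
    show "?I 0 (nwrite ''e'' 0 0 \<sigma>)" by (auto intro!: keeps_nwrite)
    fix k \<sigma>' assume k: "k < M" "?I k \<sigma>'" "nmem \<sigma>' ''e'' 0 = k" "nmem \<sigma>' ''M'' 0 = M"
    have ks: "keeps {''dE''} \<sigma> \<sigma>'" using k by simp
    have mem: "nmem \<sigma>' ''src'' k = src k" "nmem \<sigma>' ''dst'' k = dst k" "rmem \<sigma>' ''wt'' k = wt k" "nmem \<sigma>' ''T'' 0 = T"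
        "nmem \<sigma>' ''hf'' = nmem \<sigma> ''hf''" "nmem \<sigma>' ''gf'' = nmem \<sigma> ''gf''" "rmem \<sigma>' ''h'' = rmem \<sigma> ''h''" "rmem \<sigma>' ''g'' = rmem \<sigma> ''g''"
      using env_keeps[OF e ks] k(1) keepsN[OF ks, of "''hf''"] keepsN[OF ks, of "''gf''"] keepsR[OF ks, of "''h''"] keepsR[OF ks, of "''g''"]
      by (auto simp: env_def)
    show "runs (Cond
     (BAnd (NLess (NConst 0) (NRead ''hf'' (nrd ''src'' ''e''))) (BAnd (NLess (NConst 0) (NRead ''gf'' (nrd ''dst'' ''e'')))
       (BAnd (NLess (NConst 0) (nrd ''hf'' ''T''))
       (BAnd (BNot (RLess (RAdd (RAdd (RRead ''h'' (nrd ''src'' ''e'')) (RRead ''wt'' (NV ''e''))) (RRead ''g'' (nrd ''dst'' ''e''))) (RRead ''h'' (NV ''T''))))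
         (BNot (RLess (RRead ''h'' (NV ''T'')) (RAdd (RAdd (RRead ''h'' (nrd ''src'' ''e'')) (RRead ''wt'' (NV ''e''))) (RRead ''g'' (nrd ''dst'' ''e'')))))))))
     (NWrite ''dE'' (NV ''e'') (NConst 1)) (NWrite ''dE'' (NV ''e'') (NConst 0))) \<sigma>' 90
        (\<lambda>\<tau>. nmem \<tau> ''e'' 0 = k \<and> nmem \<tau> ''M'' 0 = M \<and> ?I (Suc k) (nwrite ''e'' 0 (Suc k) \<tau>))" (is "runs ?c _ _ ?Q")
    proof (rule runs_straightI)
      have d: "den ?c \<sigma>' = nwrite ''dE'' k (if tight \<sigma> k then 1 else 0) \<sigma>'"
        using k(3) mem by (auto simp: tight_def)
      show "?Q (den ?c \<sigma>')" unfolding d using k by (auto intro!: keeps_nwrite simp: less_Suc_eq)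
    qed simp_all
  qed (use e in \<open>auto simp: env_def\<close>)
  show ?thesis by (rule runs_weaken[OF 1]) (use NM in auto)
qed

end

context coding begin

definition tabs :: "state \<Rightarrow> bool" where
  "tabs \<sigma> \<longleftrightarrow> (\<forall>v\<le>N. nmem \<sigma> ''offX'' v = v * N) \<and> (\<forall>v\<le>N. nmem \<sigma> ''offA'' v = v * SA) \<and>
     (\<forall>v<M. nmem \<sigma> ''offJ'' v = v * SJ) \<and> (\<forall>v<M. nmem \<sigma> ''offI'' v = v * SI) \<and> nmem \<sigma> ''TOT'' 0 = TOT"

abbreviation tabnames :: "mem_name set" where
  "tabnames \<equiv> {''N1'', ''offX'', ''sA'', ''offA'', ''sJ'', ''offJ'', ''sI'', ''offI'', ''TOT''}"

lemma tabs_keeps: "tabs \<sigma> \<Longrightarrow> keeps A \<sigma> \<tau> \<Longrightarrow> A \<inter> {''offX'', ''offA'', ''offJ'', ''offI'', ''TOT''} = {} \<Longrightarrow> tabs \<tau>"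
  using keepsN[of A \<sigma> \<tau> "''offX''"] keepsN[of A \<sigma> \<tau> "''offA''"] keepsN[of A \<sigma> \<tau> "''offJ''"] keepsN[of A \<sigma> \<tau> "''offI''"]
    keepsN[of A \<sigma> \<tau> "''TOT''"] unfolding tabs_def by auto

lemma runs_tables_prog:
  assumes "nmem \<sigma> ''N'' 0 = N" "nmem \<sigma> ''M'' 0 = M"
  shows "runs tables_prog \<sigma> (300 * (N + M + 1)) (\<lambda>\<tau>. keeps tabnames \<sigma> \<tau> \<and> tabs \<tau>)"
proof -
  let ?K = "keeps tabnames \<sigma>"
  have kN: "nmem \<tau> ''N'' 0 = N \<and> nmem \<tau> ''M'' 0 = M" if "?K \<tau>" for \<tau>
    using keepsN[OF that, of "''N''"] keepsN[OF that, of "''M''"] assms by auto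
  have tab: "runs (table x y d) \<tau> (20 + B * 40) (\<lambda>\<rho>. ?K \<rho> \<and> (\<forall>v\<le>B. nmem \<rho> x v = v * D) \<and> keeps {x} \<tau> \<rho>)"
    if "?K \<tau>" "x \<in> tabnames" "x \<notin> {y, d, ''v''}" "y \<noteq> ''v''" "d \<noteq> ''v''" "nmem \<tau> y 0 = B" "nmem \<tau> d 0 = D" for \<tau> x y d B D
    by (rule runs_weaken[OF runs_table[OF that(3-7)]])
      (use that(1,2) in \<open>auto intro: keeps_trans elim!: keeps_mono\<close>)
  have 1: "runs (NSet ''N1'' (NAdd (NV ''N'') (NConst 1))) \<sigma> 10 (\<lambda>\<tau>. ?K \<tau> \<and> nmem \<tau> ''N1'' 0 = Suc N)"
    by (rule runs_straightI) (use assms in \<open>auto intro!: keeps_nwrite\<close>)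
  let ?X = "\<lambda>\<tau>. \<forall>v\<le>Suc N. nmem \<tau> ''offX'' v = v * N"
  let ?A = "\<lambda>\<tau>. \<forall>v\<le>Suc N. nmem \<tau> ''offA'' v = v * SA"
  let ?J = "\<lambda>\<tau>. \<forall>v\<le>M. nmem \<tau> ''offJ'' v = v * SJ"
  let ?II = "\<lambda>\<tau>. \<forall>v\<le>M. nmem \<tau> ''offI'' v = v * SI"
  have 2: "runs (table ''offX'' ''N1'' ''N'') \<tau> (20 + Suc N * 40) (\<lambda>\<tau>. ?K \<tau> \<and> nmem \<tau> ''N1'' 0 = Suc N \<and> ?X \<tau>)"
    if t: "?K \<tau> \<and> nmem \<tau> ''N1'' 0 = Suc N" for \<tau>
  proof (rule runs_weaken[OF tab[of \<tau> "''offX''" "''N1''" "''N''" "Suc N" N]])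
    fix \<rho> assume r: "?K \<rho> \<and> ?X \<rho> \<and> keeps {''offX''} \<tau> \<rho>"
    then show "?K \<rho> \<and> nmem \<rho> ''N1'' 0 = Suc N \<and> ?X \<rho>" using t keepsN[of "{''offX''}" \<tau> \<rho> "''N1''"] by auto
  qed (use t kN in auto)
  have 3: "runs (NSet ''sA'' (nrd ''offX'' ''N1'')) \<tau> 10 (\<lambda>\<tau>. ?K \<tau> \<and> nmem \<tau> ''N1'' 0 = Suc N \<and> ?X \<tau> \<and> nmem \<tau> ''sA'' 0 = SA)"
    if t: "?K \<tau> \<and> nmem \<tau> ''N1'' 0 = Suc N \<and> ?X \<tau>" for \<tau>
    by (rule runs_straightI) (use t in \<open>auto intro!: keeps_nwrite simp: SA_def\<close>)
  have 4: "runs (table ''offA'' ''N1'' ''sA'') \<tau> (20 + Suc N * 40) (\<lambda>\<tau>. ?K \<tau> \<and> nmem \<tau> ''N1'' 0 = Suc N \<and> ?X \<tau> \<and> ?A \<tau>)"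
    if t: "?K \<tau> \<and> nmem \<tau> ''N1'' 0 = Suc N \<and> ?X \<tau> \<and> nmem \<tau> ''sA'' 0 = SA" for \<tau>
  proof (rule runs_weaken[OF tab[of \<tau> "''offA''" "''N1''" "''sA''" "Suc N" SA]])
    fix \<rho> assume r: "?K \<rho> \<and> ?A \<rho> \<and> keeps {''offA''} \<tau> \<rho>"
    then show "?K \<rho> \<and> nmem \<rho> ''N1'' 0 = Suc N \<and> ?X \<rho> \<and> ?A \<rho>"
      using t keepsN[of "{''offA''}" \<tau> \<rho> "''N1''"] keepsN[of "{''offA''}" \<tau> \<rho> "''offX''"] by auto
  qed (use t kN in auto)
  have 5: "runs (NSet ''sJ'' (nrd ''offA'' ''N1'')) \<tau> 10 (\<lambda>\<tau>. ?K \<tau> \<and> ?X \<tau> \<and> ?A \<tau> \<and> nmem \<tau> ''sJ'' 0 = SJ)"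
    if t: "?K \<tau> \<and> nmem \<tau> ''N1'' 0 = Suc N \<and> ?X \<tau> \<and> ?A \<tau>" for \<tau>
    by (rule runs_straightI) (use t in \<open>auto intro!: keeps_nwrite simp: SJ_def\<close>)
  have 6: "runs (table ''offJ'' ''M'' ''sJ'') \<tau> (20 + M * 40) (\<lambda>\<tau>. ?K \<tau> \<and> ?X \<tau> \<and> ?A \<tau> \<and> ?J \<tau>)"
    if t: "?K \<tau> \<and> ?X \<tau> \<and> ?A \<tau> \<and> nmem \<tau> ''sJ'' 0 = SJ" for \<tau>
  proof (rule runs_weaken[OF tab[of \<tau> "''offJ''" "''M''" "''sJ''" M SJ]])
    fix \<rho> assume r: "?K \<rho> \<and> ?J \<rho> \<and> keeps {''offJ''} \<tau> \<rho>"
    then show "?K \<rho> \<and> ?X \<rho> \<and> ?A \<rho> \<and> ?J \<rho>"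
      using t keepsN[of "{''offJ''}" \<tau> \<rho> "''offA''"] keepsN[of "{''offJ''}" \<tau> \<rho> "''offX''"] by auto
  qed (use t kN in auto)
  have 7: "runs (NSet ''sI'' (nrd ''offJ'' ''M'')) \<tau> 10 (\<lambda>\<tau>. ?K \<tau> \<and> ?X \<tau> \<and> ?A \<tau> \<and> ?J \<tau> \<and> nmem \<tau> ''sI'' 0 = SI)"
    if t: "?K \<tau> \<and> ?X \<tau> \<and> ?A \<tau> \<and> ?J \<tau>" for \<tau>
    by (rule runs_straightI) (use t kN[of \<tau>] in \<open>auto intro!: keeps_nwrite simp: SI_def\<close>)
  have 8: "runs (table ''offI'' ''M'' ''sI'') \<tau> (20 + M * 40) (\<lambda>\<tau>. ?K \<tau> \<and> ?X \<tau> \<and> ?A \<tau> \<and> ?J \<tau> \<and> ?II \<tau>)"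
    if t: "?K \<tau> \<and> ?X \<tau> \<and> ?A \<tau> \<and> ?J \<tau> \<and> nmem \<tau> ''sI'' 0 = SI" for \<tau>
  proof (rule runs_weaken[OF tab[of \<tau> "''offI''" "''M''" "''sI''" M SI]])
    fix \<rho> assume r: "?K \<rho> \<and> ?II \<rho> \<and> keeps {''offI''} \<tau> \<rho>"
    then show "?K \<rho> \<and> ?X \<rho> \<and> ?A \<rho> \<and> ?J \<rho> \<and> ?II \<rho>"
      using t keepsN[of "{''offI''}" \<tau> \<rho> "''offA''"] keepsN[of "{''offI''}" \<tau> \<rho> "''offX''"] keepsN[of "{''offI''}" \<tau> \<rho> "''offJ''"] by auto
  qed (use t kN in auto)
  have 9: "runs (NSet ''TOT'' (nrd ''offI'' ''M'')) \<tau> 10 (\<lambda>\<tau>. keeps tabnames \<sigma> \<tau> \<and> tabs \<tau>)"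
    if t: "?K \<tau> \<and> ?X \<tau> \<and> ?A \<tau> \<and> ?J \<tau> \<and> ?II \<tau>" for \<tau>
    by (rule runs_straightI) (use t kN[of \<tau>] in \<open>auto intro!: keeps_nwrite simp: TOT_def tabs_def\<close>)
  have "runs tables_prog \<sigma> (10 + ((20 + Suc N * 40) + (10 + ((20 + Suc N * 40) + (10 + ((20 + M * 40) + (10 + ((20 + M * 40) + 10)))))))) (\<lambda>\<tau>. keeps tabnames \<sigma> \<tau> \<and> tabs \<tau>)"
    unfolding tables_prog_def
    by (rule runs_Seq[OF 1], rule runs_Seq[OF 2], assumption, rule runs_Seq[OF 3], assumption, rule runs_Seq[OF 4], assumption,
        rule runs_Seq[OF 5], assumption, rule runs_Seq[OF 6], assumption, rule runs_Seq[OF 7], assumption, rule runs_Seq[OF 8], assumption, erule 9)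
  then show ?thesis by (rule runs_weaken) auto
qed

end


lemma (in frame) apps_cond:
  assumes "(bvars b \<union> nvars f \<union> nvars t \<union> rvars c \<union> nvars l) \<inter> (tnames \<union> fst ` W) = {}" "tcells \<subseteq> X" "W \<subseteq> X"
  shows "apps (Cond b (app f t c l) Skip) W (ctime (Cond b (app f t c l) Skip))
    (\<lambda>\<sigma>. if bval b \<sigma> then [(nval f \<sigma>, nval t \<sigma>, rval c \<sigma>, nval l \<sigma>)] else [])"
proof (rule apps_widen[OF apps_if])
  fix \<sigma> \<tau> assume a: "same (W \<union> tcells) \<sigma> \<tau>"
  have i: "fst ` (W \<union> tcells) = tnames \<union> fst ` W" by (force simp: tcells_def)
  have "bval b \<tau> = bval b \<sigma>" by (rule bval_same[OF a]) (use assms i in auto)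
  moreover have "nval f \<tau> = nval f \<sigma>" by (rule nval_same[OF a]) (use assms i in auto)
  moreover have "nval t \<tau> = nval t \<sigma>" by (rule nval_same[OF a]) (use assms i in auto)
  moreover have "rval c \<tau> = rval c \<sigma>" by (rule rval_same[OF a]) (use assms i in auto)
  moreover have "nval l \<tau> = nval l \<sigma>" by (rule nval_same[OF a]) (use assms i in auto)
  ultimately show "(if bval b \<tau> then [(nval f \<tau>, nval t \<tau>, rval c \<tau>, nval l \<tau>)] else []) =
    (if bval b \<sigma> then [(nval f \<sigma>, nval t \<sigma>, rval c \<sigma>, nval l \<sigma>)] else [])" by simp
qed (use assms in auto)

lemma (in frame) apps_length: "apps c W T g \<Longrightarrow> length (g \<sigma>) \<le> T" by (simp add: apps_def)

lemma (in frame) apps_runs: "apps c W T g \<Longrightarrow> runs c \<sigma>0 T (\<lambda>\<tau>. tlist \<tau> = tlist \<sigma>0 @ g \<sigma>0 \<and> same (W \<union> tcells) \<sigma>0 \<tau>)"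
  by (simp add: apps_def)

text \<open>One shortest path computation with zero weights answers all reachability questions:
  \<open>a * N + v\<close> stands for \<open>v\<close> as seen from \<open>a\<close>, and an extra
  vertex \<open>N * N\<close> has an arc to each \<open>a * N + a\<close>.\<close>

definition reach_list :: com where
  "reach_list = Seq (For ''a'' ''N'' (Cond BTrue (app (nrd ''offX'' ''N'') (NAdd (nrd ''offX'' ''a'') (NV ''a'')) RZero (NV ''M'')) Skip))
     (For ''a'' ''N'' (For ''e'' ''M'' (Cond (isd (NV ''e''))
        (app (NAdd (nrd ''offX'' ''a'') (nrd ''src'' ''e'')) (NAdd (nrd ''offX'' ''a'') (nrd ''dst'' ''e'')) RZero (NV ''M'')) Skip)))"

definition reach_copy :: com where
  "reach_copy = For ''v'' ''nn'' (NWrite ''rc'' (NV ''v'') (NRead ''bf'' (NAdd (NV ''bb'') (NV ''v''))))"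

definition reach_prog :: com where
  "reach_prog = Seq (NSet ''tk'' (NConst 0)) (Seq reach_list
     (Seq (Seq (NSet ''nn'' (NAdd (nrd ''offX'' ''N'') (NConst 1))) (Seq (NSet ''z'' (nrd ''offX'' ''N'')) (NSet ''rr'' (NAdd (NV ''N'') (NConst 1)))))
       (Seq bellman reach_copy)))"

locale pebbles = machine N M S T src dst wt + game N M src dst wt dE rc hh gg
  for N M S T src dst wt dE rc hh gg
begin

definition penv :: "state \<Rightarrow> bool" where
  "penv \<sigma> \<longleftrightarrow> env \<sigma> \<and> tabs \<sigma> \<and> (\<forall>e<M. nmem \<sigma> ''dE'' e = (if dE e then 1 else 0)) \<and>
     (\<forall>v<N. rmem \<sigma> ''h'' v = hh v \<and> rmem \<sigma> ''g'' v = gg v)"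

abbreviation pnames :: "mem_name set" where
  "pnames \<equiv> {''N'', ''M'', ''S'', ''T'', ''src'', ''dst'', ''wt'', ''offX'', ''offA'', ''offJ'', ''offI'', ''TOT'', ''dE'', ''h'', ''g''}"

lemma penv_keeps: assumes "penv \<sigma>" "keeps A \<sigma> \<tau>" "A \<inter> pnames = {}" shows "penv \<tau>"
proof -
  have "env \<tau>" "tabs \<tau>" using env_keeps[of \<sigma> A \<tau>] tabs_keeps[of \<sigma> A \<tau>] assms unfolding penv_def by auto
  moreover have "nmem \<tau> ''dE'' = nmem \<sigma> ''dE''" "rmem \<tau> ''h'' = rmem \<sigma> ''h''" "rmem \<tau> ''g'' = rmem \<sigma> ''g''"
    using keepsN[OF assms(2), of "''dE''"] keepsR[OF assms(2), of "''h''"] keepsR[OF assms(2), of "''g''"] assms(3) by auto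
  ultimately show ?thesis using assms(1) unfolding penv_def by simp
qed

definition rlist :: "trans list" where
  "rlist = concat (map (\<lambda>a. [(N * N, a * N + a, 0, M)]) [0..<N]) @
     concat (map (\<lambda>a. concat (map (\<lambda>e. if dE e then [(a * N + src e, a * N + dst e, 0, M)] else []) [0..<M])) [0..<N])"

lemma runs_reach_list:
  assumes p: "penv \<sigma>" and tk: "nmem \<sigma> ''tk'' 0 = 0"
  shows "runs reach_list \<sigma> (400 * (N * M)) (\<lambda>\<tau>. keeps {} \<sigma> \<tau> \<and> tlist \<tau> = rlist)" "length rlist \<le> 400 * (N * M)"
proof -
  interpret frame \<sigma> "{(''e'', 0), (''a'', 0)} \<union> tcells" .
  have NMv: "nmem \<sigma> ''N'' 0 = N" "nmem \<sigma> ''M'' 0 = M" using p by (auto simp: penv_def env_def)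
  let ?f = "nrd ''offX'' ''N''" let ?t = "NAdd (nrd ''offX'' ''a'') (NV ''a'')"
  let ?f' = "NAdd (nrd ''offX'' ''a'') (nrd ''src'' ''e'')" let ?t' = "NAdd (nrd ''offX'' ''a'') (nrd ''dst'' ''e'')"
  let ?c = "Cond BTrue (app ?f ?t RZero (NV ''M'')) Skip"
  let ?c' = "Cond (isd (NV ''e'')) (app ?f' ?t' RZero (NV ''M'')) Skip"
  let ?g = "\<lambda>\<sigma>. if bval BTrue \<sigma> then [(nval ?f \<sigma>, nval ?t \<sigma>, rval RZero \<sigma>, nval (NV ''M'') \<sigma>)] else []"
  let ?g' = "\<lambda>\<sigma>. if bval (isd (NV ''e'')) \<sigma> then [(nval ?f' \<sigma>, nval ?t' \<sigma>, rval RZero \<sigma>, nval (NV ''M'') \<sigma>)] else []"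
  have "apps ?c {(''e'', 0)} (ctime ?c) ?g" by (rule apps_cond) (auto simp: BTrue_def)
  from apps_For[OF this, of "''a''" "''N''" N]
  have 1: "apps (For ''a'' ''N'' ?c) {(''a'', 0), (''e'', 0)} (9 + N * (ctime ?c + 12)) (\<lambda>\<sigma>. concat (map (\<lambda>k. ?g (nwrite ''a'' 0 k \<sigma>)) [0..<N]))"
    using NMv by (auto simp: tcells_def)
  have "apps ?c' {} (ctime ?c') ?g'" by (rule apps_cond) (auto simp: isd_def)
  from apps_For[OF this, of "''e''" "''M''" M]
  have "apps (For ''e'' ''M'' ?c') {(''e'', 0)} (9 + M * (ctime ?c' + 12)) (\<lambda>\<sigma>. concat (map (\<lambda>k. ?g' (nwrite ''e'' 0 k \<sigma>)) [0..<M]))"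
    using NMv by (auto simp: tcells_def)
  from apps_For[OF this, of "''a''" "''N''" N]
  have 2: "apps (For ''a'' ''N'' (For ''e'' ''M'' ?c')) {(''a'', 0), (''e'', 0)} (9 + N * (9 + M * (ctime ?c' + 12) + 12))
      (\<lambda>\<sigma>. concat (map (\<lambda>a. concat (map (\<lambda>k. ?g' (nwrite ''e'' 0 k (nwrite ''a'' 0 a \<sigma>))) [0..<M])) [0..<N]))"
    using NMv by (auto simp: tcells_def)
  let ?G = "\<lambda>\<sigma>. concat (map (\<lambda>k. ?g (nwrite ''a'' 0 k \<sigma>)) [0..<N]) @
      concat (map (\<lambda>a. concat (map (\<lambda>k. ?g' (nwrite ''e'' 0 k (nwrite ''a'' 0 a \<sigma>))) [0..<M])) [0..<N])"
  let ?T = "(9 + N * (ctime ?c + 12)) + (9 + N * (9 + M * (ctime ?c' + 12) + 12))"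
  have 3: "apps reach_list {(''a'', 0), (''e'', 0)} ?T ?G"
    unfolding reach_list_def by (rule apps_Seq[OF 1 2])
  have "?g (nwrite ''a'' 0 k \<sigma>) = [(N * N, k * N + k, 0, M)]" if "k < N" for k
    using p that NMv by (auto simp: penv_def tabs_def BTrue_def)
  moreover have "?g' (nwrite ''e'' 0 k (nwrite ''a'' 0 a \<sigma>)) = (if dE k then [(a * N + src k, a * N + dst k, 0, M)] else [])"
    if "k < M" "a < N" for k a using p that NMv by (auto simp: penv_def tabs_def isd_def env_def)
  ultimately have G: "?G \<sigma> = rlist"
    unfolding rlist_def by (intro arg_cong2[of _ _ _ _ "(@)"] arg_cong[of _ _ concat] map_cong refl) auto
  have f: "N \<le> N * M" "1 \<le> N * M" using NM by auto
  have ar: "9 + N * (A + 12) + (9 + N * (9 + M * (B + 12) + 12)) \<le> (A + B + 100) * (N * M)" for A B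
  proof -
    have "9 + N * (A + 12) + (9 + N * (9 + M * (B + 12) + 12)) = 18 + A * N + 33 * N + (B + 12) * (N * M)" by (simp add: algebra_simps)
    also have "\<dots> \<le> 18 * (N * M) + A * (N * M) + 33 * (N * M) + (B + 12) * (N * M)"
      by (intro add_mono mult_le_mono2 f order_refl) (use f in auto)
    also have "\<dots> \<le> (A + B + 100) * (N * M)" by (simp add: algebra_simps)
    finally show ?thesis .
  qed
  have "ctime ?c + ctime ?c' + 100 \<le> 400" by (simp add: app_def BTrue_def isd_def)
  then have T: "?T \<le> 400 * (N * M)" using le_trans[OF ar[of "ctime ?c" "ctime ?c'"] mult_le_mono1] by blast
  show "length rlist \<le> 400 * (N * M)" using le_trans[OF apps_length[OF 3, of \<sigma>] T] unfolding G .
  have "runs reach_list \<sigma> ?T (\<lambda>\<tau>. tlist \<tau> = tlist \<sigma> @ ?G \<sigma> \<and> same ({(''a'', 0), (''e'', 0)} \<union> tcells) \<sigma> \<tau>)"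
    by (rule apps_runs[OF 3])
  then show "runs reach_list \<sigma> (400 * (N * M)) (\<lambda>\<tau>. keeps {} \<sigma> \<tau> \<and> tlist \<tau> = rlist)"
  proof (rule runs_weaken[OF _ T])
    fix \<tau> assume "tlist \<tau> = tlist \<sigma> @ ?G \<sigma> \<and> same ({(''a'', 0), (''e'', 0)} \<union> tcells) \<sigma> \<tau>"
    then show "keeps {} \<sigma> \<tau> \<and> tlist \<tau> = rlist" unfolding G using tk by (auto elim!: keeps_same simp: tcells_def tlist_def)
  qed
qed

lemma rlist_lt: "(f, t, c, l) \<in> set rlist \<Longrightarrow> f < N * N + 1 \<and> t < N * N + 1"
proof -
  assume "(f, t, c, l) \<in> set rlist"
  then consider a where "a < N" "f = N * N" "t = a * N + a"
    | a e where "a < N" "e < M" "f = a * N + src e" "t = a * N + dst e" unfolding rlist_def by (auto split: if_splits)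
  then show ?thesis
  proof cases
    case 1
    then show ?thesis using radix_lt[of a N a N] by simp
  next
    case 2
    then show ?thesis using radix_lt[of a N "src e" N] radix_lt[of a N "dst e" N] ends_lt[of e] by simp
  qed
qed

text \<open>One round serves the arc that leaves the extra vertex; the remaining \<open>N\<close>
  cover any path on \<open>N\<close> vertices.\<close>

definition rcf :: "nat \<Rightarrow> nat \<Rightarrow> bool" where "rcf u v \<longleftrightarrow> lay rlist (N * N) (N + 1) (u * N + v) \<noteq> None"

lemma runs_reach_copy:
  assumes n: "nmem \<sigma> ''nn'' 0 = n" and L: "rep \<sigma> (nmem \<sigma> ''bb'' 0) n L"
  shows "runs reach_copy \<sigma> (100 * (n + 1)) (\<lambda>\<tau>. keeps {''rc''} \<sigma> \<tau> \<and> (\<forall>v<n. nmem \<tau> ''rc'' v = (if L v \<noteq> None then 1 else 0)))"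
proof -
  define b where "b = nmem \<sigma> ''bb'' 0"
  let ?c = "NWrite ''rc'' (NV ''v'') (NRead ''bf'' (NAdd (NV ''bb'') (NV ''v'')))"
  let ?I = "\<lambda>k \<tau>. keeps {''rc''} \<sigma> \<tau> \<and> nmem \<tau> ''bb'' 0 = b \<and> nmem \<tau> ''bf'' = nmem \<sigma> ''bf'' \<and>
    (\<forall>v<k. nmem \<tau> ''rc'' v = nmem \<sigma> ''bf'' (b + v))"
  have 1: "runs reach_copy \<sigma> (9 + n * (30 + 12)) (\<lambda>\<tau>. ?I n \<tau> \<and> nmem \<tau> ''v'' 0 = n \<and> nmem \<tau> ''nn'' 0 = n)"
    unfolding reach_copy_def
  proof (rule runs_For[where I = ?I])
    show "?I 0 (nwrite ''v'' 0 0 \<sigma>)" by (auto intro!: keeps_nwrite simp: b_def)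
    fix k \<sigma>' assume k: "k < n" "?I k \<sigma>'" "nmem \<sigma>' ''v'' 0 = k" "nmem \<sigma>' ''nn'' 0 = n"
    show "runs ?c \<sigma>' 30 (\<lambda>\<tau>. nmem \<tau> ''v'' 0 = k \<and> nmem \<tau> ''nn'' 0 = n \<and> ?I (Suc k) (nwrite ''v'' 0 (Suc k) \<tau>))"
      by (rule runs_straightI) (use k in \<open>auto intro!: keeps_nwrite simp: less_Suc_eq\<close>)
  qed (use n in auto)
  show ?thesis
  proof (rule runs_weaken[OF 1])
    fix \<tau> assume t: "?I n \<tau> \<and> nmem \<tau> ''v'' 0 = n \<and> nmem \<tau> ''nn'' 0 = n"
    have "nmem \<tau> ''rc'' v = (if L v \<noteq> None then 1 else 0)" if "v < n" for v
      using L t that unfolding rep_def b_def[symmetric] by (auto split: option.splits)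
    then show "keeps {''rc''} \<sigma> \<tau> \<and> (\<forall>v<n. nmem \<tau> ''rc'' v = (if L v \<noteq> None then 1 else 0))" using t by simp
  qed simp
qed

lemma runs_reach_prog:
  assumes p: "penv \<sigma>"
  shows "runs reach_prog \<sigma> (1000000 * (N * N * N * M)) (\<lambda>\<tau>. keeps {''rc''} \<sigma> \<tau> \<and>
    (\<forall>u<N. \<forall>v<N. nmem \<tau> ''rc'' (u * N + v) = (if rcf u v then 1 else 0)))"
proof -
  have 1: "runs (NSet ''tk'' (NConst 0)) \<sigma> 3 (\<lambda>\<tau>. keeps {} \<sigma> \<tau> \<and> nmem \<tau> ''tk'' 0 = 0)"
    by (rule runs_straightI) (auto intro!: keeps_nwrite)
  have pk: "penv \<tau>" if "keeps {} \<sigma> \<tau>" for \<tau> using penv_keeps[OF p that] by simp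
  have 2: "runs reach_list \<tau> (400 * (N * M)) (\<lambda>\<rho>. keeps {} \<sigma> \<rho> \<and> tlist \<rho> = rlist)"
    if t: "keeps {} \<sigma> \<tau> \<and> nmem \<tau> ''tk'' 0 = 0" for \<tau>
    by (rule runs_weaken[OF runs_reach_list(1)]) (use t pk keeps_trans in auto)
  have len: "length rlist \<le> 400 * (N * M)"
  proof -
    have "penv (nwrite ''tk'' 0 0 \<sigma>)" by (rule pk) (auto intro!: keeps_nwrite)
    then show ?thesis using runs_reach_list(2) by simp
  qed
  let ?c = "Seq (NSet ''nn'' (NAdd (nrd ''offX'' ''N'') (NConst 1))) (Seq (NSet ''z'' (nrd ''offX'' ''N'')) (NSet ''rr'' (NAdd (NV ''N'') (NConst 1))))"
  have 3: "runs ?c \<tau> 30 (\<lambda>\<rho>. keeps {} \<sigma> \<rho> \<and> tlist \<rho> = rlist \<and> nmem \<rho> ''nn'' 0 = N * N + 1 \<and> nmem \<rho> ''z'' 0 = N * N \<and> nmem \<rho> ''rr'' 0 = N + 1)"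
    if t: "keeps {} \<sigma> \<tau> \<and> tlist \<tau> = rlist" for \<tau>
  proof (rule runs_straightI)
    have "penv \<tau>" using pk t by simp
    then show "keeps {} \<sigma> (den ?c \<tau>) \<and> tlist (den ?c \<tau>) = rlist \<and> nmem (den ?c \<tau>) ''nn'' 0 = N * N + 1 \<and> nmem (den ?c \<tau>) ''z'' 0 = N * N \<and> nmem (den ?c \<tau>) ''rr'' 0 = N + 1"
      using t by (auto intro!: keeps_nwrite simp: penv_def env_def tabs_def tlist_def)
  qed auto
  let ?L = "lay rlist (N * N) (N + 1)"
  have 4: "runs bellman \<tau> (400 * (N + 1 + 1) * (N * N + 1 + length rlist + 1)) (\<lambda>\<rho>. keeps {} \<sigma> \<rho> \<and> nmem \<rho> ''nn'' 0 = N * N + 1 \<and> rep \<rho> (nmem \<rho> ''bb'' 0) (N * N + 1) ?L)"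
    if t: "keeps {} \<sigma> \<tau> \<and> tlist \<tau> = rlist \<and> nmem \<tau> ''nn'' 0 = N * N + 1 \<and> nmem \<tau> ''z'' 0 = N * N \<and> nmem \<tau> ''rr'' 0 = N + 1" for \<tau>
  proof -
    have "runs bellman \<tau> (400 * (N + 1 + 1) * (N * N + 1 + length rlist + 1)) (\<lambda>\<rho>. same bfcells \<tau> \<rho> \<and> nmem \<rho> ''bb'' 0 = (N + 1) * (N * N + 1) \<and>
       (\<forall>r\<le>N + 1. rep \<rho> (r * (N * N + 1)) (N * N + 1) (lay rlist (N * N) r)))"
      by (rule runs_bellman) (use t rlist_lt in auto)
    then show ?thesis
    proof (rule runs_weaken)
      fix \<rho> assume r: "same bfcells \<tau> \<rho> \<and> nmem \<rho> ''bb'' 0 = (N + 1) * (N * N + 1) \<and>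
       (\<forall>r\<le>N + 1. rep \<rho> (r * (N * N + 1)) (N * N + 1) (lay rlist (N * N) r))"
      have "nmem \<rho> ''nn'' = nmem \<tau> ''nn''" using r bfcells_same[of \<tau> \<rho> "''nn''"] by simp
      moreover have "keeps {} \<sigma> \<rho>" using r t by (blast intro: keeps_trans keeps_bfcells)
      moreover have "rep \<rho> (nmem \<rho> ''bb'' 0) (N * N + 1) ?L" using r by (metis order_refl)
      ultimately show "keeps {} \<sigma> \<rho> \<and> nmem \<rho> ''nn'' 0 = N * N + 1 \<and> rep \<rho> (nmem \<rho> ''bb'' 0) (N * N + 1) ?L" using t by simp
    qed simp
  qed
  have 5: "runs reach_copy \<tau> (100 * (N * N + 1 + 1)) (\<lambda>\<tau>. keeps {''rc''} \<sigma> \<tau> \<and>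
      (\<forall>u<N. \<forall>v<N. nmem \<tau> ''rc'' (u * N + v) = (if rcf u v then 1 else 0)))"
    if t: "keeps {} \<sigma> \<tau> \<and> nmem \<tau> ''nn'' 0 = N * N + 1 \<and> rep \<tau> (nmem \<tau> ''bb'' 0) (N * N + 1) ?L" for \<tau>
  proof (rule runs_weaken[OF runs_reach_copy[of \<tau> "N * N + 1" ?L]])
    fix \<rho> assume r: "keeps {''rc''} \<tau> \<rho> \<and> (\<forall>v<N * N + 1. nmem \<rho> ''rc'' v = (if ?L v \<noteq> None then 1 else 0))"
    have "nmem \<rho> ''rc'' (u * N + v) = (if rcf u v then 1 else 0)" if "u < N" "v < N" for u v
      using r radix_lt[OF that] unfolding rcf_def by simp
    moreover have "keeps {''rc''} \<sigma> \<rho>" using t r by (blast intro: keeps_trans keeps_mono[of "{}"])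
    ultimately show "keeps {''rc''} \<sigma> \<rho> \<and> (\<forall>u<N. \<forall>v<N. nmem \<rho> ''rc'' (u * N + v) = (if rcf u v then 1 else 0))" by simp
  qed (use t in auto)
  let ?T = "3 + (400 * (N * M) + (30 + (400 * (N + 1 + 1) * (N * N + 1 + length rlist + 1) + 100 * (N * N + 1 + 1))))"
  have 6: "runs reach_prog \<sigma> ?T (\<lambda>\<tau>. keeps {''rc''} \<sigma> \<tau> \<and>
    (\<forall>u<N. \<forall>v<N. nmem \<tau> ''rc'' (u * N + v) = (if rcf u v then 1 else 0)))"
    unfolding reach_prog_def by (rule runs_Seq[OF 1], rule runs_Seq[OF 2], assumption, rule runs_Seq[OF 3], assumption, rule runs_Seq[OF 4], assumption, erule 5)
  have "400 * (N + 1 + 1) * (N * N + 1 + length rlist + 1) \<le> 400 * (2 * N) * (403 * (N * N * M))"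
  proof (rule mult_le_mono)
    have "N * N \<le> N * N * M" "N * M \<le> N * N * M" "1 \<le> N * N * M" using NM by auto
    then show "N * N + 1 + length rlist + 1 \<le> 403 * (N * N * M)" using len by linarith
  qed (use NM in simp)
  moreover have "N * M \<le> N * N * N * M" "N * N \<le> N * N * N * M" "1 \<le> N * N * N * M" "400 * (2 * N) * (403 * (N * N * M)) = 322400 * (N * N * N * M)" using NM by auto
  moreover have "3 + (400 * a + (30 + (X + 100 * (b + 1 + 1)))) \<le> 1000000 * K"
    if *: "X \<le> Y" "a \<le> K" "b \<le> K" "1 \<le> K" "Y = 322400 * K" for X Y a b K :: nat
  proof -
    have "3 + (400 * a + (30 + (X + 100 * (b + 1 + 1)))) = 400 * a + X + 100 * b + 233 * 1" by simp
    also have "\<dots> \<le> 400 * K + 322400 * K + 100 * K + 233 * K" by (intro add_mono mult_le_mono2) (use * in auto)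
    also have "\<dots> = 323133 * K" by (simp add: algebra_simps)
    also have "\<dots> \<le> 1000000 * K" by (rule mult_le_mono1) simp
    finally show ?thesis .
  qed
  ultimately have "?T \<le> 1000000 * (N * N * N * M)" by blast
  then show ?thesis by (rule runs_weaken[OF 6])
qed

definition renv :: "state \<Rightarrow> bool" where
  "renv \<sigma> \<longleftrightarrow> penv \<sigma> \<and> (\<forall>u<N. \<forall>v<N. nmem \<sigma> ''rc'' (u * N + v) = (if rc u v then 1 else 0))"

lemma renv_keeps: assumes "renv \<sigma>" "keeps A \<sigma> \<tau>" "A \<inter> (insert ''rc'' pnames) = {}" shows "renv \<tau>"
  using penv_keeps[of \<sigma> A \<tau>] keepsN[OF assms(2), of "''rc''"] assms unfolding renv_def by auto

end

section \<open>Emission of the transitions of the game\<close>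

definition LnE :: "nexp \<Rightarrow> nexp \<Rightarrow> nexp \<Rightarrow> nexp" where
  "LnE i j c = NAdd (NRead ''offI'' i) (NAdd (NRead ''offJ'' j) (NAdd (nrd ''offA'' ''N'') (NAdd (nrd ''offX'' ''N'') c)))"
definition GnE :: "nexp \<Rightarrow> nexp \<Rightarrow> nexp \<Rightarrow> nexp \<Rightarrow> nexp \<Rightarrow> nexp" where
  "GnE i j a x c = NAdd (NRead ''offI'' i) (NAdd (NRead ''offJ'' j) (NAdd (NRead ''offA'' a) (NAdd (NRead ''offX'' x) c)))"
definition SrcE :: nexp where "SrcE = NAdd (NV ''TOT'') (NV ''M'')"
definition FinE :: nexp where "FinE = NAdd (NAdd (NV ''TOT'') (NV ''M'')) (NConst 1)"

type_synonym piece = "bexp \<times> nexp \<times> nexp \<times> rexp \<times> nexp"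

definition emit :: "piece \<Rightarrow> com" where "emit p = (case p of (b, f, t, c, l) \<Rightarrow> Cond b (app f t c l) Skip)"

definition out :: "piece \<Rightarrow> state \<Rightarrow> trans list" where
  "out p \<sigma> = (case p of (b, f, t, c, l) \<Rightarrow> if bval b \<sigma> then [(nval f \<sigma>, nval t \<sigma>, rval c \<sigma>, nval l \<sigma>)] else [])"

definition pvars :: "piece \<Rightarrow> mem_name set" where
  "pvars p = (case p of (b, f, t, c, l) \<Rightarrow> bvars b \<union> nvars f \<union> nvars t \<union> rvars c \<union> nvars l)"

lemma (in frame) apps_emit:
  assumes "pvars p \<inter> (tnames \<union> fst ` W) = {}" "tcells \<subseteq> X" "W \<subseteq> X" "ctime (emit p) \<le> T"
  shows "apps (emit p) W T (out p)"
proof -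
  obtain b f t c l where p: "p = (b, f, t, c, l)" by (cases p)
  have "apps (emit p) W (ctime (emit p)) (out p)"
    using apps_cond[of b f t c l W] assms(1-3) unfolding p emit_def out_def[abs_def] pvars_def by simp
  then show ?thesis using assms(4) unfolding apps_def by (auto elim!: runs_weaken intro: le_trans)
qed

lemma (in frame) apps_le: "apps c W T g \<Longrightarrow> T \<le> T' \<Longrightarrow> apps c W T' g"
  unfolding apps_def by (auto elim!: runs_weaken intro: le_trans)

definition cSrc :: piece where
  "cSrc = ((isd (NV ''i'')),
     SrcE, (NAdd (NV ''TOT'') (NV ''i'')), RZero, (NV ''i''))"

definition cStart :: piece where
  "cStart = ((BAnd (isd (NV ''i'')) (BAnd (isd (NV ''j'')) (BAnd (nrc (nrd ''src'' ''j'') (nrd ''src'' ''i'')) (BNot (BEq (nrd ''dst'' ''i'') (nrd ''src'' ''j'')))))),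
     (NAdd (NV ''TOT'') (NV ''i'')), (LnE (NV ''i'') (NV ''j'') (nrd ''src'' ''j'')), (RRead ''g'' (nrd ''src'' ''j'')), (NV ''j''))"

abbreviation LcE :: nexp where "LcE \<equiv> LnE (NV ''i'') (NV ''j'') (NV ''c'')"
abbreviation GcE :: nexp where "GcE \<equiv> GnE (NV ''i'') (NV ''j'') (NV ''a'') (NV ''x'') (NV ''c'')"

definition cL1 :: piece where
  "cL1 = ((BAnd (isd (NV ''e'')) (BAnd (BEq (nrd ''src'' ''e'') (nrd ''dst'' ''i'')) (BAnd (nrc (nrd ''dst'' ''j'') (nrd ''dst'' ''i'')) (nrc (nrd ''dst'' ''i'') (nrd ''src'' ''j''))))),
     LcE, (LnE (NV ''e'') (NV ''j'') (NV ''c'')), RZero, (NV ''e''))"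
definition cL2 :: piece where
  "cL2 = ((BAnd (isd (NV ''e'')) (BAnd (BEq (nrd ''src'' ''e'') (nrd ''dst'' ''j'')) (nrc (nrd ''dst'' ''i'') (nrd ''dst'' ''j'')))),
     LcE, (LnE (NV ''i'') (NV ''e'') (NV ''c'')), RZero, (NV ''e''))"
definition cL3 :: piece where
  "cL3 = ((BAnd (BEq (nrd ''src'' ''e'') (nrd ''dst'' ''i'')) (BAnd (BEq (nrd ''dst'' ''e'') (NV ''c'')) (BAnd (BNot (isd (NV ''e''))) (nrc (nrd ''dst'' ''j'') (nrd ''dst'' ''i''))))),
     LcE, FinE, (RAdd (RRead ''wt'' (NV ''e'')) (RRead ''h'' (nrd ''dst'' ''i''))), (NV ''e''))"
definition cOpen :: piece where
  "cOpen = ((BAnd (nrc (NV ''a'') (nrd ''src'' ''i'')) (nrc (NV ''a'') (nrd ''src'' ''j''))),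
     LcE, (GnE (NV ''i'') (NV ''j'') (NV ''a'') (NV ''a'') (NV ''c'')), RZero, (NV ''M''))"
definition cG1 :: piece where
  "cG1 = ((BAnd (isd (NV ''e'')) (BAnd (BEq (nrd ''src'' ''e'') (nrd ''dst'' ''i'')) (BAnd (nrc (nrd ''dst'' ''j'') (nrd ''dst'' ''i''))
       (BAnd (nrc (nrd ''dst'' ''i'') (nrd ''src'' ''j'')) (nrc (NV ''x'') (nrd ''dst'' ''i'')))))),
     GcE, (GnE (NV ''e'') (NV ''j'') (NV ''a'') (NV ''x'') (NV ''c'')), RZero, (NV ''e''))"
definition cG2 :: piece where
  "cG2 = ((BAnd (isd (NV ''e'')) (BAnd (BEq (nrd ''src'' ''e'') (nrd ''dst'' ''j'')) (BAnd (nrc (nrd ''dst'' ''i'') (nrd ''dst'' ''j'')) (nrc (NV ''x'') (nrd ''dst'' ''j''))))),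
     GcE, (GnE (NV ''i'') (NV ''e'') (NV ''a'') (NV ''x'') (NV ''c'')), RZero, (NV ''e''))"
definition cG3 :: piece where
  "cG3 = ((BAnd (isd (NV ''e'')) (BAnd (BEq (nrd ''src'' ''e'') (NV ''x'')) (BAnd (nrc (nrd ''dst'' ''i'') (NV ''x'')) (nrc (nrd ''dst'' ''j'') (NV ''x''))))),
     GcE, (GnE (NV ''i'') (NV ''j'') (NV ''a'') (nrd ''dst'' ''e'') (NV ''c'')), (RRead ''wt'' (NV ''e'')), (NV ''e''))"
definition cG4 :: piece where
  "cG4 = ((BAnd (BEq (nrd ''src'' ''e'') (NV ''x'')) (BAnd (BEq (nrd ''dst'' ''e'') (NV ''c'')) (BAnd (nrc (nrd ''dst'' ''i'') (NV ''x'')) (nrc (nrd ''dst'' ''j'') (NV ''x''))))),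
     GcE, (LnE (NV ''i'') (NV ''j'') (NV ''a'')), (RRead ''wt'' (NV ''e'')), (NV ''e''))"

definition game_list :: com where
  "game_list = For ''i'' ''M'' (Seq (emit cSrc) (For ''j'' ''M'' (Seq (emit cStart) (For ''c'' ''N'' (Seq (For ''e'' ''M'' (Seq (emit cL1) (Seq (emit cL2) (emit cL3))))
     (For ''a'' ''N'' (Seq (emit cOpen) (For ''x'' ''N'' (For ''e'' ''M'' (Seq (emit cG1) (Seq (emit cG2) (Seq (emit cG3) (emit cG4))))))))))))) "

text \<open>As all ranges are at least 1, the lower order terms of each loop are absorbed into the
  coefficient of the product, level by level.\<close>

lemma game_time:
  fixes M N :: nat
  assumes "3 \<le> M" "3 \<le> N"
  shows "M * (200 + M * (200 + N * (M * (200 + (200 + 200) + 21) + N * (200 + N * (M * (200 + (200 + (200 + 200)) + 21) + 21) + 21) + 21) + 21) + 21) \<le> 3000 * (M * M * M * N * N * N)"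
proof -
  have b: "B * (P * q + r) \<le> B * P * (q + r)" if "1 \<le> P" for B P q r :: nat
  proof -
    have "P * q + r \<le> P * (q + r)" using that by (cases P) (auto simp: algebra_simps)
    then show ?thesis by simp
  qed
  have 1: "N * (M * (200 + (200 + (200 + 200)) + 21) + 21) \<le> N * M * 842"
    by (rule le_trans[OF b]) (use assms in auto)
  have 2: "N * (200 + X + 21) \<le> N * P * (q + 221)" if "X \<le> P * q" "1 \<le> P" for X P q
    by (rule le_trans[OF _ b[OF that(2), of N q 221]]) (use that in auto)
  have 3: "M * (200 + X + 21) \<le> M * P * (q + 221)" if "X \<le> P * q" "1 \<le> P" for X P q
    by (rule le_trans[OF _ b[OF that(2), of M q 221]]) (use that in auto)
  have c1: "1 \<le> N * M" "1 \<le> N * (N * M)" "1 \<le> N * (N * (N * M))" "1 \<le> M * (N * (N * (N * M)))" using assms by auto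
  have a: "N * (200 + N * (M * (200 + (200 + (200 + 200)) + 21) + 21) + 21) \<le> N * (N * M) * 1063" using 2[OF 1 c1(1)] by simp
  have "N * (M * 621 + Y + 21) \<le> N * (N * (N * M)) * 1705" if "Y \<le> N * (N * M) * 1063" for Y
  proof -
    have "M * 621 \<le> N * (N * M) * 621" using assms by auto
    moreover have "21 \<le> N * (N * M) * 21" using assms by auto
    ultimately have "M * 621 + Y + 21 \<le> N * (N * M) * 621 + N * (N * M) * 1063 + N * (N * M) * 21" using that by (intro add_mono)
    also have "\<dots> = (N * (N * M)) * 1705" by (simp add: algebra_simps)
    finally show ?thesis by (metis mult_le_mono2 mult.assoc)
  qed
  from this[OF a] have d: "N * (M * (200 + (200 + 200) + 21) + N * (200 + N * (M * (200 + (200 + (200 + 200)) + 21) + 21) + 21) + 21) \<le> N * (N * (N * M)) * 1705"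
    by simp
  from 3[OF 3[OF d c1(3)] ] have "M * (200 + M * (200 + N * (M * (200 + (200 + 200) + 21) + N * (200 + N * (M * (200 + (200 + (200 + 200)) + 21) + 21) + 21) + 21) + 21) + 21)
    \<le> M * (M * (N * (N * (N * M)))) * (1705 + 221 + 221)" using c1(4) by simp
  also have "\<dots> \<le> M * (M * (N * (N * (N * M)))) * 3000" by (rule mult_le_mono2) simp
  also have "\<dots> = 3000 * (M * M * M * N * N * N)" by (simp add: algebra_simps)
  finally show ?thesis .
qed

context pebbles begin

abbreviation gX :: "(mem_name \<times> nat) set" where
  "gX \<equiv> {(''i'', 0), (''j'', 0), (''c'', 0), (''a'', 0), (''x'', 0), (''e'', 0)} \<union> tcells"

lemmas cdefs = isd_def nrc_def BEq_def LnE_def GnE_def SrcE_def FinE_def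

lemma out_eq:
  assumes r: "renv \<sigma>"
  shows "nmem \<sigma> ''i'' 0 = i \<Longrightarrow> i < M \<Longrightarrow> out cSrc \<sigma> = tSrc i"
    and "nmem \<sigma> ''i'' 0 = i \<Longrightarrow> nmem \<sigma> ''j'' 0 = j \<Longrightarrow> i < M \<Longrightarrow> j < M \<Longrightarrow> out cStart \<sigma> = tStart i j"
    and "nmem \<sigma> ''i'' 0 = i \<Longrightarrow> nmem \<sigma> ''j'' 0 = j \<Longrightarrow> nmem \<sigma> ''c'' 0 = c \<Longrightarrow> nmem \<sigma> ''e'' 0 = e \<Longrightarrow> i < M \<Longrightarrow> j < M \<Longrightarrow> c < N \<Longrightarrow> e < M \<Longrightarrow>
      out cL1 \<sigma> @ out cL2 \<sigma> @ out cL3 \<sigma> = tL i j c e"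
    and "nmem \<sigma> ''i'' 0 = i \<Longrightarrow> nmem \<sigma> ''j'' 0 = j \<Longrightarrow> nmem \<sigma> ''c'' 0 = c \<Longrightarrow> nmem \<sigma> ''a'' 0 = a \<Longrightarrow> i < M \<Longrightarrow> j < M \<Longrightarrow> c < N \<Longrightarrow> a < N \<Longrightarrow>
      out cOpen \<sigma> = tOpen i j c a"
    and "nmem \<sigma> ''i'' 0 = i \<Longrightarrow> nmem \<sigma> ''j'' 0 = j \<Longrightarrow> nmem \<sigma> ''c'' 0 = c \<Longrightarrow> nmem \<sigma> ''a'' 0 = a \<Longrightarrow> nmem \<sigma> ''x'' 0 = x \<Longrightarrow> nmem \<sigma> ''e'' 0 = e \<Longrightarrow>
      i < M \<Longrightarrow> j < M \<Longrightarrow> c < N \<Longrightarrow> a < N \<Longrightarrow> x < N \<Longrightarrow> e < M \<Longrightarrow>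
      out cG1 \<sigma> @ out cG2 \<sigma> @ out cG3 \<sigma> @ out cG4 \<sigma> = tG i j c a x e"
proof -
  have v: "nmem \<sigma> ''N'' 0 = N" "nmem \<sigma> ''M'' 0 = M" "nmem \<sigma> ''TOT'' 0 = TOT" "nmem \<sigma> ''offX'' N = N * N" "nmem \<sigma> ''offA'' N = N * SA"
    using r by (auto simp: renv_def penv_def env_def tabs_def)
  have m: "nmem \<sigma> ''src'' e = src e" "nmem \<sigma> ''dst'' e = dst e" "rmem \<sigma> ''wt'' e = wt e" "src e < N" "dst e < N" "nmem \<sigma> ''offI'' e = e * SI"
      "nmem \<sigma> ''offJ'' e = e * SJ" "nmem \<sigma> ''dE'' e = (if dE e then 1 else 0)" if "e < M" for e
    using r ends_lt[OF that] that by (auto simp: renv_def penv_def env_def tabs_def)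
  have n: "nmem \<sigma> ''offX'' u = u * N" "nmem \<sigma> ''offA'' u = u * SA" "rmem \<sigma> ''h'' u = hh u" "rmem \<sigma> ''g'' u = gg u" if "u < N" for u
    using r that by (auto simp: renv_def penv_def env_def tabs_def)
  have rr: "nmem \<sigma> ''rc'' (u * N + u') = (if rc u u' then 1 else 0)" if "u < N" "u' < N" for u u'
    using r that by (auto simp: renv_def)
  have lt: "(\<not> a < b \<and> \<not> b < a) = (a = b)" for a b :: nat by auto
  note S = out_def cdefs v m n rr lt enc5_def
  show "out cSrc \<sigma> = tSrc i" if "nmem \<sigma> ''i'' 0 = i" "i < M" using that by (simp add: cSrc_def tSrc_def S)
  show "out cStart \<sigma> = tStart i j" if "nmem \<sigma> ''i'' 0 = i" "nmem \<sigma> ''j'' 0 = j" "i < M" "j < M"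
    using that by (simp add: cStart_def tStart_def S)
  show "out cL1 \<sigma> @ out cL2 \<sigma> @ out cL3 \<sigma> = tL i j c e"
    if "nmem \<sigma> ''i'' 0 = i" "nmem \<sigma> ''j'' 0 = j" "nmem \<sigma> ''c'' 0 = c" "nmem \<sigma> ''e'' 0 = e" "i < M" "j < M" "c < N" "e < M"
    unfolding cL1_def cL2_def cL3_def tL_def
    by (intro arg_cong2[of _ _ _ _ "(@)"]) (use that in \<open>simp_all add: S\<close>)
  show "out cOpen \<sigma> = tOpen i j c a"
    if "nmem \<sigma> ''i'' 0 = i" "nmem \<sigma> ''j'' 0 = j" "nmem \<sigma> ''c'' 0 = c" "nmem \<sigma> ''a'' 0 = a" "i < M" "j < M" "c < N" "a < N"
    using that by (simp add: cOpen_def tOpen_def S)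
  show "out cG1 \<sigma> @ out cG2 \<sigma> @ out cG3 \<sigma> @ out cG4 \<sigma> = tG i j c a x e"
    if "nmem \<sigma> ''i'' 0 = i" "nmem \<sigma> ''j'' 0 = j" "nmem \<sigma> ''c'' 0 = c" "nmem \<sigma> ''a'' 0 = a" "nmem \<sigma> ''x'' 0 = x" "nmem \<sigma> ''e'' 0 = e"
      "i < M" "j < M" "c < N" "a < N" "x < N" "e < M"
    unfolding cG1_def cG2_def cG3_def cG4_def tG_def
    by (intro arg_cong2[of _ _ _ _ "(@)"]) (use that in \<open>simp_all add: S\<close>)
qed

lemma runs_game_list:
  assumes r: "renv \<sigma>" and tk: "nmem \<sigma> ''tk'' 0 = 0"
  shows "runs game_list \<sigma> (3000 * (M * M * M * N * N * N)) (\<lambda>\<tau>. keeps {} \<sigma> \<tau> \<and> tlist \<tau> = tAll)"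
    "length tAll \<le> 3000 * (M * M * M * N * N * N)"
proof -
  interpret frame \<sigma> gX .
  have NMv: "nmem \<sigma> ''N'' 0 = N" "nmem \<sigma> ''M'' 0 = M" using r by (auto simp: renv_def penv_def env_def)
  have tX: "tcells \<subseteq> gX" by auto
  have yX: "(''N'', 0) \<notin> gX" "(''M'', 0) \<notin> gX" by (auto simp: tcells_def)
  note ct = cdefs app_def
  let ?V1 = "{(''e'', 0::nat)}" let ?V2 = "insert (''x'', 0) ?V1" let ?V3 = "insert (''a'', 0) ?V2"
  let ?V4 = "insert (''c'', 0) ?V3" let ?V5 = "insert (''j'', 0) ?V4" let ?V6 = "insert (''i'', 0) ?V5"
  have G1: "apps (emit cG1) {} 200 (out cG1)" by (rule apps_emit) (use tX in \<open>auto simp: ct pvars_def emit_def cG1_def\<close>)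
  have G2: "apps (emit cG2) {} 200 (out cG2)" by (rule apps_emit) (use tX in \<open>auto simp: ct pvars_def emit_def cG2_def\<close>)
  have G3: "apps (emit cG3) {} 200 (out cG3)" by (rule apps_emit) (use tX in \<open>auto simp: ct pvars_def emit_def cG3_def\<close>)
  have G4: "apps (emit cG4) {} 200 (out cG4)" by (rule apps_emit) (use tX in \<open>auto simp: ct pvars_def emit_def cG4_def\<close>)
  have L1: "apps (emit cL1) {(''x'', 0), (''a'', 0)} 200 (out cL1)" by (rule apps_emit) (use tX in \<open>auto simp: ct pvars_def emit_def cL1_def\<close>)
  have L2: "apps (emit cL2) {(''x'', 0), (''a'', 0)} 200 (out cL2)" by (rule apps_emit) (use tX in \<open>auto simp: ct pvars_def emit_def cL2_def\<close>)
  have L3: "apps (emit cL3) {(''x'', 0), (''a'', 0)} 200 (out cL3)" by (rule apps_emit) (use tX in \<open>auto simp: ct pvars_def emit_def cL3_def\<close>)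
  have O: "apps (emit cOpen) ?V2 200 (out cOpen)" by (rule apps_emit) (use tX in \<open>auto simp: ct pvars_def emit_def cOpen_def\<close>)
  have St: "apps (emit cStart) ?V4 200 (out cStart)" by (rule apps_emit) (use tX in \<open>auto simp: ct pvars_def emit_def cStart_def\<close>)
  have Sr: "apps (emit cSrc) ?V5 200 (out cSrc)" by (rule apps_emit) (use tX in \<open>auto simp: ct pvars_def emit_def cSrc_def\<close>)
  have lp: "apps (For x y c) (insert (x, 0) W) (B * (A + 21)) (\<lambda>\<sigma>. concat (map (\<lambda>k. g (nwrite x 0 k \<sigma>)) [0..<B]))"
    if "apps c W A g" "(x, 0) \<notin> W" "x \<in> {''i'', ''j'', ''c'', ''a'', ''x'', ''e''}" "y = ''M'' \<and> B = M \<or> y = ''N'' \<and> B = N" for c W A g x y B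
  proof (rule apps_le[OF apps_For[OF that(1)]])
    show "nmem \<sigma> y 0 = B" using that(4) NMv by (elim disjE conjE) simp_all
    show "(y, 0) \<notin> gX" using that(4) by (elim disjE conjE) (simp_all only: yX not_False_eq_True)
    have "x \<notin> tnames \<union> rnames" using that(3) by auto
    then show "(x, 0) \<notin> W \<union> tcells" "x \<notin> rnames" using that(2) by (simp_all add: tcells_def)
    show "(x, 0) \<in> gX" using that(3) by (simp, blast)
    have "y = ''M'' \<or> y = ''N''" using that(4) by blast
    then show "x \<noteq> y" using that(3) by (elim disjE) auto
    show "9 + B * (A + 12) \<le> B * (A + 21)" by (rule For_time) (use that(4) NM in auto)
  qed
  note MN = disjI1[OF conjI[OF refl refl]] disjI2[OF conjI[OF refl refl]]
  have m: "''i'' \<in> {''i'', ''j'', ''c'', ''a'', ''x'', ''e''}" "''j'' \<in> {''i'', ''j'', ''c'', ''a'', ''x'', ''e''}" "''c'' \<in> {''i'', ''j'', ''c'', ''a'', ''x'', ''e''}"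
    "''a'' \<in> {''i'', ''j'', ''c'', ''a'', ''x'', ''e''}" "''x'' \<in> {''i'', ''j'', ''c'', ''a'', ''x'', ''e''}" "''e'' \<in> {''i'', ''j'', ''c'', ''a'', ''x'', ''e''}" by simp_all
  have V: "(''e'', 0::nat) \<notin> {}" "(''x'', 0) \<notin> ?V1" "(''a'', 0) \<notin> ?V2" "(''c'', 0) \<notin> ?V3" "(''j'', 0) \<notin> ?V4" "(''i'', 0) \<notin> ?V5"
    "(''e'', 0::nat) \<notin> {(''x'', 0), (''a'', 0)}" by simp_all
  note 1 = lp[OF apps_Seq[OF G1 apps_Seq[OF G2 apps_Seq[OF G3 G4]]] V(1) m(6) MN(1)]
  note 2 = apps_Seq[OF O lp[OF 1 V(2) m(5) MN(2)]]
  note 3 = lp[OF 2 V(3) m(4) MN(2)]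
  have V3: "insert (''e'', 0) {(''x'', 0), (''a'', 0)} = ?V3" by auto
  note 4 = lp[OF apps_Seq[OF L1 apps_Seq[OF L2 L3]] V(7) m(6) MN(1), unfolded V3]
  note 6 = apps_Seq[OF St lp[OF apps_Seq[OF 4 3] V(4) m(3) MN(2)]]
  note 7 = apps_Seq[OF Sr lp[OF 6 V(5) m(2) MN(1)]]
  note 8 = lp[OF 7 V(6) m(1) MN(1), folded game_list_def]
  have K: "keeps {} \<sigma> (nwrite x 0 k \<tau>)" if "keeps {} \<sigma> \<tau>" "x \<in> {''i'', ''j'', ''c'', ''a'', ''x'', ''e''}" for x k \<tau>
    by (rule keeps_nwrite) (use that in auto)
  have R: "renv \<tau>" if "keeps {} \<sigma> \<tau>" for \<tau> by (rule renv_keeps[OF r that]) simp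
  \<comment> \<open>The counters are written in the order of nesting, so every piece is evaluated in
    a state that holds its own indices, and \<open>out_eq\<close> applies to each of them.\<close>
  have G: "(concat (map (\<lambda>i. (\<lambda>\<sigma>. out cSrc \<sigma> @ concat (map (\<lambda>j. (\<lambda>\<sigma>. out cStart \<sigma> @ concat (map (\<lambda>c. (\<lambda>\<sigma>.
      concat (map (\<lambda>e. (\<lambda>\<sigma>. out cL1 \<sigma> @ out cL2 \<sigma> @ out cL3 \<sigma>) (nwrite ''e'' 0 e \<sigma>)) [0..<M]) @
      concat (map (\<lambda>a. (\<lambda>\<sigma>. out cOpen \<sigma> @ concat (map (\<lambda>x. (\<lambda>\<sigma>. concat (map (\<lambda>e. (\<lambda>\<sigma>.
         out cG1 \<sigma> @ out cG2 \<sigma> @ out cG3 \<sigma> @ out cG4 \<sigma>) (nwrite ''e'' 0 e \<sigma>)) [0..<M])) (nwrite ''x'' 0 x \<sigma>)) [0..<N])) (nwrite ''a'' 0 a \<sigma>)) [0..<N]))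
      (nwrite ''c'' 0 c \<sigma>)) [0..<N])) (nwrite ''j'' 0 j \<sigma>)) [0..<M])) (nwrite ''i'' 0 i \<sigma>)) [0..<M])) = tAll"
    unfolding tAll_def
    by (intro arg_cong[of _ _ concat] arg_cong2[of _ _ _ _ "(@)"] map_cong refl) ((intro out_eq R K keeps_refl m; simp)+)
  let ?A = "M * M * M * N * N * N"
  have T: "M * (200 + M * (200 + N * (M * (200 + (200 + 200) + 21) + N * (200 + N * (M * (200 + (200 + (200 + 200)) + 21) + 21) + 21) + 21) + 21) + 21) \<le> 3000 * ?A"
    by (rule game_time) (use NM in auto)
  show "length tAll \<le> 3000 * ?A" using le_trans[OF apps_length[OF 8, of \<sigma>] T] unfolding G .
  show "runs game_list \<sigma> (3000 * ?A) (\<lambda>\<tau>. keeps {} \<sigma> \<tau> \<and> tlist \<tau> = tAll)"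
  proof (rule runs_weaken[OF apps_runs[OF 8, unfolded G] T])
    fix \<tau> assume "tlist \<tau> = tlist \<sigma> @ tAll \<and> same (?V6 \<union> tcells) \<sigma> \<tau>"
    then show "keeps {} \<sigma> \<tau> \<and> tlist \<tau> = tAll" using tk by (auto elim!: keeps_same simp: tcells_def tlist_def)
  qed
qed

end

section \<open>Solving the game and reading off the path\<close>

definition game_prog :: com where
  "game_prog = Seq (NSet ''tk'' (NConst 0)) (Seq game_list
     (Seq (Seq (NSet ''nn'' (NAdd FinE (NConst 1))) (Seq (NSet ''z'' SrcE) (NSet ''rr'' (NAdd (NAdd (NV ''N'') (NV ''N'')) (NAdd (NV ''N'') (NV ''N''))))))
       bellman))"

text \<open>Arcs of \<open>De\<close> may share a tail or a head. Whichever is written last is as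
  good as any other: following \<open>nxt\<close> or \<open>prv\<close> stays in \<open>De\<close>,
  and all ways through \<open>De\<close> between two vertices have the same length.\<close>

definition default_prog :: com where
  "default_prog = For ''e'' ''M'' (Cond (isd (NV ''e''))
     (Seq (NWrite ''nxt'' (nrd ''src'' ''e'') (nrd ''dst'' ''e'')) (NWrite ''prv'' (nrd ''dst'' ''e'') (nrd ''src'' ''e''))) Skip)"

text \<open>Labels are met from the last to the first, so \<open>lab\<close> finally holds the arc
  guessed by \<open>tr_src\<close>, at whose tail \<open>prefix_prog\<close> begins.\<close>

definition trace_prog :: com where
  "trace_prog = Seq (Seq (NSet ''cur'' FinE) (NSet ''lab'' (NV ''M'')))
     (For ''r'' ''rr'' (Seq (NSet ''pt'' (NRead ''bp'' (NAdd (NV ''bb'') (NV ''cur''))))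
       (Seq (Cond (NLess (NConst 0) (NV ''pt''))
          (Seq (NSet ''lab'' (NRead ''TL'' (NSub (NV ''pt'') (NConst 1))))
            (Seq (NWrite ''nxt'' (nrd ''src'' ''lab'') (nrd ''dst'' ''lab'')) (NSet ''cur'' (NRead ''TF'' (NSub (NV ''pt'') (NConst 1)))))) Skip)
         (NSet ''bb'' (NSub (NV ''bb'') (NV ''nn''))))))"

definition prefix_prog :: com where
  "prefix_prog = Seq (NSet ''v'' (nrd ''src'' ''lab''))
     (For ''r'' ''N'' (Cond (BNot (BEq (NV ''v'') (NV ''S'')))
       (Seq (NWrite ''nxt'' (nrd ''prv'' ''v'') (NV ''v'')) (NSet ''v'' (nrd ''prv'' ''v''))) Skip))"

definition out_prog :: com where
  "out_prog = Seq (Seq (NSet ''found'' (NConst 1)) (Seq (NSet ''cur'' (NV ''s'')) (Seq (NSet ''len'' (NConst 0)) (NSet ''fl'' (NConst 0)))))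
     (For ''r'' ''N'' (Cond (NLess (NV ''fl'') (NConst 1))
        (Seq (NWrite ''path'' (NV ''len'') (NV ''cur'')) (Seq (NSet ''len'' (NAdd (NV ''len'') (NConst 1)))
          (Cond (BEq (NV ''cur'') (NV ''t'')) (NSet ''fl'' (NConst 1)) (NSet ''cur'' (nrd ''nxt'' ''cur''))))) Skip))"

text \<open>\<open>g\<close> arises from \<open>f\<close> by writes along the arcs in \<open>A\<close>, in any order.\<close>

definition ovr :: "(nat \<times> nat) set \<Rightarrow> (nat \<Rightarrow> nat) \<Rightarrow> (nat \<Rightarrow> nat) \<Rightarrow> bool" where
  "ovr A f g \<longleftrightarrow> (\<forall>v. (v, g v) \<in> A \<or> (\<forall>b. (v, b) \<notin> A) \<and> g v = f v)"

lemma ovr_empty [simp]: "ovr {} f f" by (simp add: ovr_def)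

lemma ovr_upd: "ovr A f g \<Longrightarrow> ovr (insert (a, b) A) f (g(a := b))"
  unfolding ovr_def by auto

lemma ovr_trans: "ovr A f g \<Longrightarrow> ovr B g h \<Longrightarrow> ovr (A \<union> B) f h"
  unfolding ovr_def by (metis UnCI UnE)

text \<open>The fuel \<open>k\<close> mirrors the fixed number of rounds of the program; in an
  acyclic graph on \<open>N\<close> vertices, \<open>N\<close> of them suffice.\<close>

primrec chain :: "nat \<Rightarrow> (nat \<Rightarrow> nat) \<Rightarrow> nat \<Rightarrow> nat \<Rightarrow> nat list" where
  "chain S f 0 u = [u]"
| "chain S f (Suc k) u = (if u = S then [u] else u # chain S f k (f u))"

lemma hd_chain: "\<exists>xs. chain S f k u = u # xs" by (cases k) auto

context pebbles begin

definition genv :: "state \<Rightarrow> bool" where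
  "genv \<sigma> \<longleftrightarrow> renv \<sigma> \<and> tlist \<sigma> = tAll \<and> nmem \<sigma> ''nn'' 0 = TOT + M + 2 \<and> nmem \<sigma> ''rr'' 0 = 4 * N \<and>
     nmem \<sigma> ''bb'' 0 = 4 * N * (TOT + M + 2) \<and> (\<forall>r\<le>4 * N. rep \<sigma> (r * (TOT + M + 2)) (TOT + M + 2) (lay tAll (enc Src) r))"

lemma runs_game_prog:
  assumes r: "renv \<sigma>"
  shows "runs game_prog \<sigma> (7000000 * (M * M * M * N * N * N * N)) (\<lambda>\<tau>. keeps {} \<sigma> \<tau> \<and> genv \<tau>)"
proof -
  have 1: "runs (NSet ''tk'' (NConst 0)) \<sigma> 3 (\<lambda>\<tau>. keeps {} \<sigma> \<tau> \<and> nmem \<tau> ''tk'' 0 = 0)"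
    by (rule runs_straightI) (auto intro!: keeps_nwrite)
  have rk: "renv \<tau>" if "keeps {} \<sigma> \<tau>" for \<tau> using renv_keeps[OF r that] by simp
  let ?A = "M * M * M * N * N * N" let ?n = "TOT + M + 2"
  have 2: "runs game_list \<tau> (3000 * ?A) (\<lambda>\<rho>. keeps {} \<sigma> \<rho> \<and> tlist \<rho> = tAll)"
    if t: "keeps {} \<sigma> \<tau> \<and> nmem \<tau> ''tk'' 0 = 0" for \<tau>
    by (rule runs_weaken[OF runs_game_list(1)]) (use t rk keeps_trans in auto)
  have len: "length tAll \<le> 3000 * ?A"
  proof -
    have "renv (nwrite ''tk'' 0 0 \<sigma>)" by (rule rk) (auto intro!: keeps_nwrite)
    then show ?thesis using runs_game_list(2) by simp
  qed
  let ?c = "Seq (NSet ''nn'' (NAdd FinE (NConst 1))) (Seq (NSet ''z'' SrcE) (NSet ''rr'' (NAdd (NAdd (NV ''N'') (NV ''N'')) (NAdd (NV ''N'') (NV ''N'')))))"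
  let ?P = "\<lambda>\<rho>. keeps {} \<sigma> \<rho> \<and> tlist \<rho> = tAll \<and> nmem \<rho> ''nn'' 0 = ?n \<and> nmem \<rho> ''z'' 0 = enc Src \<and> nmem \<rho> ''rr'' 0 = 4 * N"
  have 3: "runs ?c \<tau> 60 ?P" if t: "keeps {} \<sigma> \<tau> \<and> tlist \<tau> = tAll" for \<tau>
  proof (rule runs_straightI)
    have "renv \<tau>" using rk t by simp
    then show "?P (den ?c \<tau>)"
      using t by (auto intro!: keeps_nwrite simp: renv_def penv_def env_def tabs_def tlist_def FinE_def SrcE_def)
  qed (auto simp: FinE_def SrcE_def)
  have 4: "runs bellman \<tau> (400 * (4 * N + 1) * (?n + length tAll + 1)) (\<lambda>\<rho>. keeps {} \<sigma> \<rho> \<and> genv \<rho>)"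
    if t: "?P \<tau>" for \<tau>
  proof -
    have "runs bellman \<tau> (400 * (4 * N + 1) * (?n + length tAll + 1)) (\<lambda>\<rho>. same bfcells \<tau> \<rho> \<and> nmem \<rho> ''bb'' 0 = 4 * N * ?n \<and>
       (\<forall>r\<le>4 * N. rep \<rho> (r * ?n) ?n (lay tAll (enc Src) r)))"
      by (rule runs_bellman) (use t tAll_lt in auto)
    then show ?thesis
    proof (rule runs_weaken)
      fix \<rho> assume s: "same bfcells \<tau> \<rho> \<and> nmem \<rho> ''bb'' 0 = 4 * N * ?n \<and> (\<forall>r\<le>4 * N. rep \<rho> (r * ?n) ?n (lay tAll (enc Src) r))"
      have k: "keeps {} \<sigma> \<rho>" using s t by (blast intro: keeps_trans keeps_bfcells)
      moreover have "nmem \<rho> ''nn'' = nmem \<tau> ''nn''" "nmem \<rho> ''rr'' = nmem \<tau> ''rr''" using s bfcells_same[of \<tau> \<rho>] by simp_all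
      moreover have "tlist \<rho> = tlist \<tau>"
        using s bfcells_same[of \<tau> \<rho> "''tk''"] bfcells_same[of \<tau> \<rho> "''TF''"] bfcells_same[of \<tau> \<rho> "''TT''"] bfcells_same[of \<tau> \<rho> "''TC''"] bfcells_same[of \<tau> \<rho> "''TL''"]
        by (simp add: tlist_def)
      ultimately show "keeps {} \<sigma> \<rho> \<and> genv \<rho>" using s t rk[OF k] by (simp add: genv_def)
    qed simp
  qed
  let ?T = "3 + (3000 * ?A + (60 + 400 * (4 * N + 1) * (?n + length tAll + 1)))"
  have 5: "runs game_prog \<sigma> ?T (\<lambda>\<tau>. keeps {} \<sigma> \<tau> \<and> genv \<tau>)"
    unfolding game_prog_def by (rule runs_Seq[OF 1], rule runs_Seq[OF 2], assumption, rule runs_Seq[OF 3], assumption, erule 4)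
  have N1: "1 \<le> N" "1 \<le> M" "1 \<le> M * M" "1 \<le> M * N" "1 \<le> N * N" using NM by auto
  \<comment> \<open>Two digits of the code have \<open>Suc N\<close> values. This costs a factor 4,
    so up to a constant the number of states stays below the bound on the number of
    transitions.\<close>
  have "Suc N \<le> 2 * N" using NM by simp
  then have "TOT \<le> M * (M * ((2 * N) * ((2 * N) * N)))"
    unfolding TOT_def SI_def SJ_def SA_def by (intro mult_le_mono order_refl) auto
  also have "\<dots> = (4 * (M * M * N * N * N)) * 1" by (simp add: algebra_simps)
  also have "\<dots> \<le> (4 * (M * M * N * N * N)) * M" using N1 by (intro mult_le_mono2)
  finally have tot: "TOT \<le> 4 * ?A" by (simp add: algebra_simps)
  have "M * (1 * 1 * 1 * 1 * 1) \<le> M * (M * M * N * N * N)" using N1 by (intro mult_le_mono2 mult_le_mono)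
  then have mA: "M \<le> ?A" by (simp add: algebra_simps)
  have A1: "1 \<le> ?A" using N1 by simp
  have "?n + length tAll + 1 \<le> 4 * ?A + ?A + 2 * ?A + 3000 * ?A + 1 * ?A" using tot mA A1 len by (intro add_mono) auto
  also have "\<dots> = 3008 * ?A" by (simp add: algebra_simps)
  finally have n: "?n + length tAll + 1 \<le> 3008 * ?A" .
  have "400 * (4 * N + 1) \<le> 2000 * N" using N1 by simp
  from mult_le_mono[OF this n] have m: "400 * (4 * N + 1) * (?n + length tAll + 1) \<le> 6016000 * (?A * N)" by (simp add: algebra_simps)
  have AN: "?A \<le> ?A * N" "1 \<le> ?A * N" using N1 by auto
  have "?T = 3000 * ?A + 63 * 1 + 400 * (4 * N + 1) * (?n + length tAll + 1)" by simp
  also have "\<dots> \<le> 3000 * (?A * N) + 63 * (?A * N) + 6016000 * (?A * N)"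
    by (intro add_mono mult_le_mono2 AN m)
  also have "\<dots> = 6019063 * (?A * N)" by (simp add: algebra_simps)
  also have "\<dots> \<le> 7000000 * (?A * N)" by (rule mult_le_mono1) simp
  finally show ?thesis using runs_weaken[OF 5] by (simp add: mult.assoc)
qed

lemma runs_default_prog:
  assumes r: "renv \<sigma>"
  shows "runs default_prog \<sigma> (M * 100) (\<lambda>\<tau>. keeps {''nxt'', ''prv''} \<sigma> \<tau> \<and> (\<forall>x\<in>{''tk'', ''TF'', ''TT'', ''TL'', ''nn'', ''rr'', ''bb'', ''bf'', ''bp''}. nmem \<tau> x = nmem \<sigma> x) \<and>
    rmem \<tau> = rmem \<sigma> \<and>
    (\<forall>e<M. dE e \<longrightarrow> (\<exists>e'<M. dE e' \<and> src e' = src e \<and> nmem \<tau> ''nxt'' (src e) = dst e') \<and> (\<exists>e'<M. dE e' \<and> dst e' = dst e \<and> nmem \<tau> ''prv'' (dst e) = src e')))"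
proof -
  let ?c = "Cond (isd (NV ''e''))
     (Seq (NWrite ''nxt'' (nrd ''src'' ''e'') (nrd ''dst'' ''e'')) (NWrite ''prv'' (nrd ''dst'' ''e'') (nrd ''src'' ''e''))) Skip"
  let ?D = "\<lambda>k \<tau>. \<forall>e<k. dE e \<longrightarrow> (\<exists>e'<M. dE e' \<and> src e' = src e \<and> nmem \<tau> ''nxt'' (src e) = dst e') \<and> (\<exists>e'<M. dE e' \<and> dst e' = dst e \<and> nmem \<tau> ''prv'' (dst e) = src e')"
  let ?X = "{''tk'', ''TF'', ''TT'', ''TL'', ''nn'', ''rr'', ''bb'', ''bf'', ''bp''}"
  let ?I = "\<lambda>k \<tau>. keeps {''nxt'', ''prv''} \<sigma> \<tau> \<and> (\<forall>x\<in>?X. nmem \<tau> x = nmem \<sigma> x) \<and> rmem \<tau> = rmem \<sigma> \<and> ?D k \<tau>"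
  have 1: "runs default_prog \<sigma> (9 + M * (60 + 12)) (\<lambda>\<tau>. ?I M \<tau> \<and> nmem \<tau> ''e'' 0 = M \<and> nmem \<tau> ''M'' 0 = M)"
    unfolding default_prog_def
  proof (rule runs_For[where I = ?I])
    show "?I 0 (nwrite ''e'' 0 0 \<sigma>)" by (auto intro!: keeps_nwrite)
    fix k \<sigma>' assume k: "k < M" "?I k \<sigma>'" "nmem \<sigma>' ''e'' 0 = k" "nmem \<sigma>' ''M'' 0 = M"
    have "renv \<sigma>'" by (rule renv_keeps[OF r]) (use k(2) in auto)
    then have mem: "nmem \<sigma>' ''src'' k = src k" "nmem \<sigma>' ''dst'' k = dst k" "nmem \<sigma>' ''dE'' k = (if dE k then 1 else 0)"
      using k(1) by (auto simp: renv_def penv_def env_def)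
    have d: "den ?c \<sigma>' = (if dE k then nwrite ''prv'' (dst k) (src k) (nwrite ''nxt'' (src k) (dst k) \<sigma>') else \<sigma>')"
      using mem k(3) by (simp add: isd_def)
    have D: "?D (Suc k) (den ?c \<sigma>')"
    proof (intro allI impI conjI)
      fix e assume e: "e < Suc k" "dE e"
      have a: "e \<noteq> k \<Longrightarrow> (\<exists>e'<M. dE e' \<and> src e' = src e \<and> nmem \<sigma>' ''nxt'' (src e) = dst e')" "e \<noteq> k \<Longrightarrow> (\<exists>e'<M. dE e' \<and> dst e' = dst e \<and> nmem \<sigma>' ''prv'' (dst e) = src e')"
        using k(2) e by auto
      show "\<exists>e'<M. dE e' \<and> src e' = src e \<and> nmem (den ?c \<sigma>') ''nxt'' (src e) = dst e'"
      proof (cases "dE k \<and> src e = src k")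
        case True then show ?thesis unfolding d using k(1) by auto
      next
        case False
        then have "nmem (den ?c \<sigma>') ''nxt'' (src e) = nmem \<sigma>' ''nxt'' (src e)" "e \<noteq> k" unfolding d using e by auto
        then show ?thesis using a(1) by auto
      qed
      show "\<exists>e'<M. dE e' \<and> dst e' = dst e \<and> nmem (den ?c \<sigma>') ''prv'' (dst e) = src e'"
      proof (cases "dE k \<and> dst e = dst k")
        case True then show ?thesis unfolding d using k(1) by auto
      next
        case False
        then have "nmem (den ?c \<sigma>') ''prv'' (dst e) = nmem \<sigma>' ''prv'' (dst e)" "e \<noteq> k" unfolding d using e by auto
        then show ?thesis using a(2) by auto
      qed
    qed
    show "runs ?c \<sigma>' 60 (\<lambda>\<tau>. nmem \<tau> ''e'' 0 = k \<and> nmem \<tau> ''M'' 0 = M \<and> ?I (Suc k) (nwrite ''e'' 0 (Suc k) \<tau>))"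
    proof (rule runs_straightI)
      have "keeps {''nxt'', ''prv''} \<sigma> (nwrite ''e'' 0 (Suc k) (den ?c \<sigma>'))" unfolding d using k(2) by (auto intro!: keeps_nwrite)
      moreover have "nmem (den ?c \<sigma>') ''e'' 0 = k" "nmem (den ?c \<sigma>') ''M'' 0 = M" "rmem (den ?c \<sigma>') = rmem \<sigma>" "\<forall>x\<in>?X. nmem (den ?c \<sigma>') x = nmem \<sigma> x"
        unfolding d using k by auto
      ultimately show "nmem (den ?c \<sigma>') ''e'' 0 = k \<and> nmem (den ?c \<sigma>') ''M'' 0 = M \<and> ?I (Suc k) (nwrite ''e'' 0 (Suc k) (den ?c \<sigma>'))"
        using D by simp
    qed (simp_all add: isd_def)
  qed (use r in \<open>auto simp: renv_def penv_def env_def\<close>)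
  show ?thesis by (rule runs_weaken[OF 1]) (use NM in auto)
qed

end

context pebbles begin

lemma tlist_nth: "k < length (tlist \<sigma>) \<Longrightarrow> tlist \<sigma> ! k = (nmem \<sigma> ''TF'' k, nmem \<sigma> ''TT'' k, rmem \<sigma> ''TC'' k, nmem \<sigma> ''TL'' k)"
  by (simp add: tlist_def)

abbreviation xarc :: "nat \<Rightarrow> nat \<times> nat" where "xarc l \<equiv> (src l, dst l)"

lemma runs_trace_prog:
  assumes g: "genv \<sigma>" and Fin: "lay tAll (enc Src) (4 * N) (enc Fin) \<noteq> None" and ls: "ls = trace tAll (enc Src) (4 * N) (enc Fin)"
  shows "runs trace_prog \<sigma> (1000 * N) (\<lambda>\<tau>. keeps {''nxt'', ''cur'', ''lab'', ''pt'', ''r''} \<sigma> \<tau> \<and>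
     nmem \<tau> ''lab'' 0 = last (M # ls) \<and> ovr (xarc ` set ls) (nmem \<sigma> ''nxt'') (nmem \<tau> ''nxt''))"
proof -
  let ?n = "TOT + M + 2" let ?R = "4 * N" let ?L = "lay tAll (enc Src)" let ?tr = "trace tAll (enc Src)"
  let ?K = "keeps {''nxt'', ''cur'', ''lab'', ''pt'', ''r''} \<sigma>"
  let ?init = "Seq (NSet ''cur'' FinE) (NSet ''lab'' (NV ''M''))"
  let ?b = "Cond (NLess (NConst 0) (NV ''pt''))
          (Seq (NSet ''lab'' (NRead ''TL'' (NSub (NV ''pt'') (NConst 1))))
            (Seq (NWrite ''nxt'' (nrd ''src'' ''lab'') (nrd ''dst'' ''lab'')) (NSet ''cur'' (NRead ''TF'' (NSub (NV ''pt'') (NConst 1)))))) Skip"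
  let ?c = "Seq (NSet ''pt'' (NRead ''bp'' (NAdd (NV ''bb'') (NV ''cur'')))) (Seq ?b (NSet ''bb'' (NSub (NV ''bb'') (NV ''nn''))))"
  have r: "renv \<sigma>" and tl: "tlist \<sigma> = tAll" and nn: "nmem \<sigma> ''nn'' 0 = ?n" and rr: "nmem \<sigma> ''rr'' 0 = ?R"
    and bb: "nmem \<sigma> ''bb'' 0 = ?R * ?n" and rp: "\<And>r. r \<le> ?R \<Longrightarrow> rep \<sigma> (r * ?n) ?n (?L r)" using g by (auto simp: genv_def)
  let ?F = "\<lambda>\<tau>. ?K \<tau> \<and> nmem \<tau> ''nn'' = nmem \<sigma> ''nn'' \<and> nmem \<tau> ''bp'' = nmem \<sigma> ''bp'' \<and> nmem \<tau> ''TL'' = nmem \<sigma> ''TL'' \<and> nmem \<tau> ''TF'' = nmem \<sigma> ''TF''"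
  have 0: "runs ?init \<sigma> 20 (\<lambda>\<tau>. ?F \<tau> \<and> nmem \<tau> ''rr'' 0 = ?R \<and> nmem \<tau> ''bb'' 0 = ?R * ?n \<and> nmem \<tau> ''cur'' 0 = enc Fin \<and> nmem \<tau> ''lab'' 0 = M \<and> nmem \<tau> ''nxt'' = nmem \<sigma> ''nxt'')"
  proof (rule runs_straightI)
    have "nmem \<sigma> ''M'' 0 = M" "nmem \<sigma> ''TOT'' 0 = TOT" using r by (auto simp: renv_def penv_def env_def tabs_def)
    then have d: "den ?init \<sigma> = nwrite ''lab'' 0 M (nwrite ''cur'' 0 (enc Fin) \<sigma>)" by (simp add: FinE_def)
    have "?K (den ?init \<sigma>)" unfolding d by (intro keeps_nwrite keeps_refl) simp_all
    then show "?F (den ?init \<sigma>) \<and> nmem (den ?init \<sigma>) ''rr'' 0 = ?R \<and> nmem (den ?init \<sigma>) ''bb'' 0 = ?R * ?n \<and> nmem (den ?init \<sigma>) ''cur'' 0 = enc Fin \<and> nmem (den ?init \<sigma>) ''lab'' 0 = M \<and> nmem (den ?init \<sigma>) ''nxt'' = nmem \<sigma> ''nxt''"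
      unfolding d using bb rr by simp
  qed (simp_all add: FinE_def)
  \<comment> \<open>\<open>ds\<close> are the labels already processed. The rest of the trace starts
    at the current state in the layer to which \<open>bb\<close> points.\<close>
  let ?I = "\<lambda>k \<tau>. ?F \<tau> \<and> nmem \<tau> ''bb'' 0 = (?R - k) * ?n \<and> nmem \<tau> ''cur'' 0 < ?n \<and> ?L (?R - k) (nmem \<tau> ''cur'' 0) \<noteq> None \<and>
     (\<exists>ds. ls = ds @ ?tr (?R - k) (nmem \<tau> ''cur'' 0) \<and> nmem \<tau> ''lab'' 0 = last (M # ds) \<and> ovr (xarc ` set ds) (nmem \<sigma> ''nxt'') (nmem \<tau> ''nxt''))"
  have 1: "runs (For ''r'' ''rr'' ?c) \<tau> (9 + ?R * (100 + 12)) (\<lambda>\<tau>. ?I ?R \<tau> \<and> nmem \<tau> ''r'' 0 = ?R \<and> nmem \<tau> ''rr'' 0 = ?R)"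
    if t: "?F \<tau> \<and> nmem \<tau> ''rr'' 0 = ?R \<and> nmem \<tau> ''bb'' 0 = ?R * ?n \<and> nmem \<tau> ''cur'' 0 = enc Fin \<and> nmem \<tau> ''lab'' 0 = M \<and> nmem \<tau> ''nxt'' = nmem \<sigma> ''nxt''" for \<tau>
  proof (rule runs_For[where I = ?I])
    have "?F (nwrite ''r'' 0 0 \<tau>)" using t by (auto intro!: keeps_nwrite)
    then show "?I 0 (nwrite ''r'' 0 0 \<tau>)" using t Fin ls by (auto intro!: exI[of _ "[]"])
    show "nmem \<tau> ''rr'' 0 = ?R" using t by simp
  next
    fix k \<sigma>' assume k: "k < ?R" "?I k \<sigma>'" "nmem \<sigma>' ''r'' 0 = k" "nmem \<sigma>' ''rr'' 0 = ?R"
    define u where "u = nmem \<sigma>' ''cur'' 0"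
    define r where "r = ?R - Suc k"
    have rS: "?R - k = Suc r" "Suc r \<le> ?R" using k(1) by (auto simp: r_def)
    obtain ds where ds: "ls = ds @ ?tr (Suc r) u" "nmem \<sigma>' ''lab'' 0 = last (M # ds)" "ovr (xarc ` set ds) (nmem \<sigma> ''nxt'') (nmem \<sigma>' ''nxt'')"
      using k(2) unfolding u_def rS by blast
    have un: "u < ?n" and Lu: "?L (Suc r) u \<noteq> None" and F: "?F \<sigma>'" and b: "nmem \<sigma>' ''bb'' 0 = Suc r * ?n" using k(2) unfolding u_def rS by blast+
    obtain c p where cp: "?L (Suc r) u = Some (c, p)" using Lu by auto
    have pt: "nmem \<sigma>' ''bp'' (nmem \<sigma>' ''bb'' 0 + nmem \<sigma>' ''cur'' 0) = p"
      using rp[OF rS(2)] un cp F unfolding rep_def b u_def[symmetric] by (auto split: option.splits)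
    have nn': "nmem \<sigma>' ''nn'' 0 = ?n" using F nn by simp
    show "runs ?c \<sigma>' 100 (\<lambda>\<tau>. nmem \<tau> ''r'' 0 = k \<and> nmem \<tau> ''rr'' 0 = ?R \<and> ?I (Suc k) (nwrite ''r'' 0 (Suc k) \<tau>))" (is "runs _ _ _ ?Q")
    proof (rule runs_straightI)
      define D where "D = den ?c \<sigma>'"
      define \<rho> where "\<rho> = nwrite ''r'' 0 (Suc k) D"
      have Q: "?Q D" if "nmem D ''r'' 0 = k" "nmem D ''rr'' 0 = ?R" "?F \<rho>" "nmem \<rho> ''bb'' 0 = r * ?n" "nmem \<rho> ''cur'' 0 = f" "f < ?n" "?L r f \<noteq> None"
        "ls = ds @ ?tr r f" "nmem \<rho> ''lab'' 0 = last (M # ds)" "ovr (xarc ` set ds) (nmem \<sigma> ''nxt'') (nmem \<rho> ''nxt'')" for f ds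
        unfolding \<rho>_def[symmetric] r_def[symmetric] by (intro conjI exI[of _ ds]) (use that in simp_all)
      from relaxes_inv[OF cp[unfolded lay.simps]] have "?Q D"
      proof
        assume p: "p = 0 \<and> (\<exists>q. ?L r u = Some (c, q))"
        have d: "D = nwrite ''bb'' 0 (r * ?n) (nwrite ''pt'' 0 0 \<sigma>')" unfolding D_def using pt p b nn' by simp
        have tr: "?tr (Suc r) u = ?tr r u" using cp p by (simp del: lay.simps)
        have K: "?K \<rho>" unfolding \<rho>_def d by (intro keeps_nwrite) (use F in simp_all)
        have Lr: "?L r u \<noteq> None" using p by blast
        show ?thesis by (rule Q[of u ds]) (use F K k(3,4) Lr un ds tr in \<open>simp_all add: \<rho>_def d u_def del: trace.simps\<close>)
      next
        assume "\<exists>q<length tAll. \<exists>f d q' l b. p = Suc q \<and> tAll ! q = (f, u, d, l) \<and> ?L r f = Some (b, q') \<and> c = b + d"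
        then obtain q f d q' l b' where q: "q < length tAll" "p = Suc q" "tAll ! q = (f, u, d, l)" "?L r f = Some (b', q')" by blast
        have inA: "(f, u, d, l) \<in> set tAll" using q by (metis nth_mem)
        have fn: "f < ?n" and lM: "l \<le> M" using tAll_lt[OF inA] tAll_label[OF inA] by auto
        have TL: "nmem \<sigma>' ''TL'' q = l" "nmem \<sigma>' ''TF'' q = f" using tlist_nth[of q \<sigma>] q tl F by auto
        have "renv \<sigma>'" using renv_keeps[OF \<open>renv \<sigma>\<close>, of "{''nxt'', ''cur'', ''lab'', ''pt'', ''r''}" \<sigma>'] F by simp
        then have sd: "nmem \<sigma>' ''src'' l = src l" "nmem \<sigma>' ''dst'' l = dst l" using lM by (auto simp: renv_def penv_def env_def)
        have d: "D = nwrite ''bb'' 0 (r * ?n) (nwrite ''cur'' 0 f (nwrite ''nxt'' (src l) (dst l) (nwrite ''lab'' 0 l (nwrite ''pt'' 0 p \<sigma>'))))"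
          unfolding D_def using pt q(2) b nn' TL sd by simp
        have tr: "?tr (Suc r) u = l # ?tr r f" using cp q by (simp del: lay.simps)
        have o: "ovr (xarc ` set (ds @ [l])) (nmem \<sigma> ''nxt'') ((nmem \<sigma>' ''nxt'')(src l := dst l))" using ovr_upd[OF ds(3)] by simp
        have K: "?K \<rho>" unfolding \<rho>_def d by (intro keeps_nwrite) (use F in simp_all)
        have nx: "nmem \<rho> ''nxt'' = (nmem \<sigma>' ''nxt'')(src l := dst l)" unfolding \<rho>_def d by simp
        show ?thesis
        proof (rule Q[of f "ds @ [l]"])
          show "ovr (xarc ` set (ds @ [l])) (nmem \<sigma> ''nxt'') (nmem \<rho> ''nxt'')" using o unfolding nx .
        qed (use F K k(3,4) q(4) fn ds(1) tr in \<open>simp_all add: \<rho>_def d del: trace.simps\<close>)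
      qed
      then show "?Q (den ?c \<sigma>')" unfolding D_def .
    qed simp_all
  qed simp
  have 2: "runs trace_prog \<sigma> (20 + (9 + ?R * (100 + 12))) (\<lambda>\<tau>. ?I ?R \<tau> \<and> nmem \<tau> ''r'' 0 = ?R \<and> nmem \<tau> ''rr'' 0 = ?R)"
    unfolding trace_prog_def by (rule runs_Seq[OF 0 1])
  show ?thesis
  proof (rule runs_weaken[OF 2])
    show "20 + (9 + ?R * (100 + 12)) \<le> 1000 * N" using NM by simp
    fix \<tau> assume "?I ?R \<tau> \<and> nmem \<tau> ''r'' 0 = ?R \<and> nmem \<tau> ''rr'' 0 = ?R"
    then show "?K \<tau> \<and> nmem \<tau> ''lab'' 0 = last (M # ls) \<and> ovr (xarc ` set ls) (nmem \<sigma> ''nxt'') (nmem \<tau> ''nxt'')" by auto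
  qed
qed

lemma runs_prefix_prog:
  assumes r: "renv \<sigma>" and l: "nmem \<sigma> ''lab'' 0 = l" "l < M"
  shows "runs prefix_prog \<sigma> (200 * N) (\<lambda>\<tau>. keeps {''nxt'', ''r''} \<sigma> \<tau> \<and>
     ovr ((set (arcs_of (chain S (nmem \<sigma> ''prv'') N (src l))))\<inverse>) (nmem \<sigma> ''nxt'') (nmem \<tau> ''nxt''))"
proof -
  define prv where "prv = nmem \<sigma> ''prv''"
  let ?K = "keeps {''nxt'', ''r''} \<sigma>" let ?ch = "chain S prv"
  \<comment> \<open>The chain of predecessors runs against the arcs, hence the converse.\<close>
  let ?A = "\<lambda>k u. (set (arcs_of (?ch k u)))\<inverse>"
  have A0: "?A 0 u = {}" for u by simp
  have AS: "?A (Suc k) u = (if u = S then {} else insert (prv u, u) (?A k (prv u)))" for k u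
    using hd_chain[of S prv k "prv u"] by auto
  let ?c = "Cond (BNot (BEq (NV ''v'') (NV ''S'')))
       (Seq (NWrite ''nxt'' (nrd ''prv'' ''v'') (NV ''v'')) (NSet ''v'' (nrd ''prv'' ''v''))) Skip"
  let ?I = "\<lambda>k \<tau>. ?K \<tau> \<and> (\<exists>D. ?A N (src l) = D \<union> ?A (N - k) (nmem \<tau> ''v'' 0) \<and> ovr D (nmem \<sigma> ''nxt'') (nmem \<tau> ''nxt''))"
  have 0: "runs (NSet ''v'' (nrd ''src'' ''lab'')) \<sigma> 10 (\<lambda>\<tau>. ?K \<tau> \<and> nmem \<tau> ''v'' 0 = src l \<and> nmem \<tau> ''nxt'' = nmem \<sigma> ''nxt'')"
  proof (rule runs_straightI)
    have "nmem \<sigma> ''src'' l = src l" using r l by (auto simp: renv_def penv_def env_def)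
    then show "?K (den (NSet ''v'' (nrd ''src'' ''lab'')) \<sigma>) \<and> nmem (den (NSet ''v'' (nrd ''src'' ''lab'')) \<sigma>) ''v'' 0 = src l \<and> nmem (den (NSet ''v'' (nrd ''src'' ''lab'')) \<sigma>) ''nxt'' = nmem \<sigma> ''nxt''"
      using l by (auto intro!: keeps_nwrite)
  qed simp_all
  have Kr: "renv \<tau>" if "?K \<tau>" for \<tau> by (rule renv_keeps[OF r that]) simp
  have 1: "runs (For ''r'' ''N'' ?c) \<tau> (9 + N * (60 + 12)) (\<lambda>\<tau>. ?I N \<tau> \<and> nmem \<tau> ''r'' 0 = N \<and> nmem \<tau> ''N'' 0 = N)"
    if t: "?K \<tau> \<and> nmem \<tau> ''v'' 0 = src l \<and> nmem \<tau> ''nxt'' = nmem \<sigma> ''nxt''" for \<tau>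
  proof (rule runs_For[where I = ?I])
    have "?K (nwrite ''r'' 0 0 \<tau>)" using t by (auto intro!: keeps_nwrite)
    then show "?I 0 (nwrite ''r'' 0 0 \<tau>)" using t by (auto intro!: exI[of _ "{}"])
    show "nmem \<tau> ''N'' 0 = N" using Kr[of \<tau>] t by (auto simp: renv_def penv_def env_def)
  next
    fix k \<sigma>' assume k: "k < N" "?I k \<sigma>'" "nmem \<sigma>' ''r'' 0 = k" "nmem \<sigma>' ''N'' 0 = N"
    define u where "u = nmem \<sigma>' ''v'' 0"
    have rS: "N - k = Suc (N - Suc k)" using k(1) by simp
    obtain D where D: "?A N (src l) = D \<union> ?A (Suc (N - Suc k)) u" "ovr D (nmem \<sigma> ''nxt'') (nmem \<sigma>' ''nxt'')" using k(2) unfolding rS u_def by blast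
    have K: "?K \<sigma>'" using k by simp
    have S: "nmem \<sigma>' ''S'' 0 = S" using Kr[OF K] by (auto simp: renv_def penv_def env_def)
    have P: "nmem \<sigma>' ''prv'' = prv" using keepsN[OF K, of "''prv''"] by (simp add: prv_def)
    have d: "den ?c \<sigma>' = (if u = S then \<sigma>' else nwrite ''v'' 0 (prv u) (nwrite ''nxt'' (prv u) u \<sigma>'))"
      using S P unfolding u_def by (auto simp: BEq_def)
    show "runs ?c \<sigma>' 60 (\<lambda>\<tau>. nmem \<tau> ''r'' 0 = k \<and> nmem \<tau> ''N'' 0 = N \<and> ?I (Suc k) (nwrite ''r'' 0 (Suc k) \<tau>))" (is "runs _ _ _ ?Q")
    proof (rule runs_straightI)
      have "?K (nwrite ''r'' 0 (Suc k) (den ?c \<sigma>'))" unfolding d using K by (auto intro!: keeps_nwrite)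
      moreover have "nmem (den ?c \<sigma>') ''r'' 0 = k" "nmem (den ?c \<sigma>') ''N'' 0 = N" unfolding d using k by auto
      moreover have "\<exists>D. ?A N (src l) = D \<union> ?A (N - Suc k) (nmem (nwrite ''r'' 0 (Suc k) (den ?c \<sigma>')) ''v'' 0) \<and>
          ovr D (nmem \<sigma> ''nxt'') (nmem (nwrite ''r'' 0 (Suc k) (den ?c \<sigma>')) ''nxt'')"
      proof (cases "u = S")
        case True
        have "?A (N - Suc k) u = {}" using True by (cases "N - Suc k") auto
        then show ?thesis unfolding d using True D AS by (intro exI[of _ D]) (auto simp: u_def[symmetric])
      next
        case False
        then show ?thesis unfolding d using D ovr_upd[OF D(2), of "prv u" u] AS[of "N - Suc k" u]
          by (intro exI[of _ "insert (prv u, u) D"]) auto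
      qed
      ultimately show "?Q (den ?c \<sigma>')" by blast
    qed (simp_all add: BEq_def)
  qed simp
  have 2: "runs prefix_prog \<sigma> (10 + (9 + N * (60 + 12))) (\<lambda>\<tau>. ?I N \<tau> \<and> nmem \<tau> ''r'' 0 = N \<and> nmem \<tau> ''N'' 0 = N)"
    unfolding prefix_prog_def by (rule runs_Seq[OF 0 1])
  show ?thesis
  proof (rule runs_weaken[OF 2])
    show "10 + (9 + N * (60 + 12)) \<le> 200 * N" using NM by simp
    fix \<tau> assume "?I N \<tau> \<and> nmem \<tau> ''r'' 0 = N \<and> nmem \<tau> ''N'' 0 = N"
    then show "?K \<tau> \<and> ovr ((set (arcs_of (chain S (nmem \<sigma> ''prv'') N (src l))))\<inverse>) (nmem \<sigma> ''nxt'') (nmem \<tau> ''nxt'')"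
      unfolding prv_def by auto
  qed
qed

lemma runs_out_prog:
  assumes r: "renv \<sigma>" and s: "nmem \<sigma> ''s'' 0 = hd xs" and t: "nmem \<sigma> ''t'' 0 = last xs"
    and xs: "xs \<noteq> []" "distinct xs" "length xs \<le> N" "\<And>k. Suc k < length xs \<Longrightarrow> nmem \<sigma> ''nxt'' (xs ! k) = xs ! Suc k"
  shows "runs out_prog \<sigma> (200 * N) (\<lambda>\<tau>. result \<tau> = Some xs)"
proof -
  let ?W = "{''r'', ''found'', ''cur'', ''len'', ''fl'', ''path''}"
  let ?K = "keeps ?W \<sigma>"
  let ?init = "Seq (NSet ''found'' (NConst 1)) (Seq (NSet ''cur'' (NV ''s'')) (Seq (NSet ''len'' (NConst 0)) (NSet ''fl'' (NConst 0))))"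
  let ?c = "Cond (NLess (NV ''fl'') (NConst 1))
        (Seq (NWrite ''path'' (NV ''len'') (NV ''cur'')) (Seq (NSet ''len'' (NAdd (NV ''len'') (NConst 1)))
          (Cond (BEq (NV ''cur'') (NV ''t'')) (NSet ''fl'' (NConst 1)) (NSet ''cur'' (nrd ''nxt'' ''cur''))))) Skip"
  let ?I = "\<lambda>k \<tau>. ?K \<tau> \<and> nmem \<tau> ''found'' 0 = 1 \<and> (if k < length xs
    then nmem \<tau> ''fl'' 0 = 0 \<and> nmem \<tau> ''len'' 0 = k \<and> nmem \<tau> ''cur'' 0 = xs ! k \<and> (\<forall>i<k. nmem \<tau> ''path'' i = xs ! i)
    else nmem \<tau> ''fl'' 0 = 1 \<and> nmem \<tau> ''len'' 0 = length xs \<and> (\<forall>i<length xs. nmem \<tau> ''path'' i = xs ! i))"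
  have 0: "runs ?init \<sigma> 20 (?I 0)"
  proof (rule runs_straightI)
    have d: "den ?init \<sigma> = nwrite ''fl'' 0 0 (nwrite ''len'' 0 0 (nwrite ''cur'' 0 (xs ! 0) (nwrite ''found'' 0 1 \<sigma>)))"
      using s xs(1) by (simp add: hd_conv_nth)
    show "?I 0 (den ?init \<sigma>)" unfolding d using xs(1) by (auto intro!: keeps_nwrite)
  qed simp_all
  have 1: "runs (For ''r'' ''N'' ?c) \<tau> (9 + N * (60 + 12)) (\<lambda>\<tau>. ?I N \<tau> \<and> nmem \<tau> ''r'' 0 = N \<and> nmem \<tau> ''N'' 0 = N)" if I: "?I 0 \<tau>" for \<tau>
  proof (rule runs_For[where I = ?I])
    show "?I 0 (nwrite ''r'' 0 0 \<tau>)" using I xs by (auto intro!: keeps_nwrite)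
    have "renv \<tau>" using renv_keeps[OF r, of ?W \<tau>] I by simp
    then show "nmem \<tau> ''N'' 0 = N" by (auto simp: renv_def penv_def env_def)
  next
    fix k \<sigma>' assume k: "k < N" "?I k \<sigma>'" "nmem \<sigma>' ''r'' 0 = k" "nmem \<sigma>' ''N'' 0 = N"
    have K: "?K \<sigma>'" using k(2) by simp
    have t': "nmem \<sigma>' ''t'' 0 = last xs" using keepsN[OF K, of "''t''"] t by simp
    have nx: "nmem \<sigma>' ''nxt'' = nmem \<sigma> ''nxt''" using keepsN[OF K, of "''nxt''"] by simp
    show "runs ?c \<sigma>' 60 (\<lambda>\<tau>. nmem \<tau> ''r'' 0 = k \<and> nmem \<tau> ''N'' 0 = N \<and> ?I (Suc k) (nwrite ''r'' 0 (Suc k) \<tau>))" (is "runs _ _ _ ?Q")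
    proof (rule runs_straightI)
      consider "length xs \<le> k" | "Suc k = length xs" | "Suc k < length xs" by linarith
      then show "?Q (den ?c \<sigma>')"
      proof cases
        case 1
        then have d: "den ?c \<sigma>' = \<sigma>'" using k(2) by simp
        show ?thesis unfolding d using 1 k by (auto intro!: keeps_nwrite)
      next
        case 2
        then have "xs ! k = last xs" using xs(1) by (metis diff_Suc_1 last_conv_nth)
        then have d: "den ?c \<sigma>' = nwrite ''fl'' 0 1 (nwrite ''len'' 0 (Suc k) (nwrite ''path'' k (xs ! k) \<sigma>'))" using k(2) 2 t' by (simp add: BEq_def)
        show ?thesis unfolding d using 2 k by (auto intro!: keeps_nwrite simp: less_Suc_eq)
      next
        case 3
        have "xs ! k \<noteq> last xs" using 3 xs(1,2) by (simp add: last_conv_nth nth_eq_iff_index_eq)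
        then have d: "den ?c \<sigma>' = nwrite ''cur'' 0 (xs ! Suc k) (nwrite ''len'' 0 (Suc k) (nwrite ''path'' k (xs ! k) \<sigma>'))"
          using k(2) 3 t' xs(4)[OF 3] nx by (auto simp: BEq_def)
        show ?thesis unfolding d using 3 k by (auto intro!: keeps_nwrite simp: less_Suc_eq)
      qed
    qed (simp_all add: BEq_def)
  qed simp
  have 2: "runs out_prog \<sigma> (20 + (9 + N * (60 + 12))) (\<lambda>\<tau>. ?I N \<tau> \<and> nmem \<tau> ''r'' 0 = N \<and> nmem \<tau> ''N'' 0 = N)"
    unfolding out_prog_def by (rule runs_Seq[OF 0 1])
  show ?thesis
  proof (rule runs_weaken[OF 2])
    show "20 + (9 + N * (60 + 12)) \<le> 200 * N" using NM by simp
    fix \<tau> assume i: "?I N \<tau> \<and> nmem \<tau> ''r'' 0 = N \<and> nmem \<tau> ''N'' 0 = N"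
    then have "nmem \<tau> ''len'' 0 = length xs" "\<forall>i<length xs. nmem \<tau> ''path'' i = xs ! i" "nmem \<tau> ''found'' 0 = 1" using xs(3) by auto
    then show "result \<tau> = Some xs" by (auto simp: result_def intro: nth_equalityI)
  qed
qed

end

section \<open>Correctness\<close>

lemma arcs_of_snoc: "xs \<noteq> [] \<Longrightarrow> arcs_of (xs @ [y]) = arcs_of xs @ [(last xs, y)]"
  by (simp add: arcs_of_join)

lemma arcs_of_rev: "arcs_of (rev xs) = rev (map prod.swap (arcs_of xs))"
proof (induction xs)
  case (Cons x xs)
  show ?case
  proof (cases xs)
    case (Cons y ys)
    then have "arcs_of (rev xs @ [x]) = arcs_of (rev xs) @ [(y, x)]" by (subst arcs_of_snoc) (auto simp: last_rev)
    then show ?thesis using Cons.IH Cons by simp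
  qed simp
qed simp

lemma set_arcs_of_rev: "set (arcs_of (rev xs)) = (set (arcs_of xs))\<inverse>"
  by (force simp: arcs_of_rev)

lemma walk_rev: "walk (E\<inverse>) a xs b \<longleftrightarrow> walk E b (rev xs) a"
  by (auto simp: walk_def set_arcs_of_rev hd_rev last_rev)

lemma cost_rev: "cost (\<lambda>e. w (prod.swap e)) xs = cost w (rev xs)"
  by (simp add: cost_def arcs_of_rev comp_def sum_list_rev flip: rev_map)

text \<open>The alternative about the length says that the fuel ran out before \<open>z\<close> was
  met. It is later excluded by counting vertices.\<close>

lemma walk_chain:
  assumes "\<And>u. Q u \<Longrightarrow> u \<noteq> z \<Longrightarrow> (u, f u) \<in> R \<and> Q (f u)" "Q u"
  shows "\<exists>v. walk R u (chain z f k u) v \<and> (v = z \<or> length (chain z f k u) = Suc k)"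
  using assms(2)
proof (induction k arbitrary: u)
  case (Suc k)
  show ?case
  proof (cases "u = z")
    case False
    then obtain v where v: "walk R (f u) (chain z f k (f u)) v" "v = z \<or> length (chain z f k (f u)) = Suc k"
      using Suc assms(1) by blast
    obtain xs where "chain z f k (f u) = f u # xs" using hd_chain by blast
    then show ?thesis using v False Suc.prems assms(1)[of u] by (auto simp: walk_Cons2)
  qed simp
qed simp

context machine begin

lemma brun_walk:
  assumes "brun (arclist p q) z v c ls" "\<And>e. e < M \<Longrightarrow> w (p e, q e) = wt e"
  shows "\<exists>W. walk ((\<lambda>e. (p e, q e)) ` {..<M}) z W v \<and> cost w W = c"
  using assms(1)
proof (induction rule: brun.induct)
  case brun_0
  then show ?case by (intro exI[of _ "[z]"]) auto
next
  case (brun_Suc u c ks v d l)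
  then obtain W where W: "walk ((\<lambda>e. (p e, q e)) ` {..<M}) z W u" "cost w W = c" by blast
  have l: "l < M" "u = p l" "v = q l" "d = wt l" using brun_Suc(2) by (auto simp: arclist_def)
  have "walk ((\<lambda>e. (p e, q e)) ` {..<M}) z (W @ [v]) v" by (rule walk_join[OF W(1)]) (use l in auto)
  moreover have "cost w (W @ [v]) = c + d" using W l assms(2)[OF l(1)] by (simp add: cost_join walk_def)
  ultimately show ?case by blast
qed

lemma walk_brun:
  assumes "walk ((\<lambda>e. (p e, q e)) ` {..<M}) z W v" "\<And>e. e < M \<Longrightarrow> w (p e, q e) = wt e"
  shows "\<exists>ls. brun (arclist p q) z v (cost w W) ls \<and> Suc (length ls) = length W"
  using assms(1)
proof (induction W arbitrary: v rule: rev_induct)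
  case (snoc x xs)
  show ?case
  proof (cases "xs = []")
    case True
    then show ?thesis using snoc.prems by (auto intro!: exI[of _ "[]"] brun_0)
  next
    case False
    have a: "walk ((\<lambda>e. (p e, q e)) ` {..<M}) z xs (last xs)" "(last xs, x) \<in> (\<lambda>e. (p e, q e)) ` {..<M}" "x = v"
      using snoc.prems False by (auto simp: walk_def arcs_of_snoc)
    obtain ls where ls: "brun (arclist p q) z (last xs) (cost w xs) ls" "Suc (length ls) = length xs" using snoc.IH[OF a(1)] by blast
    obtain e where e: "e < M" "last xs = p e" "x = q e" using a(2) by auto
    have "(last xs, v, wt e, e) \<in> set (arclist p q)" using e a(3) by (auto simp: arclist_def)
    from brun_Suc[OF ls(1) this] show ?thesis
      using ls(2) e a(3) False assms(2)[OF e(1)] by (intro exI[of _ "e # ls"]) (auto simp: cost_join)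
  qed
qed (simp add: walk_def)

text \<open>With positive weights a walk can be shortened to a path without increasing its cost, and
  a path has at most \<open>N\<close> vertices, so \<open>N\<close> rounds determine the
  distances.\<close>

lemma lay_dist:
  assumes w: "\<And>e. e < M \<Longrightarrow> w (p e, q e) = wt e" "\<And>e. e < M \<Longrightarrow> 0 < wt e" and lt: "\<And>e. e < M \<Longrightarrow> p e < N \<and> q e < N" "z < N"
  defines "E' \<equiv> (\<lambda>e. (p e, q e)) ` {..<M}"
  shows "lay (arclist p q) z N v = Some (c, k) \<Longrightarrow> \<exists>W. walk E' z W v \<and> cost w W = c"
    and "lay (arclist p q) z N v = Some (c, k) \<Longrightarrow> walk E' z W v \<Longrightarrow> c \<le> cost w W"
    and "lay (arclist p q) z N v \<noteq> None \<longleftrightarrow> (z, v) \<in> E'\<^sup>*"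
proof -
  have pos: "\<forall>e\<in>E'. 0 < w e" using w by (auto simp: E'_def)
  have main: "le_opt (lay (arclist p q) z N v) (cost w W)" if W: "walk E' z W v" for W
  proof -
    obtain ys where ys: "path E' z ys v" "cost w ys \<le> cost w W" using walk_to_path[OF W pos] by blast
    have "set ys \<subseteq> {..<N}"
    proof
      fix y assume "y \<in> set ys"
      then have "(z, y) \<in> E'\<^sup>*" using walk_verts_rtrancl[of E' z ys v y] ys(1) unfolding path_def by blast
      then show "y \<in> {..<N}" using lt by (cases rule: rtranclE) (auto simp: E'_def)
    qed
    then have "length ys \<le> N" using ys(1) card_mono[of "{..<N}" "set ys"] unfolding path_def by (simp add: distinct_card)
    moreover obtain ls where "brun (arclist p q) z v (cost w ys) ls" "Suc (length ls) = length ys"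
      using walk_brun[of p q z ys v w] ys(1) w(1) unfolding path_def E'_def by blast
    ultimately have "le_opt (lay (arclist p q) z N v) (cost w ys)" using lay_le[of "arclist p q" z v "cost w ys" ls N] by simp
    then show ?thesis using ys(2) unfolding le_opt_def by force
  qed
  show 1: "\<exists>W. walk E' z W v \<and> cost w W = c" if "lay (arclist p q) z N v = Some (c, k)" for c k
    using brun_walk[OF lay_trace[OF that]] w(1) unfolding E'_def by blast
  show "c \<le> cost w W" if "lay (arclist p q) z N v = Some (c, k)" "walk E' z W v"
    using main[OF that(2)] that(1) by (auto simp: le_opt_def)
  show "lay (arclist p q) z N v \<noteq> None \<longleftrightarrow> (z, v) \<in> E'\<^sup>*"
  proof
    assume "lay (arclist p q) z N v \<noteq> None"
    then show "(z, v) \<in> E'\<^sup>*" using 1 walk_rtrancl by fastforce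
  next
    assume "(z, v) \<in> E'\<^sup>*"
    from rtrancl_path[OF this] obtain W where "walk E' z W v" unfolding path_def by blast
    from main[OF this] show "lay (arclist p q) z N v \<noteq> None" by (auto simp: le_opt_def)
  qed
qed

end

section \<open>Distances in the augmented graph\<close>

locale augmented = machine N M S T src dst wt for N M S T src dst wt +
  fixes E :: "(nat \<times> nat) set" and w :: "nat \<times> nat \<Rightarrow> real"
  assumes E_arcs: "E = (\<lambda>e. (src e, dst e)) ` {..<M}"
    and arcs_inj: "inj_on (\<lambda>e. (src e, dst e)) {..<M}"
    and w_arc: "e < M \<Longrightarrow> w (src e, dst e) = wt e"
    and wt_pos: "e < M \<Longrightarrow> 0 < wt e"
    and S_in: "(u, S) \<notin> E" and T_out: "(T, u) \<notin> E" and S_neq_T: "S \<noteq> T"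
    and S_out: "(S, u) \<in> E \<Longrightarrow> (S, v) \<in> E \<Longrightarrow> u = v" and T_in: "(u, T) \<in> E \<Longrightarrow> (v, T) \<in> E \<Longrightarrow> u = v"
begin

abbreviation hL :: layer where "hL \<equiv> lay (arclist src dst) S N"
abbreviation gL :: layer where "gL \<equiv> lay (arclist dst src) T N"

lemma E_pos: "\<forall>e\<in>E. 0 < w e" using E_arcs w_arc wt_pos by auto

lemma E_lt: "(u, v) \<in> E \<Longrightarrow> u < N \<and> v < N" using E_arcs ends_lt by auto

lemma hL_dist:
  "hL v = Some (c, k) \<Longrightarrow> \<exists>W. walk E S W v \<and> cost w W = c"
  "hL v = Some (c, k) \<Longrightarrow> walk E S W v \<Longrightarrow> c \<le> cost w W"
  "hL v \<noteq> None \<longleftrightarrow> (S, v) \<in> E\<^sup>*"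
  using lay_dist[where p = src and q = dst and z = S and w = w, folded E_arcs] w_arc wt_pos ends_lt ST by blast+

text \<open>Distances to \<open>T\<close> are distances from \<open>T\<close> in the converse graph,
  whose walks are the reversed ones.\<close>

lemma gL_dist:
  "gL v = Some (c, k) \<Longrightarrow> \<exists>W. walk E v W T \<and> cost w W = c"
  "gL v = Some (c, k) \<Longrightarrow> walk E v W T \<Longrightarrow> c \<le> cost w W"
  "gL v \<noteq> None \<longleftrightarrow> (v, T) \<in> E\<^sup>*"
proof -
  have Ei: "(\<lambda>e. (dst e, src e)) ` {..<M} = E\<inverse>" using E_arcs by auto
  note L = lay_dist[where p = dst and q = src and z = T and w = "\<lambda>e. w (prod.swap e)", unfolded Ei walk_rev cost_rev]
  show "gL v = Some (c, k) \<Longrightarrow> \<exists>W. walk E v W T \<and> cost w W = c"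
    using L(1)[of v c k] w_arc wt_pos ends_lt ST by auto
  show "gL v = Some (c, k) \<Longrightarrow> walk E v W T \<Longrightarrow> c \<le> cost w W"
    using L(2)[of v c k "rev W"] w_arc wt_pos ends_lt ST by auto
  show "gL v \<noteq> None \<longleftrightarrow> (v, T) \<in> E\<^sup>*"
    using L(3)[of v] w_arc wt_pos ends_lt ST by (auto simp: rtrancl_converse)
qed

end

locale labelled = augmented N M S T src dst wt E w for N M S T src dst wt E w +
  fixes hh gg :: "nat \<Rightarrow> real" and dE :: "nat \<Rightarrow> bool"
  assumes hh_L: "v < N \<Longrightarrow> hL v = Some (c, k) \<Longrightarrow> hh v = c" and gg_L: "v < N \<Longrightarrow> gL v = Some (c, k) \<Longrightarrow> gg v = c"
    and dE_iff: "e < M \<Longrightarrow> dE e \<longleftrightarrow> hL (src e) \<noteq> None \<and> gL (dst e) \<noteq> None \<and> hL T \<noteq> None \<and> hh (src e) + wt e + gg (dst e) = hh T"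
begin

definition De :: "(nat \<times> nat) set" where "De = (\<lambda>e. (src e, dst e)) ` {e. e < M \<and> dE e}"

lemma hh_walk: "(S, v) \<in> E\<^sup>* \<Longrightarrow> \<exists>W. walk E S W v \<and> cost w W = hh v"
proof -
  assume a: "(S, v) \<in> E\<^sup>*"
  then obtain c k where "hL v = Some (c, k)" using hL_dist(3) by fastforce
  moreover have "v < N" using a E_lt ST by (metis rtranclE)
  ultimately show ?thesis using hL_dist(1) hh_L by blast
qed

lemma hh_le: "walk E S W v \<Longrightarrow> hh v \<le> cost w W"
proof -
  assume a: "walk E S W v"
  then have r: "(S, v) \<in> E\<^sup>*" by (rule walk_rtrancl)
  then obtain c k where "hL v = Some (c, k)" using hL_dist(3) by fastforce
  moreover have "v < N" using r E_lt ST by (metis rtranclE)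
  ultimately show ?thesis using hL_dist(2) hh_L a by blast
qed

lemma gg_walk: "(v, T) \<in> E\<^sup>* \<Longrightarrow> \<exists>W. walk E v W T \<and> cost w W = gg v"
proof -
  assume a: "(v, T) \<in> E\<^sup>*"
  then obtain c k where "gL v = Some (c, k)" using gL_dist(3) by fastforce
  moreover have "v < N" using a E_lt ST by (metis converse_rtranclE)
  ultimately show ?thesis using gL_dist(1) gg_L by blast
qed

lemma gg_le: "walk E v W T \<Longrightarrow> gg v \<le> cost w W"
proof -
  assume a: "walk E v W T"
  then have r: "(v, T) \<in> E\<^sup>*" by (rule walk_rtrancl)
  then obtain c k where "gL v = Some (c, k)" using gL_dist(3) by fastforce
  moreover have "v < N" using r E_lt ST by (metis converse_rtranclE)
  ultimately show ?thesis using gL_dist(2) gg_L a by blast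
qed

lemma hh_gg: "(S, v) \<in> E\<^sup>* \<Longrightarrow> (v, T) \<in> E\<^sup>* \<Longrightarrow> hh T \<le> hh v + gg v"
  using hh_walk[of v] gg_walk[of v] walk_glue[of E S _ v _ T] hh_le by metis

lemma hh_step: "(S, u) \<in> E\<^sup>* \<Longrightarrow> (u, v) \<in> E \<Longrightarrow> hh v \<le> hh u + w (u, v)"
proof -
  assume a: "(S, u) \<in> E\<^sup>*" "(u, v) \<in> E"
  obtain W where W: "walk E S W u" "cost w W = hh u" using hh_walk[OF a(1)] by blast
  have "walk E S (W @ [v]) v" by (rule walk_join[OF W(1)]) (use a in auto)
  from hh_le[OF this] show ?thesis using W by (auto simp: cost_join walk_def)
qed

lemma De_iff: "(u, v) \<in> De \<longleftrightarrow> (u, v) \<in> E \<and> (S, u) \<in> E\<^sup>* \<and> (v, T) \<in> E\<^sup>* \<and> hh u + w (u, v) + gg v = hh T"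
proof
  assume "(u, v) \<in> De"
  then obtain e where e: "e < M" "dE e" "u = src e" "v = dst e" by (auto simp: De_def)
  then show "(u, v) \<in> E \<and> (S, u) \<in> E\<^sup>* \<and> (v, T) \<in> E\<^sup>* \<and> hh u + w (u, v) + gg v = hh T"
    using dE_iff[OF e(1)] hL_dist(3) gL_dist(3) w_arc[OF e(1)] E_arcs by auto
next
  assume a: "(u, v) \<in> E \<and> (S, u) \<in> E\<^sup>* \<and> (v, T) \<in> E\<^sup>* \<and> hh u + w (u, v) + gg v = hh T"
  then obtain e where e: "e < M" "u = src e" "v = dst e" using E_arcs by auto
  have "(S, T) \<in> E\<^sup>*" using a by (meson rtrancl.rtrancl_into_rtrancl rtrancl_trans)
  then have "dE e" using dE_iff[OF e(1)] hL_dist(3) gL_dist(3) w_arc[OF e(1)] a e by auto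
  then show "(u, v) \<in> De" using e by (auto simp: De_def)
qed

lemma De_dE: "e < M \<Longrightarrow> (src e, dst e) \<in> De \<longleftrightarrow> dE e"
proof
  assume e: "e < M" "(src e, dst e) \<in> De"
  then obtain e' where "e' < M" "dE e'" "(src e, dst e) = (src e', dst e')" by (auto simp: De_def)
  then show "dE e" using arcs_inj e(1) by (metis (no_types, lifting) inj_onD lessThan_iff)
qed (auto simp: De_def)

text \<open>Split \<open>W\<close> at an arc from \<open>a\<close> to \<open>b\<close>. Its cost is
  at least \<open>hh a + w (a, b) + gg b\<close>, which is at least \<open>hh b + gg b\<close> and
  so at least \<open>hh T\<close>. As the cost is \<open>hh T\<close>, all of these are equal and
  the arc is tight.\<close>

lemma tight_walk:
  assumes W: "walk E S W T" "cost w W = hh T"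
  shows "set (arcs_of W) \<subseteq> De"
proof
  fix e assume e: "e \<in> set (arcs_of W)"
  then obtain i where i: "Suc i < length W" "e = (W ! i, W ! Suc i)" using in_arcs_of_iff by blast
  let ?a = "W ! i" let ?b = "W ! Suc i"
  have s1: "W = take i W @ ?a # drop (Suc i) W" using i by (simp add: id_take_nth_drop)
  have s2: "drop (Suc i) W = ?b # drop (Suc (Suc i)) W" using i by (simp add: Cons_nth_drop_Suc)
  have w1: "walk E S (take i W @ [?a]) ?a" "walk E ?a (?a # drop (Suc i) W) T" using walk_splitI[of E S "take i W" ?a "drop (Suc i) W" T] W(1) s1 by simp_all
  then have w2: "(?a, ?b) \<in> E" "walk E ?b (drop (Suc i) W) T" unfolding s2 by (auto simp: walk_Cons2)
  have "cost w W = cost w (take i W @ [?a]) + (w (?a, ?b) + cost w (drop (Suc i) W))"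
    using cost_split[of w "take i W" ?a "drop (Suc i) W"] s1 s2 by simp
  moreover have "hh ?a \<le> cost w (take i W @ [?a])" "gg ?b \<le> cost w (drop (Suc i) W)" using hh_le[OF w1(1)] gg_le[OF w2(2)] .
  moreover have r: "(S, ?a) \<in> E\<^sup>*" "(?b, T) \<in> E\<^sup>*" using walk_rtrancl[OF w1(1)] walk_rtrancl[OF w2(2)] .
  moreover have "hh ?b \<le> hh ?a + w (?a, ?b)" using hh_step[OF r(1) w2(1)] .
  moreover have "hh T \<le> hh ?b + gg ?b" using hh_gg[OF _ r(2)] r(1) w2(1) by (meson rtrancl.rtrancl_into_rtrancl)
  ultimately show "e \<in> De" unfolding i(2) De_iff using W(2) w2(1) by auto
qed

sublocale spd E De w hh S T
proof
  show "\<forall>e\<in>E. 0 < w e" by (rule E_pos)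
  show "De \<subseteq> E" using De_iff by auto
  show "hh v = hh u + w (u, v)" if "(u, v) \<in> De" for u v
    using that hh_step[of u v] hh_gg[of v] unfolding De_iff by (force intro: rtrancl.rtrancl_into_rtrancl)
  show "hh v \<le> hh u + w (u, v)" if "(S, u) \<in> E\<^sup>*" "(u, v) \<in> E" for u v using hh_step that .
  have key: "\<exists>W1 W2. walk De S W1 u \<and> walk De v W2 T" if uv: "(u, v) \<in> De" for u v
  proof -
    obtain W1 W2 where 1: "walk E S W1 u" "cost w W1 = hh u" "walk E v W2 T" "cost w W2 = gg v"
      using uv hh_walk gg_walk unfolding De_iff by blast
    have "walk E S (W1 @ W2) T" by (rule walk_join[OF 1(1,3)]) (use uv De_iff in auto)
    moreover have "cost w (W1 @ W2) = hh T" using 1 uv unfolding De_iff by (auto simp: cost_join walk_def)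
    ultimately have "set (arcs_of (W1 @ W2)) \<subseteq> De" by (rule tight_walk)
    then have "set (arcs_of W1) \<subseteq> De" "set (arcs_of W2) \<subseteq> De" using 1 by (auto simp: arcs_of_join walk_def)
    then show ?thesis using 1 unfolding walk_def by blast
  qed
  show "(S, u) \<in> De\<^sup>*" if "(u, v) \<in> De" for u v using key[OF that] walk_rtrancl[of De S _ u] by blast
  show "(v, T) \<in> De\<^sup>*" if "(u, v) \<in> De" for u v using key[OF that] walk_rtrancl[of De v _ T] by blast
  show "(u, S) \<notin> E" "(T, u) \<notin> E" "S \<noteq> T" for u using S_in T_out S_neq_T by auto
  have tw: "\<exists>W. walk E S W T \<and> set (arcs_of W) \<subseteq> De" if "(S, T) \<in> E\<^sup>*"
    using hh_walk[OF that] tight_walk by blast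
  \<comment> \<open>Some shortest walk leaves \<open>S\<close> on an arc of \<open>De\<close>, and
    \<open>S\<close> has only one outgoing arc.\<close>
  show "(S, v) \<in> De" if "(S, T) \<in> E\<^sup>*" "(S, v) \<in> E" for v
  proof -
    have "\<exists>W. walk De S W T" using tw[OF that(1)] unfolding walk_def by blast
    then obtain v' where "(S, v') \<in> De" using S_neq_T walk_rtrancl by (metis converse_rtranclE)
    then show ?thesis using S_out[OF that(2)] De_iff by metis
  qed
  show "(u, T) \<in> De" if "(S, T) \<in> E\<^sup>*" "(u, T) \<in> E" for u
  proof -
    have "\<exists>W. walk De S W T" using tw[OF that(1)] unfolding walk_def by blast
    then obtain v' where "(v', T) \<in> De" using S_neq_T walk_rtrancl by (metis rtranclE)
    then show ?thesis using T_in[OF that(2)] De_iff by metis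
  qed
qed

lemma hh_S: "hh S = 0"
proof -
  obtain W where W: "walk E S W S" "cost w W = hh S" using hh_walk by blast
  have "0 \<le> cost w W" by (rule cost_nonneg) (use W(1) E_pos in \<open>auto simp: walk_def\<close>)
  moreover have "hh S \<le> 0" using hh_le[of "[S]" S] by simp
  ultimately show ?thesis using W(2) by simp
qed

lemma gg_dv: "dv u \<Longrightarrow> gg u = hh T - hh u"
proof -
  assume "dv u"
  then have r: "reach S u" "reach u T" by (auto simp: dv_def)
  have sub: "De\<^sup>* \<subseteq> E\<^sup>*" using De_sub by (rule rtrancl_mono)
  obtain W where W: "walk De u W T" using rtrancl_path[OF r(2)] unfolding path_def by blast
  have "gg u \<le> cost w W" using gg_le walk_mono[OF W De_sub] by blast
  moreover have "cost w W = hh T - hh u" using cost_De[of W] W by (auto simp: walk_def)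
  moreover have "hh T \<le> hh u + gg u" using hh_gg r sub by blast
  ultimately show ?thesis by simp
qed

lemma De_lt: "(u, v) \<in> De \<Longrightarrow> u < N \<and> v < N" using E_lt De_sub by blast

lemma De_walk_length:
  assumes "walk De a xs b" "a < N" shows "length xs \<le> N"
proof -
  have "set xs \<subseteq> {..<N}"
  proof
    fix y assume "y \<in> set xs"
    then have "(a, y) \<in> De\<^sup>*" using walk_verts_rtrancl[OF assms(1)] by blast
    then show "y \<in> {..<N}" using assms(2) De_lt by (metis lessThan_iff rtranclE)
  qed
  then show ?thesis using walk_De_distinct[OF assms(1)] card_mono[of "{..<N}" "set xs"] by (simp add: distinct_card)
qed

lemma dv_lt: "dv u \<Longrightarrow> u < N" unfolding dv_def using De_lt ST by (metis rtranclE)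

text \<open>Every step follows an arc of \<open>De\<close>, so the vertices are distinct; running
  out of fuel would require \<open>N + 1\<close> of them.\<close>

lemma suf_chain:
  assumes "\<And>e. e < M \<Longrightarrow> dE e \<Longrightarrow> \<exists>e'<M. dE e' \<and> src e' = src e \<and> nxt (src e) = dst e'" "dv u"
  shows "walk De u (chain T nxt N u) T"
proof -
  have "\<exists>v. walk De u (chain T nxt N u) v \<and> (v = T \<or> length (chain T nxt N u) = Suc N)"
  proof (rule walk_chain[where Q = dv])
    fix u assume u: "dv u" "u \<noteq> T"
    then obtain v where "(u, v) \<in> De" unfolding dv_def by (metis converse_rtranclE)
    then obtain e where "e < M" "dE e" "u = src e" by (auto simp: De_def)
    then obtain e' where "e' < M" "dE e'" "src e' = u" "nxt u = dst e'" using assms(1) by blast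
    then have "(u, nxt u) \<in> De" unfolding De_def by force
    then show "(u, nxt u) \<in> De \<and> dv (nxt u)" using De_dv by blast
  qed (rule assms(2))
  then show ?thesis using De_walk_length dv_lt[OF assms(2)] by fastforce
qed

lemma pre_chain:
  assumes "\<And>e. e < M \<Longrightarrow> dE e \<Longrightarrow> \<exists>e'<M. dE e' \<and> dst e' = dst e \<and> prv (dst e) = src e'" "dv u"
  shows "walk De S (rev (chain S prv N u)) u"
proof -
  have "\<exists>v. walk (De\<inverse>) u (chain S prv N u) v \<and> (v = S \<or> length (chain S prv N u) = Suc N)"
  proof (rule walk_chain[where Q = dv])
    fix u assume u: "dv u" "u \<noteq> S"
    then obtain v where "(v, u) \<in> De" unfolding dv_def by (metis rtranclE)
    then obtain e where "e < M" "dE e" "u = dst e" by (auto simp: De_def)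
    then obtain e' where "e' < M" "dE e'" "dst e' = u" "prv u = src e'" using assms(1) by blast
    then have "(prv u, u) \<in> De" unfolding De_def by force
    then show "(u, prv u) \<in> De\<inverse> \<and> dv (prv u)" using De_dv by blast
  qed (rule assms(2))
  then obtain v where v: "walk De v (rev (chain S prv N u)) u" "v = S \<or> length (chain S prv N u) = Suc N" unfolding walk_rev by blast
  have "v < N"
  proof -
    have "(v, u) \<in> De\<^sup>*" using walk_rtrancl[OF v(1)] .
    then show ?thesis using dv_lt[OF assms(2)] De_lt by (metis converse_rtranclE)
  qed
  then show ?thesis using De_walk_length[OF v(1)] v by auto
qed

end

section \<open>The computed reachability relation\<close>

context pebbles begin

abbreviation dag :: "(nat \<times> nat) set" where "dag \<equiv> (\<lambda>e. (src e, dst e)) ` {e. e < M \<and> dE e}"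

lemma rlist_cases:
  assumes "(f, t, c, l) \<in> set rlist"
  obtains a where "a < N" "f = N * N" "t = a * N + a"
    | a e where "a < N" "e < M" "dE e" "f = a * N + src e" "t = a * N + dst e"
  using assms unfolding rlist_def by (auto split: if_splits)

lemma brun_rlist:
  "brun rlist (N * N) x c ls \<Longrightarrow> x = N * N \<or> (\<exists>a b. a < N \<and> b < N \<and> x = a * N + b \<and> (a, b) \<in> dag\<^sup>*)"
proof (induction rule: brun.induct)
  case (brun_Suc u c ks v d l)
  from brun_Suc(2) show ?case
  proof (cases rule: rlist_cases)
    case (1 a)
    then show ?thesis by blast
  next
    case (2 a e)
    have e: "src e < N" "dst e < N" using ends_lt[OF 2(2)] by auto
    have "u \<noteq> N * N" using radix_lt[OF 2(1) e(1)] 2(4) by simp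
    then obtain a' b where ab: "a' < N" "b < N" "u = a' * N + b" "(a', b) \<in> dag\<^sup>*" using brun_Suc.IH by blast
    have "a' = a" "b = src e" using radix_inj[of a' N b a "src e"] ab e 2(4) by auto
    moreover have "(src e, dst e) \<in> dag" using 2 by blast
    ultimately have "(a, dst e) \<in> dag\<^sup>*" using ab(4) by (meson rtrancl.rtrancl_into_rtrancl)
    then show ?thesis using 2 e by blast
  qed
qed simp

lemma walk_rlist:
  "walk dag u ys v \<Longrightarrow> u < N \<Longrightarrow> \<exists>ls. brun rlist (N * N) (u * N + v) 0 ls \<and> length ls = length ys"
proof (induction ys arbitrary: v rule: rev_induct)
  case (snoc x xs)
  show ?case
  proof (cases "xs = []")
    case True
    have "(N * N, u * N + u, 0, M) \<in> set rlist" using snoc.prems unfolding rlist_def by auto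
    from brun_Suc[OF brun_0 this] show ?thesis using True snoc.prems by (intro exI[of _ "[M]"]) auto
  next
    case False
    have a: "walk dag u xs (last xs)" "(last xs, x) \<in> dag" "x = v"
      using snoc.prems False by (auto simp: walk_def arcs_of_snoc)
    obtain ls where ls: "brun rlist (N * N) (u * N + last xs) 0 ls" "length ls = length xs" using snoc.IH[OF a(1) snoc.prems(2)] by blast
    obtain e where e: "e < M" "dE e" "last xs = src e" "x = dst e" using a(2) by auto
    have "(u * N + last xs, u * N + v, 0, M) \<in> set rlist" using e a(3) snoc.prems(2) unfolding rlist_def by fastforce
    from brun_Suc[OF ls(1) this] show ?thesis using ls(2) by (intro exI[of _ "M # ls"]) auto
  qed
qed (simp add: walk_def)

lemma rcf_iff:
  assumes "u < N" "v < N" shows "rcf u v \<longleftrightarrow> (u, v) \<in> dag\<^sup>*"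
proof
  assume "rcf u v"
  then obtain c p where "lay rlist (N * N) (N + 1) (u * N + v) = Some (c, p)" unfolding rcf_def by auto
  from brun_rlist[OF lay_trace[OF this]] obtain a b where ab: "a < N" "b < N" "u * N + v = a * N + b" "(a, b) \<in> dag\<^sup>*"
    using radix_lt[OF assms] by auto
  then show "(u, v) \<in> dag\<^sup>*" using radix_inj[of u N v a b] assms by simp
next
  assume "(u, v) \<in> dag\<^sup>*"
  from rtrancl_path[OF this] obtain ys where ys: "walk dag u ys v" "distinct ys" unfolding path_def by blast
  have "set ys \<subseteq> {..<N}"
  proof
    fix y assume "y \<in> set ys"
    then have "(u, y) \<in> dag\<^sup>*" using walk_verts_rtrancl[OF ys(1)] by blast
    then show "y \<in> {..<N}" using assms ends_lt by (cases rule: rtranclE) auto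
  qed
  then have "length ys \<le> N" using ys(2) card_mono[of "{..<N}" "set ys"] by (simp add: distinct_card)
  moreover obtain ls where "brun rlist (N * N) (u * N + v) 0 ls" "length ls = length ys" using walk_rlist[OF ys(1) assms(1)] by blast
  ultimately have "le_opt (lay rlist (N * N) (N + 1) (u * N + v)) 0" using lay_le[of rlist "N * N" "u * N + v" 0 ls "N + 1"] by simp
  then show "rcf u v" unfolding rcf_def le_opt_def by auto
qed

end

section \<open>Cheapest runs and optimal not-shortest paths\<close>

context augmented begin

definition nsp :: "nat list \<Rightarrow> bool" where
  "nsp P \<longleftrightarrow> path E S P T \<and> (\<exists>Q. path E S Q T \<and> cost w Q < cost w P)"

definition answer :: "nat list option \<Rightarrow> bool" where
  "answer r \<longleftrightarrow> (case r of None \<Rightarrow> \<not> (\<exists>P. nsp P)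
     | Some xs \<Rightarrow> nsp (S # xs @ [T]) \<and> (\<forall>P. nsp P \<longrightarrow> cost w (S # xs @ [T]) \<le> cost w P))"

lemma E_walk_lt: "walk E S W v \<Longrightarrow> set W \<subseteq> {..<N}"
proof
  fix y assume "walk E S W v" "y \<in> set W"
  then have "(S, y) \<in> E\<^sup>*" using walk_verts_rtrancl by metis
  then show "y \<in> {..<N}" using ST E_lt by (metis lessThan_iff rtranclE)
qed

lemma path_length: "path E S W v \<Longrightarrow> length W \<le> N"
  using E_walk_lt[of W v] card_mono[of "{..<N}" "set W"] unfolding path_def by (simp add: distinct_card)

lemma finite_paths: "finite {W. path E S W v}"
proof (rule finite_subset)
  show "{W. path E S W v} \<subseteq> {W. set W \<subseteq> {..<N} \<and> length W \<le> N}" using E_walk_lt path_length unfolding path_def by blast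
  show "finite {W. set W \<subseteq> {..<N} \<and> length W \<le> N}" by (rule finite_lists_length_le) simp
qed

end

locale solved = labelled N M S T src dst wt E w hh gg dE + pebbles N M S T src dst wt dE rc hh gg
  for N M S T src dst wt E w hh gg dE rc +
  assumes rc_iff: "u < N \<Longrightarrow> v < N \<Longrightarrow> rc u v \<longleftrightarrow> (u, v) \<in> De\<^sup>*"
begin

lemma dp_inst:
  assumes "\<And>u. dv u \<Longrightarrow> walk De S (pre u) u" "\<And>u. dv u \<Longrightarrow> walk De u (suf u) T"
  shows "dp N M src dst wt dE rc hh gg E De w S T pre suf"
  by unfold_locales (use E_arcs arcs_inj w_arc De_dE ends_lt rc_iff gg_dv hh_S assms in auto)

text \<open>Inside \<open>De\<close> the length telescopes to \<open>hh T\<close>, the minimum.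
  Conversely a path of that length lies in \<open>De\<close> by \<open>tight_walk\<close>.\<close>

lemma nsp_iff: "nsp P \<longleftrightarrow> path E S P T \<and> \<not> set (arcs_of P) \<subseteq> De"
proof (cases "path E S P T")
  case True
  then have W: "walk E S P T" by (simp add: path_def)
  have "(S, T) \<in> E\<^sup>*" using walk_rtrancl[OF W] .
  then obtain W0 where W0: "walk E S W0 T" "cost w W0 = hh T" using hh_walk by blast
  show ?thesis
  proof
    assume n: "nsp P"
    have "cost w P = hh T" if "set (arcs_of P) \<subseteq> De" using cost_De[OF that] W hh_S by (auto simp: walk_def)
    moreover obtain Q where "path E S Q T" "cost w Q < cost w P" using n by (auto simp: nsp_def)
    ultimately show "path E S P T \<and> \<not> set (arcs_of P) \<subseteq> De" using True hh_le[of Q T] unfolding path_def by force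
  next
    assume "path E S P T \<and> \<not> set (arcs_of P) \<subseteq> De"
    then have "cost w P \<noteq> hh T" using tight_walk[OF W] by blast
    then have "hh T < cost w P" using hh_le[OF W] by simp
    moreover obtain Q where "path E S Q T" "cost w Q \<le> cost w W0" using walk_to_path[OF W0(1) E_pos] by blast
    ultimately show "nsp P" using True W0(2) unfolding nsp_def by force
  qed
qed (simp add: nsp_def)

lemma opt_exists:
  assumes "nsp P0"
  shows "\<exists>P. opt E De w hh S T P"
proof -
  let ?A = "{P. nsp P}"
  have fin: "finite ?A" by (rule finite_subset[OF _ finite_paths[of T]]) (auto simp: nsp_def)
  define c where "c = Min (cost w ` ?A)"
  have c: "c \<in> cost w ` ?A" "\<And>P. nsp P \<Longrightarrow> c \<le> cost w P" using fin assms unfolding c_def by (auto intro!: Min_in Min_le)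
  let ?k = "\<lambda>P. card (set (arcs_of P) - De)"
  obtain P1 where "nsp P1 \<and> cost w P1 = c" using c(1) by auto
  then obtain P where P: "nsp P \<and> cost w P = c" "\<And>Q. nsp Q \<and> cost w Q = c \<Longrightarrow> ?k P \<le> ?k Q"
    using ex_has_least_nat[of "\<lambda>P. nsp P \<and> cost w P = c" P1 ?k] by blast
  have "opt E De w hh S T P"
  proof unfold_locales
    show "path E S P T" "\<not> set (arcs_of P) \<subseteq> De" using P(1) unfolding nsp_iff by auto
    fix Q assume "path E S Q T" "\<not> set (arcs_of Q) \<subseteq> De"
    then have Q: "nsp Q" unfolding nsp_iff by simp
    show "cost w P < cost w Q \<or> cost w P = cost w Q \<and> ?k P \<le> ?k Q" using P(1) P(2)[of Q] c(2)[OF Q] Q by fastforce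
  qed
  then show ?thesis by blast
qed

text \<open>An optimal path has at most \<open>N\<close> vertices and is played by a run of at most
  four times that length, which \<open>4 * N\<close> rounds find or undercut.\<close>

lemma complete:
  assumes "nsp P0"
  shows "\<exists>c p. lay tAll (enc Src) (4 * N) (enc Fin) = Some (c, p) \<and> (\<forall>P. nsp P \<longrightarrow> c \<le> cost w P)"
proof -
  obtain P where P: "opt E De w hh S T P" using opt_exists[OF assms] by blast
  \<comment> \<open>Any shortest paths will do here. The ones that the program follows matter only
    for \<open>sound\<close>.\<close>
  have "\<forall>u. \<exists>xs. dv u \<longrightarrow> walk De S xs u" "\<forall>u. \<exists>xs. dv u \<longrightarrow> walk De u xs T"
    using rtrancl_path[of S _ De] rtrancl_path[of _ T De] unfolding dv_def path_def by blast+
  then obtain pre suf where pre: "\<And>u. dv u \<Longrightarrow> walk De S (pre u) u" and suf: "\<And>u. dv u \<Longrightarrow> walk De u (suf u) T" by metis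
  interpret o: dp_opt N M src dst wt dE rc hh gg E De w S T pre suf P
    using dp_inst[of pre suf] pre suf P by (intro dp_opt.intro) auto
  obtain ls where ls: "run Fin (cost w P) ls" "length ls \<le> 4 * length P" using o.run_complete by blast
  have "length P \<le> N" using path_length o.P by blast
  then have "le_opt (lay tAll (enc Src) (4 * N) (enc Fin)) (cost w P)"
    using lay_le[OF run_brun[OF ls(1)], of "4 * N"] ls(2) by simp
  moreover have "cost w P \<le> cost w Q" if "nsp Q" for Q using o.Pmin[of Q] that unfolding nsp_iff by auto
  ultimately show ?thesis unfolding le_opt_def by (meson order_trans)
qed

text \<open>By \<open>complete\<close> no not-shortest path is cheaper than the run that was found,
  which excludes the second alternative of the invariant at \<open>Fin\<close>; so \<open>W\<close>
  is simple and optimal. Its arcs are described in the form in which the program stores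
  successors.\<close>

lemma sound:
  assumes L: "lay tAll (enc Src) (4 * N) (enc Fin) = Some (c, p)"
    and pre: "\<And>u. dv u \<Longrightarrow> walk De S (pre u) u" and suf: "\<And>u. dv u \<Longrightarrow> walk De u (suf u) T"
  defines "ls \<equiv> trace tAll (enc Src) (4 * N) (enc Fin)"
  shows "ls \<noteq> [] \<and> last ls < M \<and> dE (last ls) \<and> (\<exists>W q. nsp W \<and> (\<forall>P. nsp P \<longrightarrow> cost w W \<le> cost w P) \<and> dv q \<and>
    set (arcs_of W) = set (arcs_of (pre (src (last ls)))) \<union> (\<lambda>e. (src e, dst e)) ` (set ls - {M}) \<union> set (arcs_of (suf q)))"
proof -
  interpret d: dp N M src dst wt dE rc hh gg E De w S T pre suf by (rule dp_inst) (use pre suf in auto)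
  have "brun tAll (enc Src) (enc Fin) c ls" unfolding ls_def by (rule lay_trace[OF L])
  then have "run Fin c ls" by (rule brun_run_Fin)
  from d.run_inv[OF this, unfolded d.state_inv.simps] obtain W q where
    ls: "ls \<noteq> [] \<and> last ls < M \<and> dE (last ls)" and
    W: "walk E S W T" "cost w W = c" "dv q" "set (arcs_of W) = d.labset ls \<union> set (arcs_of (suf q))" "\<not> set (arcs_of W) \<subseteq> De" and
    dis: "distinct W \<or> (\<exists>N. path E S N T \<and> \<not> set (arcs_of N) \<subseteq> De \<and> cost w N < c)" by blast
  have min: "c \<le> cost w P" if "nsp P" for P using complete[OF that] L that by auto
  have "distinct W" using dis min unfolding nsp_iff by force
  then have "nsp W" unfolding nsp_iff path_def using W by simp
  then show ?thesis using ls W min unfolding d.labset_def by blast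
qed

end

section \<open>Assembling the program\<close>

definition extract_prog :: com where
  "extract_prog = Seq default_prog (Seq trace_prog (Seq prefix_prog out_prog))"

definition decide_prog :: com where
  "decide_prog = Cond (NLess (NConst 0) (NRead ''bf'' (NAdd (NV ''bb'') FinE))) extract_prog Skip"

definition core_prog :: com where
  "core_prog = Seq (dist_prog ''src'' ''dst'' ''S'' ''hf'' ''h'') (Seq (dist_prog ''dst'' ''src'' ''T'' ''gf'' ''g'')
     (Seq dE_prog (Seq tables_prog (Seq reach_prog (Seq game_prog decide_prog)))))"

lemma arcs_chain: "(a, b) \<in> set (arcs_of (chain z f k u)) \<Longrightarrow> b = f a"
proof (induction k arbitrary: u)
  case (Suc k)
  obtain xs where "chain z f k (f u) = f u # xs" using hd_chain by blast
  then show ?case using Suc.IH[of "f u"] Suc.prems by (auto split: if_splits)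
qed simp

context solved begin

lemma runs_extract_prog:
  assumes g: "genv \<sigma>" and L: "lay tAll (enc Src) (4 * N) (enc Fin) = Some (c, p)"
    and st: "nmem \<sigma> ''s'' 0 = s" "nmem \<sigma> ''t'' 0 = t" "(S, s) \<in> E" "(t, T) \<in> E" "s \<noteq> T"
  shows "runs extract_prog \<sigma> (M * 100 + 2000 * N) (\<lambda>\<tau>. answer (result \<tau>))"
proof -
  define ls where "ls = trace tAll (enc Src) (4 * N) (enc Fin)"
  let ?X = "{''tk'', ''TF'', ''TT'', ''TL'', ''nn'', ''rr'', ''bb'', ''bf'', ''bp''}"
  let ?D = "\<lambda>\<tau>. \<forall>e<M. dE e \<longrightarrow> (\<exists>e'<M. dE e' \<and> src e' = src e \<and> nmem \<tau> ''nxt'' (src e) = dst e') \<and> (\<exists>e'<M. dE e' \<and> dst e' = dst e \<and> nmem \<tau> ''prv'' (dst e) = src e')"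
  have r: "renv \<sigma>" using g by (simp add: genv_def)
  have 1: "runs default_prog \<sigma> (M * 100) (\<lambda>\<tau>. keeps {''nxt'', ''prv''} \<sigma> \<tau> \<and> (\<forall>x\<in>?X. nmem \<tau> x = nmem \<sigma> x) \<and> rmem \<tau> = rmem \<sigma> \<and> ?D \<tau>)"
    by (rule runs_default_prog[OF r])
  have 2: "runs (Seq trace_prog (Seq prefix_prog out_prog)) \<tau> (1000 * N + (200 * N + 200 * N)) (\<lambda>\<tau>. answer (result \<tau>))"
    if t1: "keeps {''nxt'', ''prv''} \<sigma> \<tau>" and t2: "\<forall>x\<in>?X. nmem \<tau> x = nmem \<sigma> x" and t3: "rmem \<tau> = rmem \<sigma>" and t4: "?D \<tau>" for \<tau>
  proof -
    define nxt where "nxt = nmem \<tau> ''nxt''"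
    define prv where "prv = nmem \<tau> ''prv''"
    have tl: "tlist \<tau> = tlist \<sigma>" using t2 t3 by (simp add: tlist_def)
    have rp: "rep \<tau> b n L = rep \<sigma> b n L" for b n L using t2 t3 by (simp add: rep_def cong: option.case_cong)
    have rt: "renv \<tau>" by (rule renv_keeps[OF r t1]) simp
    have gt: "genv \<tau>" using g rt t2 unfolding genv_def tl rp by simp
    \<comment> \<open>\<open>sound\<close> is instantiated with the very paths that the program
      follows along \<open>prv\<close> and \<open>nxt\<close>.\<close>
    let ?pre = "\<lambda>u. rev (chain S prv N u)" let ?suf = "\<lambda>u. chain T nxt N u"
    have pre: "walk De S (?pre u) u" if "dv u" for u by (rule pre_chain) (use t4 that in \<open>auto simp: prv_def\<close>)
    have suf: "walk De u (?suf u) T" if "dv u" for u by (rule suf_chain) (use t4 that in \<open>auto simp: nxt_def\<close>)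
    from sound[OF L, of ?pre ?suf, OF pre suf, folded ls_def] obtain W q where
      ls: "ls \<noteq> []" "last ls < M" "dE (last ls)" and W: "nsp W" "\<And>P. nsp P \<Longrightarrow> cost w W \<le> cost w P" "dv q"
      and arcsW: "set (arcs_of W) = set (arcs_of (?pre (src (last ls)))) \<union> xarc ` (set ls - {M}) \<union> set (arcs_of (?suf q))" by blast
    have pW: "walk E S W T" "distinct W" using W(1) by (auto simp: nsp_def path_def)
    have lenW: "length W \<le> N" using path_length W(1) by (auto simp: nsp_def)
    have Wlt: "v < N" if "v \<in> set W" for v using E_walk_lt[OF pW(1)] that by blast
    obtain W' where W': "W = S # W'" using pW(1) by (cases W) (auto simp: walk_def)
    have "W' \<noteq> []" using pW(1) W' S_neq_T by (auto simp: walk_def)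
    then obtain xs where xs: "W = S # xs @ [T]" using pW(1) W' by (metis append_butlast_last_id last_ConsR walk_def)
    have xne: "xs \<noteq> []"
    proof
      assume "xs = []"
      then have "(S, T) \<in> E" using pW(1) xs by (simp add: walk_def)
      then show False using S_out[OF st(3)] st(5) by blast
    qed
    have "(S, hd xs) \<in> E" "(last xs, T) \<in> E"
    proof -
      have "set (arcs_of (S # xs @ [T])) \<subseteq> E" using pW(1) xs by (simp add: walk_def)
      moreover have "arcs_of (S # xs @ [T]) = arcs_of [S] @ (S, hd xs) # arcs_of xs @ [(last xs, T)]"
        using arcs_of_join[of "[S]" "xs @ [T]"] arcs_of_snoc[OF xne, of T] xne by simp
      ultimately show "(S, hd xs) \<in> E" "(last xs, T) \<in> E" by auto
    qed
    then have hl: "hd xs = s" "last xs = t" using S_out[OF st(3)] T_in[OF st(4)] by blast+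
    have ans: "answer (Some xs)" using W(1,2) xs by (simp add: answer_def)
    have 3: "runs trace_prog \<tau> (1000 * N) (\<lambda>\<rho>. keeps {''nxt'', ''cur'', ''lab'', ''pt'', ''r''} \<tau> \<rho> \<and>
       nmem \<rho> ''lab'' 0 = last (M # ls) \<and> ovr (xarc ` set ls) nxt (nmem \<rho> ''nxt''))"
      unfolding nxt_def by (rule runs_trace_prog[OF gt _ ls_def]) (use L in simp)
    have 4: "runs (Seq prefix_prog out_prog) \<rho> (200 * N + 200 * N) (\<lambda>\<tau>. answer (result \<tau>))"
      if p1: "keeps {''nxt'', ''cur'', ''lab'', ''pt'', ''r''} \<tau> \<rho>" and p2: "nmem \<rho> ''lab'' 0 = last (M # ls)" and p3: "ovr (xarc ` set ls) nxt (nmem \<rho> ''nxt'')" for \<rho>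
    proof (rule runs_Seq)
      have rr: "renv \<rho>" by (rule renv_keeps[OF rt p1]) simp
      have pp: "nmem \<rho> ''prv'' = prv" using keepsN[OF p1, of "''prv''"] by (simp add: prv_def)
      have lab: "nmem \<rho> ''lab'' 0 = last ls" using p2 ls(1) by simp
      show "runs prefix_prog \<rho> (200 * N) (\<lambda>\<upsilon>. keeps {''nxt'', ''r''} \<rho> \<upsilon> \<and> ovr ((set (arcs_of (chain S prv N (src (last ls)))))\<inverse>) (nmem \<rho> ''nxt'') (nmem \<upsilon> ''nxt''))"
        using runs_prefix_prog[OF rr lab ls(2)] unfolding pp .
      fix \<upsilon> assume u: "keeps {''nxt'', ''r''} \<rho> \<upsilon> \<and> ovr ((set (arcs_of (chain S prv N (src (last ls)))))\<inverse>) (nmem \<rho> ''nxt'') (nmem \<upsilon> ''nxt'')"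
      let ?f = "nmem \<upsilon> ''nxt''"
      have o: "ovr (xarc ` set ls \<union> set (arcs_of (?pre (src (last ls))))) nxt ?f"
        using ovr_trans[OF p3] u unfolding set_arcs_of_rev by blast
      \<comment> \<open>An overwritten cell holds an arc of \<open>W\<close>, and \<open>W\<close>
        has only one arc out of each vertex. At any other cell the arc of \<open>W\<close> belongs
        to the suffix, which follows the default successors.\<close>
      have f: "?f a = b" if ab: "(a, b) \<in> set (arcs_of W)" for a b
      proof -
        have aN: "a < N" using Wlt set_arcs_of_subset[OF ab] by blast
        from o consider "(a, ?f a) \<in> xarc ` set ls \<union> set (arcs_of (?pre (src (last ls))))"
          | "\<forall>b. (a, b) \<notin> xarc ` set ls \<union> set (arcs_of (?pre (src (last ls))))" "?f a = nxt a" unfolding ovr_def by blast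
        then show ?thesis
        proof cases
          case 1
          \<comment> \<open>The dummy label \<open>M\<close> affects only cell \<open>N\<close>, and
            \<open>a\<close> is smaller.\<close>
          then have "(a, ?f a) \<in> set (arcs_of W)" unfolding arcsW using aN dummy by auto
          then show ?thesis using distinct_arcs_eq[OF pW(2)] ab by metis
        next
          case 2
          then have "(a, b) \<in> set (arcs_of (?suf q))" using ab unfolding arcsW by blast
          then have "b = nxt a" by (rule arcs_chain)
          then show ?thesis using 2 by simp
        qed
      qed
      have sv: "nmem \<upsilon> ''s'' 0 = s" "nmem \<upsilon> ''t'' 0 = t"
        using st(1,2) keepsN[OF t1, of "''s''"] keepsN[OF t1, of "''t''"] keepsN[OF p1, of "''s''"] keepsN[OF p1, of "''t''"]
          keepsN[OF conjunct1[OF u], of "''s''"] keepsN[OF conjunct1[OF u], of "''t''"] by simp_all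
      have ru: "renv \<upsilon>" by (rule renv_keeps[OF rr conjunct1[OF u]]) simp
      have "runs out_prog \<upsilon> (200 * N) (\<lambda>\<tau>. result \<tau> = Some xs)"
      proof (rule runs_out_prog[OF ru _ _ xne])
        show "nmem \<upsilon> ''s'' 0 = hd xs" "nmem \<upsilon> ''t'' 0 = last xs" using sv hl by auto
        show "distinct xs" "length xs \<le> N" using pW(2) lenW xs by auto
        fix k assume k: "Suc k < length xs"
        have "(xs ! k, xs ! Suc k) \<in> set (arcs_of W)" unfolding in_arcs_of_iff xs using k
          by (intro exI[of _ "Suc k"]) (auto simp: nth_append)
        then show "?f (xs ! k) = xs ! Suc k" by (rule f)
      qed
      then show "runs out_prog \<upsilon> (200 * N) (\<lambda>\<tau>. answer (result \<tau>))" by (rule runs_weaken) (use ans in auto)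
    qed
    show ?thesis by (rule runs_Seq[OF 3]) (use 4 in blast)
  qed
  have "runs extract_prog \<sigma> (M * 100 + (1000 * N + (200 * N + 200 * N))) (\<lambda>\<tau>. answer (result \<tau>))"
    unfolding extract_prog_def by (rule runs_Seq[OF 1]) (use 2 in blast)
  then show ?thesis by (rule runs_weaken) auto
qed

lemma runs_decide_prog:
  assumes g: "genv \<sigma>" and st: "nmem \<sigma> ''s'' 0 = s" "nmem \<sigma> ''t'' 0 = t" "(S, s) \<in> E" "(t, T) \<in> E" "s \<noteq> T"
    and found: "nmem \<sigma> ''found'' 0 = 0"
  shows "runs decide_prog \<sigma> (M * 100 + 2000 * N + 100) (\<lambda>\<tau>. answer (result \<tau>))"
proof -
  let ?b = "NLess (NConst 0) (NRead ''bf'' (NAdd (NV ''bb'') FinE))"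
  let ?L = "lay tAll (enc Src) (4 * N) (enc Fin)"
  have v: "nmem \<sigma> ''TOT'' 0 = TOT" "nmem \<sigma> ''M'' 0 = M" using g by (auto simp: genv_def renv_def penv_def tabs_def env_def)
  have rp: "rep \<sigma> (4 * N * (TOT + M + 2)) (TOT + M + 2) (lay tAll (enc Src) (4 * N))" and bb: "nmem \<sigma> ''bb'' 0 = 4 * N * (TOT + M + 2)"
    using g by (auto simp: genv_def)
  have b: "bval ?b \<sigma> \<longleftrightarrow> ?L \<noteq> None"
    using rp[unfolded rep_def, rule_format, of "enc Fin"] v bb by (auto simp: FinE_def split: option.splits)
  have "runs decide_prog \<sigma> (1 + bcost ?b + (M * 100 + 2000 * N)) (\<lambda>\<tau>. answer (result \<tau>))"
    unfolding decide_prog_def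
  proof (rule runs_Cond)
    assume "bval ?b \<sigma>"
    then obtain c p where "?L = Some (c, p)" using b by auto
    from runs_extract_prog[OF g this st] show "runs extract_prog \<sigma> (M * 100 + 2000 * N) (\<lambda>\<tau>. answer (result \<tau>))" .
  next
    assume "\<not> bval ?b \<sigma>"
    then have "\<not> (\<exists>P. nsp P)" using b complete by force
    then have "answer (result \<sigma>)" using found by (simp add: result_def answer_def)
    then show "runs Skip \<sigma> (M * 100 + 2000 * N) (\<lambda>\<tau>. answer (result \<tau>))"
      by (intro runs_straightI) (use NM in auto)
  qed
  then show ?thesis by (rule runs_weaken) (auto simp: FinE_def)
qed

end

context augmented begin

lemma repd_hh:
  assumes "repd \<sigma> hf h L" "v < N"
  shows "0 < nmem \<sigma> hf v \<longleftrightarrow> L v \<noteq> None" "L v = Some (c, k) \<Longrightarrow> rmem \<sigma> h v = c"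
  using assms unfolding repd_def by (auto split: option.splits)

lemma runs_core_prog:
  assumes e: "env \<sigma>" and st: "nmem \<sigma> ''s'' 0 = s" "nmem \<sigma> ''t'' 0 = t" "(S, s) \<in> E" "(t, T) \<in> E" "s \<noteq> T"
    and found: "nmem \<sigma> ''found'' 0 = 0"
  shows "runs core_prog \<sigma> (9000000 * (M * M * M * N * N * N * N)) (\<lambda>\<tau>. answer (result \<tau>))"
proof -
  let ?io = "\<lambda>\<tau>. nmem \<tau> ''s'' 0 = s \<and> nmem \<tau> ''t'' 0 = t \<and> nmem \<tau> ''found'' 0 = 0"
  have io: "?io \<tau>" if "?io \<rho>" "keeps A \<rho> \<tau>" "A \<inter> {''s'', ''t'', ''found''} = {}" for A \<rho> \<tau>
    using that keepsN[OF that(2), of "''s''"] keepsN[OF that(2), of "''t''"] keepsN[OF that(2), of "''found''"] by auto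
  let ?P1 = "\<lambda>\<tau>. env \<tau> \<and> ?io \<tau> \<and> repd \<tau> ''hf'' ''h'' hL"
  let ?P2 = "\<lambda>\<tau>. ?P1 \<tau> \<and> repd \<tau> ''gf'' ''g'' gL"
  have 1: "runs (dist_prog ''src'' ''dst'' ''S'' ''hf'' ''h'') \<sigma> (1000 * (N + 1) * (N + M + 1)) ?P1"
  proof (rule runs_weaken[OF runs_dist_prog[OF e, of "''src''" src "''dst''" dst "''hf''" "''h''" "''S''" S]])
    fix \<tau> assume t: "keeps {''hf'', ''h''} \<sigma> \<tau> \<and> repd \<tau> ''hf'' ''h'' hL"
    show "?P1 \<tau>" using t env_keeps[OF e, of "{''hf'', ''h''}" \<tau>] io[of \<sigma> "{''hf'', ''h''}" \<tau>] st found by simp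
  qed simp_all
  have 2: "runs (dist_prog ''dst'' ''src'' ''T'' ''gf'' ''g'') \<tau> (1000 * (N + 1) * (N + M + 1)) ?P2" if t: "?P1 \<tau>" for \<tau>
  proof (rule runs_weaken[OF runs_dist_prog[of \<tau> "''dst''" dst "''src''" src "''gf''" "''g''" "''T''" T]])
    fix \<rho> assume u: "keeps {''gf'', ''g''} \<tau> \<rho> \<and> repd \<rho> ''gf'' ''g'' gL"
    then have k: "keeps {''gf'', ''g''} \<tau> \<rho>" by simp
    have "nmem \<rho> ''hf'' = nmem \<tau> ''hf''" "rmem \<rho> ''h'' = rmem \<tau> ''h''" using keepsN[OF k, of "''hf''"] keepsR[OF k, of "''h''"] by simp_all
    then have "repd \<rho> ''hf'' ''h'' hL" using t unfolding repd_def by (simp cong: option.case_cong)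
    then show "?P2 \<rho>" using t u env_keeps[OF _ k] io[OF _ k] by simp
  qed (use t in simp_all)
  have 3: "runs (Seq dE_prog (Seq tables_prog (Seq reach_prog (Seq game_prog decide_prog)))) \<tau>
      (M * 200 + (300 * (N + M + 1) + (1000000 * (N * N * N * M) + (7000000 * (M * M * M * N * N * N * N) + (M * 100 + 2000 * N + 100)))))
      (\<lambda>\<tau>. answer (result \<tau>))" if t: "?P2 \<tau>" for \<tau>
  proof -
    define hh where "hh = rmem \<tau> ''h''"
    define gg where "gg = rmem \<tau> ''g''"
    define dE where "dE = tight \<tau>"
    interpret labelled N M S T src dst wt E w hh gg dE
    proof
      fix v c k assume "v < N"
      then show "hL v = Some (c, k) \<Longrightarrow> hh v = c" "gL v = Some (c, k) \<Longrightarrow> gg v = c"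
        using t repd_hh(2)[of \<tau> "''hf''" "''h''" hL v c k] repd_hh(2)[of \<tau> "''gf''" "''g''" gL v c k] by (simp_all add: hh_def gg_def)
    next
      fix e assume "e < M"
      then show "dE e \<longleftrightarrow> hL (src e) \<noteq> None \<and> gL (dst e) \<noteq> None \<and> hL T \<noteq> None \<and> hh (src e) + wt e + gg (dst e) = hh T"
        using t repd_hh(1)[of \<tau> "''hf''" "''h''" hL] repd_hh(1)[of \<tau> "''gf''" "''g''" gL] ends_lt[of e] ST
        unfolding dE_def tight_def hh_def gg_def by auto
    qed
    \<comment> \<open>\<open>rcf\<close> does not depend on the relation \<open>rc\<close> of the
      locale. A dummy relation makes \<open>rcf\<close> available, which then serves as the relation
      of \<open>solved\<close>.\<close>
    interpret q: pebbles N M S T src dst wt dE "\<lambda>_ _. False" hh gg by unfold_locales (use ends_lt in auto)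
    interpret solved N M S T src dst wt E w hh gg dE q.rcf
    proof unfold_locales
      show "q.rcf u v \<longleftrightarrow> (u, v) \<in> De\<^sup>*" if "u < N" "v < N" for u v using q.rcf_iff[OF that] unfolding De_def .
    qed
    let ?Q1 = "\<lambda>\<rho>. env \<rho> \<and> ?io \<rho> \<and> (\<forall>e<M. nmem \<rho> ''dE'' e = (if dE e then 1 else 0)) \<and> rmem \<rho> ''h'' = hh \<and> rmem \<rho> ''g'' = gg"
    have 4: "runs dE_prog \<tau> (M * 200) ?Q1"
    proof (rule runs_weaken[OF runs_dE_prog])
      fix \<rho> assume u: "keeps {''dE''} \<tau> \<rho> \<and> (\<forall>e<M. nmem \<rho> ''dE'' e = (if tight \<tau> e then 1 else 0))"
      then have k: "keeps {''dE''} \<tau> \<rho>" by simp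
      show "?Q1 \<rho>" using t u env_keeps[OF _ k] io[OF _ k] keepsR[OF k, of "''h''"] keepsR[OF k, of "''g''"] by (simp add: dE_def hh_def gg_def)
    qed (use t in simp_all)
    let ?Q2 = "\<lambda>\<rho>. q.penv \<rho> \<and> ?io \<rho>"
    have 5: "runs tables_prog \<rho> (300 * (N + M + 1)) ?Q2" if u: "?Q1 \<rho>" for \<rho>
    proof (rule runs_weaken[OF q.runs_tables_prog])
      fix \<upsilon> assume x: "keeps q.tabnames \<rho> \<upsilon> \<and> q.tabs \<upsilon>"
      then have k: "keeps q.tabnames \<rho> \<upsilon>" by simp
      have "nmem \<upsilon> ''dE'' = nmem \<rho> ''dE''" "rmem \<upsilon> ''h'' = hh" "rmem \<upsilon> ''g'' = gg"
        using u keepsN[OF k, of "''dE''"] keepsR[OF k, of "''h''"] keepsR[OF k, of "''g''"] by simp_all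
      then show "?Q2 \<upsilon>" using x u env_keeps[OF _ k] io[OF _ k] unfolding q.penv_def by simp
    qed (use u in \<open>simp_all add: env_def\<close>)
    let ?Q3 = "\<lambda>\<rho>. renv \<rho> \<and> ?io \<rho>"
    have 6: "runs reach_prog \<rho> (1000000 * (N * N * N * M)) ?Q3" if u: "?Q2 \<rho>" for \<rho>
    proof (rule runs_weaken[OF q.runs_reach_prog])
      fix \<upsilon> assume x: "keeps {''rc''} \<rho> \<upsilon> \<and> (\<forall>u<N. \<forall>v<N. nmem \<upsilon> ''rc'' (u * N + v) = (if q.rcf u v then 1 else 0))"
      then have k: "keeps {''rc''} \<rho> \<upsilon>" by simp
      show "?Q3 \<upsilon>" using x u q.penv_keeps[OF _ k] io[OF _ k] unfolding renv_def by simp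
    qed (use u in simp_all)
    let ?Q4 = "\<lambda>\<rho>. genv \<rho> \<and> ?io \<rho>"
    have 7: "runs game_prog \<rho> (7000000 * (M * M * M * N * N * N * N)) ?Q4" if u: "?Q3 \<rho>" for \<rho>
    proof (rule runs_weaken[OF runs_game_prog])
      fix \<upsilon> assume x: "keeps {} \<rho> \<upsilon> \<and> genv \<upsilon>"
      then show "?Q4 \<upsilon>" using u io[of \<rho> "{}" \<upsilon>] by simp
    qed (use u in simp_all)
    have 8: "runs decide_prog \<rho> (M * 100 + 2000 * N + 100) (\<lambda>\<tau>. answer (result \<tau>))" if u: "?Q4 \<rho>" for \<rho>
      by (rule runs_decide_prog) (use u st in simp_all)
    show ?thesis by (rule runs_Seq[OF 4], rule runs_Seq[OF 5], assumption, rule runs_Seq[OF 6], assumption, rule runs_Seq[OF 7], assumption, erule 8)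
  qed
  let ?A = "M * M * M * N * N * N * N"
  have 9: "runs core_prog \<sigma> (1000 * (N + 1) * (N + M + 1) + (1000 * (N + 1) * (N + M + 1) + (M * 200 + (300 * (N + M + 1) + (1000000 * (N * N * N * M) + (7000000 * ?A + (M * 100 + 2000 * N + 100)))))))
      (\<lambda>\<tau>. answer (result \<tau>))"
    unfolding core_prog_def by (rule runs_Seq[OF 1], rule runs_Seq[OF 2], assumption, erule 3)
  have N1: "1 \<le> N" "1 \<le> M" using NM by auto
  have "N * 1 * (M * 1) \<le> N * (N * N * N) * (M * (M * M))" using N1 by (intro mult_le_mono order_refl) auto
  then have a1: "N * M \<le> ?A" by (simp add: algebra_simps)
  have "N * N * (1 * 1) * (M * 1) \<le> N * N * (N * N) * (M * (M * M))" using N1 by (intro mult_le_mono order_refl) auto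
  then have a2: "N * N * M \<le> ?A" by (simp add: algebra_simps)
  have "N * N * (N * 1) * (M * 1) \<le> N * N * (N * N) * (M * (M * M))" using N1 by (intro mult_le_mono order_refl) auto
  then have a3: "N * N * N * M \<le> ?A" by (simp add: algebra_simps)
  have a4: "M \<le> ?A" "N \<le> ?A" "1 \<le> ?A" using order_trans[OF _ a1] N1 by auto
  have "(N + 1) * (N + M + 1) \<le> (2 * N) * (3 * (N * M))"
  proof (rule mult_le_mono)
    have "N \<le> N * M" "M \<le> N * M" "1 \<le> N * M" using N1 by auto
    then show "N + M + 1 \<le> 3 * (N * M)" by linarith
  qed (use N1 in simp)
  also have "\<dots> = 6 * (N * N * M)" by simp
  also have "\<dots> \<le> 6 * ?A" using a2 by simp
  finally have a5: "(N + 1) * (N + M + 1) \<le> 6 * ?A" .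
  have ar: "1000 * x + (1000 * x + (m * 200 + (300 * (n + m + 1) + (1000000 * y + (7000000 * A + (m * 100 + 2000 * n + 100)))))) \<le> 9000000 * A"
    if "x \<le> 6 * A" "m \<le> A" "n \<le> A" "1 \<le> A" "y \<le> A" for x m n y A :: nat
  proof -
    have "1000 * x + (1000 * x + (m * 200 + (300 * (n + m + 1) + (1000000 * y + (7000000 * A + (m * 100 + 2000 * n + 100)))))) =
      2000 * x + 600 * m + 2300 * n + 1000000 * y + 7000000 * A + 400 * 1" by simp
    also have "\<dots> \<le> 2000 * (6 * A) + 600 * A + 2300 * A + 1000000 * A + 7000000 * A + 400 * A"
      using that by (intro add_mono mult_le_mono2) auto
    also have "\<dots> = 8015300 * A" by simp
    also have "\<dots> \<le> 9000000 * A" by (rule mult_le_mono1) simp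
    finally show ?thesis .
  qed
  show ?thesis by (rule runs_weaken[OF 9[unfolded mult.assoc[of 1000]] ar[OF a5 a4 a3]])
qed

end

section \<open>Walks of the library as lists of vertices\<close>

lemma pawalk_verts_arcs_of:
  "pcas u p v \<Longrightarrow> arcs_of (pawalk_verts u p) = p \<and> hd (pawalk_verts u p) = u \<and> last (pawalk_verts u p) = v \<and> pawalk_verts u p \<noteq> []"
proof (induction p arbitrary: u)
  case (Cons e p)
  obtain a b where e: "e = (a, b)" by (cases e)
  from Cons have "arcs_of (pawalk_verts b p) = p \<and> hd (pawalk_verts b p) = b \<and> last (pawalk_verts b p) = v \<and> pawalk_verts b p \<noteq> []" using e by auto
  then show ?case using Cons.prems e by (cases "pawalk_verts b p") auto
qed simp

lemma arcs_of_pawalk_verts: "xs \<noteq> [] \<Longrightarrow> pawalk_verts (hd xs) (arcs_of xs) = xs \<and> pcas (hd xs) (arcs_of xs) (last xs)"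
  by (induction xs rule: arcs_of.induct) auto

context pair_wf_digraph begin

lemma apath_path: "apath u p v \<Longrightarrow> path (parcs G) u (pawalk_verts u p) v \<and> arcs_of (pawalk_verts u p) = p"
  using pawalk_verts_arcs_of[of u p v] unfolding apath_def awalk_def path_def walk_def by auto

lemma path_apath: "path (parcs G) u xs v \<Longrightarrow> u \<in> pverts G \<Longrightarrow> apath u (arcs_of xs) v \<and> pawalk_verts u (arcs_of xs) = xs"
  using arcs_of_pawalk_verts[of xs] unfolding apath_def awalk_def path_def walk_def by auto

text \<open>A value exceeds an infimum iff it exceeds a member, so no minimum has to be
  exhibited.\<close>

lemma not_shortest_iff:
  "not_shortest_path w u p v \<longleftrightarrow> apath u p v \<and> (\<exists>q. apath u q v \<and> awalk_cost w q < awalk_cost w p)"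
  unfolding not_shortest_path_def path_dist_def by (auto simp: INF_less_iff)

end

text \<open>
  The only real constant of the machine is \<open>0\<close>, so the two new arcs get the weight of arc \<open>0\<close>. Arc \<open>M\<close>
  is a dummy that absorbs the writes caused by label \<open>M\<close>.
\<close>

definition setup_prog :: com where
  "setup_prog = Seq (NSet ''N'' (NAdd (NV ''n'') (NConst 2))) (Seq (NSet ''M'' (NAdd (NV ''m'') (NConst 2)))
     (Seq (NSet ''S'' (NV ''n'')) (Seq (NSet ''T'' (NAdd (NV ''n'') (NConst 1)))
     (Seq (NWrite ''src'' (NV ''m'') (NV ''n'')) (Seq (NWrite ''dst'' (NV ''m'') (NV ''s'')) (Seq (RWrite ''wt'' (NV ''m'') (RRead ''wt'' (NConst 0)))
     (Seq (NWrite ''src'' (NAdd (NV ''m'') (NConst 1)) (NV ''t'')) (Seq (NWrite ''dst'' (NAdd (NV ''m'') (NConst 1)) (NAdd (NV ''n'') (NConst 1)))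
     (Seq (RWrite ''wt'' (NAdd (NV ''m'') (NConst 1)) (RRead ''wt'' (NConst 0)))
     (Seq (NWrite ''src'' (NV ''M'') (NV ''N'')) (NWrite ''dst'' (NV ''M'') (NV ''N''))))))))))))"

text \<open>Without arcs there is no weight to copy to the two new arcs. The empty path is then the
  only possible one, and the untouched output means that the answer is \<open>None\<close>.\<close>

definition main_prog :: com where
  "main_prog = Cond (NLess (NConst 0) (NV ''m'')) (Seq setup_prog core_prog) Skip"

section \<open>The input with source and sink added\<close>

locale input =
  fixes n :: nat and es :: "(nat \<times> nat) list" and w :: "nat \<times> nat \<Rightarrow> real" and s t :: nat
  assumes es_lt: "(u, v) \<in> set es \<Longrightarrow> u < n \<and> v < n" and st_lt: "s < n" "t < n"
    and es_dist: "distinct es" and es_ne: "es \<noteq> []" and w_pos: "e \<in> set es \<Longrightarrow> 0 < w e"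
begin

abbreviation m :: nat where "m \<equiv> length es"

definition src :: "nat \<Rightarrow> nat" where
  "src e = (if e < m then fst (es ! e) else if e = m then n else if e = m + 1 then t else n + 2)"
definition dst :: "nat \<Rightarrow> nat" where
  "dst e = (if e < m then snd (es ! e) else if e = m then s else if e = m + 1 then n + 1 else n + 2)"
definition wt :: "nat \<Rightarrow> real" where "wt e = (if e < m then w (es ! e) else w (es ! 0))"
definition E :: "(nat \<times> nat) set" where "E = set es \<union> {(n, s), (t, n + 1)}"
definition w' :: "nat \<times> nat \<Rightarrow> real" where "w' e = (if fst e = n \<or> snd e = n + 1 then w (es ! 0) else w e)"

lemma arc_old: "e < m \<Longrightarrow> (src e, dst e) = es ! e" by (simp add: src_def dst_def)

lemma arcs_range: "E = (\<lambda>e. (src e, dst e)) ` {..<m + 2}"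
proof -
  have "{..<m + 2} = {..<m} \<union> {m, m + 1}" by auto
  moreover have "(\<lambda>e. (src e, dst e)) ` {..<m} = set es"
    unfolding set_conv_nth by (auto simp: arc_old image_iff)
  ultimately show ?thesis unfolding E_def by (auto simp: src_def dst_def image_Un)
qed

lemma arcs_inj0: "inj_on (\<lambda>e. (src e, dst e)) {..<m + 2}"
proof (rule inj_onI)
  fix a b assume ab: "a \<in> {..<m + 2}" "b \<in> {..<m + 2}" "(src a, dst a) = (src b, dst b)"
  have old: "src e < n \<and> dst e < n" if "e < m" for e
    using es_lt[of "fst (es ! e)" "snd (es ! e)"] that nth_mem[OF that] by (simp add: src_def dst_def)
  consider "a < m" "b < m" | "a < m" "b \<ge> m" | "a \<ge> m" "b < m" | "a \<ge> m" "b \<ge> m" by linarith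
  then show "a = b"
  proof cases
    case 1
    then have "es ! a = es ! b" using ab(3) by (simp add: arc_old)
    then show ?thesis using 1 es_dist nth_eq_iff_index_eq by blast
  next
    case 2
    then have "b = m \<or> b = m + 1" using ab(2) by auto
    then show ?thesis using old[of a] 2 ab(3) by (auto simp: src_def dst_def)
  next
    case 3
    then have "a = m \<or> a = m + 1" using ab(1) by auto
    then show ?thesis using old[of b] 3 ab(3)[symmetric] st_lt by (auto simp: src_def dst_def)
  next
    case 4
    then have "a = m \<or> a = m + 1" "b = m \<or> b = m + 1" using ab by auto
    then show ?thesis using ab(3) st_lt by (auto simp: src_def dst_def)
  qed
qed

lemma augmented: "augmented (n + 2) (m + 2) n (n + 1) src dst wt E w'"
proof
  have n1: "1 \<le> n" "1 \<le> m" using st_lt es_ne by (auto simp: Suc_le_eq)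
  then show "3 \<le> n + 2" "3 \<le> m + 2" "n < n + 2" "n + 1 < n + 2" by auto
  show "src e < n + 2 \<and> dst e < n + 2" if "e < m + 2" for e
    using es_lt[of "fst (es ! e)" "snd (es ! e)"] that nth_mem[of e es] st_lt by (auto simp: src_def dst_def)
  show "src (m + 2) = n + 2" "dst (m + 2) = n + 2" by (auto simp: src_def dst_def)
  show "E = (\<lambda>e. (src e, dst e)) ` {..<m + 2}" by (rule arcs_range)
  show "inj_on (\<lambda>e. (src e, dst e)) {..<m + 2}" by (rule arcs_inj0)
  show "w' (src e, dst e) = wt e" if "e < m + 2" for e
    using es_lt[of "fst (es ! e)" "snd (es ! e)"] that nth_mem[of e es] st_lt by (auto simp: src_def dst_def wt_def w'_def)
  show "0 < wt e" if "e < m + 2" for e using w_pos[OF nth_mem[of e es]] w_pos[OF nth_mem[of 0 es]] es_ne by (auto simp: wt_def)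
  have old: "(u, n) \<notin> set es" "(n, u) \<notin> set es" "(u, Suc n) \<notin> set es" "(Suc n, u) \<notin> set es" for u
    using es_lt[of u n] es_lt[of n u] es_lt[of u "Suc n"] es_lt[of "Suc n" u] by auto
  show "(u, n) \<notin> E" "(n + 1, u) \<notin> E" "n \<noteq> n + 1" for u using old[of u] st_lt by (auto simp: E_def)
  show "u = v" if "(n, u) \<in> E" "(n, v) \<in> E" for u v using that old[of u] old[of v] st_lt by (auto simp: E_def)
  show "u = v" if "(u, n + 1) \<in> E" "(v, n + 1) \<in> E" for u v using that old[of u] old[of v] st_lt by (auto simp: E_def)
qed

sublocale augmented "n + 2" "m + 2" n "n + 1" src dst wt E w' by (rule augmented)

lemma cost_old: "set (arcs_of xs) \<subseteq> set es \<Longrightarrow> cost w' xs = cost w xs"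
proof -
  assume a: "set (arcs_of xs) \<subseteq> set es"
  have "w' e = w e" if "e \<in> set (arcs_of xs)" for e
    using a that es_lt[of "fst e" "snd e"] by (auto simp: w'_def)
  then show ?thesis unfolding cost_def by (metis map_cong)
qed

text \<open>Every path gains the same length by the extension, so comparisons of lengths carry
  over.\<close>

lemma path_ext:
  assumes "path (set es) s xs t"
  shows "path E n (n # xs @ [n + 1]) (n + 1)" "cost w' (n # xs @ [n + 1]) = cost w xs + 2 * w (es ! 0)"
proof -
  have x: "xs \<noteq> []" "hd xs = s" "last xs = t" "set (arcs_of xs) \<subseteq> set es" "distinct xs" using assms by (auto simp: path_def walk_def)
  have arcs: "arcs_of (n # xs @ [n + 1]) = (n, s) # arcs_of xs @ [(t, n + 1)]"
    using arcs_of_join[of "[n]" "xs @ [n + 1]"] arcs_of_snoc[OF x(1), of "n + 1"] x by simp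
  have "set xs \<subseteq> {..<n}"
  proof
    fix v assume "v \<in> set xs"
    then have "(s, v) \<in> (set es)\<^sup>*" using walk_verts_rtrancl assms unfolding path_def by metis
    then show "v \<in> {..<n}" using es_lt st_lt by (metis lessThan_iff rtranclE)
  qed
  then show "path E n (n # xs @ [n + 1]) (n + 1)" using x arcs unfolding path_def walk_def E_def by auto
  show "cost w' (n # xs @ [n + 1]) = cost w xs + 2 * w (es ! 0)"
    using cost_old[OF x(4)] unfolding cost_def arcs by (simp add: w'_def)
qed

lemma path_int:
  assumes "path E n P (n + 1)"
  shows "\<exists>xs. P = n # xs @ [n + 1] \<and> path (set es) s xs t"
proof -
  have P: "P \<noteq> []" "hd P = n" "last P = n + 1" "set (arcs_of P) \<subseteq> E" "distinct P" using assms by (auto simp: path_def walk_def)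
  obtain P' where P': "P = n # P'" using P by (cases P) auto
  have "P' \<noteq> []" using P P' by auto
  then obtain xs where xs: "P = n # xs @ [n + 1]" using P P' by (metis append_butlast_last_id last_ConsR)
  have sub: "set (arcs_of (n # xs @ [n + 1])) \<subseteq> E" using P(4) xs by simp
  have xne: "xs \<noteq> []"
  proof
    assume "xs = []"
    then have "(n, n + 1) \<in> E" using sub by simp
    then show False using es_lt st_lt by (auto simp: E_def)
  qed
  have arcs: "arcs_of (n # xs @ [n + 1]) = (n, hd xs) # arcs_of xs @ [(last xs, n + 1)]"
    using arcs_of_join[of "[n]" "xs @ [n + 1]"] arcs_of_snoc[OF xne, of "n + 1"] xne by simp
  have nx: "n \<notin> set xs" "n + 1 \<notin> set xs" "distinct xs" using P(5) xs by auto
  have "(n, hd xs) \<in> E" "(last xs, n + 1) \<in> E" using sub arcs by auto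
  then have "hd xs = s" "last xs = t" using es_lt[of n "hd xs"] es_lt[of "last xs" "n + 1"] st_lt unfolding E_def by auto
  moreover have "set (arcs_of xs) \<subseteq> set es"
  proof
    fix e assume e: "e \<in> set (arcs_of xs)"
    obtain a b where ab: "e = (a, b)" by (cases e)
    have "a \<in> set xs" "b \<in> set xs" using set_arcs_of_subset[of a b xs] e ab by auto
    then have "a \<noteq> n" "b \<noteq> n + 1" using nx by auto
    moreover have "(a, b) \<in> E" using e ab sub arcs by auto
    ultimately show "e \<in> set es" using ab by (auto simp: E_def)
  qed
  ultimately show ?thesis using xs xne nx by (auto simp: path_def walk_def)
qed

lemma nsp_ext:
  "nsp P \<longleftrightarrow> (\<exists>xs. P = n # xs @ [n + 1] \<and> path (set es) s xs t \<and> (\<exists>ys. path (set es) s ys t \<and> cost w ys < cost w xs))"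
proof
  assume "nsp P"
  then obtain Q where PQ: "path E n P (n + 1)" "path E n Q (n + 1)" "cost w' Q < cost w' P" unfolding nsp_def by blast
  obtain xs ys where x: "P = n # xs @ [n + 1]" "path (set es) s xs t" "Q = n # ys @ [n + 1]" "path (set es) s ys t"
    using path_int[OF PQ(1)] path_int[OF PQ(2)] by blast
  have "cost w ys < cost w xs" using PQ(3) path_ext(2)[OF x(2)] path_ext(2)[OF x(4)] x(1,3) by simp
  then show "\<exists>xs. P = n # xs @ [n + 1] \<and> path (set es) s xs t \<and> (\<exists>ys. path (set es) s ys t \<and> cost w ys < cost w xs)" using x by blast
next
  assume "\<exists>xs. P = n # xs @ [n + 1] \<and> path (set es) s xs t \<and> (\<exists>ys. path (set es) s ys t \<and> cost w ys < cost w xs)"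
  then obtain xs ys where x: "P = n # xs @ [n + 1]" "path (set es) s xs t" "path (set es) s ys t" "cost w ys < cost w xs" by blast
  then show "nsp P" using path_ext[OF x(2)] path_ext[OF x(3)] unfolding nsp_def by (metis add_less_cancel_right)
qed

lemma runs_setup_prog:
  "runs setup_prog (input_state n es w s t) 100 (\<lambda>\<tau>. env \<tau> \<and> nmem \<tau> ''s'' 0 = s \<and> nmem \<tau> ''t'' 0 = t \<and> nmem \<tau> ''found'' 0 = 0)"
proof (rule runs_straightI)
  let ?\<sigma> = "input_state n es w s t"
  have i: "nmem ?\<sigma> ''n'' 0 = n" "nmem ?\<sigma> ''m'' 0 = m" "nmem ?\<sigma> ''s'' 0 = s" "nmem ?\<sigma> ''t'' 0 = t" "nmem ?\<sigma> ''found'' 0 = 0"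
    "\<And>e. e < m \<Longrightarrow> nmem ?\<sigma> ''src'' e = fst (es ! e)" "\<And>e. e < m \<Longrightarrow> nmem ?\<sigma> ''dst'' e = snd (es ! e)" "\<And>e. e < m \<Longrightarrow> rmem ?\<sigma> ''wt'' e = w (es ! e)"
    by (simp_all add: input_state_def array_def)
  define \<sigma> where "\<sigma> = ?\<sigma>"
  have w0: "rmem \<sigma> ''wt'' 0 = w (es ! 0)" using i(8)[of 0] es_ne by (simp add: \<sigma>_def)
  have m0: "m \<noteq> 0" using es_ne by simp
  have d: "den setup_prog \<sigma> = nwrite ''dst'' (m + 2) (n + 2) (nwrite ''src'' (m + 2) (n + 2) (rwrite ''wt'' (m + 1) (w (es ! 0)) (nwrite ''dst'' (m + 1) (n + 1)
     (nwrite ''src'' (m + 1) t (rwrite ''wt'' m (w (es ! 0)) (nwrite ''dst'' m s (nwrite ''src'' m n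
     (nwrite ''T'' 0 (n + 1) (nwrite ''S'' 0 n (nwrite ''M'' 0 (m + 2) (nwrite ''N'' 0 (n + 2) \<sigma>)))))))))))"
    using i w0 m0 unfolding setup_prog_def \<sigma>_def[symmetric] by simp
  have "env (den setup_prog \<sigma>)" unfolding env_def
  proof (intro conjI allI impI)
    fix e assume "e \<le> m + 2"
    then consider "e < m" | "e = m" | "e = m + 1" | "e = m + 2" by linarith
    then show "nmem (den setup_prog \<sigma>) ''src'' e = src e" "nmem (den setup_prog \<sigma>) ''dst'' e = dst e"
      unfolding d using i(6,7)[of e] by (cases; simp add: src_def dst_def \<sigma>_def)+
  next
    fix e assume "e < m + 2"
    then consider "e < m" | "e = m" | "e = m + 1" by linarith
    then show "rmem (den setup_prog \<sigma>) ''wt'' e = wt e"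
      unfolding d using i(8)[of e] by (cases; simp add: wt_def \<sigma>_def)
  qed (unfold d, simp_all)
  moreover have "nmem (den setup_prog \<sigma>) ''s'' 0 = s \<and> nmem (den setup_prog \<sigma>) ''t'' 0 = t \<and> nmem (den setup_prog \<sigma>) ''found'' 0 = 0"
    unfolding d using i by (simp add: \<sigma>_def)
  ultimately show "env (den setup_prog ?\<sigma>) \<and> nmem (den setup_prog ?\<sigma>) ''s'' 0 = s \<and> nmem (den setup_prog ?\<sigma>) ''t'' 0 = t \<and> nmem (den setup_prog ?\<sigma>) ''found'' 0 = 0"
    unfolding \<sigma>_def by simp
qed (simp_all add: setup_prog_def)

lemma runs_main_prog:
  "runs main_prog (input_state n es w s t) (200 + 9000000 * ((m + 2) ^ 3 * (n + 2) ^ 4))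
     (\<lambda>\<tau>. answer (result \<tau>))"
proof -
  let ?A = "(m + 2) ^ 3 * (n + 2) ^ 4"
  have A: "(m + 2) * (m + 2) * (m + 2) * (n + 2) * (n + 2) * (n + 2) * (n + 2) = ?A"
    by (simp only: power4_eq_xxxx power3_eq_cube mult.assoc)
  have 1: "runs (Seq setup_prog core_prog) (input_state n es w s t) (100 + 9000000 * ?A) (\<lambda>\<tau>. answer (result \<tau>))"
  proof (rule runs_Seq[OF runs_setup_prog])
    fix \<tau> assume t: "env \<tau> \<and> nmem \<tau> ''s'' 0 = s \<and> nmem \<tau> ''t'' 0 = t \<and> nmem \<tau> ''found'' 0 = 0"
    show "runs core_prog \<tau> (9000000 * ?A) (\<lambda>\<tau>. answer (result \<tau>))"
      by (rule runs_core_prog[of \<tau> s t, unfolded A]) (use t st_lt in \<open>auto simp: E_def\<close>)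
  qed
  have "nmem (input_state n es w s t) ''m'' 0 = m" by (simp add: input_state_def array_def)
  then have b: "bval (NLess (NConst 0) (NV ''m'')) (input_state n es w s t)" using es_ne by simp
  have 2: "runs main_prog (input_state n es w s t) (1 + bcost (NLess (NConst 0) (NV ''m'')) + (100 + 9000000 * ?A)) (\<lambda>\<tau>. answer (result \<tau>))"
    unfolding main_prog_def by (rule runs_Cond) (use 1 b in blast)+
  have "1 + bcost (NLess (NConst 0) (NV ''m'')) + (100 + X) \<le> 200 + X" for X by simp
  from this show ?thesis by (rule runs_weaken[OF 2])
qed

end

section \<open>The result for the original digraph\<close>

lemma answer_correct:
  fixes G :: "nat pair_pre_digraph"
  assumes G: "pair_wf_digraph G" and i: "input n es w s t" and es: "set es = parcs G" and s: "s \<in> pverts G"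
    and a: "augmented.answer n (n + 1) (input.E n es s t) (input.w' n es w) r"
  shows "correct_answer G w s t r"
proof -
  interpret pair_wf_digraph G by (rule G)
  interpret input n es w s t by (rule i)
  let ?sp = "\<lambda>xs. path (parcs G) s xs t \<and> (\<exists>ys. path (parcs G) s ys t \<and> cost w ys < cost w xs)"
  have c: "awalk_cost w (arcs_of xs) = cost w xs" for xs by (simp add: awalk_cost_def cost_def)
  have sp: "?sp (pawalk_verts s p)" if "not_shortest_path w s p t" for p
    using that apath_path unfolding not_shortest_iff by (metis c)
  have ns: "not_shortest_path w s (arcs_of xs) t" if "?sp xs" for xs
    using that path_apath[OF _ s] unfolding not_shortest_iff by (metis c)
  have nsp: "nsp (n # xs @ [n + 1]) \<longleftrightarrow> ?sp xs" for xs unfolding nsp_ext es by simp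
  show ?thesis
  proof (cases r)
    case None
    then have "\<not> ?sp xs" for xs using a nsp unfolding answer_def by auto
    then have "\<not> not_shortest_path w s p t" for p using sp by blast
    then show ?thesis using None unfolding correct_answer_def next_to_shortest_path_def by simp
  next
    case (Some xs)
    then have x: "nsp (n # xs @ [n + 1])" "\<And>P. nsp P \<Longrightarrow> cost w' (n # xs @ [n + 1]) \<le> cost w' P" using a unfolding answer_def by auto
    have p: "path (parcs G) s xs t" using x(1) nsp by blast
    have "awalk_cost w (arcs_of xs) \<le> awalk_cost w q" if q: "not_shortest_path w s q t" for q
    proof -
      have y: "?sp (pawalk_verts s q)" "arcs_of (pawalk_verts s q) = q" using sp[OF q] apath_path q unfolding not_shortest_path_def by auto
      have "cost w xs + 2 * w (es ! 0) \<le> cost w (pawalk_verts s q) + 2 * w (es ! 0)"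
        using x(2) nsp y(1) path_ext(2)[of xs] path_ext(2)[of "pawalk_verts s q"] p unfolding es by metis
      then show ?thesis using c[of xs] c[of "pawalk_verts s q"] y(2) by simp
    qed
    then have "next_to_shortest_path w s (arcs_of xs) t" unfolding next_to_shortest_path_def using ns x(1) nsp by blast
    moreover have "xs = pre_digraph.awalk_verts (with_proj G) s (arcs_of xs)"
      using path_apath[OF p s] awalk_verts_with_proj_eq[of G] by simp
    ultimately show ?thesis using Some unfolding correct_answer_def by auto
  qed
qed

text \<open>From \<open>n + 2 \<le> 3 * n\<close> and \<open>m + 2 \<le> 3 * m\<close> comes the
  factor \<open>3 ^ 7 = 2187\<close>, and 9000000 times 2187 is 19683000000. The remainder up to
  20000000000 absorbs the additive 200. The logarithm is at least 1 as \<open>n\<close> is at least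
  2.\<close>

lemma time_bound:
  fixes n m k :: nat
  assumes "2 \<le> n" "1 \<le> m" and k: "k \<le> 200 + 9000000 * ((m + 2) ^ 3 * (n + 2) ^ 4)"
  shows "real k \<le> 20000000000 * max 1 (real n ^ 4 * real m ^ 3 * log 2 (real n))"
proof -
  define A where "A = real n ^ 4 * real m ^ 3"
  define X where "X = (m + 2) ^ 3 * (n + 2) ^ 4"
  have nm: "real n + 2 \<le> 3 * real n" "real m + 2 \<le> 3 * real m" using assms by simp_all
  have "real X = (real n + 2) ^ 4 * (real m + 2) ^ 3"
    unfolding X_def by (simp add: add.commute)
  also have "\<dots> \<le> (3 * real n) ^ 4 * (3 * real m) ^ 3"
    by (intro mult_mono power_mono nm) auto
  also have "\<dots> = 2187 * A" by (simp add: power_mult_distrib A_def)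
  finally have 1: "real X \<le> 2187 * A" .
  have "real k \<le> real (200 + 9000000 * X)" using k unfolding X_def[symmetric] by (simp only: of_nat_le_iff)
  also have "\<dots> = 200 + 9000000 * real X" by simp
  also have "\<dots> \<le> 200 + 9000000 * (2187 * A)" using 1 by simp
  finally have 2: "real k \<le> 200 + 19683000000 * A" by simp
  have "1 * 1 \<le> A" unfolding A_def by (intro mult_mono one_le_power) (use assms in auto)
  then have A1: "1 \<le> A" by simp
  have "1 \<le> log 2 (real n)" using assms(1) by (simp add: le_log_iff)
  then have "A * 1 \<le> A * log 2 (real n)" using A1 by (intro mult_left_mono) auto
  then have "A \<le> max 1 (A * log 2 (real n))" by simp
  then show ?thesis using 2 A1 unfolding A_def[symmetric] by linarith
qed

lemma no_arcs_correct:
  fixes G :: "nat pair_pre_digraph"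
  assumes G: "pair_wf_digraph G" and "parcs G = {}"
  shows "correct_answer G w s t None"
proof -
  interpret pair_wf_digraph G by (rule G)
  have "p = []" if "apath s p t" for p using that assms(2) unfolding apath_def awalk_def by auto
  then have "\<not> not_shortest_path w s p t" for p unfolding not_shortest_iff by (metis less_irrefl)
  then show ?thesis unfolding correct_answer_def next_to_shortest_path_def by simp
qed

lemma main_prog_correct:
  fixes G :: "nat pair_pre_digraph"
  assumes G: "pair_digraph G" and V: "pverts G = {..<card (pverts G)}"
    and es: "distinct es" "set es = parcs G" and w: "\<forall>e\<in>parcs G. w e > 0" and st: "s \<in> pverts G" "t \<in> pverts G"
  shows "\<exists>k \<tau>. exec main_prog (input_state (card (pverts G)) es w s t) k \<tau> \<and>
    real k \<le> 20000000000 * max 1 (real (card (pverts G)) ^ 4 * real (card (parcs G)) ^ 3 * log 2 (real (card (pverts G)))) \<and>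
    correct_answer G w s t (result \<tau>)"
proof -
  interpret pair_digraph G by (rule G)
  define n where "n = card (pverts G)"
  have lt: "v \<in> pverts G \<longleftrightarrow> v < n" for v using V unfolding n_def by blast
  have m: "card (parcs G) = length es" using es by (metis distinct_card)
  show ?thesis
  proof (cases "es = []")
    case True
    let ?\<sigma> = "input_state n es w s t"
    have "nmem ?\<sigma> ''m'' 0 = 0" "nmem ?\<sigma> ''found'' 0 = 0" using True by (simp_all add: input_state_def array_def)
    then have b: "\<not> bval (NLess (NConst 0) (NV ''m'')) ?\<sigma>" and r: "result ?\<sigma> = None" by (simp_all add: result_def)
    have e: "exec main_prog ?\<sigma> (1 + bcost (NLess (NConst 0) (NV ''m'')) + 1) ?\<sigma>"
      unfolding main_prog_def by (rule exec.CondFalse[OF b exec.Skip])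
    have "correct_answer G w s t (result ?\<sigma>)" unfolding r by (rule no_arcs_correct[OF pair_wf_digraph_axioms]) (use es(2) True in simp)
    \<comment> \<open>The time is a constant here; the maximum with 1 in the bound covers graphs
      without arcs.\<close>
    moreover have "real (1 + bcost (NLess (NConst 0) (NV ''m'')) + 1) \<le> 20000000000 * max 1 (real n ^ 4 * real (card (parcs G)) ^ 3 * log 2 (real n))"
      using True m by simp
    ultimately show ?thesis using e unfolding n_def by blast
  next
    case False
    have i: "input n es w s t"
      by unfold_locales (use es w st lt False arc_fst_in_verts arc_snd_in_verts in force)+
    \<comment> \<open>An arc that is not a loop has two different ends, so there are at least two
      vertices.\<close>
    obtain e where e: "e \<in> parcs G" using False es(2) by (metis last_in_set)
    have "fst e \<noteq> snd e" "fst e < n" "snd e < n" using pair_no_loops[OF e] arc_fst_in_verts[OF e] arc_snd_in_verts[OF e] lt by auto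
    then have n2: "2 \<le> n" by linarith
    obtain k \<tau> where k: "exec main_prog (input_state n es w s t) k \<tau>"
        "k \<le> 200 + 9000000 * ((length es + 2) ^ 3 * (n + 2) ^ 4)"
        "augmented.answer n (n + 1) (input.E n es s t) (input.w' n es w) (result \<tau>)"
      using input.runs_main_prog[OF i] unfolding runs_def by blast
    have "correct_answer G w s t (result \<tau>)" by (rule answer_correct[OF pair_wf_digraph_axioms i es(2) st(1) k(3)])
    moreover have "real k \<le> 20000000000 * max 1 (real n ^ 4 * real (card (parcs G)) ^ 3 * log 2 (real n))"
      unfolding m by (rule time_bound[OF n2 _ k(2)]) (use False in \<open>simp add: Suc_le_eq\<close>)
    ultimately show ?thesis using k(1) unfolding n_def by blast
  qed
qed

theorem theorem1p1:
  shows "\<exists>(c :: com) (C :: real).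
    \<forall>(G :: nat pair_pre_digraph) (w :: (nat \<times> nat) \<Rightarrow> real) (es :: (nat \<times> nat) list) (s :: nat) (t :: nat).
      pair_digraph G \<and> pverts G = {..<card (pverts G)} \<and>
      distinct es \<and> set es = parcs G \<and> (\<forall>e\<in>parcs G. w e > 0) \<and>
      s \<in> pverts G \<and> t \<in> pverts G \<longrightarrow>
      (\<exists>(k :: nat) \<tau>. exec c (input_state (card (pverts G)) es w s t) k \<tau> \<and>
         real k \<le> C * max 1 (real (card (pverts G)) ^ 4 * real (card (parcs G)) ^ 3
                              * log 2 (real (card (pverts G)))) \<and>
         correct_answer G w s t (result \<tau>))"
  using main_prog_correct by blast

end
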